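(* Let $n\ge 1$ and let $\Bbbk$ be a field. Let $Q$ be the quiver of $\Bbbk\,\mathcal{SEO}_n$: its vertices are $[0],[1],\dots,[n]$; for each $1\le k\le n-1$ there are exactly $k$ arrows $d^k_1,\dots,d^k_k$ from $[k+1]$ to $[k]$, where $d_i^k$ corresponds to the unique order-preserving onto function $f:[k+1]\to[k]$ with $f(i)=f(i+1)$; and there are no other arrows (in particular $[0]$ is isolated). Then a quiver presentation of $\Bbbk\,\mathcal{SEO}_n$, and hence of $\Bbbk\,\mathcal{PO}_n$, is given by $Q$ together with the relations $$d_i^{k-1}d_j^{k}=d_{j-1}^{k-1}d_i^{k}\qquad(2\le k\le n-1,\ 1\le i<j\le k).$$
   Context: $[k]=\{1,\dots,k\}$, $[0]=\varnothing$. $\mathcal{PO}_n$ is the monoid (under composition) of all order-preserving partial functions on $[n]$, i.e. partial functions $f$ with $x\le y\Rightarrow f(x)\le f(y)$ for all $x,y$ in the domain of $f$; $\Bbbk\mathcal{PO}_n$ is its monoid algebra. $\mathcal{SEO}_n$ is the category with objects $[k]$, $0\le k\le n$, and morphisms all (total) order-preserving onto functions between them. For a finite category $E$, the category algebra $\Bbbk E$ has basis the morphisms of $E$, with $m'\cdot m=m'm$ if the composition is defined and $0$ otherwise. Composition, also of paths, is from right to left. For a graph $Q$, $Q^*$ is the free category on $Q$ (morphisms are paths, including one empty path per vertex). $L_\Bbbk[E]$ is the $\Bbbk$-linear category with the same objects as $E$ whose hom-spaces have bases the hom-sets of $E$, with bilinearly extended composition. For a relation $R$ on morphisms of $L_\Bbbk[Q^*]$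 (relating only morphisms with the same domain and range), $\rho_R$ is the smallest congruence containing $R$ that is both a category congruence and a vector space congruence on each hom-space. An algebra $A$ is split basic if $A/\mathrm{Rad}\,A\simeq\Bbbk^r$ for some $r$. For such $A$ with complete set of primitive orthogonal idempotents $\{e_1,\dots,e_r\}$, $\mathscr{L}(A)$ is the $\Bbbk$-linear category with objects $e_1,\dots,e_r$ and $\mathscr{L}(A)(e_i,e_j)=e_jAe_i$, composition being multiplication in $A$. The quiver of $A$ has vertices $e_1,\dots,e_r$ and, as arrows from $e_k$ to $e_l$, a basis of $e_l(\mathrm{Rad}A/\mathrm{Rad}^2A)e_k$. A quiver presentation of $A$ is a pair $(Q,R)$ where $Q$ is the quiver of $A$ and $L_\Bbbk[Q^*]/\rho_R\simeq\mathscr{L}(A)$. A quiver presentation of a general finite-dimensional algebra means a quiver presentation of a split basic algebra Morita equivalent to it. *)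

theory Defs
  imports
    "Jordan_Normal_Form.VS_Connect"
    "Graph_Theory.Arc_Walk"
    "HOL-Algebra.QuotRing"
    "HOL-Algebra.Ideal_Product"
begin

text \<open>
  The ground field is a type \<open>'k::field\<close>, viewed as the structure \<open>class_ring\<close>. Algebras and vector
  spaces over it are records of type \<^typ>\<open>('k, 'a) module\<close>; for a bare vector space the fields
  \<open>mult\<close> and \<open>one\<close> of the record carry no information. The locale \<open>algebra\<close> of HOL-Algebra is
  restricted to commutative algebras and hence not usable here.
\<close>

section \<open>Finite-dimensional algebras\<close>

definition fin_dim_algebra :: "('k::field, 'a) module \<Rightarrow> bool" where
  "fin_dim_algebra A \<longleftrightarrow>
     ring A \<and> vectorspace class_ring A \<and> vectorspace.fin_dim class_ring A \<and>
     (\<forall>c. \<forall>x\<in>carrier A. \<forall>y\<in>carrier A.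
        (c \<odot>\<^bsub>A\<^esub> x) \<otimes>\<^bsub>A\<^esub> y = c \<odot>\<^bsub>A\<^esub> (x \<otimes>\<^bsub>A\<^esub> y) \<and>
        x \<otimes>\<^bsub>A\<^esub> (c \<odot>\<^bsub>A\<^esub> y) = c \<odot>\<^bsub>A\<^esub> (x \<otimes>\<^bsub>A\<^esub> y))"

definition algebra_isomorphic :: "('k::field, 'a) module \<Rightarrow> ('k, 'b) module \<Rightarrow> bool" where
  "algebra_isomorphic A B \<longleftrightarrow> ring_iso A B \<inter> LinearCombinations.module_hom class_ring A B \<noteq> {}"

definition quot_algebra :: "('k::field, 'a) module \<Rightarrow> 'a set \<Rightarrow> ('k, 'a set) module" where
  "quot_algebra A I =
     ring.extend (A Quot I) (module.fields (\<lambda>c X. \<Union>x\<in>X. I +>\<^bsub>A\<^esub> (c \<odot>\<^bsub>A\<^esub> x)))"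

text \<open>The algebra \<open>k\<^sup>r\<close> with pointwise operations.\<close>

definition power_algebra :: "nat \<Rightarrow> ('k::field, nat \<Rightarrow> 'k) module" where
  "power_algebra r =
     \<lparr>carrier = {..<r} \<rightarrow>\<^sub>E UNIV,
      monoid.mult = (\<lambda>f g. \<lambda>i\<in>{..<r}. f i * g i),
      one = (\<lambda>i\<in>{..<r}. 1),
      zero = (\<lambda>i\<in>{..<r}. 0),
      add = (\<lambda>f g. \<lambda>i\<in>{..<r}. f i + g i),
      smult = (\<lambda>c f. \<lambda>i\<in>{..<r}. c * f i)\<rparr>"

definition left_ideal :: "'a set \<Rightarrow> ('a, 'z) ring_scheme \<Rightarrow> bool" where
  "left_ideal I A \<longleftrightarrow>
     additive_subgroup I A \<and> (\<forall>a\<in>carrier A. \<forall>x\<in>I. a \<otimes>\<^bsub>A\<^esub> x \<in> I)"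

definition maximal_left_ideal :: "'a set \<Rightarrow> ('a, 'z) ring_scheme \<Rightarrow> bool" where
  "maximal_left_ideal I A \<longleftrightarrow>
     left_ideal I A \<and> I \<noteq> carrier A \<and>
     (\<forall>J. left_ideal J A \<and> I \<subseteq> J \<longrightarrow> J = I \<or> J = carrier A)"

definition Rad :: "('a, 'z) ring_scheme \<Rightarrow> 'a set" where
  "Rad A = {x \<in> carrier A. \<forall>I. maximal_left_ideal I A \<longrightarrow> x \<in> I}"

definition Rad2 :: "('a, 'z) ring_scheme \<Rightarrow> 'a set" where
  "Rad2 A = Rad A \<cdot>\<^bsub>A\<^esub> Rad A"

definition split_basic :: "('k::field, 'a) module \<Rightarrow> bool" where
  "split_basic A \<longleftrightarrow>
     fin_dim_algebra A \<and>
     (\<exists>r. algebra_isomorphic (quot_algebra A (Rad A)) (power_algebra r :: ('k, nat \<Rightarrow> 'k) module))"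

definition idempotent_elt :: "('a, 'z) ring_scheme \<Rightarrow> 'a \<Rightarrow> bool" where
  "idempotent_elt A e \<longleftrightarrow> e \<in> carrier A \<and> e \<otimes>\<^bsub>A\<^esub> e = e"

definition orthogonal_elts :: "('a, 'z) ring_scheme \<Rightarrow> 'a \<Rightarrow> 'a \<Rightarrow> bool" where
  "orthogonal_elts A e f \<longleftrightarrow> e \<otimes>\<^bsub>A\<^esub> f = \<zero>\<^bsub>A\<^esub> \<and> f \<otimes>\<^bsub>A\<^esub> e = \<zero>\<^bsub>A\<^esub>"

definition primitive_idempotent :: "('a, 'z) ring_scheme \<Rightarrow> 'a \<Rightarrow> bool" where
  "primitive_idempotent A e \<longleftrightarrow>
     idempotent_elt A e \<and> e \<noteq> \<zero>\<^bsub>A\<^esub> \<and>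
     (\<forall>f g. idempotent_elt A f \<and> idempotent_elt A g \<and> orthogonal_elts A f g \<and> e = f \<oplus>\<^bsub>A\<^esub> g
        \<longrightarrow> f = \<zero>\<^bsub>A\<^esub> \<or> g = \<zero>\<^bsub>A\<^esub>)"

definition complete_primitive_idempotents :: "('a, 'z) ring_scheme \<Rightarrow> 'a set \<Rightarrow> bool" where
  "complete_primitive_idempotents A E \<longleftrightarrow>
     finite E \<and> (\<forall>e\<in>E. primitive_idempotent A e) \<and>
     (\<forall>e\<in>E. \<forall>f\<in>E. e \<noteq> f \<longrightarrow> orthogonal_elts A e f) \<and>
     (\<Oplus>\<^bsub>A\<^esub>e\<in>E. e) = \<one>\<^bsub>A\<^esub>"


section \<open>Linear categories\<close>

text \<open>
  \<open>LHom C a b\<close> is the space of morphisms from \<open>a\<close> to \<open>b\<close>. Hom-spaces for different pairs of objects need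
  not be disjoint, so composition and identities take the objects as arguments: \<open>LComp C a b c g f\<close>
  is \<open>g\<close> after \<open>f\<close> for \<open>f : a \<rightarrow> b\<close> and \<open>g : b \<rightarrow> c\<close>.
\<close>

record ('o, 'h, 'k) lincat =
  LObj :: "'o set"
  LHom :: "'o \<Rightarrow> 'o \<Rightarrow> ('k, 'h) module"
  LId :: "'o \<Rightarrow> 'h"
  LComp :: "'o \<Rightarrow> 'o \<Rightarrow> 'o \<Rightarrow> 'h \<Rightarrow> 'h \<Rightarrow> 'h"

definition lin_functor ::
  "('o, 'h, 'k::field) lincat \<Rightarrow> ('p, 'i, 'k) lincat \<Rightarrow> ('o \<Rightarrow> 'p) \<Rightarrow> ('o \<Rightarrow> 'o \<Rightarrow> 'h \<Rightarrow> 'i) \<Rightarrow> bool"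
  where
  "lin_functor C D Fo Fa \<longleftrightarrow>
     (\<forall>a\<in>LObj C. Fo a \<in> LObj D \<and> Fa a a (LId C a) = LId D (Fo a)) \<and>
     (\<forall>a\<in>LObj C. \<forall>b\<in>LObj C.
        Fa a b \<in> LinearCombinations.module_hom class_ring (LHom C a b) (LHom D (Fo a) (Fo b))) \<and>
     (\<forall>a\<in>LObj C. \<forall>b\<in>LObj C. \<forall>c\<in>LObj C.
        \<forall>f\<in>carrier (LHom C a b). \<forall>g\<in>carrier (LHom C b c).
          Fa a c (LComp C a b c g f) = LComp D (Fo a) (Fo b) (Fo c) (Fa b c g) (Fa a b f))"

definition lincat_isomorphic :: "('o, 'h, 'k::field) lincat \<Rightarrow> ('p, 'i, 'k) lincat \<Rightarrow> bool" where
  "lincat_isomorphic C D \<longleftrightarrow>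
     (\<exists>Fo Fa. lin_functor C D Fo Fa \<and> bij_betw Fo (LObj C) (LObj D) \<and>
        (\<forall>a\<in>LObj C. \<forall>b\<in>LObj C.
           bij_betw (Fa a b) (carrier (LHom C a b)) (carrier (LHom D (Fo a) (Fo b)))))"

definition isomorphism_in :: "('o, 'h, 'k) lincat \<Rightarrow> 'o \<Rightarrow> 'o \<Rightarrow> 'h \<Rightarrow> bool" where
  "isomorphism_in C a b f \<longleftrightarrow>
     f \<in> carrier (LHom C a b) \<and>
     (\<exists>g\<in>carrier (LHom C b a). LComp C a b a g f = LId C a \<and> LComp C b a b f g = LId C b)"

definition naturally_isomorphic ::
  "('o, 'h, 'k) lincat \<Rightarrow> ('p, 'i, 'k) lincat \<Rightarrow>
   ('o \<Rightarrow> 'p) \<Rightarrow> ('o \<Rightarrow> 'o \<Rightarrow> 'h \<Rightarrow> 'i) \<Rightarrow> ('o \<Rightarrow> 'p) \<Rightarrow> ('o \<Rightarrow> 'o \<Rightarrow> 'h \<Rightarrow> 'i) \<Rightarrow> bool"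
  where
  "naturally_isomorphic C D Fo Fa Go Ga \<longleftrightarrow>
     (\<exists>\<eta>. (\<forall>a\<in>LObj C. isomorphism_in D (Fo a) (Go a) (\<eta> a)) \<and>
        (\<forall>a\<in>LObj C. \<forall>b\<in>LObj C. \<forall>f\<in>carrier (LHom C a b).
           LComp D (Fo a) (Fo b) (Go b) (\<eta> b) (Fa a b f) =
           LComp D (Fo a) (Go a) (Go b) (Ga a b f) (\<eta> a)))"

definition lincat_equivalent :: "('o, 'h, 'k::field) lincat \<Rightarrow> ('p, 'i, 'k) lincat \<Rightarrow> bool" where
  "lincat_equivalent C D \<longleftrightarrow>
     (\<exists>Fo Fa Go Ga. lin_functor C D Fo Fa \<and> lin_functor D C Go Ga \<and>
        naturally_isomorphic C C
          (\<lambda>a. Go (Fo a)) (\<lambda>a b f. Ga (Fo a) (Fo b) (Fa a b f)) (\<lambda>a. a) (\<lambda>a b f. f) \<and>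
        naturally_isomorphic D D
          (\<lambda>a. Fo (Go a)) (\<lambda>a b f. Fa (Go a) (Go b) (Ga a b f)) (\<lambda>a. a) (\<lambda>a b f. f))"

definition lin_congruence :: "('o, 'h, 'k::field) lincat \<Rightarrow> ('o \<Rightarrow> 'o \<Rightarrow> 'h rel) \<Rightarrow> bool" where
  "lin_congruence C S \<longleftrightarrow>
     (\<forall>a\<in>LObj C. \<forall>b\<in>LObj C.
        equiv (carrier (LHom C a b)) (S a b) \<and>
        (\<forall>(f, f')\<in>S a b. \<forall>(g, g')\<in>S a b.
           (f \<oplus>\<^bsub>LHom C a b\<^esub> g, f' \<oplus>\<^bsub>LHom C a b\<^esub> g') \<in> S a b) \<and>
        (\<forall>c. \<forall>(f, f')\<in>S a b. (c \<odot>\<^bsub>LHom C a b\<^esub> f, c \<odot>\<^bsub>LHom C a b\<^esub> f') \<in> S a b)) \<and>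
     (\<forall>a\<in>LObj C. \<forall>b\<in>LObj C. \<forall>c\<in>LObj C. \<forall>(f, f')\<in>S a b. \<forall>(g, g')\<in>S b c.
        (LComp C a b c g f, LComp C a b c g' f') \<in> S a c)"

definition gen_congruence ::
  "('o, 'h, 'k::field) lincat \<Rightarrow> ('o \<Rightarrow> 'o \<Rightarrow> 'h rel) \<Rightarrow> 'o \<Rightarrow> 'o \<Rightarrow> 'h rel" where
  "gen_congruence C R a b =
     \<Inter>{S a b |S. lin_congruence C S \<and> (\<forall>u\<in>LObj C. \<forall>v\<in>LObj C. R u v \<subseteq> S u v)}"

definition quot_lincat ::
  "('o, 'h, 'k::field) lincat \<Rightarrow> ('o \<Rightarrow> 'o \<Rightarrow> 'h rel) \<Rightarrow> ('o, 'h set, 'k) lincat" where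
  "quot_lincat C S =
     \<lparr>LObj = LObj C,
      LHom = (\<lambda>a b.
        \<lparr>carrier = carrier (LHom C a b) // S a b,
         monoid.mult = undefined,
         one = undefined,
         zero = S a b `` {\<zero>\<^bsub>LHom C a b\<^esub>},
         add = (\<lambda>X Y. \<Union>x\<in>X. \<Union>y\<in>Y. S a b `` {x \<oplus>\<^bsub>LHom C a b\<^esub> y}),
         smult = (\<lambda>c X. \<Union>x\<in>X. S a b `` {c \<odot>\<^bsub>LHom C a b\<^esub> x})\<rparr>),
      LId = (\<lambda>a. S a a `` {LId C a}),
      LComp = (\<lambda>a b c Y X. \<Union>y\<in>Y. \<Union>x\<in>X. S a c `` {LComp C a b c y x})\<rparr>"

text \<open>The category written \<open>\<L>(A)\<close> for a complete set \<open>E\<close> of primitive orthogonal idempotents.\<close>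

definition idempotent_lincat :: "('k::field, 'a) module \<Rightarrow> 'a set \<Rightarrow> ('a, 'a, 'k) lincat" where
  "idempotent_lincat A E =
     \<lparr>LObj = E,
      LHom = (\<lambda>e f. A\<lparr>carrier := {f \<otimes>\<^bsub>A\<^esub> x \<otimes>\<^bsub>A\<^esub> e |x. x \<in> carrier A}\<rparr>),
      LId = (\<lambda>e. e),
      LComp = (\<lambda>_ _ _ g f. g \<otimes>\<^bsub>A\<^esub> f)\<rparr>"


section \<open>Morita equivalence\<close>

text \<open>The locale \<open>module\<close> of HOL-Algebra assumes a commutative ring of scalars.\<close>

locale left_module = R?: ring R + M?: abelian_group M
  for R :: "('a, 'z) ring_scheme" (structure) and M :: "('a, 'm) module" (structure) +
  assumes smult_closed:
      "\<lbrakk>a \<in> carrier R; x \<in> carrier M\<rbrakk> \<Longrightarrow> a \<odot>\<^bsub>M\<^esub> x \<in> carrier M"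
    and smult_l_distr:
      "\<lbrakk>a \<in> carrier R; b \<in> carrier R; x \<in> carrier M\<rbrakk> \<Longrightarrow>
       (a \<oplus>\<^bsub>R\<^esub> b) \<odot>\<^bsub>M\<^esub> x = a \<odot>\<^bsub>M\<^esub> x \<oplus>\<^bsub>M\<^esub> b \<odot>\<^bsub>M\<^esub> x"
    and smult_r_distr:
      "\<lbrakk>a \<in> carrier R; x \<in> carrier M; y \<in> carrier M\<rbrakk> \<Longrightarrow>
       a \<odot>\<^bsub>M\<^esub> (x \<oplus>\<^bsub>M\<^esub> y) = a \<odot>\<^bsub>M\<^esub> x \<oplus>\<^bsub>M\<^esub> a \<odot>\<^bsub>M\<^esub> y"
    and smult_assoc:
      "\<lbrakk>a \<in> carrier R; b \<in> carrier R; x \<in> carrier M\<rbrakk> \<Longrightarrow>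
       (a \<otimes>\<^bsub>R\<^esub> b) \<odot>\<^bsub>M\<^esub> x = a \<odot>\<^bsub>M\<^esub> (b \<odot>\<^bsub>M\<^esub> x)"
    and smult_one:
      "x \<in> carrier M \<Longrightarrow> \<one>\<^bsub>R\<^esub> \<odot>\<^bsub>M\<^esub> x = x"

text \<open>
  The category of all left \<open>A\<close>-modules whose underlying set is contained in the type \<open>'m\<close>, which plays
  the role of a universe; it has to be infinite for finite direct sums to exist, and statements are
  made for every such type. The field \<open>k\<close> acts on a module through \<open>c \<mapsto> c \<cdot> 1\<close>. Records that differ
  only in the meaningless fields \<open>mult\<close> and \<open>one\<close> are isomorphic objects.
\<close>

definition left_modules :: "('k::field, 'a) module \<Rightarrow> (('a, 'm) module, 'm \<Rightarrow> 'm, 'k) lincat" where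
  "left_modules A =
     \<lparr>LObj = {M. left_module A M},
      LHom = (\<lambda>M N.
        \<lparr>carrier = LinearCombinations.module_hom A M N \<inter> extensional (carrier M),
         monoid.mult = undefined,
         one = undefined,
         zero = (\<lambda>x\<in>carrier M. \<zero>\<^bsub>N\<^esub>),
         add = (\<lambda>f g. \<lambda>x\<in>carrier M. f x \<oplus>\<^bsub>N\<^esub> g x),
         smult = (\<lambda>c f. \<lambda>x\<in>carrier M. (c \<odot>\<^bsub>A\<^esub> \<one>\<^bsub>A\<^esub>) \<odot>\<^bsub>N\<^esub> f x)\<rparr>),
      LId = (\<lambda>M. \<lambda>x\<in>carrier M. x),
      LComp = (\<lambda>M _ _ g f. compose (carrier M) g f)\<rparr>"

definition morita_equivalent ::
  "'m itself \<Rightarrow> ('k::field, 'a) module \<Rightarrow> ('k, 'b) module \<Rightarrow> bool" where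
  "morita_equivalent (U :: 'm itself) A B \<longleftrightarrow>
     lincat_equivalent
       (left_modules A :: (('a, 'm) module, 'm \<Rightarrow> 'm, 'k) lincat)
       (left_modules B :: (('b, 'm) module, 'm \<Rightarrow> 'm, 'k) lincat)"


section \<open>Monoid algebras, category algebras and free linear categories\<close>

record ('o, 'm) smallcat =
  Obj :: "'o set"
  Arr :: "'m set"
  Dom :: "'m \<Rightarrow> 'o"
  Cod :: "'m \<Rightarrow> 'o"
  Id :: "'o \<Rightarrow> 'm"
  Comp :: "'m \<Rightarrow> 'm \<Rightarrow> 'm"  \<comment> \<open>\<open>Comp g f\<close> is \<open>g\<close> after \<open>f\<close>\<close>

text \<open>The vector space with basis \<open>S\<close>: finitely supported coefficient functions.\<close>

definition free_space :: "'m set \<Rightarrow> ('k::field, 'm \<Rightarrow> 'k) module" where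
  "free_space S =
     \<lparr>carrier = {a. finite {m. a m \<noteq> 0} \<and> {m. a m \<noteq> 0} \<subseteq> S},
      monoid.mult = undefined,
      one = undefined,
      zero = (\<lambda>_. 0),
      add = (\<lambda>a b m. a m + b m),
      smult = (\<lambda>c a m. c * a m)\<rparr>"

definition basis_vec :: "'m \<Rightarrow> 'm \<Rightarrow> 'k::field" where
  "basis_vec m = (\<lambda>m'. if m' = m then 1 else 0)"

text \<open>
  Bilinear extension of a partial operation \<open>mul\<close> on basis elements, defined on the pairs
  satisfying \<open>P\<close>; the remaining products of basis elements are \<open>0\<close>.
\<close>

definition conv ::
  "('m \<Rightarrow> 'm \<Rightarrow> bool) \<Rightarrow> ('m \<Rightarrow> 'm \<Rightarrow> 'm) \<Rightarrow> ('m \<Rightarrow> 'k::field) \<Rightarrow> ('m \<Rightarrow> 'k) \<Rightarrow> 'm \<Rightarrow> 'k" where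
  "conv P mul a b =
     (\<lambda>m. \<Sum>(p, q)\<in>{(p, q). a p \<noteq> 0 \<and> b q \<noteq> 0 \<and> P p q \<and> mul p q = m}. a p * b q)"

definition monoid_algebra :: "('m, 'z) monoid_scheme \<Rightarrow> ('k::field, 'm \<Rightarrow> 'k) module" where
  "monoid_algebra G =
     (free_space (carrier G))
       \<lparr>monoid.mult := conv (\<lambda>_ _. True) (monoid.mult G), one := basis_vec \<one>\<^bsub>G\<^esub>\<rparr>"

text \<open>The unit is the sum of the identity morphisms; there are only finitely many objects.\<close>

definition category_algebra :: "('o, 'm) smallcat \<Rightarrow> ('k::field, 'm \<Rightarrow> 'k) module" where
  "category_algebra E =
     (free_space (Arr E))
       \<lparr>monoid.mult := conv (\<lambda>g f. Dom E g = Cod E f) (Comp E),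
        one := (\<lambda>m. if m \<in> Id E ` Obj E then 1 else 0)\<rparr>"

text \<open>The category written \<open>L\<^sub>k[E]\<close>.\<close>

definition free_lincat :: "('o, 'm) smallcat \<Rightarrow> ('o, 'm \<Rightarrow> 'k::field, 'k) lincat" where
  "free_lincat E =
     \<lparr>LObj = Obj E,
      LHom = (\<lambda>a b. free_space {m \<in> Arr E. Dom E m = a \<and> Cod E m = b}),
      LId = (\<lambda>a. basis_vec (Id E a)),
      LComp = (\<lambda>_ _ _ g f. conv (\<lambda>q p. Dom E q = Cod E p) (Comp E) g f)\<rparr>"

text \<open>
  Quivers are directed multigraphs. A path from \<open>u\<close> to \<open>v\<close> is \<open>(u, p, v)\<close>, where \<open>p\<close> lists the
  arrows in the order in which they are traversed; the path written \<open>x\<^sub>r \<dots> x\<^sub>1\<close> from right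
  to left has \<open>p = [x\<^sub>1, \<dots>, x\<^sub>r]\<close>.
\<close>

definition free_cat :: "('v, 'e) pre_digraph \<Rightarrow> ('v, 'v \<times> 'e list \<times> 'v) smallcat" where
  "free_cat Q =
     \<lparr>Obj = verts Q,
      Arr = {(u, p, v). pre_digraph.awalk Q u p v},
      Dom = (\<lambda>(u, p, v). u),
      Cod = (\<lambda>(u, p, v). v),
      Id = (\<lambda>u. (u, [], u)),
      Comp = (\<lambda>(u', q, v') (u, p, v). (u, p @ q, v'))\<rparr>"


section \<open>Quiver presentations\<close>

text \<open>
  \<open>Q\<close> is the quiver of \<open>A\<close>, where the vertex \<open>u\<close> stands for the idempotent \<open>\<epsilon> u\<close> and the arrow \<open>x\<close> for
  the basis element \<open>\<beta> x\<close>. The space \<open>e (Rad A / Rad\<^sup>2 A) e'\<close> is a subspace of \<open>A / Rad\<^sup>2 A\<close>.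
\<close>

definition arrow_space :: "('k::field, 'a) module \<Rightarrow> 'a \<Rightarrow> 'a \<Rightarrow> ('k, 'a set) module" where
  "arrow_space A e' e =
     (quot_algebra A (Rad2 A))
       \<lparr>carrier := {Rad2 A +>\<^bsub>A\<^esub> (e' \<otimes>\<^bsub>A\<^esub> x \<otimes>\<^bsub>A\<^esub> e) |x. x \<in> Rad A}\<rparr>"

definition quiver_of ::
  "('k::field, 'a) module \<Rightarrow> ('v, 'e) pre_digraph \<Rightarrow> ('v \<Rightarrow> 'a) \<Rightarrow> ('e \<Rightarrow> 'a set) \<Rightarrow> bool" where
  "quiver_of A Q \<epsilon> \<beta> \<longleftrightarrow>
     wf_digraph Q \<and> inj_on \<epsilon> (verts Q) \<and> complete_primitive_idempotents A (\<epsilon> ` verts Q) \<and>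
     (\<forall>u\<in>verts Q. \<forall>v\<in>verts Q.
        inj_on \<beta> {x \<in> arcs Q. tail Q x = u \<and> head Q x = v} \<and>
        vectorspace.basis class_ring (arrow_space A (\<epsilon> v) (\<epsilon> u))
          (\<beta> ` {x \<in> arcs Q. tail Q x = u \<and> head Q x = v}))"

definition basic_quiver_presentation ::
  "('k::field, 'a) module \<Rightarrow> ('v, 'e) pre_digraph \<Rightarrow>
   ('v \<Rightarrow> 'v \<Rightarrow> ('v \<times> 'e list \<times> 'v \<Rightarrow> 'k) rel) \<Rightarrow> bool" where
  "basic_quiver_presentation A Q R \<longleftrightarrow>
     split_basic A \<and>
     (let L = free_lincat (free_cat Q) in
        (\<forall>u\<in>verts Q. \<forall>v\<in>verts Q. R u v \<subseteq> carrier (LHom L u v) \<times> carrier (LHom L u v)) \<and>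
        (\<exists>\<epsilon> \<beta>. quiver_of A Q \<epsilon> \<beta> \<and>
           lincat_isomorphic (quot_lincat L (gen_congruence L R))
             (idempotent_lincat A (\<epsilon> ` verts Q))))"

text \<open>
  Letting the split basic algebra \<open>B\<close> range over algebras on the same type as \<open>A\<close> is no restriction: a
  basic algebra Morita equivalent to \<open>A\<close> is isomorphic to some \<open>eAe\<close>, \<open>e\<close> idempotent.
\<close>

definition quiver_presentation ::
  "'m itself \<Rightarrow> ('k::field, 'a) module \<Rightarrow> ('v, 'e) pre_digraph \<Rightarrow>
   ('v \<Rightarrow> 'v \<Rightarrow> ('v \<times> 'e list \<times> 'v \<Rightarrow> 'k) rel) \<Rightarrow> bool" where
  "quiver_presentation U A Q R \<longleftrightarrow>
     fin_dim_algebra A \<and>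
     (\<exists>B :: ('k, 'a) module. morita_equivalent U A B \<and> basic_quiver_presentation B Q R)"


section \<open>Order-preserving functions\<close>

definition order_preserving :: "(nat \<rightharpoonup> nat) \<Rightarrow> bool" where
  "order_preserving f \<longleftrightarrow> (\<forall>x\<in>dom f. \<forall>y\<in>dom f. x \<le> y \<longrightarrow> the (f x) \<le> the (f y))"

definition PO :: "nat \<Rightarrow> (nat \<rightharpoonup> nat) monoid" where
  "PO n =
     \<lparr>carrier = {f. dom f \<subseteq> {1..n} \<and> ran f \<subseteq> {1..n} \<and> order_preserving f},
      monoid.mult = (\<lambda>g f. g \<circ>\<^sub>m f),
      one = Some |` {1..n}\<rparr>"

text \<open>
  A function from \<open>[k]\<close> onto \<open>[l]\<close> is a partial function with domain \<open>[k]\<close> and range \<open>[l]\<close>.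
\<close>

definition SEO :: "nat \<Rightarrow> (nat set, nat \<rightharpoonup> nat) smallcat" where
  "SEO n =
     \<lparr>Obj = {{1..k} |k. k \<le> n},
      Arr = {f. dom f \<in> {{1..k} |k. k \<le> n} \<and> ran f \<in> {{1..k} |k. k \<le> n} \<and> order_preserving f},
      Dom = dom,
      Cod = ran,
      Id = (\<lambda>S. Some |` S),
      Comp = (\<lambda>g f. g \<circ>\<^sub>m f)\<rparr>"

definition merge_map :: "nat \<Rightarrow> nat \<Rightarrow> (nat \<rightharpoonup> nat)" where
  "merge_map k i =
     (THE f. dom f = {1..k + 1} \<and> ran f = {1..k} \<and> order_preserving f \<and> f i = f (i + 1))"

text \<open>The vertex \<open>k\<close> is \<open>[k]\<close>, and the arrow \<open>(k, i)\<close> is \<open>d\<^sup>k\<^sub>i : [k + 1] \<rightarrow> [k]\<close>.\<close>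

definition SEO_quiver :: "nat \<Rightarrow> (nat, nat \<times> nat) pre_digraph" where
  "SEO_quiver n =
     \<lparr>verts = {0..n},
      arcs = {(k, i). 1 \<le> k \<and> k \<le> n - 1 \<and> 1 \<le> i \<and> i \<le> k},
      tail = (\<lambda>(k, i). k + 1),
      head = (\<lambda>(k, i). k)\<rparr>"

definition SEO_vertex :: "nat \<Rightarrow> nat \<Rightarrow> (nat \<rightharpoonup> nat) \<Rightarrow> 'k::field" where
  "SEO_vertex n k = basis_vec (Id (SEO n) {1..k})"

definition SEO_arrow :: "nat \<Rightarrow> nat \<times> nat \<Rightarrow> ((nat \<rightharpoonup> nat) \<Rightarrow> 'k::field) set" where
  "SEO_arrow n = (\<lambda>(k, i).
     let A = category_algebra (SEO n) in Rad2 A +>\<^bsub>A\<^esub> basis_vec (merge_map k i))"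

text \<open>The relations \<open>d\<^sup>k\<^sup>-\<^sup>1\<^sub>i d\<^sup>k\<^sub>j = d\<^sup>k\<^sup>-\<^sup>1\<^sub>j\<^sub>-\<^sub>1 d\<^sup>k\<^sub>i\<close>.\<close>

definition SEO_relations ::
  "nat \<Rightarrow> nat \<Rightarrow> nat \<Rightarrow> (nat \<times> (nat \<times> nat) list \<times> nat \<Rightarrow> 'k::field) rel" where
  "SEO_relations n u v =
     {(basis_vec (u, [(k, j), (k - 1, i)], v), basis_vec (u, [(k, i), (k - 1, j - 1)], v)) |k i j.
        2 \<le> k \<and> k \<le> n - 1 \<and> 1 \<le> i \<and> i < j \<and> j \<le> k \<and> u = k + 1 \<and> v = k - 1}"

end

theory Submission
  imports Defs
begin

text \<open>
  In a category whose non-identity morphisms strictly lower a rank, the non-identities span the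
  radical and the products of two of them span its square. So the algebra is split basic with the
  identities as primitive idempotents, and the arrows of its quiver are the irreducible morphisms,
  which for the order-preserving surjections are the maps merging two adjacent points. Modulo the
  relations every path of merges becomes one with weakly increasing indices, and such a path is
  determined by the surjection it composes to; hence the relations generate the kernel.

  For partial functions, Moebius inversion over restrictions identifies the monoid algebra with the
  algebra of the category of all order-preserving surjections between subsets of \<open>[n]\<close>. Every
  subset is isomorphic to an initial segment, so the algebra of surjections between initial segments
  is a full corner of it. For a full corner \<open>e A e\<close> with \<open>\<Sum> p i q i = 1\<close>, where \<open>p i \<in> A e\<close> and
  \<open>q i \<in> e A\<close>, restriction to \<open>e M\<close> is an equivalence of module categories.
\<close>

text \<open>The monoid algebra and the category algebras share one description, a finite basis with
  a partial product: \<open>P\<close> is constantly true for a monoid and composability for a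
  category, and the unit is a sum over a set of local units. Ring axioms and finite dimension are
  proved once for both. The radical is given by maximal left ideals. All of them contain the
  non-identities because 1 - j in \<open>I\<close> carries over to 1 - j^k in \<open>I\<close>, and
  the powers vanish; nothing else lies in all of them because the coefficient at each identity is a
  character with a maximal kernel. For the relations a statement on single paths is enough: an
  element of the kernel of evaluation is reduced to zero by moving the coefficient of one path to
  another path of equal value. The obstacle in the Morita equivalence is the universe: all modules
  must live on the type \<open>'m\<close>, so the tensor product of \<open>A e\<close> with
  \<open>N\<close> is not formed as a quotient. It is cut out of a finite power of \<open>N\<close>
  by an idempotent matrix and then carried into \<open>'m\<close> by an injection, for which
  \<open>'m\<close> has to be infinite. The zeta transform is never inverted by a formula;
  triangularity makes it bijective.\<close>

lemma free_space_simps [simp]: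
  "carrier (free_space S) = {a. finite {m. a m \<noteq> 0} \<and> {m. a m \<noteq> 0} \<subseteq> S}"
  "\<zero>\<^bsub>free_space S\<^esub> = (\<lambda>_. 0)"
  "a \<oplus>\<^bsub>free_space S\<^esub> b = (\<lambda>m. a m + b m)"
  "c \<odot>\<^bsub>free_space S\<^esub> a = (\<lambda>m. c * a m)"
  by (simp_all add: free_space_def)

definition supported :: "'m set \<Rightarrow> ('m \<Rightarrow> 'k::field) set" where
  "supported D = {a. \<forall>m. m \<notin> D \<longrightarrow> a m = 0}"

lemma supported_iff: "a \<in> supported D \<longleftrightarrow> (\<forall>m. m \<notin> D \<longrightarrow> a m = 0)"
  by (simp add: supported_def)

lemma supportedD: "a \<in> supported D \<Longrightarrow> m \<notin> D \<Longrightarrow> a m = 0"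
  by (simp add: supported_def)

lemma basis_vec_supported: "m \<in> D \<Longrightarrow> basis_vec m \<in> supported D"
  by (auto simp: supported_def basis_vec_def)

lemma supported_mono: "D \<subseteq> D' \<Longrightarrow> a \<in> supported D \<Longrightarrow> a \<in> supported D'"
  by (auto simp: supported_def)

section \<open>Bilinear extension of partial products\<close>

lemma conv_eq_sum:
  assumes "finite S" "\<forall>p. p \<notin> S \<longrightarrow> a p = 0" "finite T" "\<forall>q. q \<notin> T \<longrightarrow> b q = 0"
  shows "conv P mul a b m =
    (\<Sum>p\<in>S. \<Sum>q\<in>T. if P p q \<and> mul p q = m then a p * b q else 0)"
proof -
  have "conv P mul a b m = (\<Sum>x\<in>S \<times> T. case x of (p, q) \<Rightarrow>
      if P p q \<and> mul p q = m then a p * b q else 0)"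
    unfolding conv_def using assms
    \<comment> \<open>The defining sum runs over the joint support, which varies with
      \<open>a\<close> and \<open>b\<close>. The added terms are zero, and with fixed finite
      \<open>S\<close> and \<open>T\<close> sums for different arguments can be added and
      interchanged.\<close>
    by (intro sum.mono_neutral_cong_left) (auto split: if_splits)
  then show ?thesis by (simp add: sum.cartesian_product)
qed

lemma conv_add:
  fixes a b c :: "'m \<Rightarrow> 'k::field"
  assumes "finite {m. a m \<noteq> 0}" "finite {m. b m \<noteq> 0}" "finite {m. c m \<noteq> 0}"
  shows conv_add_left: "conv P mul (\<lambda>m. a m + b m) c = (\<lambda>m. conv P mul a c m + conv P mul b c m)"
    and conv_add_right: "conv P mul c (\<lambda>m. a m + b m) = (\<lambda>m. conv P mul c a m + conv P mul c b m)"
proof -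
  let ?S = "{m. a m \<noteq> 0} \<union> {m. b m \<noteq> 0}" and ?T = "{m. c m \<noteq> 0}"
  have fin: "finite ?S" using assms by simp
  have supp: "\<forall>m. m \<notin> ?S \<longrightarrow> a m = 0" "\<forall>m. m \<notin> ?S \<longrightarrow> b m = 0" "\<forall>m. m \<notin> ?S \<longrightarrow> a m + b m = 0"
    "\<forall>m. m \<notin> ?T \<longrightarrow> c m = 0" by auto
  show "conv P mul (\<lambda>m. a m + b m) c = (\<lambda>m. conv P mul a c m + conv P mul b c m)"
    unfolding conv_eq_sum[OF fin supp(1) assms(3) supp(4)] conv_eq_sum[OF fin supp(2) assms(3) supp(4)]
      conv_eq_sum[OF fin supp(3) assms(3) supp(4)] sum.distrib[symmetric]
    by (intro ext sum.cong refl) (simp add: ring_distribs)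
  show "conv P mul c (\<lambda>m. a m + b m) = (\<lambda>m. conv P mul c a m + conv P mul c b m)"
    unfolding conv_eq_sum[OF assms(3) supp(4) fin supp(1)] conv_eq_sum[OF assms(3) supp(4) fin supp(2)]
      conv_eq_sum[OF assms(3) supp(4) fin supp(3)] sum.distrib[symmetric]
    by (intro ext sum.cong refl) (simp add: ring_distribs)
qed

lemma conv_scale:
  fixes a b :: "'m \<Rightarrow> 'k::field"
  assumes "finite {m. a m \<noteq> 0}" "finite {m. b m \<noteq> 0}"
  shows conv_scale_left: "conv P mul (\<lambda>m. c * a m) b = (\<lambda>m. c * conv P mul a b m)"
    and conv_scale_right: "conv P mul a (\<lambda>m. c * b m) = (\<lambda>m. c * conv P mul a b m)"
proof -
  let ?S = "{m. a m \<noteq> 0}" and ?T = "{m. b m \<noteq> 0}"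
  have supp: "\<forall>m. m \<notin> ?S \<longrightarrow> a m = 0" "\<forall>m. m \<notin> ?S \<longrightarrow> c * a m = 0"
    "\<forall>m. m \<notin> ?T \<longrightarrow> b m = 0" "\<forall>m. m \<notin> ?T \<longrightarrow> c * b m = 0" by auto
  show "conv P mul (\<lambda>m. c * a m) b = (\<lambda>m. c * conv P mul a b m)"
    unfolding conv_eq_sum[OF assms(1) supp(1) assms(2) supp(3)]
      conv_eq_sum[OF assms(1) supp(2) assms(2) supp(3)] sum_distrib_left
    by (intro ext sum.cong refl) simp
  show "conv P mul a (\<lambda>m. c * b m) = (\<lambda>m. c * conv P mul a b m)"
    unfolding conv_eq_sum[OF assms(1) supp(1) assms(2) supp(3)]
      conv_eq_sum[OF assms(1) supp(1) assms(2) supp(4)] sum_distrib_left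
    by (intro ext sum.cong refl) simp
qed

lemma conv_basis_vec:
  assumes "P p q"
  shows "conv P mul (basis_vec p) (basis_vec q) = (basis_vec (mul p q) :: 'm \<Rightarrow> 'k::field)"
proof
  fix m
  have "\<forall>p'. p' \<notin> {p} \<longrightarrow> (basis_vec p p' :: 'k) = 0" "\<forall>q'. q' \<notin> {q} \<longrightarrow> (basis_vec q q' :: 'k) = 0"
    by (auto simp: basis_vec_def)
  then show "conv P mul (basis_vec p) (basis_vec q) m = (basis_vec (mul p q) m :: 'k)"
    using assms by (subst conv_eq_sum[of "{p}" _ "{q}"]) (auto simp: basis_vec_def)
qed

text \<open>Interchange of summation: each pair with \<open>P p q\<close> contributes through
  exactly one \<open>x\<close>, namely \<open>mul p q\<close>, and \<open>closed\<close> puts it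
  into \<open>S\<close>. The weight \<open>F\<close> is arbitrary; associativity, push-forward and
  the zeta transform all reduce to this formula.\<close>

lemma sum_conv:
  fixes a b :: "'m \<Rightarrow> 'k::field"
  assumes "finite S" "finite A" "finite B" "\<forall>p. p \<notin> A \<longrightarrow> a p = 0" "\<forall>q. q \<notin> B \<longrightarrow> b q = 0"
    and closed: "\<And>p q. p \<in> A \<Longrightarrow> q \<in> B \<Longrightarrow> P p q \<Longrightarrow> mul p q \<in> S"
  shows "(\<Sum>x\<in>S. conv P mul a b x * F x) =
    (\<Sum>p\<in>A. \<Sum>q\<in>B. if P p q then a p * b q * F (mul p q) else 0)"
proof -
  have "(\<Sum>x\<in>S. conv P mul a b x * F x) =
      (\<Sum>x\<in>S. \<Sum>p\<in>A. \<Sum>q\<in>B. (if P p q \<and> mul p q = x then a p * b q else 0) * F x)"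
    by (simp add: conv_eq_sum[OF assms(2,4,3,5)] sum_distrib_right)
  also have "\<dots> = (\<Sum>p\<in>A. \<Sum>q\<in>B. \<Sum>x\<in>S. (if P p q \<and> mul p q = x then a p * b q else 0) * F x)"
    by (subst sum.swap) (intro sum.cong refl sum.swap)
  also have "\<dots> = (\<Sum>p\<in>A. \<Sum>q\<in>B. if P p q then a p * b q * F (mul p q) else 0)"
  proof (intro sum.cong refl)
    fix p q assume "p \<in> A" "q \<in> B"
    show "(\<Sum>x\<in>S. (if P p q \<and> mul p q = x then a p * b q else 0) * F x) =
        (if P p q then a p * b q * F (mul p q) else 0)"
    proof (cases "P p q")
      case True
      have "(\<Sum>x\<in>S. (if P p q \<and> mul p q = x then a p * b q else 0) * F x) =
          (\<Sum>x\<in>S. if mul p q = x then a p * b q * F (mul p q) else 0)"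
        using True by (intro sum.cong) auto
      then show ?thesis
        using True assms(1) closed[OF \<open>p \<in> A\<close> \<open>q \<in> B\<close>] by simp
    qed simp
  qed
  finally show ?thesis .
qed

lemma conv_nonzeroE:
  assumes "conv P mul a b m \<noteq> 0"
  obtains p q where "a p \<noteq> 0" "b q \<noteq> 0" "P p q" "mul p q = m"
proof -
  have "{(p, q). a p \<noteq> 0 \<and> b q \<noteq> 0 \<and> P p q \<and> mul p q = m} \<noteq> {}"
  proof
    assume *: "{(p, q). a p \<noteq> 0 \<and> b q \<noteq> 0 \<and> P p q \<and> mul p q = m} = {}"
    show False using assms unfolding conv_def * by simp
  qed
  then show ?thesis using that by auto
qed

lemma conv_support:
  assumes "\<forall>p. p \<notin> S \<longrightarrow> a p = 0" "\<forall>q. q \<notin> S \<longrightarrow> b q = 0"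
    and "\<And>p q. p \<in> S \<Longrightarrow> q \<in> S \<Longrightarrow> P p q \<Longrightarrow> mul p q \<in> S"
  shows "\<forall>m. m \<notin> S \<longrightarrow> conv P mul a b m = 0"
proof (intro allI impI, rule ccontr)
  fix m assume "m \<notin> S" and m: "conv P mul a b m \<noteq> 0"
  from m obtain p q where "a p \<noteq> 0" "b q \<noteq> 0" "P p q" "mul p q = m"
    by (rule conv_nonzeroE)
  then show False using assms \<open>m \<notin> S\<close> by blast
qed

section \<open>Algebras with a multiplicative basis\<close>

text \<open>Finite categories and finite monoids are both instances. \<open>assoc_defined\<close>
  makes the two bracketings of a triple defined together; \<open>U\<close> is a set because the unit
  of a category algebra is a sum of identities, exactly one of which composes with a given
  \<open>p\<close> on each side.\<close>

locale partial_monoid =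
  fixes S :: "'m set" and P :: "'m \<Rightarrow> 'm \<Rightarrow> bool" and mul :: "'m \<Rightarrow> 'm \<Rightarrow> 'm" and U :: "'m set"
  assumes finite: "finite S"
    and closed: "\<lbrakk>p \<in> S; q \<in> S; P p q\<rbrakk> \<Longrightarrow> mul p q \<in> S"
    and assoc_defined:
      "\<lbrakk>p \<in> S; q \<in> S; r \<in> S\<rbrakk> \<Longrightarrow> (P q r \<and> P p (mul q r)) = (P p q \<and> P (mul p q) r)"
    and assoc: "\<lbrakk>p \<in> S; q \<in> S; r \<in> S; P p q; P (mul p q) r\<rbrakk> \<Longrightarrow> mul (mul p q) r = mul p (mul q r)"
    and units: "U \<subseteq> S"
    and left_unit: "p \<in> S \<Longrightarrow> \<exists>i\<in>U. P i p \<and> (\<forall>j\<in>U. P j p \<longrightarrow> j = i) \<and> mul i p = p"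
    and right_unit: "p \<in> S \<Longrightarrow> \<exists>i\<in>U. P p i \<and> (\<forall>j\<in>U. P p j \<longrightarrow> j = i) \<and> mul p i = p"
begin

definition algebra :: "('k::field, 'm \<Rightarrow> 'k) module" where
  "algebra = (free_space S)
     \<lparr>monoid.mult := conv P mul, one := (\<lambda>m. if m \<in> U then 1 else 0)\<rparr>"

text \<open>Finiteness of \<open>S\<close> makes the finite-support condition automatic, so
  vanishing outside \<open>S\<close> describes the carrier.\<close>

lemma algebra_simps [simp]:
  "carrier (algebra :: ('k::field, 'm \<Rightarrow> 'k) module) = supported S"
  "\<zero>\<^bsub>algebra :: ('k, 'm \<Rightarrow> 'k) module\<^esub> = (\<lambda>_. 0)"
  "a \<oplus>\<^bsub>algebra\<^esub> b = (\<lambda>m. a m + (b m :: 'k))"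
  "c \<odot>\<^bsub>algebra\<^esub> a = (\<lambda>m. c * (a m :: 'k))"
  "a \<otimes>\<^bsub>algebra\<^esub> b = (conv P mul a b :: 'm \<Rightarrow> 'k)"
  "\<one>\<^bsub>algebra :: ('k, 'm \<Rightarrow> 'k) module\<^esub> = (\<lambda>m. if m \<in> U then 1 else 0)"
  using finite by (auto simp: algebra_def free_space_def supported_def intro: finite_subset[of _ S])

lemma conv_eq:
  assumes "\<forall>m. m \<notin> S \<longrightarrow> a m = 0" "\<forall>m. m \<notin> S \<longrightarrow> b m = 0"
  shows "conv P mul a b m = (\<Sum>p\<in>S. \<Sum>q\<in>S. if P p q \<and> mul p q = m then a p * b q else 0)"
  using assms finite by (intro conv_eq_sum)

text \<open>Both bracketings expand into the same triple sum over \<open>p\<close>,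
  \<open>q\<close>, \<open>r\<close>; \<open>assoc_defined\<close> and \<open>assoc\<close> match
  the summation conditions.\<close>

lemma conv_assoc:
  fixes a b c :: "'m \<Rightarrow> 'k::field"
  assumes "\<forall>m. m \<notin> S \<longrightarrow> a m = 0" "\<forall>m. m \<notin> S \<longrightarrow> b m = 0" "\<forall>m. m \<notin> S \<longrightarrow> c m = 0"
  shows "conv P mul (conv P mul a b) c = conv P mul a (conv P mul b c)"
proof
  fix m
  have ab: "\<forall>m. m \<notin> S \<longrightarrow> conv P mul a b m = 0"
    by (rule conv_support[OF assms(1,2)]) (rule closed)
  have bc: "\<forall>m. m \<notin> S \<longrightarrow> conv P mul b c m = 0"
    by (rule conv_support[OF assms(2,3)]) (rule closed)
  have "conv P mul (conv P mul a b) c m =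
      (\<Sum>x\<in>S. conv P mul a b x * (\<Sum>r\<in>S. if P x r \<and> mul x r = m then c r else 0))"
    unfolding conv_eq[OF ab assms(3)] sum_distrib_left by (intro sum.cong refl) simp
  also have "\<dots> = (\<Sum>p\<in>S. \<Sum>q\<in>S. if P p q then a p * b q *
      (\<Sum>r\<in>S. if P (mul p q) r \<and> mul (mul p q) r = m then c r else 0) else 0)"
    using finite finite finite assms(1,2) closed by (rule sum_conv)
  also have "\<dots> = (\<Sum>p\<in>S. \<Sum>q\<in>S. \<Sum>r\<in>S.
      if P p q \<and> P (mul p q) r \<and> mul (mul p q) r = m then a p * b q * c r else 0)"
    by (intro sum.cong refl) (simp add: sum_distrib_left if_distrib[of "\<lambda>x. _ * x"] cong: if_cong)
  also have "\<dots> = (\<Sum>p\<in>S. \<Sum>q\<in>S. \<Sum>r\<in>S.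
      if P q r \<and> P p (mul q r) \<and> mul p (mul q r) = m then a p * b q * c r else 0)"
  proof (intro sum.cong refl if_cong)
    fix p q r assume "p \<in> S" "q \<in> S" "r \<in> S"
    then show "(P p q \<and> P (mul p q) r \<and> mul (mul p q) r = m) =
        (P q r \<and> P p (mul q r) \<and> mul p (mul q r) = m)"
      using assoc_defined[of p q r] assoc[of p q r] by auto
  qed
  also have "\<dots> = (\<Sum>p\<in>S. a p * (\<Sum>q\<in>S. \<Sum>r\<in>S. if P q r then b q * c r *
      (if P p (mul q r) \<and> mul p (mul q r) = m then 1 else 0) else 0))"
    unfolding sum_distrib_left by (intro sum.cong refl) (simp add: sum_distrib_left mult.assoc)
  also have "\<dots> = (\<Sum>p\<in>S. a p * (\<Sum>x\<in>S. conv P mul b c x *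
      (if P p x \<and> mul p x = m then 1 else 0)))"
    by (subst sum_conv[OF finite finite finite assms(2,3) closed]) auto
  also have "\<dots> = conv P mul a (conv P mul b c) m"
    unfolding conv_eq[OF assms(1) bc] sum_distrib_left by (intro sum.cong refl) simp
  finally show "conv P mul (conv P mul a b) c m = conv P mul a (conv P mul b c) m" .
qed

lemma conv_left_unit:
  fixes a :: "'m \<Rightarrow> 'k::field"
  assumes "\<forall>m. m \<notin> S \<longrightarrow> a m = 0"
  shows "conv P mul (\<lambda>m. if m \<in> U then 1 else 0) a = a"
proof
  fix m
  have U: "\<forall>m. m \<notin> S \<longrightarrow> (if m \<in> U then 1 else 0 :: 'k) = 0" using units by auto
  have "conv P mul (\<lambda>m. if m \<in> U then 1 else 0) a m =
      (\<Sum>q\<in>S. \<Sum>p\<in>S. if P p q \<and> mul p q = m then (if p \<in> U then 1 else 0) * a q else 0)"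
    by (simp add: conv_eq[OF U assms]) (rule sum.swap)
  also have "\<dots> = (\<Sum>q\<in>S. if q = m then a q else 0)"
  proof (intro sum.cong refl)
    fix q assume "q \<in> S"
    then obtain i where i: "i \<in> U" "P i q" "\<forall>j\<in>U. P j q \<longrightarrow> j = i" "mul i q = q"
      using left_unit by blast
    have iff: "P p q \<longleftrightarrow> p = i" if "p \<in> U" for p
      using i(1-3) that by blast
    \<comment> \<open>Among the units only \<open>i\<close> composes with \<open>q\<close>, so the
      sum over \<open>p\<close> has a single term.\<close>
    have "(\<Sum>p\<in>S. if P p q \<and> mul p q = m then (if p \<in> U then 1 else 0) * a q else 0) =
        (\<Sum>p\<in>S. if p = i then (if q = m then a q else 0) else 0)"
      using i(1,4) iff by (intro sum.cong refl) auto
    also have "\<dots> = (if q = m then a q else 0)" using i(1) units finite by auto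
    finally show "(\<Sum>p\<in>S. if P p q \<and> mul p q = m then (if p \<in> U then 1 else 0) * a q else 0) =
        (if q = m then a q else 0)" .
  qed
  also have "\<dots> = a m" using finite assms by auto
  finally show "conv P mul (\<lambda>m. if m \<in> U then 1 else 0) a m = a m" .
qed

lemma conv_right_unit:
  fixes a :: "'m \<Rightarrow> 'k::field"
  assumes "\<forall>m. m \<notin> S \<longrightarrow> a m = 0"
  shows "conv P mul a (\<lambda>m. if m \<in> U then 1 else 0) = a"
proof
  fix m
  have U: "\<forall>m. m \<notin> S \<longrightarrow> (if m \<in> U then 1 else 0 :: 'k) = 0" using units by auto
  have "conv P mul a (\<lambda>m. if m \<in> U then 1 else 0) m =
      (\<Sum>q\<in>S. \<Sum>p\<in>S. if P q p \<and> mul q p = m then a q * (if p \<in> U then 1 else 0) else 0)"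
    by (simp add: conv_eq[OF assms U])
  also have "\<dots> = (\<Sum>q\<in>S. if q = m then a q else 0)"
  proof (intro sum.cong refl)
    fix q assume "q \<in> S"
    then obtain i where i: "i \<in> U" "P q i" "\<forall>j\<in>U. P q j \<longrightarrow> j = i" "mul q i = q"
      using right_unit by blast
    have iff: "P q p \<longleftrightarrow> p = i" if "p \<in> U" for p
      using i(1-3) that by blast
    have "(\<Sum>p\<in>S. if P q p \<and> mul q p = m then a q * (if p \<in> U then 1 else 0) else 0) =
        (\<Sum>p\<in>S. if p = i then (if q = m then a q else 0) else 0)"
      using i(1,4) iff by (intro sum.cong refl) auto
    also have "\<dots> = (if q = m then a q else 0)" using i(1) units finite by auto
    finally show "(\<Sum>p\<in>S. if P q p \<and> mul q p = m then a q * (if p \<in> U then 1 else 0) else 0) =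
        (if q = m then a q else 0)" .
  qed
  also have "\<dots> = a m" using finite assms by auto
  finally show "conv P mul a (\<lambda>m. if m \<in> U then 1 else 0) m = a m" .
qed

lemma finite_support:
  "\<forall>m. m \<notin> S \<longrightarrow> a m = 0 \<Longrightarrow> finite {m. a m \<noteq> 0}"
  using finite by (rule finite_subset[rotated]) auto

lemma algebra_ring: "ring (algebra :: ('k::field, 'm \<Rightarrow> 'k) module)"
proof (intro ringI abelian_groupI monoidI)
  fix x :: "'m \<Rightarrow> 'k" assume "x \<in> carrier algebra"
  then show "\<exists>y\<in>carrier algebra. y \<oplus>\<^bsub>algebra\<^esub> x = \<zero>\<^bsub>algebra\<^esub>"
    by (intro bexI[of _ "\<lambda>m. - x m"]) (auto simp: supported_iff)
next
  fix x y :: "'m \<Rightarrow> 'k" assume "x \<in> carrier algebra" "y \<in> carrier algebra"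
  then have "\<forall>m. m \<notin> S \<longrightarrow> conv P mul x y m = 0"
    by (intro conv_support closed) (auto simp: supported_iff)
  then show "x \<otimes>\<^bsub>algebra\<^esub> y \<in> carrier algebra" by (simp add: supported_iff)
next
  show "\<one>\<^bsub>algebra :: ('k, 'm \<Rightarrow> 'k) module\<^esub> \<in> carrier algebra"
    using units by (auto simp: supported_iff)
qed (simp_all add: supported_iff ac_simps conv_assoc conv_left_unit conv_right_unit
    conv_add_left conv_add_right finite_support)

end


section \<open>Bases from linear coordinates\<close>

text \<open>The vector space structure of \<open>V\<close> is pulled back along the linear bijection
  \<open>T\<close>, so \<open>V\<close> starts as a bare record. \<open>zero\<close> is a separate
  assumption because that field is not tied to the others before \<open>V\<close> is known to be a
  group. The instances are the identity map for the algebra and the coset map for arrow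
  spaces.\<close>

locale coordinates =
  fixes S :: "'m set" and T :: "('m \<Rightarrow> 'k::field) \<Rightarrow> 'b" and V :: "('k, 'b) module"
  assumes finite: "finite S"
    and bij: "bij_betw T {a. \<forall>m. m \<notin> S \<longrightarrow> a m = 0} (carrier V)"
    and add: "\<lbrakk>\<forall>m. m \<notin> S \<longrightarrow> a m = 0; \<forall>m. m \<notin> S \<longrightarrow> b m = 0\<rbrakk> \<Longrightarrow>
      T (\<lambda>m. a m + b m) = T a \<oplus>\<^bsub>V\<^esub> T b"
    and scale: "\<forall>m. m \<notin> S \<longrightarrow> a m = 0 \<Longrightarrow> T (\<lambda>m. c * a m) = c \<odot>\<^bsub>V\<^esub> T a"
    and zero: "T (\<lambda>_. 0) = \<zero>\<^bsub>V\<^esub>"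
begin

lemma carrierE:
  assumes "x \<in> carrier V"
  obtains a where "\<forall>m. m \<notin> S \<longrightarrow> a m = 0" "x = T a"
  using assms bij_betw_imp_surj_on[OF bij] by blast

lemma carrierI: "\<forall>m. m \<notin> S \<longrightarrow> a m = 0 \<Longrightarrow> T a \<in> carrier V"
  using bij_betw_imp_surj_on[OF bij] by blast

lemma eqD: "\<lbrakk>T a = T b; \<forall>m. m \<notin> S \<longrightarrow> a m = 0; \<forall>m. m \<notin> S \<longrightarrow> b m = 0\<rbrakk> \<Longrightarrow> a = b"
  using bij_betw_imp_inj_on[OF bij] by (auto dest: inj_onD)

lemma abelian_group: "abelian_group V"
proof (rule abelian_groupI)
  fix x y assume "x \<in> carrier V" "y \<in> carrier V"
  then obtain a b where *: "\<forall>m. m \<notin> S \<longrightarrow> a m = 0" "x = T a" "\<forall>m. m \<notin> S \<longrightarrow> b m = 0" "y = T b"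
    by (auto elim!: carrierE)
  show "x \<oplus>\<^bsub>V\<^esub> y \<in> carrier V"
    unfolding * add[OF *(1,3), symmetric] by (rule carrierI) (simp add: *(1,3))
  show "x \<oplus>\<^bsub>V\<^esub> y = y \<oplus>\<^bsub>V\<^esub> x"
    unfolding * add[OF *(1,3), symmetric] add[OF *(3,1), symmetric] by (simp add: add.commute)
  fix z assume "z \<in> carrier V"
  then obtain c where c: "\<forall>m. m \<notin> S \<longrightarrow> c m = 0" "z = T c"
    by (auto elim!: carrierE)
  have ab: "\<forall>m. m \<notin> S \<longrightarrow> a m + b m = 0" and bc: "\<forall>m. m \<notin> S \<longrightarrow> b m + c m = 0"
    using * c by auto
  show "x \<oplus>\<^bsub>V\<^esub> y \<oplus>\<^bsub>V\<^esub> z = x \<oplus>\<^bsub>V\<^esub> (y \<oplus>\<^bsub>V\<^esub> z)"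
    unfolding *(2,4) c(2) add[OF *(1,3), symmetric] add[OF ab c(1), symmetric]
      add[OF *(3) c(1), symmetric] add[OF *(1) bc, symmetric] by (simp add: add.assoc)
next
  show "\<zero>\<^bsub>V\<^esub> \<in> carrier V" unfolding zero[symmetric] by (rule carrierI) simp
next
  fix x assume "x \<in> carrier V"
  then obtain a where *: "\<forall>m. m \<notin> S \<longrightarrow> a m = 0" "x = T a" by (rule carrierE)
  have z: "\<forall>m. m \<notin> S \<longrightarrow> (\<lambda>_. 0::'k) m = 0" and na: "\<forall>m. m \<notin> S \<longrightarrow> - a m = 0"
    using * by auto
  show "\<zero>\<^bsub>V\<^esub> \<oplus>\<^bsub>V\<^esub> x = x"
    unfolding *(2) zero[symmetric] add[OF z *(1), symmetric] by simp
  show "\<exists>y\<in>carrier V. y \<oplus>\<^bsub>V\<^esub> x = \<zero>\<^bsub>V\<^esub>"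
    unfolding *(2) using add[OF na *(1)] by (intro bexI[OF _ carrierI[OF na]]) (simp add: zero)
qed

lemma vectorspace: "vectorspace class_ring V"
proof -
  interpret V: abelian_group V by (rule abelian_group)
  have "Module.module class_ring V"
  proof (rule Module.moduleI)
    show "cring (class_ring :: 'k ring)" by (rule class_cring.is_cring)
    show "abelian_group V" by (rule abelian_group)
    fix c d :: 'k and x assume "x \<in> carrier V"
    then obtain a where a: "\<forall>m. m \<notin> S \<longrightarrow> a m = 0" "x = T a" by (rule carrierE)
    have sa: "\<forall>m. m \<notin> S \<longrightarrow> r * a m = 0" for r using a by auto
    show "c \<odot>\<^bsub>V\<^esub> x \<in> carrier V"
      unfolding a(2) scale[OF a(1), symmetric] by (rule carrierI[OF sa])
    show "(c \<oplus>\<^bsub>class_ring\<^esub> d) \<odot>\<^bsub>V\<^esub> x = c \<odot>\<^bsub>V\<^esub> x \<oplus>\<^bsub>V\<^esub> d \<odot>\<^bsub>V\<^esub> x"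
      unfolding a(2) scale[OF a(1), symmetric] add[OF sa sa, symmetric]
      by (simp add: ring_distribs)
    show "(c \<otimes>\<^bsub>class_ring\<^esub> d) \<odot>\<^bsub>V\<^esub> x = c \<odot>\<^bsub>V\<^esub> (d \<odot>\<^bsub>V\<^esub> x)"
      unfolding a(2) scale[OF a(1), symmetric] scale[OF sa, symmetric] by (simp add: mult.assoc)
    show "\<one>\<^bsub>class_ring\<^esub> \<odot>\<^bsub>V\<^esub> x = x"
      unfolding a(2) scale[OF a(1), symmetric] by simp
    fix y assume "y \<in> carrier V"
    then obtain b where b: "\<forall>m. m \<notin> S \<longrightarrow> b m = 0" "y = T b" by (rule carrierE)
    have sb: "\<forall>m. m \<notin> S \<longrightarrow> c * b m = 0" and ab: "\<forall>m. m \<notin> S \<longrightarrow> a m + b m = 0"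
      using a b by auto
    show "c \<odot>\<^bsub>V\<^esub> (x \<oplus>\<^bsub>V\<^esub> y) = c \<odot>\<^bsub>V\<^esub> x \<oplus>\<^bsub>V\<^esub> c \<odot>\<^bsub>V\<^esub> y"
      unfolding a(2) b(2) scale[OF a(1), symmetric] scale[OF b(1), symmetric]
        add[OF sa sb, symmetric] add[OF a(1) b(1), symmetric] scale[OF ab, symmetric]
      by (simp add: ring_distribs)
  qed
  then show ?thesis
    by (rule vectorspace.intro) (rule class_field.field_axioms)
qed

lemma inj_basis: "inj_on (\<lambda>m. T (basis_vec m)) S"
proof (rule inj_onI)
  fix x y assume "x \<in> S" "y \<in> S" "T (basis_vec x) = T (basis_vec y)"
  then have "(basis_vec x :: 'm \<Rightarrow> 'k) = basis_vec y"
    by (intro eqD) (auto simp: basis_vec_def)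
  then have "(basis_vec x :: 'm \<Rightarrow> 'k) x = basis_vec y x" by simp
  then show "x = y" by (auto simp: basis_vec_def split: if_splits)
qed

lemma lincomb_basis:
  assumes "c \<in> (\<lambda>m. T (basis_vec m)) ` S \<rightarrow> UNIV"
  shows "LinearCombinations.module.lincomb V c ((\<lambda>m. T (basis_vec m)) ` S) =
    T (\<lambda>m. if m \<in> S then c (T (basis_vec m)) else 0)"
proof -
  interpret V: vectorspace class_ring V by (rule vectorspace)
  have supp: "\<forall>k. k \<notin> S \<longrightarrow> (basis_vec m k :: 'k) = 0" if "m \<in> S" for m
    using that by (auto simp: basis_vec_def)
  have in_V: "c (T (basis_vec m)) \<odot>\<^bsub>V\<^esub> T (basis_vec m) \<in> carrier V" if "m \<in> S" for m
    using V.smult_closed[of "c (T (basis_vec m))"] carrierI[OF supp[OF that]] by simp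
  \<comment> \<open>Stated for subsets \<open>R\<close> of \<open>S\<close>, so that induction can
    add one basis vector at a time.\<close>
  have "(\<Oplus>\<^bsub>V\<^esub>m\<in>R. c (T (basis_vec m)) \<odot>\<^bsub>V\<^esub> T (basis_vec m)) =
      T (\<lambda>m. if m \<in> R then c (T (basis_vec m)) else 0)" if "R \<subseteq> S" for R
    using finite_subset[OF that finite] that
  proof (induction R rule: finite_induct)
    case empty
    then show ?case by (simp add: zero)
  next
    case (insert x R)
    have 1: "\<forall>m. m \<notin> S \<longrightarrow> c (T (basis_vec x)) * basis_vec x m = 0"
      and 2: "\<forall>m. m \<notin> S \<longrightarrow> (if m \<in> R then c (T (basis_vec m)) else 0) = 0"
      using insert by (auto simp: basis_vec_def)
    have x: "x \<in> S" using insert by auto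
    have "(\<Oplus>\<^bsub>V\<^esub>m\<in>insert x R. c (T (basis_vec m)) \<odot>\<^bsub>V\<^esub> T (basis_vec m)) =
        c (T (basis_vec x)) \<odot>\<^bsub>V\<^esub> T (basis_vec x) \<oplus>\<^bsub>V\<^esub>
        (\<Oplus>\<^bsub>V\<^esub>m\<in>R. c (T (basis_vec m)) \<odot>\<^bsub>V\<^esub> T (basis_vec m))"
      using insert in_V by (intro V.finsum_insert) auto
    also have "\<dots> = T (\<lambda>m. c (T (basis_vec x)) * basis_vec x m +
        (if m \<in> R then c (T (basis_vec m)) else 0))"
      using insert by (simp add: add[OF 1 2] scale[OF supp[OF x]])
    also have "(\<lambda>m. c (T (basis_vec x)) * basis_vec x m +
        (if m \<in> R then c (T (basis_vec m)) else 0)) =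
        (\<lambda>m. if m \<in> insert x R then c (T (basis_vec m)) else 0)"
      using insert by (auto simp: basis_vec_def)
    finally show ?case .
  qed
  from this[of S] show ?thesis
    unfolding V.lincomb_def using inj_basis in_V by (subst V.finsum_reindex) auto
qed

lemma basis: "vectorspace.basis class_ring V ((\<lambda>m. T (basis_vec m)) ` S)"
proof -
  interpret V: vectorspace class_ring V by (rule vectorspace)
  let ?B = "(\<lambda>m. T (basis_vec m)) ` S"
  have B: "?B \<subseteq> carrier V" by (auto intro!: carrierI simp: basis_vec_def)
  have "\<exists>!c. c \<in> ?B \<rightarrow>\<^sub>E carrier class_ring \<and> V.lincomb c ?B = v" if "v \<in> carrier V" for v
  proof -
    obtain a where a: "\<forall>m. m \<notin> S \<longrightarrow> a m = 0" "v = T a" using \<open>v \<in> carrier V\<close> by (rule carrierE)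
    \<comment> \<open>By injectivity of \<open>T\<close> a combination equals \<open>v\<close>
      exactly when its coefficients are the coordinates of \<open>v\<close>; existence and
      uniqueness both follow.\<close>
    have lin: "V.lincomb c ?B = v \<longleftrightarrow> (\<forall>m\<in>S. c (T (basis_vec m)) = a m)" for c
    proof -
      have "V.lincomb c ?B = v \<longleftrightarrow> (\<lambda>m. if m \<in> S then c (T (basis_vec m)) else 0) = a"
        unfolding a(2) by (subst lincomb_basis) (auto intro: eqD simp: a(1))
      then show ?thesis using a(1) by (auto simp: fun_eq_iff)
    qed
    show ?thesis
    proof (rule ex1I)
      let ?c = "\<lambda>x\<in>?B. a (the_inv_into S (\<lambda>m. T (basis_vec m)) x)"
      show "?c \<in> ?B \<rightarrow>\<^sub>E carrier class_ring \<and> V.lincomb ?c ?B = v"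
        unfolding lin by (auto simp: the_inv_into_f_f[OF inj_basis])
      fix c assume c: "c \<in> ?B \<rightarrow>\<^sub>E carrier class_ring \<and> V.lincomb c ?B = v"
      show "c = ?c"
      proof
        fix x show "c x = ?c x"
          using c unfolding lin by (cases "x \<in> ?B") (auto simp: the_inv_into_f_f[OF inj_basis] PiE_def extensional_def)
      qed
    qed
  qed
  then show ?thesis using V.basis_criterion[OF _ B] finite by auto
qed

lemma fin_dim: "vectorspace.fin_dim class_ring V"
proof -
  interpret V: vectorspace class_ring V by (rule vectorspace)
  show ?thesis
    using basis finite unfolding V.fin_dim_def V.basis_def by blast
qed

end

context partial_monoid
begin

lemma coordinates_algebra: "coordinates S (\<lambda>a. a) (algebra :: ('k::field, 'm \<Rightarrow> 'k) module)"
  using finite by unfold_locales (auto simp: bij_betw_def supported_def)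

lemma fin_dim_algebra: "fin_dim_algebra (algebra :: ('k::field, 'm \<Rightarrow> 'k) module)"
proof -
  interpret coordinates S "\<lambda>a. a" "algebra :: ('k, 'm \<Rightarrow> 'k) module"
    by (rule coordinates_algebra)
  show ?thesis
    unfolding fin_dim_algebra_def using algebra_ring vectorspace fin_dim
    by (auto simp: conv_scale finite_support supported_iff)
qed

end

section \<open>Category algebras\<close>

context partial_monoid
begin

text \<open>The hypothesis concerns only pairs with nonzero coefficients, so knowledge of the
  supports of \<open>a\<close> and \<open>b\<close> can be used to locate the product.\<close>

lemma conv_in_supported:
  assumes "a \<in> supported S" "b \<in> supported S"
    and "\<And>p q. \<lbrakk>p \<in> S; q \<in> S; P p q; a p \<noteq> 0; b q \<noteq> 0\<rbrakk> \<Longrightarrow> mul p q \<in> D"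
  shows "conv P mul a b \<in> supported D"
  unfolding supported_iff
proof (intro allI impI, rule ccontr)
  fix m assume "m \<notin> D" and m: "conv P mul a b m \<noteq> 0"
  from m obtain p q where "a p \<noteq> 0" "b q \<noteq> 0" "P p q" "mul p q = m"
    by (rule conv_nonzeroE)
  moreover have "p \<in> S" "q \<in> S"
    using calculation assms(1,2) by (auto dest: supportedD)
  ultimately show False using assms(3) \<open>m \<notin> D\<close> by blast
qed

lemma a_inv_algebra: "a \<in> supported S \<Longrightarrow> \<ominus>\<^bsub>algebra\<^esub> a = (\<lambda>m. - (a m :: 'k::field))"
proof -
  interpret ring "algebra :: ('k, 'm \<Rightarrow> 'k) module" by (rule algebra_ring)
  assume "a \<in> supported S"
  then show ?thesis by (intro minus_equality) (auto simp: supported_iff)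
qed

lemma finsum_algebra:
  assumes "finite F" "\<And>i. i \<in> F \<Longrightarrow> g i \<in> supported S"
  shows "(\<Oplus>\<^bsub>algebra\<^esub>i\<in>F. g i) = (\<lambda>m. \<Sum>i\<in>F. g i m :: 'k::field)"
proof -
  interpret ring "algebra :: ('k, 'm \<Rightarrow> 'k) module" by (rule algebra_ring)
  show ?thesis using assms
  proof (induction F rule: finite_induct)
    case (insert x F)
    then have "(\<Oplus>\<^bsub>algebra\<^esub>i\<in>insert x F. g i) = g x \<oplus>\<^bsub>algebra\<^esub> (\<Oplus>\<^bsub>algebra\<^esub>i\<in>F. g i)"
      by (intro finsum_insert) auto
    then show ?case using insert by simp
  qed simp
qed

lemma left_ideal_algebraI:
  fixes I :: "('m \<Rightarrow> 'k::field) set"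
  assumes "I \<subseteq> supported S" "(\<lambda>_. 0) \<in> I" "\<And>a b. \<lbrakk>a \<in> I; b \<in> I\<rbrakk> \<Longrightarrow> (\<lambda>m. a m + b m) \<in> I"
    and mult: "\<And>a b. \<lbrakk>a \<in> supported S; b \<in> I\<rbrakk> \<Longrightarrow> conv P mul a b \<in> I"
  shows "left_ideal I algebra"
proof -
  interpret A: ring "algebra :: ('k, 'm \<Rightarrow> 'k) module" by (rule algebra_ring)
  \<comment> \<open>Closure under negation comes for free from left multiplication by the negated
    unit.\<close>
  have neg: "(\<lambda>m. - b m) \<in> I" if "b \<in> I" for b
  proof -
    have b: "b \<in> carrier algebra" using that assms(1) by auto
    have "\<ominus>\<^bsub>algebra\<^esub> \<one>\<^bsub>algebra\<^esub> \<otimes>\<^bsub>algebra\<^esub> b \<in> I"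
      using mult[of "\<ominus>\<^bsub>algebra\<^esub> \<one>\<^bsub>algebra\<^esub>" b] A.a_inv_closed[OF A.one_closed] that by simp
    also have "\<ominus>\<^bsub>algebra\<^esub> \<one>\<^bsub>algebra\<^esub> \<otimes>\<^bsub>algebra\<^esub> b = \<ominus>\<^bsub>algebra\<^esub> b"
      using A.l_minus[OF A.one_closed b] A.l_one[OF b] by metis
    finally show ?thesis using a_inv_algebra[of b] b by simp
  qed
  have "subgroup I (add_monoid algebra)"
  proof (rule A.add.subgroupI)
    fix a b assume "a \<in> I" "b \<in> I"
    show "\<ominus>\<^bsub>algebra\<^esub> a \<in> I"
      using neg[OF \<open>a \<in> I\<close>] a_inv_algebra[of a] \<open>a \<in> I\<close> assms(1) by auto
    show "a \<oplus>\<^bsub>algebra\<^esub> b \<in> I"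
      using assms(3)[OF \<open>a \<in> I\<close> \<open>b \<in> I\<close>] by simp
  qed (use assms(1,2) in auto)
  then show ?thesis
    unfolding left_ideal_def using mult by (auto intro: additive_subgroupI)
qed

lemma supported_ideal:
  assumes "D \<subseteq> S"
    and "\<And>p q. \<lbrakk>p \<in> S; q \<in> D; P p q\<rbrakk> \<Longrightarrow> mul p q \<in> D"
    and "\<And>p q. \<lbrakk>p \<in> D; q \<in> S; P p q\<rbrakk> \<Longrightarrow> mul p q \<in> D"
  shows "ideal (supported D) (algebra :: ('k::field, 'm \<Rightarrow> 'k) module)"
proof -
  interpret A: ring "algebra :: ('k, 'm \<Rightarrow> 'k) module" by (rule algebra_ring)
  have sub: "supported D \<subseteq> supported S" using assms(1) by (auto intro: supported_mono)
  have l: "conv P mul a b \<in> supported D"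
    if "a \<in> supported S" "b \<in> supported D" for a b :: "'m \<Rightarrow> 'k"
    using that sub assms(2) supportedD[OF that(2)] by (intro conv_in_supported) blast+
  have r: "conv P mul a b \<in> supported D"
    if "a \<in> supported D" "b \<in> supported S" for a b :: "'m \<Rightarrow> 'k"
    using that sub assms(3) supportedD[OF that(1)] by (intro conv_in_supported) blast+
  have "left_ideal (supported D) (algebra :: ('k, 'm \<Rightarrow> 'k) module)"
    using sub l by (intro left_ideal_algebraI) (auto simp: supported_iff)
  then have "subgroup (supported D) (add_monoid (algebra :: ('k, 'm \<Rightarrow> 'k) module))"
    unfolding left_ideal_def by (auto dest: additive_subgroup.a_subgroup)
  then show ?thesis
    using l r by (intro idealI algebra_ring) auto
qed

text \<open>Turns a coset of a coordinate subspace into a condition on the coefficients outside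
  \<open>D\<close>, which makes the quotient operations pointwise.\<close>

lemma supported_coset:
  "supported D +>\<^bsub>algebra\<^esub> a = {b :: 'm \<Rightarrow> 'k::field. \<forall>m. m \<notin> D \<longrightarrow> b m = a m}"
proof -
  have "\<exists>d\<in>supported D. b = (\<lambda>m. d m + a m)" if "\<forall>m. m \<notin> D \<longrightarrow> b m = a m" for b :: "'m \<Rightarrow> 'k"
    using that by (intro bexI[of _ "\<lambda>m. b m - a m"]) (auto simp: supported_iff)
  then show ?thesis by (auto simp: a_r_coset_def' supported_iff)
qed

lemma quot_algebra_smult:
  "c \<odot>\<^bsub>quot_algebra algebra (supported D)\<^esub> (supported D +>\<^bsub>algebra\<^esub> a) =
    supported D +>\<^bsub>algebra\<^esub> (\<lambda>m. c * (a m :: 'k::field))"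
proof -
  \<comment> \<open>After scaling, all representatives give the same coset, so the union in
    \<open>quot_algebra\<close> is that coset.\<close>
  have "(\<Union>x\<in>supported D +>\<^bsub>algebra\<^esub> a. supported D +>\<^bsub>algebra\<^esub> (c \<odot>\<^bsub>algebra\<^esub> x)) =
      supported D +>\<^bsub>algebra\<^esub> (\<lambda>m. c * a m)"
    unfolding supported_coset by auto
  then show ?thesis by (simp add: quot_algebra_def ring.defs module.defs FactRing_def)
qed

lemma quot_algebra_simps:
  fixes I :: "('m \<Rightarrow> 'k::field) set"
  shows "carrier (quot_algebra algebra I) = a_rcosets\<^bsub>algebra\<^esub> I"
    "\<zero>\<^bsub>quot_algebra algebra I\<^esub> = I"
    "X \<oplus>\<^bsub>quot_algebra algebra I\<^esub> Y = X <+>\<^bsub>algebra\<^esub> Y"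
    "X \<otimes>\<^bsub>quot_algebra algebra I\<^esub> Y = X \<otimes>\<^bsub>algebra Quot I\<^esub> Y"
    "\<one>\<^bsub>quot_algebra algebra I\<^esub> = \<one>\<^bsub>algebra Quot I\<^esub>"
  by (simp_all add: quot_algebra_def ring.defs module.defs FactRing_def)

end

locale small_category =
  fixes E :: "('o, 'm) smallcat"
  assumes dom_in: "f \<in> Arr E \<Longrightarrow> Dom E f \<in> Obj E"
    and cod_in: "f \<in> Arr E \<Longrightarrow> Cod E f \<in> Obj E"
    and id_in: "a \<in> Obj E \<Longrightarrow> Id E a \<in> Arr E"
    and dom_id: "a \<in> Obj E \<Longrightarrow> Dom E (Id E a) = a"
    and cod_id: "a \<in> Obj E \<Longrightarrow> Cod E (Id E a) = a"
    and comp_in: "\<lbrakk>g \<in> Arr E; f \<in> Arr E; Dom E g = Cod E f\<rbrakk> \<Longrightarrow> Comp E g f \<in> Arr E"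
    and dom_comp: "\<lbrakk>g \<in> Arr E; f \<in> Arr E; Dom E g = Cod E f\<rbrakk> \<Longrightarrow> Dom E (Comp E g f) = Dom E f"
    and cod_comp: "\<lbrakk>g \<in> Arr E; f \<in> Arr E; Dom E g = Cod E f\<rbrakk> \<Longrightarrow> Cod E (Comp E g f) = Cod E g"
    and comp_assoc: "\<lbrakk>h \<in> Arr E; g \<in> Arr E; f \<in> Arr E; Dom E h = Cod E g; Dom E g = Cod E f\<rbrakk> \<Longrightarrow>
      Comp E (Comp E h g) f = Comp E h (Comp E g f)"
    and id_comp: "f \<in> Arr E \<Longrightarrow> Comp E (Id E (Cod E f)) f = f"
    and comp_id: "f \<in> Arr E \<Longrightarrow> Comp E f (Id E (Dom E f)) = f"

locale finite_category = small_category E for E :: "('o, 'm) smallcat" +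
  assumes finite_arr: "finite (Arr E)"
begin

text \<open>The left unit of \<open>p\<close> is the identity at its codomain, the right unit the
  identity at its domain; they are unique because an identity determines its object.\<close>

sublocale partial_monoid "Arr E" "\<lambda>g f. Dom E g = Cod E f" "Comp E" "Id E ` Obj E"
proof unfold_locales
  fix p assume p: "p \<in> Arr E"
  show "\<exists>i\<in>Id E ` Obj E. Dom E i = Cod E p \<and> (\<forall>j\<in>Id E ` Obj E. Dom E j = Cod E p \<longrightarrow> j = i) \<and>
      Comp E i p = p"
    using p cod_in[OF p] by (intro bexI[of _ "Id E (Cod E p)"]) (auto simp: dom_id id_comp)
  show "\<exists>i\<in>Id E ` Obj E. Dom E p = Cod E i \<and> (\<forall>j\<in>Id E ` Obj E. Dom E p = Cod E j \<longrightarrow> j = i) \<and>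
      Comp E p i = p"
    using p dom_in[OF p] by (intro bexI[of _ "Id E (Dom E p)"]) (auto simp: cod_id comp_id)
qed (auto simp: finite_arr comp_in dom_comp cod_comp comp_assoc id_in)

lemma finite_obj: "finite (Obj E)"
proof (rule inj_on_finite)
  show "inj_on (Id E) (Obj E)" by (metis dom_id inj_onI)
  show "Id E ` Obj E \<subseteq> Arr E" by (auto simp: id_in)
qed (rule finite_arr)

lemma category_algebra_eq: "category_algebra E = (algebra :: ('k::field, 'm \<Rightarrow> 'k) module)"
  by (simp add: category_algebra_def algebra_def)

lemma conv_id_left:
  assumes "a \<in> supported (Arr E)" "c \<in> Obj E"
  shows "conv (\<lambda>g f. Dom E g = Cod E f) (Comp E) (basis_vec (Id E c)) a =
    (\<lambda>m. if m \<in> Arr E \<and> Cod E m = c then a m else (0 :: 'k::field))"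
proof
  fix m
  have b: "\<forall>m. m \<notin> {Id E c} \<longrightarrow> (basis_vec (Id E c) m :: 'k) = 0"
    by (auto simp: basis_vec_def)
  have a: "\<forall>m. m \<notin> Arr E \<longrightarrow> a m = 0" using assms(1) by (simp add: supported_iff)
  have "conv (\<lambda>g f. Dom E g = Cod E f) (Comp E) (basis_vec (Id E c)) a m =
      (\<Sum>q\<in>Arr E. if c = Cod E q \<and> Comp E (Id E c) q = m then a q else 0)"
    by (subst conv_eq_sum[OF _ b finite_arr a]) (simp_all add: basis_vec_def dom_id assms(2) cong: if_cong)
  also have "\<dots> = (\<Sum>q\<in>Arr E. if q = m then (if Cod E m = c then a m else 0) else 0)"
  proof (intro sum.cong refl)
    fix q assume "q \<in> Arr E"
    then have "c = Cod E q \<and> Comp E (Id E c) q = m \<longleftrightarrow> q = m \<and> Cod E m = c"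
      using id_comp by auto
    then show "(if c = Cod E q \<and> Comp E (Id E c) q = m then a q else 0) =
        (if q = m then (if Cod E m = c then a m else 0) else 0)" by auto
  qed
  also have "\<dots> = (if m \<in> Arr E \<and> Cod E m = c then a m else 0)"
    using finite_arr by auto
  finally show "conv (\<lambda>g f. Dom E g = Cod E f) (Comp E) (basis_vec (Id E c)) a m =
    (if m \<in> Arr E \<and> Cod E m = c then a m else 0)" .
qed

lemma conv_id_right:
  assumes "a \<in> supported (Arr E)" "c \<in> Obj E"
  shows "conv (\<lambda>g f. Dom E g = Cod E f) (Comp E) a (basis_vec (Id E c)) =
    (\<lambda>m. if m \<in> Arr E \<and> Dom E m = c then a m else (0 :: 'k::field))"
proof
  fix m
  have b: "\<forall>m. m \<notin> {Id E c} \<longrightarrow> (basis_vec (Id E c) m :: 'k) = 0"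
    by (auto simp: basis_vec_def)
  have a: "\<forall>m. m \<notin> Arr E \<longrightarrow> a m = 0" using assms(1) by (simp add: supported_iff)
  have "conv (\<lambda>g f. Dom E g = Cod E f) (Comp E) a (basis_vec (Id E c)) m =
      (\<Sum>q\<in>Arr E. if Dom E q = c \<and> Comp E q (Id E c) = m then a q else 0)"
    by (subst conv_eq_sum[OF finite_arr a _ b]) (simp_all add: basis_vec_def cod_id assms(2) cong: if_cong)
  also have "\<dots> = (\<Sum>q\<in>Arr E. if q = m then (if Dom E m = c then a m else 0) else 0)"
  proof (intro sum.cong refl)
    fix q assume "q \<in> Arr E"
    then have "Dom E q = c \<and> Comp E q (Id E c) = m \<longleftrightarrow> q = m \<and> Dom E m = c"
      using comp_id by auto
    then show "(if Dom E q = c \<and> Comp E q (Id E c) = m then a q else 0) =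
        (if q = m then (if Dom E m = c then a m else 0) else 0)" by auto
  qed
  also have "\<dots> = (if m \<in> Arr E \<and> Dom E m = c then a m else 0)"
    using finite_arr by auto
  finally show "conv (\<lambda>g f. Dom E g = Cod E f) (Comp E) a (basis_vec (Id E c)) m =
    (if m \<in> Arr E \<and> Dom E m = c then a m else 0)" .
qed

end

section \<open>Maximal left ideals\<close>

context ring
begin

text \<open>Uses 1 - y j = (1 - y) + y (1 - j). Iterated with \<open>y\<close> a power of
  \<open>j\<close>, it carries 1 - j in the left ideal to 1 - j^k in the left ideal.\<close>

lemma left_ideal_step:
  assumes "left_ideal I R" "y \<in> carrier R" "j \<in> carrier R" "\<one> \<ominus> y \<in> I" "\<one> \<ominus> j \<in> I"
  shows "\<one> \<ominus> y \<otimes> j \<in> I"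
proof -
  interpret I: additive_subgroup I R using assms(1) by (simp add: left_ideal_def)
  have "(\<one> \<ominus> y) \<oplus> y \<otimes> (\<one> \<ominus> j) \<in> I"
    using assms unfolding left_ideal_def by blast
  also have "(\<one> \<ominus> y) \<oplus> y \<otimes> (\<one> \<ominus> j) = (\<one> \<ominus> y) \<oplus> (y \<otimes> \<one> \<ominus> y \<otimes> j)"
    using assms(2,3) one_closed by algebra
  also have "\<dots> = \<one> \<ominus> y \<otimes> j"
    unfolding r_one[OF assms(2)] using assms(2,3) one_closed by algebra
  finally show ?thesis .
qed

lemma left_ideal_eq_carrier:
  assumes "left_ideal I R" "\<one> \<in> I"
  shows "I = carrier R"
proof
  interpret I: additive_subgroup I R using assms(1) by (simp add: left_ideal_def)
  show "I \<subseteq> carrier R" by (rule I.a_subset)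
  show "carrier R \<subseteq> I"
  proof
    fix y assume y: "y \<in> carrier R"
    then have "y \<otimes> \<one> \<in> I" using assms unfolding left_ideal_def by blast
    then show "y \<in> I" using y by simp
  qed
qed

lemma left_ideal_adjoin:
  assumes "left_ideal I R" and x: "x \<in> carrier R"
  shows "left_ideal {i \<oplus> a \<otimes> x |i a. i \<in> I \<and> a \<in> carrier R} R" (is "left_ideal ?K R")
proof -
  interpret I: additive_subgroup I R using assms(1) by (simp add: left_ideal_def)
  have "subgroup ?K (add_monoid R)"
  proof (rule add.subgroupI)
    show "?K \<subseteq> carrier R" using I.a_Hcarr x by auto
    have "\<zero> \<oplus> \<zero> \<otimes> x \<in> ?K" using I.zero_closed zero_closed by blast
    then show "?K \<noteq> {}" by blast
    fix u v assume "u \<in> ?K" "v \<in> ?K"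
    then obtain i a j b where u: "i \<in> I" "a \<in> carrier R" "u = i \<oplus> a \<otimes> x"
      and v: "j \<in> I" "b \<in> carrier R" "v = j \<oplus> b \<otimes> x" by blast
    note c = I.a_Hcarr[OF u(1)] I.a_Hcarr[OF v(1)]
    have "\<ominus> u = \<ominus> i \<oplus> (\<ominus> a) \<otimes> x" unfolding u(3) using c u(2) x by algebra
    then show "\<ominus> u \<in> ?K" using I.a_inv_closed[OF u(1)] a_inv_closed[OF u(2)] by blast
    have "u \<oplus> v = (i \<oplus> j) \<oplus> (a \<oplus> b) \<otimes> x"
      unfolding u(3) v(3) using c u(2) v(2) x by algebra
    then show "u \<oplus> v \<in> ?K" using I.a_closed[OF u(1) v(1)] a_closed[OF u(2) v(2)] by blast
  qed
  moreover have "r \<otimes> u \<in> ?K" if r: "r \<in> carrier R" and "u \<in> ?K" for r u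
  proof -
    obtain i a where u: "i \<in> I" "a \<in> carrier R" "u = i \<oplus> a \<otimes> x" using \<open>u \<in> ?K\<close> by blast
    have "r \<otimes> u = r \<otimes> i \<oplus> (r \<otimes> a) \<otimes> x"
      unfolding u(3) using I.a_Hcarr[OF u(1)] u(2) x r by algebra
    moreover have "r \<otimes> i \<in> I" using assms(1) r u(1) by (simp add: left_ideal_def)
    ultimately show ?thesis using m_closed[OF r u(2)] by blast
  qed
  ultimately show ?thesis by (simp add: left_ideal_def additive_subgroupI)
qed

text \<open>Were \<open>x\<close> outside \<open>I\<close>, maximality would make
  \<open>I + R x\<close> the whole ring. Then 1 = i + a x with \<open>i\<close> in \<open>I\<close>,
  so 1 - a x lies in \<open>I\<close>, and the hypothesis puts the unit into
  \<open>I\<close>.\<close>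

lemma maximal_left_ideal_memI:
  assumes I: "maximal_left_ideal I R" and x: "x \<in> carrier R"
    and one: "\<And>a. \<lbrakk>a \<in> carrier R; \<one> \<ominus> a \<otimes> x \<in> I\<rbrakk> \<Longrightarrow> \<one> \<in> I"
  shows "x \<in> I"
proof (rule ccontr)
  assume "x \<notin> I"
  have li: "left_ideal I R" using I by (simp add: maximal_left_ideal_def)
  interpret I: additive_subgroup I R using li by (simp add: left_ideal_def)
  let ?K = "{i \<oplus> a \<otimes> x |i a. i \<in> I \<and> a \<in> carrier R}"
  have "I \<subseteq> ?K"
  proof
    fix i assume i: "i \<in> I"
    have "i = i \<oplus> \<zero> \<otimes> x" using I.a_Hcarr[OF i] x by algebra
    then show "i \<in> ?K" using i zero_closed by blast
  qed
  moreover have "?K \<noteq> I"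
  proof -
    have "x = \<zero> \<oplus> \<one> \<otimes> x" using x by algebra
    then have "x \<in> ?K" using I.zero_closed one_closed by blast
    then show ?thesis using \<open>x \<notin> I\<close> by blast
  qed
  moreover have "left_ideal J R \<and> I \<subseteq> J \<longrightarrow> J = I \<or> J = carrier R" for J
    using I by (simp add: maximal_left_ideal_def)
  from this[of ?K] have "left_ideal ?K R \<and> I \<subseteq> ?K \<longrightarrow> ?K = I \<or> ?K = carrier R" .
  ultimately have "?K = carrier R"
    using left_ideal_adjoin[OF li x] by argo
  then have "\<one> \<in> ?K" by simp
  then obtain i a where *: "i \<in> I" "a \<in> carrier R" "\<one> = i \<oplus> a \<otimes> x" by blast
  have "\<one> \<ominus> a \<otimes> x = i"
    unfolding *(3) using I.a_Hcarr[OF *(1)] *(2) x by algebra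
  then have "\<one> \<in> I" using one[OF *(2)] *(1) by simp
  then show False using left_ideal_eq_carrier[OF li] I by (simp add: maximal_left_ideal_def)
qed

end

section \<open>Radical, primitive idempotents and quiver of a directed category algebra\<close>

section \<open>Directed categories\<close>

text \<open>The rank encodes that non-identity morphisms only go downwards.\<close>

locale directed_category = finite_category E for E :: "('o, 'm) smallcat" +
  fixes rank :: "'o \<Rightarrow> nat"
  assumes id_or_rank_less: "f \<in> Arr E \<Longrightarrow> f = Id E (Dom E f) \<or> rank (Cod E f) < rank (Dom E f)"
begin

abbreviation mult_alg :: "('m \<Rightarrow> 'k::field) \<Rightarrow> ('m \<Rightarrow> 'k) \<Rightarrow> 'm \<Rightarrow> 'k" (infixl "\<star>" 70) where
  "a \<star> b \<equiv> conv (\<lambda>g f. Dom E g = Cod E f) (Comp E) a b"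

abbreviation ident :: "'o \<Rightarrow> 'm \<Rightarrow> 'k::field" where
  "ident c \<equiv> basis_vec (Id E c)"

definition nonid :: "'m set" where
  "nonid = Arr E - Id E ` Obj E"

definition reducible :: "'m set" where
  "reducible = {Comp E g f |g f. g \<in> nonid \<and> f \<in> nonid \<and> Dom E g = Cod E f}"

definition irreducible :: "'o \<Rightarrow> 'o \<Rightarrow> 'm set" where
  "irreducible c d = {f \<in> nonid - reducible. Dom E f = c \<and> Cod E f = d}"

lemma rank_le: "f \<in> Arr E \<Longrightarrow> rank (Cod E f) \<le> rank (Dom E f)"
  using id_or_rank_less[of f] dom_in[of f] by (metis cod_id dual_order.refl order_less_imp_le)

lemma rank_less: "f \<in> nonid \<Longrightarrow> rank (Cod E f) < rank (Dom E f)"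
  using id_or_rank_less[of f] dom_in[of f] by (auto simp: nonid_def)

lemma nonid_arr: "f \<in> nonid \<Longrightarrow> f \<in> Arr E"
  by (simp add: nonid_def)

lemma nonid_iff_rank: "f \<in> nonid \<longleftrightarrow> f \<in> Arr E \<and> rank (Cod E f) < rank (Dom E f)"
  using rank_less by (auto simp: nonid_def dom_id cod_id)

lemma endo_eq_id:
  assumes "f \<in> Arr E" "Dom E f = c" "Cod E f = c"
  shows "f = Id E c"
  using id_or_rank_less[of f] assms by auto

lemma comp_nonid:
  assumes "g \<in> Arr E" "f \<in> Arr E" "Dom E g = Cod E f" "g \<in> nonid \<or> f \<in> nonid"
  shows "Comp E g f \<in> nonid"
  using assms rank_le[of g] rank_le[of f]
  by (auto simp: nonid_iff_rank comp_in dom_comp cod_comp)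

text \<open>A composite with a non-identity factor lowers the rank, so an identity has only the
  trivial factorisation.\<close>

lemma comp_eq_id_iff:
  assumes "g \<in> Arr E" "f \<in> Arr E" "Dom E g = Cod E f" "c \<in> Obj E"
  shows "Comp E g f = Id E c \<longleftrightarrow> g = Id E c \<and> f = Id E c"
proof
  assume eq: "Comp E g f = Id E c"
  then have "g \<notin> nonid" "f \<notin> nonid"
    using comp_nonid[OF assms(1-3)] assms(4) by (auto simp: nonid_def)
  then obtain a b where "a \<in> Obj E" "b \<in> Obj E" "g = Id E a" "f = Id E b"
    using assms(1,2) by (auto simp: nonid_def)
  then show "g = Id E c \<and> f = Id E c"
    using eq assms(3,4) id_comp[OF assms(2)] by (auto simp: dom_id cod_id)
next
  assume "g = Id E c \<and> f = Id E c"
  then show "Comp E g f = Id E c" using id_comp[OF assms(2)] assms(4) by (simp add: cod_id)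
qed

lemma reducible_nonid: "reducible \<subseteq> nonid"
  using comp_nonid nonid_arr by (auto simp: reducible_def)

lemma reducible_arr: "reducible \<subseteq> Arr E"
  using reducible_nonid nonid_arr by auto

lemma conv_at_id:
  assumes "a \<in> supported (Arr E)" "b \<in> supported (Arr E)" "c \<in> Obj E"
  shows "(a \<star> b) (Id E c) = a (Id E c) * b (Id E c)"
proof -
  have "(a \<star> b) (Id E c) = (\<Sum>p\<in>Arr E. \<Sum>q\<in>Arr E.
      if Dom E p = Cod E q \<and> Comp E p q = Id E c then a p * b q else 0)"
    using assms by (intro conv_eq) (auto simp: supported_iff)
  also have "\<dots> = (\<Sum>p\<in>Arr E. \<Sum>q\<in>Arr E.
      if p = Id E c then (if q = Id E c then a p * b q else 0) else 0)"
  proof (intro sum.cong refl)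
    fix p q assume "p \<in> Arr E" "q \<in> Arr E"
    then have "(Dom E p = Cod E q \<and> Comp E p q = Id E c) \<longleftrightarrow> p = Id E c \<and> q = Id E c"
      using comp_eq_id_iff assms(3) dom_id cod_id by metis
    then show "(if Dom E p = Cod E q \<and> Comp E p q = Id E c then a p * b q else 0) =
        (if p = Id E c then (if q = Id E c then a p * b q else 0) else 0)"
      by auto
  qed
  also have "\<dots> = (\<Sum>p\<in>Arr E. if p = Id E c then (\<Sum>q\<in>Arr E. if q = Id E c then a p * b q else 0) else 0)"
    by (intro sum.cong refl) auto
  also have "\<dots> = a (Id E c) * b (Id E c)"
    using finite_arr id_in[OF assms(3)] by simp
  finally show ?thesis .
qed

subsection \<open>The radical\<close>

text \<open>Filtration by the amount the rank drops: a product of \<open>k\<close> elements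
  supported on \<open>nonid\<close> is supported on \<open>drop_at_least k\<close>.\<close>

definition drop_at_least :: "nat \<Rightarrow> 'm set" where
  "drop_at_least k = {f \<in> Arr E. rank (Cod E f) + k \<le> rank (Dom E f)}"

lemma conv_drop:
  assumes "a \<in> supported (drop_at_least k)" "b \<in> supported nonid"
  shows "a \<star> b \<in> supported (drop_at_least (Suc k))"
proof (rule conv_in_supported)
  show "a \<in> supported (Arr E)" "b \<in> supported (Arr E)"
    using assms by (auto elim!: supported_mono[rotated] simp: drop_at_least_def nonid_def)
  fix p q assume *: "p \<in> Arr E" "q \<in> Arr E" "Dom E p = Cod E q" "a p \<noteq> 0" "b q \<noteq> 0"
  then have "p \<in> drop_at_least k" "q \<in> nonid"
    using assms by (auto dest: supportedD)
  then show "Comp E p q \<in> drop_at_least (Suc k)"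
    using * rank_less[of q] by (auto simp: drop_at_least_def comp_in dom_comp cod_comp)
qed

text \<open>No drop exceeds the largest rank of an object. This is the nilpotency of the span of the
  non-identities.\<close>

lemma drop_empty: "\<exists>k. drop_at_least k = {}"
proof
  have "rank (Dom E f) \<le> Max (rank ` Obj E)" if "f \<in> Arr E" for f
    using finite_obj dom_in[OF that] by auto
  then show "drop_at_least (Suc (Max (rank ` Obj E))) = {}"
    by (fastforce simp: drop_at_least_def)
qed

lemma supported_nonid_arr: "a \<in> supported nonid \<Longrightarrow> a \<in> supported (Arr E)"
  by (erule supported_mono[rotated]) (auto simp: nonid_def)

lemma supported_nonid_iff:
  "a \<in> supported nonid \<longleftrightarrow> a \<in> supported (Arr E) \<and> (\<forall>c\<in>Obj E. a (Id E c) = 0)"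
  by (auto simp: supported_iff nonid_def)

lemma ideal_nonid: "ideal (supported nonid) (algebra :: ('k::field, 'm \<Rightarrow> 'k) module)"
  using comp_nonid by (intro supported_ideal) (auto simp: nonid_def)

text \<open>Multiplying \<open>y\<close> by \<open>j\<close> on the right moves it one step down the
  rank filtration and keeps 1 - y in \<open>I\<close>. At the empty step \<open>y\<close> is zero,
  and the unit itself lies in \<open>I\<close>.\<close>

lemma left_ideal_one_minus:
  fixes I :: "('m \<Rightarrow> 'k::field) set"
  assumes I: "left_ideal I algebra" and j: "j \<in> supported nonid"
    and one_minus: "\<one>\<^bsub>algebra\<^esub> \<ominus>\<^bsub>algebra\<^esub> j \<in> I"
  shows "\<one>\<^bsub>algebra\<^esub> \<in> I"
proof -
  interpret A: ring "algebra :: ('k, 'm \<Rightarrow> 'k) module" by (rule algebra_ring)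
  interpret I: additive_subgroup I "algebra :: ('k, 'm \<Rightarrow> 'k) module"
    using I by (simp add: left_ideal_def)
  have "\<exists>y\<in>supported (drop_at_least k). \<one>\<^bsub>algebra\<^esub> \<ominus>\<^bsub>algebra\<^esub> y \<in> I" for k
  proof (induction k)
    case 0
    have "j \<in> supported (drop_at_least 0)"
      using j rank_less by (elim supported_mono[rotated]) (auto simp: drop_at_least_def nonid_def rank_le)
    then show ?case using one_minus by blast
  next
    case (Suc k)
    then obtain y where y: "y \<in> supported (drop_at_least k)" "\<one>\<^bsub>algebra\<^esub> \<ominus>\<^bsub>algebra\<^esub> y \<in> I" by blast
    have c: "y \<in> carrier algebra" "j \<in> carrier algebra"
      using y(1) j by (auto simp: drop_at_least_def nonid_def elim!: supported_mono[rotated])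
    show ?case
      using conv_drop[OF y(1) j] A.left_ideal_step[OF I c y(2) one_minus]
      by (intro bexI[of _ "y \<star> j"]) simp_all
  qed
  moreover obtain k where "drop_at_least k = {}" using drop_empty by blast
  ultimately obtain y where y: "y \<in> supported {}" "\<one>\<^bsub>algebra\<^esub> \<ominus>\<^bsub>algebra\<^esub> y \<in> I" by metis
  have "y = \<zero>\<^bsub>algebra\<^esub>" using y(1) by (auto simp: supported_iff)
  moreover have "\<one>\<^bsub>algebra\<^esub> \<ominus>\<^bsub>algebra\<^esub> \<zero>\<^bsub>algebra\<^esub> = \<one>\<^bsub>algebra :: ('k, 'm \<Rightarrow> 'k) module\<^esub>"
    unfolding a_minus_def using A.minus_zero A.r_zero[OF A.one_closed] by metis
  ultimately show ?thesis using y(2) by metis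
qed

text \<open>\<open>supported nonid\<close> is an ideal, so \<open>left_ideal_one_minus\<close>
  applies to \<open>a x\<close> for every \<open>a\<close>, as
  \<open>maximal_left_ideal_memI\<close> demands.\<close>

lemma nonid_in_maximal:
  fixes I :: "('m \<Rightarrow> 'k::field) set"
  assumes I: "maximal_left_ideal I algebra"
  shows "supported nonid \<subseteq> I"
proof
  fix x :: "'m \<Rightarrow> 'k" assume x: "x \<in> supported nonid"
  interpret A: ring "algebra :: ('k, 'm \<Rightarrow> 'k) module" by (rule algebra_ring)
  interpret N: ideal "supported nonid" "algebra :: ('k, 'm \<Rightarrow> 'k) module" by (rule ideal_nonid)
  show "x \<in> I"
  proof (rule A.maximal_left_ideal_memI[OF I])
    show "x \<in> carrier algebra" using N.a_Hcarr[OF x] .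
    fix a :: "'m \<Rightarrow> 'k" assume "a \<in> carrier algebra" "\<one>\<^bsub>algebra\<^esub> \<ominus>\<^bsub>algebra\<^esub> a \<otimes>\<^bsub>algebra\<^esub> x \<in> I"
    then show "\<one>\<^bsub>algebra\<^esub> \<in> I"
      using left_ideal_one_minus[OF _ N.I_l_closed[OF x]] I unfolding maximal_left_ideal_def by blast
  qed
qed

text \<open>The kernel of a character has codimension one, so any larger left ideal is
  everything.\<close>

lemma maximal_at_id:
  assumes c: "c \<in> Obj E"
  shows "maximal_left_ideal {a \<in> supported (Arr E). a (Id E c) = (0 :: 'k::field)} algebra"
proof -
  let ?I = "{a \<in> supported (Arr E). a (Id E c) = (0 :: 'k)}"
  interpret A: ring "algebra :: ('k, 'm \<Rightarrow> 'k) module" by (rule algebra_ring)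
  have sub: "a \<star> b \<in> supported (Arr E)" if "a \<in> supported (Arr E)" "b \<in> supported (Arr E)"
    for a b :: "'m \<Rightarrow> 'k"
    using A.m_closed[of a b] that by simp
  have "left_ideal ?I algebra"
    using c sub by (intro left_ideal_algebraI) (auto simp: conv_at_id, auto simp: supported_iff)
  moreover have "\<one>\<^bsub>algebra\<^esub> \<notin> ?I" using c by auto
  moreover have "J = carrier algebra" if J: "left_ideal J algebra" "?I \<subseteq> J" "J \<noteq> ?I" for J
  proof -
    interpret J: additive_subgroup J "algebra :: ('k, 'm \<Rightarrow> 'k) module"
      using J(1) by (simp add: left_ideal_def)
    obtain x where x: "x \<in> J" "x \<notin> ?I" using J by blast
    have xs: "x \<in> supported (Arr E)" using J.a_Hcarr[OF x(1)] by simp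
    define d where "d = x (Id E c)"
    have "d \<noteq> 0" using x xs by (auto simp: d_def)
    have "a \<in> J" if "a \<in> supported (Arr E)" for a
    proof -
      \<comment> \<open>The factor that gives \<open>x\<close> the same coefficient at
        \<open>Id E c\<close> as \<open>a\<close>; the difference then lies in
        \<open>?I\<close>.\<close>
      let ?r = "a (Id E c) / d"
      have one: "(\<lambda>m. ?r * (if m \<in> Id E ` Obj E then 1 else 0)) \<in> supported (Arr E)"
        by (auto simp: supported_iff id_in)
      have fin: "finite {m. (if m \<in> Id E ` Obj E then 1 else 0 :: 'k) \<noteq> 0}" "finite {m. x m \<noteq> 0}"
        using xs finite_obj by (auto intro!: finite_support simp: supported_iff)
      have "(\<lambda>m. ?r * (if m \<in> Id E ` Obj E then 1 else 0)) \<star> x = (\<lambda>m. ?r * x m)"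
        unfolding conv_scale_left[OF fin] using xs by (simp add: conv_left_unit supported_iff)
      then have "(\<lambda>m. ?r * x m) \<in> J"
        using J(1) one x(1) unfolding left_ideal_def by force
      moreover have "(\<lambda>m. a m - ?r * x m) \<in> J"
        using J(2) that xs \<open>d \<noteq> 0\<close> by (auto simp: d_def supported_iff)
      ultimately have "(\<lambda>m. a m - ?r * x m) \<oplus>\<^bsub>algebra\<^esub> (\<lambda>m. ?r * x m) \<in> J"
        by (rule J.a_closed[rotated])
      then show ?thesis by simp
    qed
    then show ?thesis using J.a_subset by auto
  qed
  ultimately show ?thesis
    unfolding maximal_left_ideal_def using A.one_closed by blast
qed

text \<open>The maximal left ideals at the identities bound the radical from above, nilpotency of
  the non-identities bounds it from below.\<close>

lemma Rad_algebra: "Rad (algebra :: ('k::field, 'm \<Rightarrow> 'k) module) = supported nonid"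
proof
  show "Rad (algebra :: ('k, 'm \<Rightarrow> 'k) module) \<subseteq> supported nonid"
  proof
    fix x :: "'m \<Rightarrow> 'k" assume x: "x \<in> Rad algebra"
    then have "x (Id E c) = 0" if "c \<in> Obj E" for c
      using maximal_at_id[OF that] unfolding Rad_def by blast
    then show "x \<in> supported nonid"
      using x by (simp add: supported_nonid_iff Rad_def)
  qed
  show "supported nonid \<subseteq> Rad (algebra :: ('k, 'm \<Rightarrow> 'k) module)"
    using nonid_in_maximal by (auto simp: Rad_def supported_nonid_iff)
qed

end

context partial_monoid
begin

lemma supported_coset_add:
  "(supported D +>\<^bsub>algebra\<^esub> a) <+>\<^bsub>algebra\<^esub> (supported D +>\<^bsub>algebra\<^esub> b) =
    supported D +>\<^bsub>algebra\<^esub> (\<lambda>m. a m + (b m :: 'k::field))"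
proof -
  have "\<exists>x. (\<forall>m. m \<notin> D \<longrightarrow> x m = a m) \<and> (\<exists>y. (\<forall>m. m \<notin> D \<longrightarrow> y m = b m) \<and> z = (\<lambda>m. x m + y m))"
    if "\<forall>m. m \<notin> D \<longrightarrow> z m = a m + b m" for z
    using that by (intro exI[of _ a] conjI exI[of _ "\<lambda>m. z m - a m"]) auto
  then show ?thesis unfolding supported_coset set_add_def' by auto
qed

lemma supported_coset_eq_iff:
  fixes a b :: "'m \<Rightarrow> 'k::field"
  shows "supported D +>\<^bsub>algebra\<^esub> a = supported D +>\<^bsub>algebra\<^esub> b \<longleftrightarrow> (\<forall>m. m \<notin> D \<longrightarrow> a m = b m)"
  unfolding supported_coset by auto

end

lemma ring_power_algebra: "ring (power_algebra r :: ('k::field, nat \<Rightarrow> 'k) module)"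
proof (intro ringI abelian_groupI monoidI)
  fix x :: "nat \<Rightarrow> 'k" assume x: "x \<in> carrier (power_algebra r)"
  show "\<exists>y\<in>carrier (power_algebra r). y \<oplus>\<^bsub>power_algebra r\<^esub> x = \<zero>\<^bsub>power_algebra r\<^esub>"
    by (intro bexI[of _ "\<lambda>i\<in>{..<r}. - x i"]) (auto simp: power_algebra_def fun_eq_iff)
qed (auto simp: power_algebra_def fun_eq_iff PiE_def extensional_def algebra_simps)

context directed_category
begin

text \<open>Taking the coefficients at the identities is a surjection onto a power of the field with
  kernel the radical; the homomorphism theorem does the rest.\<close>

lemma split_basic_algebra: "split_basic (algebra :: ('k::field, 'm \<Rightarrow> 'k) module)"
proof -
  interpret A: ring "algebra :: ('k, 'm \<Rightarrow> 'k) module" by (rule algebra_ring)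
  \<comment> \<open>The objects are numbered because the coordinates of \<open>power_algebra\<close>
    are natural numbers.\<close>
  obtain h where h: "bij_betw h {..<card (Obj E)} (Obj E)"
    using ex_bij_betw_nat_finite[OF finite_obj] by (auto simp: lessThan_atLeast0)
  let ?r = "card (Obj E)"
  have h_obj: "h i \<in> Obj E" if "i < ?r" for i
    using bij_betwE[OF h] that by auto
  define \<phi> :: "('m \<Rightarrow> 'k) \<Rightarrow> nat \<Rightarrow> 'k" where "\<phi> = (\<lambda>a. \<lambda>i\<in>{..<?r}. a (Id E (h i)))"
  have hom: "\<phi> \<in> Ring.ring_hom algebra (power_algebra ?r)"
    using h_obj
    by (intro ring_hom_memI) (auto simp: \<phi>_def power_algebra_def conv_at_id fun_eq_iff)
  interpret \<phi>: ring_hom_ring algebra "power_algebra ?r :: ('k, nat \<Rightarrow> 'k) module" \<phi>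
    by (intro ring_hom_ringI2 A.ring_axioms ring_power_algebra hom)
  have ker: "a_kernel algebra (power_algebra ?r :: ('k, nat \<Rightarrow> 'k) module) \<phi> = Rad algebra"
  proof -
    have "\<phi> a = \<zero>\<^bsub>power_algebra ?r\<^esub> \<longleftrightarrow> (\<forall>c\<in>Obj E. a (Id E c) = 0)" for a
    proof -
      have "\<phi> a = \<zero>\<^bsub>power_algebra ?r\<^esub> \<longleftrightarrow> (\<forall>i\<in>{..<?r}. a (Id E (h i)) = 0)"
        unfolding \<phi>_def power_algebra_def by (simp add: fun_eq_iff restrict_def) auto
      also have "\<dots> \<longleftrightarrow> (\<forall>c\<in>h ` {..<?r}. a (Id E c) = 0)" by blast
      finally show ?thesis unfolding bij_betw_imp_surj_on[OF h] .
    qed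
    then show ?thesis
      unfolding a_kernel_def' Rad_algebra by (auto simp: supported_nonid_iff)
  qed
  have surj: "\<phi> ` carrier algebra = carrier (power_algebra ?r)"
  proof
    show "\<phi> ` carrier algebra \<subseteq> carrier (power_algebra ?r)"
      using \<phi>.hom_closed by blast
    show "carrier (power_algebra ?r) \<subseteq> \<phi> ` carrier algebra"
    proof
      fix y :: "nat \<Rightarrow> 'k" assume y: "y \<in> carrier (power_algebra ?r)"
      define a where "a = (\<lambda>m. if m \<in> Id E ` Obj E then y (the_inv_into {..<?r} h (Dom E m)) else 0)"
      have "\<phi> a = y"
      proof
        fix i show "\<phi> a i = y i"
          using y h_obj the_inv_into_f_f[OF bij_betw_imp_inj_on[OF h], of i]
          by (cases "i < ?r") (auto simp: \<phi>_def a_def power_algebra_def PiE_def extensional_def dom_id)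
      qed
      moreover have "a \<in> carrier algebra" by (auto simp: a_def supported_iff id_in)
      ultimately show "y \<in> \<phi> ` carrier algebra" by blast
    qed
  qed
  let ?\<psi> = "\<lambda>X. the_elem (\<phi> ` X)"
  have "?\<psi> \<in> ring_iso (algebra Quot Rad algebra) (power_algebra ?r)"
    using \<phi>.FactRing_iso_set[OF surj] unfolding ker .
  then have iso: "?\<psi> \<in> ring_iso (quot_algebra algebra (Rad algebra)) (power_algebra ?r)"
    by (simp add: ring_iso_def Ring.ring_hom_def quot_algebra_simps FactRing_def)
  \<comment> \<open>\<open>\<phi>\<close> is constant on cosets of the radical. The isomorphism so
    far is one of rings; compatibility with scalars is computed on representatives.\<close>
  have elem: "?\<psi> (Rad algebra +>\<^bsub>algebra\<^esub> a) = \<phi> a" for a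
  proof -
    have "\<phi> ` (Rad algebra +>\<^bsub>algebra\<^esub> a) = {\<phi> a}"
      unfolding Rad_algebra supported_coset using h_obj
      by (auto simp: \<phi>_def nonid_def fun_eq_iff intro!: image_eqI[of _ _ a])
    then show ?thesis by simp
  qed
  have "?\<psi> \<in> LinearCombinations.module_hom class_ring (quot_algebra algebra (Rad algebra)) (power_algebra ?r)"
    unfolding LinearCombinations.module_hom_def
  proof (intro CollectI conjI allI impI)
    show "?\<psi> \<in> carrier (quot_algebra algebra (Rad algebra)) \<rightarrow> carrier (power_algebra ?r)"
      using iso by (auto simp: ring_iso_def Ring.ring_hom_def)
    fix X Y :: "('m \<Rightarrow> 'k) set"
    assume "X \<in> carrier (quot_algebra algebra (Rad algebra)) \<and> Y \<in> carrier (quot_algebra algebra (Rad algebra))"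
    then show "?\<psi> (X \<oplus>\<^bsub>quot_algebra algebra (Rad algebra)\<^esub> Y) =
        ?\<psi> X \<oplus>\<^bsub>power_algebra ?r\<^esub> ?\<psi> Y"
      using iso by (auto simp: ring_iso_def Ring.ring_hom_def)
  next
    fix c :: 'k and X :: "('m \<Rightarrow> 'k) set"
    assume "c \<in> carrier class_ring \<and> X \<in> carrier (quot_algebra algebra (Rad algebra))"
    then obtain a where a: "a \<in> carrier algebra" "X = Rad algebra +>\<^bsub>algebra\<^esub> a"
      by (auto simp: quot_algebra_simps A_RCOSETS_def')
    have "?\<psi> (c \<odot>\<^bsub>quot_algebra algebra (Rad algebra)\<^esub> X) = \<phi> (\<lambda>m. c * a m)"
      unfolding a(2) Rad_algebra quot_algebra_smult using elem[unfolded Rad_algebra] by simp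
    also have "\<dots> = c \<odot>\<^bsub>power_algebra ?r\<^esub> ?\<psi> X"
      unfolding a(2) elem by (auto simp: \<phi>_def power_algebra_def)
    finally show "?\<psi> (c \<odot>\<^bsub>quot_algebra algebra (Rad algebra)\<^esub> X) = c \<odot>\<^bsub>power_algebra ?r\<^esub> ?\<psi> X" .
  qed
  then show ?thesis
    unfolding split_basic_def algebra_isomorphic_def using iso fin_dim_algebra by blast
qed

lemma ident_supported: "c \<in> Obj E \<Longrightarrow> ident c \<in> supported (Arr E)"
  by (simp add: basis_vec_supported id_in)

lemma ident_mult_ident:
  assumes "c \<in> Obj E" "d \<in> Obj E"
  shows "ident c \<star> ident d = (if c = d then ident c else (\<lambda>_. 0 :: 'k::field))"
  unfolding conv_id_left[OF ident_supported[OF assms(2)] assms(1)]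
  using assms by (auto simp: fun_eq_iff basis_vec_def id_in cod_id)

lemma inj_ident: "inj_on (\<lambda>c. ident c :: 'm \<Rightarrow> 'k::field) (Obj E)"
proof (rule inj_onI)
  fix c d assume "c \<in> Obj E" "d \<in> Obj E" "(ident c :: 'm \<Rightarrow> 'k) = ident d"
  then have "(ident c :: 'm \<Rightarrow> 'k) (Id E c) = ident d (Id E c)" by simp
  then have "Id E c = Id E d" by (simp add: basis_vec_def split: if_splits)
  then show "c = d" using \<open>c \<in> Obj E\<close> \<open>d \<in> Obj E\<close> by (metis dom_id)
qed

text \<open>If \<open>ident c\<close> splits into orthogonal idempotents \<open>f\<close> and
  \<open>g\<close>, then \<open>f\<close> is fixed by \<open>ident c\<close> on both sides and hence
  supported on endomorphisms of \<open>c\<close>. By directedness the identity is the only one, and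
  its coefficient is an idempotent of the field, so 0 or 1.\<close>

lemma primitive_ident:
  assumes c: "c \<in> Obj E"
  shows "primitive_idempotent (algebra :: ('k::field, 'm \<Rightarrow> 'k) module) (ident c)"
proof -
  have "f = (\<lambda>_. 0) \<or> g = (\<lambda>_. 0)"
    if f: "f \<in> supported (Arr E)" "f \<star> f = f" and g: "g \<in> supported (Arr E)"
      and fg: "f \<star> g = (\<lambda>_. 0)" "g \<star> f = (\<lambda>_. 0)" and sum: "ident c = (\<lambda>m. f m + g m)"
    for f g :: "'m \<Rightarrow> 'k"
  proof -
    have fin: "finite {m. f m \<noteq> 0}" "finite {m. g m \<noteq> 0}"
      using f g by (auto intro!: finite_support simp: supported_iff)
    have "ident c \<star> f = f" "f \<star> ident c = f"
      unfolding sum conv_add_left[OF fin fin(1)] conv_add_right[OF fin fin(1)] f(2) fg by simp_all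
    then have L: "(\<lambda>m. if m \<in> Arr E \<and> Cod E m = c then f m else 0) = f"
      and R: "(\<lambda>m. if m \<in> Arr E \<and> Dom E m = c then f m else 0) = f"
      using c f(1) by (simp_all add: conv_id_left conv_id_right)
    then have "f m = 0" if "m \<noteq> Id E c" for m
      using that endo_eq_id[of m c] fun_cong[OF L, of m] fun_cong[OF R, of m]
      by (auto split: if_splits)
    moreover have "f (Id E c) * f (Id E c) = f (Id E c)"
      using conv_at_id[OF f(1) f(1) c] f(2) by simp
    then have "f (Id E c) = 0 \<or> f (Id E c) = 1" by simp
    ultimately have "f = (\<lambda>_. 0) \<or> f = ident c"
      unfolding fun_eq_iff basis_vec_def by metis
    then show ?thesis using sum by (auto simp: fun_eq_iff)
  qed
  moreover have "(ident c :: 'm \<Rightarrow> 'k) \<noteq> (\<lambda>_. 0)"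
    by (auto simp: basis_vec_def fun_eq_iff)
  ultimately show ?thesis
    unfolding primitive_idempotent_def idempotent_elt_def orthogonal_elts_def
    using ident_supported[OF c] ident_mult_ident[OF c c, where ?'k = 'k] by auto
qed

lemma complete_idents:
  "complete_primitive_idempotents (algebra :: ('k::field, 'm \<Rightarrow> 'k) module) (ident ` Obj E)"
proof -
  have "(\<Oplus>\<^bsub>algebra\<^esub>e\<in>ident ` Obj E. e) = (\<lambda>m. \<Sum>e\<in>ident ` Obj E. e m :: 'k)"
    using finite_obj ident_supported by (intro finsum_algebra) auto
  also have "\<dots> = (\<lambda>m. \<Sum>c\<in>Obj E. ident c m)"
    by (subst sum.reindex[OF inj_ident]) simp
  also have "\<dots> = \<one>\<^bsub>algebra\<^esub>"
  proof
    fix m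
    show "(\<Sum>c\<in>Obj E. ident c m) = (\<one>\<^bsub>algebra\<^esub> m :: 'k)"
    proof (cases "m \<in> Id E ` Obj E")
      case True
      then obtain c where c: "c \<in> Obj E" "m = Id E c" by blast
      have "(\<Sum>d\<in>Obj E. ident d m) = (\<Sum>d\<in>Obj E. if d = c then 1 else (0 :: 'k))"
        using c by (intro sum.cong refl) (auto simp: basis_vec_def dest: arg_cong[of _ _ "Dom E"] simp: dom_id)
      then show ?thesis using c finite_obj by simp
    next
      case False
      then have "(\<Sum>d\<in>Obj E. ident d m) = (\<Sum>d\<in>Obj E. (0 :: 'k))"
        by (intro sum.cong refl) (auto simp: basis_vec_def)
      then show ?thesis using False by simp
    qed
  qed
  finally have one: "(\<Oplus>\<^bsub>algebra\<^esub>e\<in>ident ` Obj E. e) = (\<one>\<^bsub>algebra\<^esub> :: 'm \<Rightarrow> 'k)" .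
  have "ident c \<star> ident d = (\<lambda>_. 0 :: 'k)"
    if "c \<in> Obj E" "d \<in> Obj E" "(ident c :: 'm \<Rightarrow> 'k) \<noteq> ident d" for c d
    using ident_mult_ident[of c d, where ?'k = 'k] that by (cases "c = d") auto
  then show ?thesis
    unfolding complete_primitive_idempotents_def orthogonal_elts_def one
    using finite_obj primitive_ident by auto
qed

subsection \<open>The quiver\<close>

text \<open>\<open>ideal_prod\<close> is generated by products under sums. A function supported on
  reducible morphisms is assembled from products of two basis vectors, by induction over a finite
  set of reducible morphisms.\<close>

lemma Rad2_algebra: "Rad2 (algebra :: ('k::field, 'm \<Rightarrow> 'k) module) = supported reducible"
proof
  let ?P = "supported nonid \<cdot>\<^bsub>algebra\<^esub> (supported nonid :: ('m \<Rightarrow> 'k) set)"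
  show "Rad2 (algebra :: ('k, 'm \<Rightarrow> 'k) module) \<subseteq> supported reducible"
    unfolding Rad2_def Rad_algebra
  proof
    fix x :: "'m \<Rightarrow> 'k" assume "x \<in> ?P"
    then show "x \<in> supported reducible"
    proof (induction rule: ideal_prod.induct)
      case (prod i j)
      have "i \<star> j \<in> supported reducible"
      proof (rule conv_in_supported)
        fix p q assume "p \<in> Arr E" "q \<in> Arr E" "Dom E p = Cod E q" "i p \<noteq> 0" "j q \<noteq> 0"
        then show "Comp E p q \<in> reducible"
          using prod by (auto simp: reducible_def dest: supportedD)
      qed (use prod supported_nonid_arr in auto)
      then show ?case by simp
    qed (auto simp: supported_iff)
  qed
  have zero: "(\<lambda>_. 0) \<in> ?P"
  proof -
    have "(\<lambda>_. 0) \<otimes>\<^bsub>algebra\<^esub> (\<lambda>_. 0) \<in> ?P"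
      by (rule ideal_prod.prod) (auto simp: supported_iff)
    then show ?thesis by (simp add: conv_def)
  qed
  have "a \<in> ?P" if "finite F" "F \<subseteq> reducible" "a \<in> supported F" for F and a :: "'m \<Rightarrow> 'k"
    using that
  proof (induction F arbitrary: a rule: finite_induct)
    case empty
    then have "a = (\<lambda>_. 0)" by (auto simp: supported_iff)
    then show ?case using zero by simp
  next
    case (insert x F)
    then obtain g f where x: "x = Comp E g f" "g \<in> nonid" "f \<in> nonid" "Dom E g = Cod E f"
      by (auto simp: reducible_def)
    have fin: "finite {m. (basis_vec g m :: 'k) \<noteq> 0}" "finite {m. (basis_vec f m :: 'k) \<noteq> 0}"
      by (auto simp: basis_vec_def)
    \<comment> \<open>The coefficient is put into the left factor, because \<open>ideal_prod\<close>
      is built from products and sums and not from scalar multiples.\<close>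
    have "(\<lambda>m. a x * basis_vec g m) \<otimes>\<^bsub>algebra\<^esub> basis_vec f \<in> ?P"
      using x by (intro ideal_prod.prod) (auto simp: supported_iff basis_vec_def)
    also have "(\<lambda>m. a x * basis_vec g m) \<otimes>\<^bsub>algebra\<^esub> basis_vec f = (\<lambda>m. a x * basis_vec x m)"
      by (simp add: conv_scale_left[OF fin] conv_basis_vec x)
    finally have "(\<lambda>m. a x * basis_vec x m) \<in> ?P" .
    moreover have "(\<lambda>m. if m = x then 0 else a m) \<in> ?P"
      using insert.prems by (intro insert.IH) (auto simp: supported_iff)
    ultimately have "(\<lambda>m. a x * basis_vec x m) \<oplus>\<^bsub>algebra\<^esub> (\<lambda>m. if m = x then 0 else a m) \<in> ?P"
      by (rule ideal_prod.sum)
    also have "(\<lambda>m. a x * basis_vec x m) \<oplus>\<^bsub>algebra\<^esub> (\<lambda>m. if m = x then 0 else a m) = a"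
      by (auto simp: basis_vec_def)
    finally show ?case .
  qed
  then show "supported reducible \<subseteq> Rad2 (algebra :: ('k, 'm \<Rightarrow> 'k) module)"
    unfolding Rad2_def Rad_algebra using finite_subset[OF reducible_arr finite_arr] by blast
qed

text \<open>The Peirce component of \<open>x\<close> at two identities is its restriction to a
  hom-set. Arrow spaces and the hom-spaces of \<open>idempotent_lincat\<close> are both read off
  from this.\<close>

lemma ident_mult_mult_ident:
  assumes "c \<in> Obj E" "d \<in> Obj E" "x \<in> supported (Arr E)"
  shows "ident d \<star> x \<star> ident c =
    (\<lambda>m. if m \<in> Arr E \<and> Dom E m = c \<and> Cod E m = d then x m else (0 :: 'k::field))"
proof -
  have "ident d \<star> x \<in> supported (Arr E)"
    using assms by (simp add: conv_id_left) (simp add: supported_iff)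
  then show ?thesis
    using assms by (auto simp: conv_id_right fun_eq_iff) (auto simp: conv_id_left)
qed

text \<open>Modulo the squared radical the coefficients at reducible morphisms are invisible, and
  the two identities cut out the morphisms from \<open>c\<close> to \<open>d\<close>; what remains
  of the radical is free on the irreducible ones.\<close>

lemma coordinates_arrow_space:
  assumes "c \<in> Obj E" "d \<in> Obj E"
  shows "coordinates (irreducible c d) (\<lambda>a. Rad2 algebra +>\<^bsub>algebra\<^esub> a)
    (arrow_space (algebra :: ('k::field, 'm \<Rightarrow> 'k) module) (ident d) (ident c))"
proof
  let ?V = "arrow_space (algebra :: ('k, 'm \<Rightarrow> 'k) module) (ident d) (ident c)"
  let ?T = "\<lambda>a :: 'm \<Rightarrow> 'k. Rad2 algebra +>\<^bsub>algebra\<^esub> a"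
  have irr: "m \<in> nonid" "m \<notin> reducible" "m \<in> Arr E" "Dom E m = c" "Cod E m = d"
    if "m \<in> irreducible c d" for m
    using that by (auto simp: irreducible_def nonid_def)
  show "finite (irreducible c d)"
    using finite_subset[OF _ finite_arr] irr by blast
  show "bij_betw ?T {a. \<forall>m. m \<notin> irreducible c d \<longrightarrow> a m = 0} (carrier ?V)"
    unfolding bij_betw_def
  proof
    show "inj_on ?T {a. \<forall>m. m \<notin> irreducible c d \<longrightarrow> a m = 0}"
    proof (rule inj_onI)
      fix a b :: "'m \<Rightarrow> 'k"
      assume *: "a \<in> {a. \<forall>m. m \<notin> irreducible c d \<longrightarrow> a m = 0}"
        "b \<in> {a. \<forall>m. m \<notin> irreducible c d \<longrightarrow> a m = 0}" "?T a = ?T b"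
      have "a m = b m" for m
        using * irr(2)[of m] unfolding Rad2_algebra supported_coset_eq_iff
        by (cases "m \<in> irreducible c d") auto
      then show "a = b" by auto
    qed
    show "?T ` {a. \<forall>m. m \<notin> irreducible c d \<longrightarrow> a m = 0} = carrier ?V"
    proof
      show "?T ` {a. \<forall>m. m \<notin> irreducible c d \<longrightarrow> a m = 0} \<subseteq> carrier ?V"
      proof
        fix X assume "X \<in> ?T ` {a. \<forall>m. m \<notin> irreducible c d \<longrightarrow> a m = 0}"
        then obtain a where a: "\<forall>m. m \<notin> irreducible c d \<longrightarrow> a m = 0" "X = ?T a" by blast
        have a': "a \<in> supported nonid" using a(1) irr(1) by (auto simp: supported_iff)
        have "a m = 0 \<or> m \<in> Arr E \<and> Dom E m = c \<and> Cod E m = d" for m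
          using a(1) irr(3-5)[of m] by blast
        then have "ident d \<star> a \<star> ident c = a"
          unfolding ident_mult_mult_ident[OF assms supported_nonid_arr[OF a']]
          by (intro ext) auto
        then show "X \<in> carrier ?V"
          unfolding arrow_space_def using a(2) a' by (auto simp: Rad_algebra) metis
      qed
      show "carrier ?V \<subseteq> ?T ` {a. \<forall>m. m \<notin> irreducible c d \<longrightarrow> a m = 0}"
      proof
        fix X assume "X \<in> carrier ?V"
        then obtain x :: "'m \<Rightarrow> 'k" where x: "x \<in> supported nonid" "X = ?T (ident d \<star> x \<star> ident c)"
          by (auto simp: arrow_space_def Rad_algebra)
        have "?T (ident d \<star> x \<star> ident c) = ?T (\<lambda>m. if m \<in> irreducible c d then x m else 0)"
          unfolding ident_mult_mult_ident[OF assms supported_nonid_arr[OF x(1)]]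
            Rad2_algebra supported_coset_eq_iff
          using x(1) by (auto simp: irreducible_def nonid_def supported_iff)
        then show "X \<in> ?T ` {a. \<forall>m. m \<notin> irreducible c d \<longrightarrow> a m = 0}"
          unfolding x(2) by (intro image_eqI[where x = "\<lambda>m. if m \<in> irreducible c d then x m else 0"]) auto
      qed
    qed
  qed
  show "?T (\<lambda>m. a m + b m) = ?T a \<oplus>\<^bsub>?V\<^esub> ?T b" for a b :: "'m \<Rightarrow> 'k"
    by (simp add: arrow_space_def quot_algebra_simps Rad2_algebra supported_coset_add)
  show "?T (\<lambda>m. k * a m) = k \<odot>\<^bsub>?V\<^esub> ?T a" for k and a :: "'m \<Rightarrow> 'k"
    using quot_algebra_smult[where c = k and D = reducible and a = a] by (simp add: arrow_space_def Rad2_algebra)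
  show "?T (\<lambda>_. 0) = \<zero>\<^bsub>?V\<^esub>"
    unfolding Rad2_algebra supported_coset
    by (auto simp: arrow_space_def quot_algebra_simps Rad2_algebra supported_iff)
qed

text \<open>Reindexes the bases of the arrow spaces, given by irreducible morphisms, along
  \<open>\<alpha>\<close>.\<close>

theorem quiver_of_algebra:
  fixes Q :: "('v, 'e) pre_digraph"
  assumes Q: "wf_digraph Q" and \<phi>: "bij_betw \<phi> (verts Q) (Obj E)"
    and \<alpha>: "\<And>u v. \<lbrakk>u \<in> verts Q; v \<in> verts Q\<rbrakk> \<Longrightarrow>
      bij_betw \<alpha> {x \<in> arcs Q. tail Q x = u \<and> head Q x = v} (irreducible (\<phi> u) (\<phi> v))"
  shows "quiver_of (algebra :: ('k::field, 'm \<Rightarrow> 'k) module) Q (\<lambda>u. ident (\<phi> u))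
    (\<lambda>x. Rad2 algebra +>\<^bsub>algebra\<^esub> basis_vec (\<alpha> x))"
proof -
  let ?\<epsilon> = "\<lambda>u. ident (\<phi> u) :: 'm \<Rightarrow> 'k"
  let ?\<beta> = "\<lambda>x. Rad2 algebra +>\<^bsub>algebra\<^esub> (basis_vec (\<alpha> x) :: 'm \<Rightarrow> 'k)"
  have img: "?\<epsilon> ` verts Q = ident ` Obj E"
    unfolding bij_betw_imp_surj_on[OF \<phi>, symmetric] image_image ..
  have inj: "inj_on ?\<epsilon> (verts Q)"
    using comp_inj_on[OF bij_betw_imp_inj_on[OF \<phi>], of "\<lambda>c. ident c :: 'm \<Rightarrow> 'k"]
      inj_ident[where ?'k = 'k]
    unfolding bij_betw_imp_surj_on[OF \<phi>] comp_def by blast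
  have "inj_on ?\<beta> {x \<in> arcs Q. tail Q x = u \<and> head Q x = v} \<and>
      vectorspace.basis class_ring (arrow_space algebra (?\<epsilon> v) (?\<epsilon> u))
        (?\<beta> ` {x \<in> arcs Q. tail Q x = u \<and> head Q x = v})"
    if "u \<in> verts Q" "v \<in> verts Q" for u v
  proof -
    let ?X = "{x \<in> arcs Q. tail Q x = u \<and> head Q x = v}"
    have obj: "\<phi> u \<in> Obj E" "\<phi> v \<in> Obj E" using bij_betwE[OF \<phi>] that by auto
    interpret coordinates "irreducible (\<phi> u) (\<phi> v)" "\<lambda>a. Rad2 algebra +>\<^bsub>algebra\<^esub> a"
      "arrow_space (algebra :: ('k, 'm \<Rightarrow> 'k) module) (?\<epsilon> v) (?\<epsilon> u)"
      using obj by (rule coordinates_arrow_space)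
    note a = \<alpha>[OF that]
    have "inj_on ?\<beta> ?X"
      using comp_inj_on[of \<alpha> ?X "\<lambda>m. Rad2 algebra +>\<^bsub>algebra\<^esub> (basis_vec m :: 'm \<Rightarrow> 'k)"]
        bij_betw_imp_inj_on[OF a] bij_betw_imp_surj_on[OF a] inj_basis
      by (simp add: comp_def)
    moreover have "?\<beta> ` ?X = (\<lambda>m. Rad2 algebra +>\<^bsub>algebra\<^esub> (basis_vec m :: 'm \<Rightarrow> 'k)) ` irreducible (\<phi> u) (\<phi> v)"
      using bij_betw_imp_surj_on[OF a] by (metis image_image)
    ultimately show ?thesis using basis by simp
  qed
  then show ?thesis
    unfolding quiver_of_def using Q inj complete_idents[where ?'k = 'k] img by auto
qed

end

section \<open>Evaluation of linear combinations of paths and its kernel\<close>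

lemma free_space_nonzero: "\<lbrakk>a \<in> carrier (free_space D); a x \<noteq> 0\<rbrakk> \<Longrightarrow> x \<in> D"
  by auto

lemma free_space_add:
  assumes "a \<in> carrier (free_space D)" "b \<in> carrier (free_space D)"
  shows "(\<lambda>m. a m + b m :: 'k::field) \<in> carrier (free_space D)"
proof -
  have *: "{m. a m + b m \<noteq> 0} \<subseteq> {m. a m \<noteq> 0} \<union> {m. b m \<noteq> 0}" by auto
  moreover have "{m. a m \<noteq> 0} \<union> {m. b m \<noteq> 0} \<subseteq> D" "finite ({m. a m \<noteq> 0} \<union> {m. b m \<noteq> 0})"
    using assms by simp_all
  ultimately show ?thesis by (simp, blast intro: finite_subset)
qed

lemma free_space_scale:
  "a \<in> carrier (free_space D) \<Longrightarrow> (\<lambda>m. c * a m :: 'k::field) \<in> carrier (free_space D)"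
  by (cases "c = 0") auto

section \<open>Push-forward of coefficient functions\<close>

text \<open>For finitely supported \<open>a\<close>, the linear extension of the map
  \<open>f\<close> of basis elements.\<close>

definition push :: "('p \<Rightarrow> 'm) \<Rightarrow> ('p \<Rightarrow> 'k::field) \<Rightarrow> 'm \<Rightarrow> 'k" where
  "push f a = (\<lambda>m. \<Sum>p | a p \<noteq> 0 \<and> f p = m. a p)"

lemma push_eq_sum:
  assumes "finite A" "\<forall>p. p \<notin> A \<longrightarrow> a p = 0"
  shows "push f a m = (\<Sum>p\<in>A. if f p = m then a p else 0)"
  unfolding push_def using assms
  by (intro sum.mono_neutral_cong_left) auto

lemma push_add:
  assumes "finite {p. a p \<noteq> 0}" "finite {p. b p \<noteq> 0}"
  shows "push f (\<lambda>p. a p + b p) = (\<lambda>m. push f a m + push f b m)"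
proof
  fix m
  let ?A = "{p. a p \<noteq> 0} \<union> {p. b p \<noteq> 0}"
  have f: "finite ?A" using assms by simp
  have s: "\<forall>p. p \<notin> ?A \<longrightarrow> a p = 0" "\<forall>p. p \<notin> ?A \<longrightarrow> b p = 0" "\<forall>p. p \<notin> ?A \<longrightarrow> a p + b p = 0"
    by auto
  show "push f (\<lambda>p. a p + b p) m = push f a m + push f b m"
    unfolding push_eq_sum[OF f s(1)] push_eq_sum[OF f s(2)] push_eq_sum[OF f s(3)]
      sum.distrib[symmetric] by (intro sum.cong refl) simp
qed

lemma push_scale:
  assumes "finite {p. a p \<noteq> 0}"
  shows "push f (\<lambda>p. c * a p) = (\<lambda>m. c * push f a m)"
proof
  fix m
  have s: "\<forall>p. p \<notin> {p. a p \<noteq> 0} \<longrightarrow> a p = 0" "\<forall>p. p \<notin> {p. a p \<noteq> 0} \<longrightarrow> c * a p = 0"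
    by auto
  show "push f (\<lambda>p. c * a p) m = c * push f a m"
    unfolding push_eq_sum[OF assms s(1)] push_eq_sum[OF assms s(2)] sum_distrib_left
    by (intro sum.cong refl) simp
qed

lemma push_basis_vec: "push f (basis_vec p) = (basis_vec (f p) :: 'm \<Rightarrow> 'k::field)"
proof
  fix m
  have "\<forall>q. q \<notin> {p} \<longrightarrow> (basis_vec p q :: 'k) = 0" by (simp add: basis_vec_def)
  then show "push f (basis_vec p) m = (basis_vec (f p) m :: 'k)"
    by (subst push_eq_sum[of "{p}"]) (auto simp: basis_vec_def)
qed

lemma push_nonzeroE:
  assumes "push f a m \<noteq> 0"
  obtains p where "a p \<noteq> 0" "f p = m"
proof -
  have "{p. a p \<noteq> 0 \<and> f p = m} \<noteq> {}"
  proof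
    assume *: "{p. a p \<noteq> 0 \<and> f p = m} = {}"
    show False using assms unfolding push_def * by simp
  qed
  then show ?thesis using that by auto
qed

lemma push_supported: "a \<in> supported A \<Longrightarrow> f ` A \<subseteq> B \<Longrightarrow> push f a \<in> supported B"
  unfolding supported_iff
proof (intro allI impI, rule ccontr)
  fix m assume *: "\<forall>p. p \<notin> A \<longrightarrow> a p = 0" "f ` A \<subseteq> B" "m \<notin> B" and "push f a m \<noteq> 0"
  from this(4) obtain p where "a p \<noteq> 0" "f p = m" by (rule push_nonzeroE)
  then show False using * by blast
qed

text \<open>Change of variables: the weight depends on \<open>p\<close> only through
  \<open>f p\<close>.\<close>

lemma sum_push:
  fixes a :: "'p \<Rightarrow> 'k::field"
  assumes "finite S" "finite A" "\<forall>p. p \<notin> A \<longrightarrow> a p = 0" "f ` A \<subseteq> S"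
  shows "(\<Sum>s\<in>S. push f a s * F s) = (\<Sum>p\<in>A. a p * F (f p))"
proof -
  have "(\<Sum>s\<in>S. push f a s * F s) = (\<Sum>s\<in>S. \<Sum>p\<in>A. (if f p = s then a p else 0) * F s)"
    by (simp add: push_eq_sum[OF assms(2,3)] sum_distrib_right)
  also have "\<dots> = (\<Sum>p\<in>A. \<Sum>s\<in>S. (if f p = s then a p else 0) * F s)"
    by (rule sum.swap)
  also have "\<dots> = (\<Sum>p\<in>A. \<Sum>s\<in>S. if f p = s then a p * F (f p) else 0)"
    by (intro sum.cong refl) simp
  also have "\<dots> = (\<Sum>p\<in>A. a p * F (f p))"
    using assms(1,4) by (intro sum.cong refl) auto
  finally show ?thesis .
qed

text \<open>Multiplicativity of \<open>f\<close> is asked only on the supports of \<open>a\<close>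
  and \<open>b\<close>. Evaluation of paths relies on this, as a triple that is not a walk has no
  meaningful value.\<close>

lemma push_conv:
  fixes a b :: "'p \<Rightarrow> 'k::field"
  assumes fin: "finite {p. a p \<noteq> 0}" "finite {q. b q \<noteq> 0}"
    and P: "\<And>p q. \<lbrakk>a p \<noteq> 0; b q \<noteq> 0\<rbrakk> \<Longrightarrow> P p q \<longleftrightarrow> P' (f p) (f q)"
    and mul: "\<And>p q. \<lbrakk>a p \<noteq> 0; b q \<noteq> 0; P p q\<rbrakk> \<Longrightarrow> f (mul p q) = mul' (f p) (f q)"
  shows "push f (conv P mul a b) = conv P' mul' (push f a) (push f b)"
proof
  fix m
  let ?A = "{p. a p \<noteq> 0}" and ?B = "{q. b q \<noteq> 0}"
  let ?C = "(\<lambda>(p, q). mul p q) ` (?A \<times> ?B)"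
  have finC: "finite ?C" using fin by simp
  have s: "\<forall>p. p \<notin> ?A \<longrightarrow> a p = 0" "\<forall>q. q \<notin> ?B \<longrightarrow> b q = 0" by auto
  have "\<forall>x. x \<notin> ?C \<longrightarrow> conv P mul a b x = 0"
  proof (intro allI impI, rule ccontr)
    fix x assume "x \<notin> ?C" and "conv P mul a b x \<noteq> 0"
    from this(2) obtain p q where "a p \<noteq> 0" "b q \<noteq> 0" "mul p q = x" by (rule conv_nonzeroE)
    then show False using \<open>x \<notin> ?C\<close> by force
  qed
  then have "push f (conv P mul a b) m = (\<Sum>x\<in>?C. if f x = m then conv P mul a b x else 0)"
    by (rule push_eq_sum[OF finC])
  also have "\<dots> = (\<Sum>x\<in>?C. conv P mul a b x * (if f x = m then 1 else 0))"
    by (intro sum.cong refl) simp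
  also have "\<dots> = (\<Sum>p\<in>?A. \<Sum>q\<in>?B. if P p q then a p * b q * (if f (mul p q) = m then 1 else 0) else 0)"
    by (rule sum_conv[OF finC fin s]) auto
  also have "\<dots> = (\<Sum>p\<in>?A. a p * (\<Sum>q\<in>?B. b q * (if P' (f p) (f q) \<and> mul' (f p) (f q) = m then 1 else 0)))"
    unfolding sum_distrib_left using P mul by (intro sum.cong refl) auto
  also have "\<dots> = (\<Sum>s\<in>f ` ?A. push f a s * (\<Sum>q\<in>?B. b q * (if P' s (f q) \<and> mul' s (f q) = m then 1 else 0)))"
    using fin by (subst sum_push[OF _ fin(1) s(1)]) auto
  also have "\<dots> = (\<Sum>s\<in>f ` ?A. push f a s * (\<Sum>t\<in>f ` ?B. push f b t * (if P' s t \<and> mul' s t = m then 1 else 0)))"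
    using fin by (intro sum.cong refl, subst sum_push[OF _ fin(2) s(2)]) auto
  also have "\<dots> = (\<Sum>s\<in>f ` ?A. \<Sum>t\<in>f ` ?B. if P' s t \<and> mul' s t = m then push f a s * push f b t else 0)"
    unfolding sum_distrib_left by (intro sum.cong refl) simp
  also have "\<dots> = conv P' mul' (push f a) (push f b) m"
    using fin by (intro conv_eq_sum[symmetric]) (auto elim: push_nonzeroE intro: ccontr)
  finally show "push f (conv P mul a b) m = conv P' mul' (push f a) (push f b) m" .
qed

section \<open>Presentations of category algebras by quivers with relations\<close>

definition paths :: "('v, 'e) pre_digraph \<Rightarrow> 'v \<Rightarrow> 'v \<Rightarrow> ('v \<times> 'e list \<times> 'v) set" where
  "paths Q u v = {(u, p, v) |p. pre_digraph.awalk Q u p v}"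

abbreviation path_lincat :: "('v, 'e) pre_digraph \<Rightarrow> ('v, 'v \<times> 'e list \<times> 'v \<Rightarrow> 'k::field, 'k) lincat" where
  "path_lincat Q \<equiv> free_lincat (free_cat Q)"

abbreviation path_comp ::
  "('v \<times> 'e list \<times> 'v \<Rightarrow> 'k::field) \<Rightarrow> ('v \<times> 'e list \<times> 'v \<Rightarrow> 'k) \<Rightarrow> 'v \<times> 'e list \<times> 'v \<Rightarrow> 'k" where
  "path_comp \<equiv> conv (\<lambda>(u', q, v') (u, p, v). u' = v) (\<lambda>(u', q, v') (u, p, v). (u, p @ q, v'))"

lemma path_lincat_simps:
  fixes Q :: "('v, 'e) pre_digraph"
  shows "LObj (path_lincat Q) = verts Q"
  "LHom (path_lincat Q) u v = free_space (paths Q u v)"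
  "LId (path_lincat Q) u = basis_vec (u, [], u)"
  "LComp (path_lincat Q) u v w = path_comp"
proof -
  have "{m \<in> {(u, p, v). pre_digraph.awalk Q u p v}. (\<lambda>(u, p, v). u) m = u \<and> (\<lambda>(u, p, v). v) m = v} = paths Q u v"
    by (auto simp: paths_def)
  then show "LHom (path_lincat Q) u v = free_space (paths Q u v)"
    by (simp add: free_lincat_def free_cat_def)
  show "LObj (path_lincat Q) = verts Q" "LId (path_lincat Q) u = basis_vec (u, [], u)"
    by (simp_all add: free_lincat_def free_cat_def)
  have *: "(\<lambda>q p. (case q of (u, p, v) \<Rightarrow> u) = (case p of (u, p, v) \<Rightarrow> v)) =
      (\<lambda>(u', q :: 'e list, v' :: 'v) (u :: 'v, p :: 'e list, v). u' = (v :: 'v))"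
    by (auto simp: fun_eq_iff)
  show "LComp (path_lincat Q) u v w = path_comp"
    unfolding free_lincat_def free_cat_def by (simp add: *)
qed

locale quiver_functor = directed_category E rank
  for E :: "('o, 'm) smallcat" and rank :: "'o \<Rightarrow> nat" +
  fixes Q :: "('v, 'e) pre_digraph" and \<phi> :: "'v \<Rightarrow> 'o" and \<alpha> :: "'e \<Rightarrow> 'm"
  assumes wf: "wf_digraph Q"
    and bij_verts: "bij_betw \<phi> (verts Q) (Obj E)"
    and arrow_in: "x \<in> arcs Q \<Longrightarrow> \<alpha> x \<in> Arr E"
    and dom_arrow: "x \<in> arcs Q \<Longrightarrow> Dom E (\<alpha> x) = \<phi> (tail Q x)"
    and cod_arrow: "x \<in> arcs Q \<Longrightarrow> Cod E (\<alpha> x) = \<phi> (head Q x)"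
begin

sublocale Q: wf_digraph Q by (rule wf)

text \<open>The list is in the order of traversal, so its head acts first and stands rightmost in
  the composite. The start vertex is an argument because the empty walk has to know its
  identity.\<close>

primrec walk_arr :: "'v \<Rightarrow> 'e list \<Rightarrow> 'm" where
  "walk_arr u [] = Id E (\<phi> u)"
| "walk_arr u (x # p) = Comp E (walk_arr (head Q x) p) (\<alpha> x)"

definition eval :: "'v \<times> 'e list \<times> 'v \<Rightarrow> 'm" where
  "eval = (\<lambda>(u, p, v). walk_arr u p)"

lemma vert_obj: "u \<in> verts Q \<Longrightarrow> \<phi> u \<in> Obj E"
  using bij_betwE[OF bij_verts] by blast

lemma walk_arr_typed:
  "Q.awalk u p v \<Longrightarrow> walk_arr u p \<in> Arr E \<and> Dom E (walk_arr u p) = \<phi> u \<and> Cod E (walk_arr u p) = \<phi> v"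
proof (induction p arbitrary: u)
  case Nil
  then show ?case using vert_obj by (auto simp: Q.awalk_Nil_iff id_in dom_id cod_id)
next
  case (Cons x p)
  then have "x \<in> arcs Q" "u = tail Q x" "Q.awalk (head Q x) p v"
    by (auto simp: Q.awalk_Cons_iff)
  then show ?case using Cons.IH[of "head Q x"]
    by (auto simp: comp_in dom_comp cod_comp arrow_in dom_arrow cod_arrow)
qed

lemma walk_arr_append:
  assumes "Q.awalk u p v" "Q.awalk v q w"
  shows "walk_arr u (p @ q) = Comp E (walk_arr v q) (walk_arr u p)"
  using assms(1)
proof (induction p arbitrary: u)
  case Nil
  then have "u = v" by (simp add: Q.awalk_Nil_iff)
  then show ?case
    using walk_arr_typed[OF assms(2)] comp_id[of "walk_arr v q"] by simp
next
  case (Cons x p)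
  then have x: "x \<in> arcs Q" "u = tail Q x" "Q.awalk (head Q x) p v"
    by (auto simp: Q.awalk_Cons_iff)
  then show ?case using Cons.IH[of "head Q x"] walk_arr_typed[OF x(3)] walk_arr_typed[OF assms(2)]
    by (simp add: comp_assoc arrow_in cod_arrow)
qed

definition homset :: "'v \<Rightarrow> 'v \<Rightarrow> 'm set" where
  "homset u v = {m \<in> Arr E. Dom E m = \<phi> u \<and> Cod E m = \<phi> v}"

lemma eval_paths: "eval ` paths Q u v \<subseteq> homset u v"
  using walk_arr_typed by (auto simp: eval_def paths_def homset_def)

text \<open>The kernel congruence of the linear functor that evaluates paths, to be compared with
  the congruence generated by relations.\<close>

definition kernel_rel :: "'v \<Rightarrow> 'v \<Rightarrow> ('v \<times> 'e list \<times> 'v \<Rightarrow> 'k::field) rel" where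
  "kernel_rel u v = {(a, b). a \<in> carrier (free_space (paths Q u v)) \<and>
    b \<in> carrier (free_space (paths Q u v)) \<and> push eval a = push eval b}"

lemma push_eval_comp:
  fixes a b :: "'v \<times> 'e list \<times> 'v \<Rightarrow> 'k::field"
  assumes a: "a \<in> carrier (free_space (paths Q u v))" and b: "b \<in> carrier (free_space (paths Q v w))"
  shows "push eval (path_comp b a) = push eval b \<star> push eval a"
proof (rule push_conv)
  fix q p assume "b q \<noteq> 0" "a p \<noteq> 0"
  then have "q \<in> paths Q v w" "p \<in> paths Q u v"
    using free_space_nonzero[OF a] free_space_nonzero[OF b] by blast+
  then obtain p' q' where *: "p = (u, p', v)" "q = (v, q', w)" "Q.awalk u p' v" "Q.awalk v q' w"
    by (auto simp: paths_def)
  show "(case q of (u', q, v') \<Rightarrow> \<lambda>(u, p, v). u' = v) p \<longleftrightarrow> Dom E (eval q) = Cod E (eval p)"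
    using * walk_arr_typed by (simp add: eval_def)
  show "eval ((case q of (u', q, v') \<Rightarrow> \<lambda>(u, p, v). (u, p @ q, v')) p) = Comp E (eval q) (eval p)"
    using * walk_arr_append by (simp add: eval_def)
qed (use a b in auto)

lemma path_comp_in:
  fixes a b :: "'v \<times> 'e list \<times> 'v \<Rightarrow> 'k::field"
  assumes a: "a \<in> carrier (free_space (paths Q u v))" and b: "b \<in> carrier (free_space (paths Q v w))"
  shows "path_comp b a \<in> carrier (free_space (paths Q u w))"
proof -
  have *: "{x. path_comp b a x \<noteq> 0} \<subseteq>
      (\<lambda>(q, p). case q of (u', q, v') \<Rightarrow> case p of (u, p, v) \<Rightarrow> (u, p @ q, v')) ` ({q. b q \<noteq> 0} \<times> {p. a p \<noteq> 0})"
  proof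
    fix x assume "x \<in> {x. path_comp b a x \<noteq> 0}"
    then have "path_comp b a x \<noteq> 0" by simp
    then obtain q p where "b q \<noteq> 0" "a p \<noteq> 0"
      "(case q of (u', q, v') \<Rightarrow> \<lambda>(u, p, v). (u, p @ q, v')) p = x"
      by (rule conv_nonzeroE)
    then show "x \<in> (\<lambda>(q, p). case q of (u', q, v') \<Rightarrow> case p of (u, p, v) \<Rightarrow> (u, p @ q, v')) ` ({q. b q \<noteq> 0} \<times> {p. a p \<noteq> 0})"
      by (intro image_eqI[of _ _ "(q, p)"]) (auto split: prod.splits)
  qed
  moreover have "(\<lambda>(q, p). case q of (u', q, v') \<Rightarrow> case p of (u, p, v) \<Rightarrow> (u, p @ q, v')) `
      ({q. b q \<noteq> 0} \<times> {p. a p \<noteq> 0}) \<subseteq> paths Q u w"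
    using a b by (fastforce simp: paths_def intro: Q.awalk_appendI)
  ultimately show ?thesis using finite_subset[OF *] a b by auto
qed

lemma lin_congruence_kernel: "lin_congruence (path_lincat Q) (kernel_rel :: 'v \<Rightarrow> 'v \<Rightarrow> ('v \<times> 'e list \<times> 'v \<Rightarrow> 'k::field) rel)"
proof -
  have "equiv (carrier (free_space (paths Q u v))) (kernel_rel u v :: ('v \<times> 'e list \<times> 'v \<Rightarrow> 'k) rel)" for u v
    by (rule equivI) (auto simp: kernel_rel_def refl_on_def sym_def trans_def)
  moreover have "(\<lambda>m. f m + g m, \<lambda>m. f' m + g' m) \<in> kernel_rel u v"
    if "(f, f') \<in> kernel_rel u v" "(g, g') \<in> kernel_rel u v"
    for f f' g g' :: "'v \<times> 'e list \<times> 'v \<Rightarrow> 'k" and u v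
    using that free_space_add[of f "paths Q u v" g] free_space_add[of f' "paths Q u v" g'] unfolding kernel_rel_def by (simp add: push_add)
  moreover have "(\<lambda>m. c * f m, \<lambda>m. c * f' m) \<in> kernel_rel u v"
    if "(f, f') \<in> kernel_rel u v" for f f' :: "'v \<times> 'e list \<times> 'v \<Rightarrow> 'k" and u v c
    using that free_space_scale[of f "paths Q u v" c] free_space_scale[of f' "paths Q u v" c] unfolding kernel_rel_def by (simp add: push_scale)
  moreover have "(path_comp g f, path_comp g' f') \<in> kernel_rel u w"
    if "(f, f') \<in> kernel_rel u v" "(g, g') \<in> kernel_rel v w"
    for f f' g g' :: "'v \<times> 'e list \<times> 'v \<Rightarrow> 'k" and u v w
    using that path_comp_in[of f u v g w] path_comp_in[of f' u v g' w]
      push_eval_comp[of f u v g w] push_eval_comp[of f' u v g' w]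
    unfolding kernel_rel_def by simp
  ultimately show ?thesis
    unfolding lin_congruence_def path_lincat_simps free_space_simps by blast
qed

text \<open>Reduces linear combinations to pairs of paths. If a combination evaluates to zero, each
  path in it is accompanied by another one of equal value; moving the coefficient from one to the
  other stays within the congruence and shrinks the support.\<close>

lemma kernel_rel_subset_congruence:
  fixes S :: "'v \<Rightarrow> 'v \<Rightarrow> ('v \<times> 'e list \<times> 'v \<Rightarrow> 'k::field) rel"
  assumes S: "lin_congruence (path_lincat Q) S" and uv: "u \<in> verts Q" "v \<in> verts Q"
    and nf: "\<And>x y. \<lbrakk>x \<in> paths Q u v; y \<in> paths Q u v; eval x = eval y\<rbrakk> \<Longrightarrow>
      (basis_vec x, basis_vec y) \<in> S u v"
  shows "kernel_rel u v \<subseteq> S u v"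
proof
  let ?C = "carrier (free_space (paths Q u v)) :: ('v \<times> 'e list \<times> 'v \<Rightarrow> 'k) set"
  have eq: "equiv ?C (S u v)"
    using S uv unfolding lin_congruence_def path_lincat_simps by blast
  have add: "(\<lambda>m. f m + g m, \<lambda>m. f' m + g' m) \<in> S u v"
    if "(f, f') \<in> S u v" "(g, g') \<in> S u v" for f f' g g'
    using S uv that unfolding lin_congruence_def path_lincat_simps free_space_simps by blast
  have scale: "(\<lambda>m. c * f m, \<lambda>m. c * f' m) \<in> S u v" if "(f, f') \<in> S u v" for f f' c
    using S uv that unfolding lin_congruence_def path_lincat_simps free_space_simps by blast
  have refl: "(a, a) \<in> S u v" if "a \<in> ?C" for a using eq that by (meson equivE refl_onD)
  have trans: "(a, c) \<in> S u v" if "(a, b) \<in> S u v" "(b, c) \<in> S u v" for a b c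
    using eq that by (meson equivE transD)
  have zero: "(a, \<lambda>_. 0) \<in> S u v" if "a \<in> ?C" "push eval a = (\<lambda>_. 0)" for a
    using that
  proof (induction "card {m. a m \<noteq> 0}" arbitrary: a rule: less_induct)
    case less
    show ?case
    proof (cases "a = (\<lambda>_. 0)")
      case True
      then show ?thesis using refl less.prems by simp
    next
      case False
      then obtain x where x: "a x \<noteq> 0" by blast
      have fin: "finite {m. a m \<noteq> 0}" using less.prems by simp
      \<comment> \<open>Otherwise the term of \<open>x\<close> could not cancel, and
        \<open>push eval a\<close> would have the value \<open>a x\<close> at
        \<open>eval x\<close>.\<close>
      have "\<exists>y. y \<noteq> x \<and> a y \<noteq> 0 \<and> eval y = eval x"
      proof (rule ccontr)
        assume no: "\<nexists>y. y \<noteq> x \<and> a y \<noteq> 0 \<and> eval y = eval x"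
        have "{p. a p \<noteq> 0 \<and> eval p = eval x} = {x}" using no x by auto
        then have "push eval a (eval x) = a x" by (simp add: push_def)
        then show False using less.prems(2) x by simp
      qed
      then obtain y where y: "y \<noteq> x" "a y \<noteq> 0" "eval y = eval x" by blast
      have xy: "x \<in> paths Q u v" "y \<in> paths Q u v" using x y less.prems by auto
      define r where "r = (\<lambda>m. if m = x then 0 else a m)"
      \<comment> \<open>The function \<open>a\<close> with the coefficient of \<open>x\<close> moved
        onto \<open>y\<close>: the path \<open>x\<close> leaves the support and none enters.\<close>
      define a' where "a' = (\<lambda>m. r m + a x * basis_vec y m)"
      have r: "r \<in> ?C" using less.prems(1) by (auto simp: r_def intro: rev_finite_subset[OF fin])
      have a_eq: "a = (\<lambda>m. r m + a x * basis_vec x m)"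
        by (auto simp: r_def basis_vec_def)
      have aa': "(a, a') \<in> S u v"
        using add[OF refl[OF r] scale[OF nf[OF xy y(3)[symmetric]], of "a x"]] a_eq
        unfolding a'_def by metis
      have a'C: "a' \<in> ?C" using aa' eq by (auto simp: equiv_def refl_on_def)
      have fb: "finite {p. c * (basis_vec z p :: 'k) \<noteq> 0}" "finite {p. (basis_vec z p :: 'k) \<noteq> 0}"
        for c and z :: "'v \<times> 'e list \<times> 'v"
        by (rule finite_subset[of _ "{z}"], auto simp: basis_vec_def)+
      have "push eval a' = push eval (\<lambda>m. r m + a x * basis_vec x m)"
        using r y(3) unfolding a'_def by (simp add: push_add push_scale fb push_basis_vec)
      then have a'0: "push eval a' = (\<lambda>_. 0)" using less.prems(2) a_eq by simp
      have "{m. a' m \<noteq> 0} \<subset> {m. a m \<noteq> 0}"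
        using x y by (auto simp: a'_def r_def basis_vec_def)
      then have "card {m. a' m \<noteq> 0} < card {m. a m \<noteq> 0}"
        by (rule psubset_card_mono[OF fin])
      then have "(a', \<lambda>_. 0) \<in> S u v" using less.hyps a'C a'0 by blast
      then show ?thesis using trans aa' by blast
    qed
  qed
  fix z :: "('v \<times> 'e list \<times> 'v \<Rightarrow> 'k) \<times> ('v \<times> 'e list \<times> 'v \<Rightarrow> 'k)"
  assume "z \<in> kernel_rel u v"
  then obtain a b where z: "z = (a, b)" "a \<in> ?C" "b \<in> ?C" "push eval a = push eval b"
    unfolding kernel_rel_def by auto
  have fin: "finite {m. a m \<noteq> 0}" "finite {m. b m \<noteq> 0}" "finite {m. - 1 * b m \<noteq> 0}"
    using z by auto
  let ?d = "\<lambda>m. a m + - 1 * b m"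
  have "?d \<in> ?C"
    by (intro free_space_add free_space_scale z)
  moreover have "push eval ?d = (\<lambda>_. 0)"
    unfolding push_add[OF fin(1,3)] push_scale[OF fin(2)] using z(4) by simp
  ultimately have "(?d, \<lambda>_. 0) \<in> S u v" by (rule zero)
  from add[OF this refl[OF z(3)]] show "z \<in> S u v" unfolding z by simp
qed

text \<open>\<open>R\<close> bounds the generated congruence by the kernel from above;
  \<open>nf\<close>, extended to combinations of paths, bounds it from below. The isomorphism is
  evaluation on classes, onto because every morphism is the value of some path.\<close>

theorem lincat_isomorphic_presentation:
  fixes R :: "'v \<Rightarrow> 'v \<Rightarrow> ('v \<times> 'e list \<times> 'v \<Rightarrow> 'k::field) rel"
  assumes surj: "\<And>u v m. \<lbrakk>u \<in> verts Q; v \<in> verts Q; m \<in> homset u v\<rbrakk> \<Longrightarrow> \<exists>x\<in>paths Q u v. eval x = m"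
    and R: "\<And>u v. \<lbrakk>u \<in> verts Q; v \<in> verts Q\<rbrakk> \<Longrightarrow> R u v \<subseteq> kernel_rel u v"
    and nf: "\<And>(S :: 'v \<Rightarrow> 'v \<Rightarrow> ('v \<times> 'e list \<times> 'v \<Rightarrow> 'k) rel) u v x y.
      \<lbrakk>lin_congruence (path_lincat Q) S; \<forall>u\<in>verts Q. \<forall>v\<in>verts Q. R u v \<subseteq> S u v;
       u \<in> verts Q; v \<in> verts Q; x \<in> paths Q u v; y \<in> paths Q u v; eval x = eval y\<rbrakk> \<Longrightarrow>
      (basis_vec x, basis_vec y) \<in> S u v"
  shows "lincat_isomorphic (quot_lincat (path_lincat Q) (gen_congruence (path_lincat Q) R))
    (idempotent_lincat algebra ((\<lambda>u. ident (\<phi> u)) ` verts Q))"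
proof -
  let ?L = "path_lincat Q :: ('v, 'v \<times> 'e list \<times> 'v \<Rightarrow> 'k, 'k) lincat"
  let ?G = "gen_congruence ?L R"
  let ?C = "\<lambda>u v. carrier (free_space (paths Q u v)) :: ('v \<times> 'e list \<times> 'v \<Rightarrow> 'k) set"
  let ?\<epsilon> = "\<lambda>u. ident (\<phi> u) :: 'm \<Rightarrow> 'k"
  let ?M = "quot_lincat ?L ?G"
  let ?D = "idempotent_lincat algebra (?\<epsilon> ` verts Q)"
  \<comment> \<open>Evaluation is constant on a congruence class, so the image of a class is a
    singleton.\<close>
  let ?F = "\<lambda>(u :: 'v) (v :: 'v) X. the_elem (push eval ` X) :: 'm \<Rightarrow> 'k"
  have G: "?G u v = kernel_rel u v" if "u \<in> verts Q" "v \<in> verts Q" for u v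
  proof
    show "?G u v \<subseteq> kernel_rel u v"
      unfolding gen_congruence_def using lin_congruence_kernel R
      by (intro Inter_lower CollectI exI[of _ kernel_rel]) (simp add: path_lincat_simps)
    show "kernel_rel u v \<subseteq> ?G u v"
      unfolding gen_congruence_def
    proof (rule Inter_greatest, clarify)
      fix a b :: "'v \<times> 'e list \<times> 'v \<Rightarrow> 'k" and S
      assume S: "lin_congruence ?L S" "\<forall>u\<in>LObj ?L. \<forall>v\<in>LObj ?L. R u v \<subseteq> S u v"
        and ab: "(a, b) \<in> kernel_rel u v"
      have "kernel_rel u v \<subseteq> S u v"
        using S that by (intro kernel_rel_subset_congruence nf) (auto simp: path_lincat_simps)
      then show "(a, b) \<in> S u v" using ab by blast
    qed
  qed
  have cls: "?G u v `` {a} = {b \<in> ?C u v. push eval b = push eval a}"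
    if "u \<in> verts Q" "v \<in> verts Q" "a \<in> ?C u v" for u v a
    using that unfolding G[OF that(1,2)] by (auto simp: kernel_rel_def)
  have F_cls: "?F u v (?G u v `` {a}) = push eval a" if "u \<in> verts Q" "v \<in> verts Q" "a \<in> ?C u v" for u v a
  proof -
    have "push eval ` (?G u v `` {a}) = {push eval a}"
      unfolding cls[OF that] using that(3) by auto
    then show ?thesis by simp
  qed
  have add_in: "(\<lambda>m. a m + b m) \<in> ?C u v" if "a \<in> ?C u v" "b \<in> ?C u v" for a b u v
    using that by (rule free_space_add)
  have scale_in: "(\<lambda>m. c * a m) \<in> ?C u v" if "a \<in> ?C u v" for a c u v
    using that by (rule free_space_scale)
  have hom_M: "carrier (LHom ?M u v) = {?G u v `` {a} |a. a \<in> ?C u v}" for u v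
    by (auto simp: quot_lincat_def path_lincat_simps quotient_def)
  \<comment> \<open>Operations on classes are unions over all representatives; well-definedness
    collapses each union to one class. Scalars and composition follow the same scheme.\<close>
  have add_M: "?G u v `` {a} \<oplus>\<^bsub>LHom ?M u v\<^esub> ?G u v `` {b} = ?G u v `` {\<lambda>m. a m + b m}"
    if uv: "u \<in> verts Q" "v \<in> verts Q" and ab: "a \<in> ?C u v" "b \<in> ?C u v" for u v a b
  proof -
    have "?G u v `` {\<lambda>m. x m + y m} = ?G u v `` {\<lambda>m. a m + b m}"
      if "x \<in> ?G u v `` {a}" "y \<in> ?G u v `` {b}" for x y
    proof -
      have *: "x \<in> ?C u v" "y \<in> ?C u v" "push eval x = push eval a" "push eval y = push eval b"
        using that unfolding cls[OF uv ab(1)] cls[OF uv ab(2)] by auto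
      show ?thesis
        unfolding cls[OF uv add_in[OF ab]] cls[OF uv add_in[OF *(1,2)]]
        using * ab by (simp add: push_add)
    qed
    moreover have "a \<in> ?G u v `` {a}" "b \<in> ?G u v `` {b}"
      unfolding cls[OF uv ab(1)] cls[OF uv ab(2)] using ab by auto
    ultimately have "(\<Union>x\<in>?G u v `` {a}. \<Union>y\<in>?G u v `` {b}. ?G u v `` {\<lambda>m. x m + y m}) = ?G u v `` {\<lambda>m. a m + b m}"
      by blast
    then show ?thesis by (simp add: quot_lincat_def path_lincat_simps)
  qed
  have scale_M: "c \<odot>\<^bsub>LHom ?M u v\<^esub> ?G u v `` {a} = ?G u v `` {\<lambda>m. c * a m}"
    if uv: "u \<in> verts Q" "v \<in> verts Q" and a: "a \<in> ?C u v" for u v a c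
  proof -
    have "?G u v `` {\<lambda>m. c * x m} = ?G u v `` {\<lambda>m. c * a m}" if "x \<in> ?G u v `` {a}" for x
    proof -
      have *: "x \<in> ?C u v" "push eval x = push eval a"
        using that unfolding cls[OF uv a] by auto
      show ?thesis
        unfolding cls[OF uv scale_in[OF a]] cls[OF uv scale_in[OF *(1)]]
        using * a by (simp add: push_scale)
    qed
    moreover have "a \<in> ?G u v `` {a}"
      unfolding cls[OF uv a] using a by auto
    ultimately have "(\<Union>x\<in>?G u v `` {a}. ?G u v `` {\<lambda>m. c * x m}) = ?G u v `` {\<lambda>m. c * a m}"
      by blast
    then show ?thesis by (simp add: quot_lincat_def path_lincat_simps)
  qed
  have comp_M: "LComp ?M u v w (?G v w `` {b}) (?G u v `` {a}) = ?G u w `` {path_comp b a}"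
    if uvw: "u \<in> verts Q" "v \<in> verts Q" "w \<in> verts Q" and ab: "a \<in> ?C u v" "b \<in> ?C v w" for u v w a b
  proof -
    have "?G u w `` {path_comp y x} = ?G u w `` {path_comp b a}"
      if "x \<in> ?G u v `` {a}" "y \<in> ?G v w `` {b}" for x y
    proof -
      have *: "x \<in> ?C u v" "y \<in> ?C v w" "push eval x = push eval a" "push eval y = push eval b"
        using that unfolding cls[OF uvw(1,2) ab(1)] cls[OF uvw(2,3) ab(2)] by auto
      show ?thesis
        unfolding cls[OF uvw(1,3) path_comp_in[OF ab]] cls[OF uvw(1,3) path_comp_in[OF *(1,2)]]
          push_eval_comp[OF ab] push_eval_comp[OF *(1,2)] *(3,4) ..
    qed
    moreover have "a \<in> ?G u v `` {a}" "b \<in> ?G v w `` {b}"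
      unfolding cls[OF uvw(1,2) ab(1)] cls[OF uvw(2,3) ab(2)] using ab by auto
    ultimately have "(\<Union>y\<in>?G v w `` {b}. \<Union>x\<in>?G u v `` {a}. ?G u w `` {path_comp y x}) = ?G u w `` {path_comp b a}"
      by blast
    then show ?thesis by (simp add: quot_lincat_def path_lincat_simps)
  qed
  have hom_D: "carrier (LHom ?D (?\<epsilon> u) (?\<epsilon> v)) = supported (homset u v)"
    if "u \<in> verts Q" "v \<in> verts Q" for u v
  proof -
    have *: "?\<epsilon> v \<star> x \<star> ?\<epsilon> u = (\<lambda>m. if m \<in> homset u v then x m else 0)" if "x \<in> supported (Arr E)" for x
      using ident_mult_mult_ident[OF vert_obj vert_obj that] \<open>u \<in> verts Q\<close> \<open>v \<in> verts Q\<close>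
      by (auto simp: homset_def)
    have "\<exists>x\<in>supported (Arr E). y = ?\<epsilon> v \<star> x \<star> ?\<epsilon> u" if y: "y \<in> supported (homset u v)" for y
    proof
      show y': "y \<in> supported (Arr E)" using y by (rule supported_mono[rotated]) (auto simp: homset_def)
      show "y = ?\<epsilon> v \<star> y \<star> ?\<epsilon> u" unfolding *[OF y'] using y by (auto simp: supported_iff)
    qed
    moreover have "?\<epsilon> v \<star> x \<star> ?\<epsilon> u \<in> supported (homset u v)" if "x \<in> supported (Arr E)" for x
      unfolding *[OF that] by (auto simp: supported_iff)
    ultimately show ?thesis by (auto simp: idempotent_lincat_def)
  qed
  have inj_\<epsilon>: "inj_on ?\<epsilon> (verts Q)"
    using comp_inj_on[OF bij_betw_imp_inj_on[OF bij_verts], of "\<lambda>c. ident c :: 'm \<Rightarrow> 'k"]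
      inj_ident[where ?'k = 'k]
    unfolding bij_betw_imp_surj_on[OF bij_verts] comp_def by blast
  have push_in: "push eval a \<in> supported (homset u v)" if "a \<in> ?C u v" for u v a
    using that eval_paths by (intro push_supported[of a "paths Q u v"]) (auto simp: supported_iff)
  have bij: "bij_betw (?F u v) (carrier (LHom ?M u v)) (carrier (LHom ?D (?\<epsilon> u) (?\<epsilon> v)))"
    if uv: "u \<in> verts Q" "v \<in> verts Q" for u v
    unfolding bij_betw_def
  proof
    show "inj_on (?F u v) (carrier (LHom ?M u v))"
    proof (rule inj_onI)
      fix X Y assume "X \<in> carrier (LHom ?M u v)" "Y \<in> carrier (LHom ?M u v)" and eq: "?F u v X = ?F u v Y"
      then obtain a b where ab: "a \<in> ?C u v" "b \<in> ?C u v" "X = ?G u v `` {a}" "Y = ?G u v `` {b}"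
        unfolding hom_M by blast
      have "push eval a = push eval b"
        using eq unfolding ab(3,4) F_cls[OF uv ab(1)] F_cls[OF uv ab(2)] .
      then show "X = Y" unfolding ab(3,4) cls[OF uv ab(1)] cls[OF uv ab(2)] by simp
    qed
    show "?F u v ` carrier (LHom ?M u v) = carrier (LHom ?D (?\<epsilon> u) (?\<epsilon> v))"
    proof
      show "?F u v ` carrier (LHom ?M u v) \<subseteq> carrier (LHom ?D (?\<epsilon> u) (?\<epsilon> v))"
        unfolding hom_D[OF uv] hom_M using F_cls[OF uv] push_in by auto
      show "carrier (LHom ?D (?\<epsilon> u) (?\<epsilon> v)) \<subseteq> ?F u v ` carrier (LHom ?M u v)"
      proof
        fix b assume "b \<in> carrier (LHom ?D (?\<epsilon> u) (?\<epsilon> v))"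
        then have b: "b \<in> supported (homset u v)" unfolding hom_D[OF uv] .
        \<comment> \<open>A section of evaluation, one path for each morphism; \<open>b\<close> is
          lifted by placing its coefficients on the chosen paths.\<close>
        obtain s where s: "\<And>m. m \<in> homset u v \<Longrightarrow> s m \<in> paths Q u v \<and> eval (s m) = m"
          using surj[OF uv] by metis
        define a where "a = (\<lambda>x. if x \<in> s ` homset u v then b (eval x) else 0)"
        have fin: "finite (s ` homset u v)"
          using finite_arr by (auto simp: homset_def)
        have a0: "\<forall>x. x \<notin> s ` homset u v \<longrightarrow> a x = 0" by (simp add: a_def)
        have aC: "a \<in> ?C u v"
          using s by (auto simp: a_def intro: finite_subset[OF _ fin] split: if_splits)
        have as: "a (s h) = b h" if "h \<in> homset u v" for h
          using that s[OF that] by (simp add: a_def)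
        have "push eval a = b"
        proof
          fix m
          have "push eval a m = (\<Sum>x\<in>s ` homset u v. if eval x = m then a x else 0)"
            by (rule push_eq_sum[OF fin a0])
          also have "\<dots> = (\<Sum>h\<in>homset u v. if h = m then b h else 0)"
          proof (subst sum.reindex)
            show "inj_on s (homset u v)" using s by (metis inj_onI)
            show "sum ((\<lambda>x. if eval x = m then a x else 0) \<circ> s) (homset u v) = (\<Sum>h\<in>homset u v. if h = m then b h else 0)"
              using s as by (intro sum.cong refl) auto
          qed
          also have "\<dots> = b m"
            using b finite_arr by (simp add: homset_def supported_iff)
          finally show "push eval a m = b m" .
        qed
        then have "b = ?F u v (?G u v `` {a})" using F_cls[OF uv aC] by simp
        then show "b \<in> ?F u v ` carrier (LHom ?M u v)" unfolding hom_M using aC by blast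
      qed
    qed
  qed
  have "lin_functor ?M ?D ?\<epsilon> ?F"
    unfolding lin_functor_def
  proof (intro conjI ballI)
    fix u assume "u \<in> LObj ?M"
    then have u: "u \<in> verts Q" by (simp add: quot_lincat_def path_lincat_simps)
    show "?\<epsilon> u \<in> LObj ?D" using u by (simp add: idempotent_lincat_def)
    have "(u, [], u) \<in> paths Q u u" using u by (simp add: paths_def Q.awalk_Nil_iff)
    then have *: "basis_vec (u, [], u) \<in> ?C u u"
      by (auto simp: basis_vec_def)
    have "?F u u (LId ?M u) = push eval (basis_vec (u, [], u))"
      using F_cls[OF u u *] by (simp add: quot_lincat_def path_lincat_simps)
    then show "?F u u (LId ?M u) = LId ?D (?\<epsilon> u)"
      by (simp add: push_basis_vec eval_def idempotent_lincat_def)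
  next
    fix u v assume "u \<in> LObj ?M" "v \<in> LObj ?M"
    then have uv: "u \<in> verts Q" "v \<in> verts Q" by (simp_all add: quot_lincat_def path_lincat_simps)
    show "?F u v \<in> LinearCombinations.module_hom class_ring (LHom ?M u v) (LHom ?D (?\<epsilon> u) (?\<epsilon> v))"
      unfolding LinearCombinations.module_hom_def
    proof (intro CollectI conjI allI impI)
      show "?F u v \<in> carrier (LHom ?M u v) \<rightarrow> carrier (LHom ?D (?\<epsilon> u) (?\<epsilon> v))"
        using bij_betwE[OF bij[OF uv]] by blast
      fix X Y assume "X \<in> carrier (LHom ?M u v) \<and> Y \<in> carrier (LHom ?M u v)"
      then obtain a b where ab: "a \<in> ?C u v" "b \<in> ?C u v" "X = ?G u v `` {a}" "Y = ?G u v `` {b}"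
        unfolding hom_M by blast
      show "?F u v (X \<oplus>\<^bsub>LHom ?M u v\<^esub> Y) = ?F u v X \<oplus>\<^bsub>LHom ?D (?\<epsilon> u) (?\<epsilon> v)\<^esub> ?F u v Y"
        unfolding ab(3,4) add_M[OF uv ab(1,2)] F_cls[OF uv ab(1)] F_cls[OF uv ab(2)] F_cls[OF uv add_in[OF ab(1,2)]]
        using ab by (simp add: push_add idempotent_lincat_def)
    next
      fix c :: 'k and X assume "c \<in> carrier class_ring \<and> X \<in> carrier (LHom ?M u v)"
      then obtain a where a: "a \<in> ?C u v" "X = ?G u v `` {a}"
        unfolding hom_M by blast
      show "?F u v (c \<odot>\<^bsub>LHom ?M u v\<^esub> X) = c \<odot>\<^bsub>LHom ?D (?\<epsilon> u) (?\<epsilon> v)\<^esub> ?F u v X"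
        unfolding a(2) scale_M[OF uv a(1)] F_cls[OF uv a(1)] F_cls[OF uv scale_in[OF a(1)]]
        using a by (simp add: push_scale idempotent_lincat_def)
    qed
  next
    fix u v w X Y
    assume "u \<in> LObj ?M" "v \<in> LObj ?M" "w \<in> LObj ?M"
      and XY: "X \<in> carrier (LHom ?M u v)" "Y \<in> carrier (LHom ?M v w)"
    then have uvw: "u \<in> verts Q" "v \<in> verts Q" "w \<in> verts Q"
      by (simp_all add: quot_lincat_def path_lincat_simps)
    obtain a b where ab: "a \<in> ?C u v" "b \<in> ?C v w" "X = ?G u v `` {a}" "Y = ?G v w `` {b}"
      using XY unfolding hom_M by blast
    show "?F u w (LComp ?M u v w Y X) = LComp ?D (?\<epsilon> u) (?\<epsilon> v) (?\<epsilon> w) (?F v w Y) (?F u v X)"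
      unfolding ab(3,4) comp_M[OF uvw ab(1,2)] F_cls[OF uvw(1,2) ab(1)] F_cls[OF uvw(2,3) ab(2)]
        F_cls[OF uvw(1,3) path_comp_in[OF ab(1,2)]] push_eval_comp[OF ab(1,2)]
      by (simp add: idempotent_lincat_def)
  qed
  moreover have "bij_betw ?\<epsilon> (LObj ?M) (LObj ?D)"
    using inj_\<epsilon> by (simp add: bij_betw_def quot_lincat_def path_lincat_simps idempotent_lincat_def)
  ultimately show ?thesis
    unfolding lincat_isomorphic_def using bij
    by (intro exI[of _ ?\<epsilon>] exI[of _ ?F]) (auto simp: quot_lincat_def path_lincat_simps)
qed

end

section \<open>Order-preserving surjections, merges and normal forms\<close>

section \<open>Order-preserving surjections\<close>

lemma dom_map_comp: "ran f \<subseteq> dom g \<Longrightarrow> dom (g \<circ>\<^sub>m f) = dom f"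
  by (force simp: map_comp_def dom_def ran_def split: option.splits)

lemma ran_map_comp: "ran f = dom g \<Longrightarrow> ran (g \<circ>\<^sub>m f) = ran g"
  by (force simp: map_comp_def dom_def ran_def split: option.splits)

lemma map_comp_restrict_Some: "dom f \<subseteq> S \<Longrightarrow> f \<circ>\<^sub>m (Some |` S) = f"
proof
  fix x assume "dom f \<subseteq> S"
  then have "x \<notin> S \<Longrightarrow> f x = None" by blast
  then show "(f \<circ>\<^sub>m (Some |` S)) x = f x" by (cases "x \<in> S") (simp_all add: map_comp_def)
qed

lemma restrict_Some_map_comp: "ran f \<subseteq> S \<Longrightarrow> (Some |` S) \<circ>\<^sub>m f = f"
  by (force simp: map_comp_def restrict_map_def fun_eq_iff ran_def split: option.splits)

lemma map_comp_assoc: "(h \<circ>\<^sub>m g) \<circ>\<^sub>m f = h \<circ>\<^sub>m (g \<circ>\<^sub>m f)"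
  by (auto simp: map_comp_def fun_eq_iff split: option.splits)

lemma ran_restrict_Some: "ran (Some |` S) = S"
  by (auto simp: ran_def restrict_map_def)

lemma dom_restrict_Some: "dom (Some |` S) = S"
  by (auto simp: dom_def restrict_map_def)

lemma order_preserving_alt:
  "order_preserving f \<longleftrightarrow> (\<forall>x y a b. f x = Some a \<longrightarrow> f y = Some b \<longrightarrow> x \<le> y \<longrightarrow> a \<le> b)"
  by (force simp: order_preserving_def)

lemma order_preserving_comp: "order_preserving g \<Longrightarrow> order_preserving f \<Longrightarrow> order_preserving (g \<circ>\<^sub>m f)"
  unfolding order_preserving_alt map_comp_def by (auto split: option.splits)

lemma order_preserving_restrict_Some: "order_preserving (Some |` S)"
  by (auto simp: order_preserving_alt restrict_map_def)

lemma finite_partial_maps: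
  assumes "finite A" "finite B"
  shows "finite {f :: 'a \<rightharpoonup> 'b. dom f \<subseteq> A \<and> ran f \<subseteq> B}"
proof -
  have "{f :: 'a \<rightharpoonup> 'b. dom f \<subseteq> A \<and> ran f \<subseteq> B} = (\<Union>D\<in>Pow A. {f. dom f = D \<and> ran f \<subseteq> B})"
    by auto
  moreover have "finite {f :: 'a \<rightharpoonup> 'b. dom f = D \<and> ran f \<subseteq> B}" if "D \<in> Pow A" for D
    using that assms by (auto intro!: finite_set_of_finite_maps intro: finite_subset)
  ultimately show ?thesis using assms(1) by simp
qed

text \<open>Parametrised by the objects because two instances occur: initial segments for
  \<open>SEO\<close>, and all subsets of \<open>[n]\<close> for the monoid. No codomain is stored,
  as a morphism is onto its range.\<close>

definition onto_cat :: "nat set set \<Rightarrow> (nat set, nat \<rightharpoonup> nat) smallcat" where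
  "onto_cat Ob =
     \<lparr>Obj = Ob,
      Arr = {f. dom f \<in> Ob \<and> ran f \<in> Ob \<and> order_preserving f},
      Dom = dom, Cod = ran, Id = (\<lambda>S. Some |` S), Comp = (\<lambda>g f. g \<circ>\<^sub>m f)\<rparr>"

lemma onto_cat_simps [simp]:
  "Obj (onto_cat Ob) = Ob"
  "Arr (onto_cat Ob) = {f. dom f \<in> Ob \<and> ran f \<in> Ob \<and> order_preserving f}"
  "Dom (onto_cat Ob) = dom" "Cod (onto_cat Ob) = ran"
  "Id (onto_cat Ob) S = Some |` S" "Comp (onto_cat Ob) g f = g \<circ>\<^sub>m f"
  by (simp_all add: onto_cat_def)

lemma SEO_eq: "SEO n = onto_cat {{1..k} |k. k \<le> n}"
  by (simp add: SEO_def onto_cat_def)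

lemma finite_category_onto_cat:
  assumes "\<Union>Ob \<subseteq> A" "finite A"
  shows "finite_category (onto_cat Ob)"
proof
  have "Arr (onto_cat Ob) \<subseteq> {f. dom f \<subseteq> A \<and> ran f \<subseteq> A}" using assms(1) by auto
  then show "finite (Arr (onto_cat Ob))"
    using finite_partial_maps[OF assms(2,2)] by (rule finite_subset)
qed (simp_all add: dom_map_comp ran_map_comp order_preserving_comp map_comp_assoc
      map_comp_restrict_Some restrict_Some_map_comp ran_restrict_Some dom_restrict_Some
      order_preserving_restrict_Some)

definition onto_maps :: "nat \<Rightarrow> nat \<Rightarrow> (nat \<rightharpoonup> nat) set" where
  "onto_maps k l = {f. dom f = {1..k} \<and> ran f = {1..l} \<and> order_preserving f}"

lemma onto_mapsE:
  assumes "f \<in> onto_maps k l" "1 \<le> x" "x \<le> k"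
  obtains y where "f x = Some y" "1 \<le> y" "y \<le> l"
proof -
  have "x \<in> dom f" using assms by (auto simp: onto_maps_def)
  then obtain y where y: "f x = Some y" by blast
  then have "y \<in> ran f" by (rule ranI)
  then show ?thesis using that y assms by (auto simp: onto_maps_def)
qed

lemma onto_maps_mono:
  "\<lbrakk>f \<in> onto_maps k l; f x = Some a; f y = Some b; x \<le> y\<rbrakk> \<Longrightarrow> a \<le> b"
  by (auto simp: onto_maps_def order_preserving_alt)

lemma onto_maps_domD: "\<lbrakk>f \<in> onto_maps k l; f x = Some y\<rbrakk> \<Longrightarrow> 1 \<le> x \<and> x \<le> k \<and> 1 \<le> y \<and> y \<le> l"
  using ranI[of f x y] by (force simp: onto_maps_def)

lemma onto_maps_surj:
  assumes "f \<in> onto_maps k l" "1 \<le> y" "y \<le> l"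
  obtains x where "f x = Some y"
proof -
  have "y \<in> ran f" using assms by (auto simp: onto_maps_def)
  then show ?thesis using that by (auto simp: ran_def)
qed

lemma onto_maps_first:
  assumes f: "f \<in> onto_maps k l" and k: "1 \<le> k"
  shows "f 1 = Some 1"
proof -
  obtain y where y: "f 1 = Some y" "1 \<le> y" "y \<le> l" using onto_mapsE[OF f _ k] by blast
  obtain x where x: "f x = Some 1" using onto_maps_surj[OF f, of 1] y by auto
  have "y \<le> 1" using onto_maps_mono[OF f y(1) x] onto_maps_domD[OF f x] by simp
  then show ?thesis using y by simp
qed

text \<open>A larger jump would skip \<open>Suc a\<close>, whose preimage monotonicity excludes on
  both sides of the jump.\<close>

lemma onto_maps_step:
  assumes f: "f \<in> onto_maps k l" and a: "f x = Some a" and b: "f (Suc x) = Some b"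
  shows "b \<le> Suc a"
proof (rule ccontr)
  assume "\<not> b \<le> Suc a"
  then have "Suc a \<le> l" using onto_maps_domD[OF f b] by simp
  then obtain y where y: "f y = Some (Suc a)" using onto_maps_surj[OF f, of "Suc a"] by auto
  show False
  proof (cases "y \<le> x")
    case True
    then show False using onto_maps_mono[OF f y a] by simp
  next
    case False
    then show False using onto_maps_mono[OF f b y] \<open>\<not> b \<le> Suc a\<close> by simp
  qed
qed

lemma onto_maps_last:
  assumes f: "f \<in> onto_maps k l" and k: "1 \<le> k"
  shows "f k = Some l"
proof -
  obtain y where y: "f k = Some y" "1 \<le> y" "y \<le> l" using onto_mapsE[OF f k] by blast
  obtain x where x: "f x = Some l" using onto_maps_surj[OF f, of l] y by auto
  have "l \<le> y" using onto_maps_mono[OF f x y(1)] onto_maps_domD[OF f x] by simp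
  then show ?thesis using y by simp
qed

lemma onto_maps_lipschitz:
  assumes f: "f \<in> onto_maps k l" and a: "f x = Some a" and "f (x + d) = Some b"
  shows "b \<le> a + d"
  using assms(3)
proof (induction d arbitrary: b)
  case (Suc d)
  have "1 \<le> x + d" "x + d \<le> k" using onto_maps_domD[OF f a] onto_maps_domD[OF f Suc.prems] by auto
  then obtain c where c: "f (x + d) = Some c" using onto_mapsE[OF f] by blast
  then show ?case using Suc.IH[OF c] onto_maps_step[OF f c, of b] Suc.prems by simp
qed (use a in simp)

lemma onto_maps_le:
  assumes f: "f \<in> onto_maps k l" and a: "f x = Some a"
  shows "a \<le> x"
proof -
  have x: "1 \<le> x" "x \<le> k" using onto_maps_domD[OF f a] by auto
  have "f 1 = Some 1" by (rule onto_maps_first[OF f]) (use x in simp)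
  then show ?thesis using onto_maps_lipschitz[OF f, of 1 1 "x - 1" a] a x by simp
qed

lemma onto_maps_rank_le: "f \<in> onto_maps k l \<Longrightarrow> l \<le> k"
\<comment> \<open>For \<open>k = 0\<close> there is no last point to evaluate at.\<close>
proof (cases "k = 0")
  case True
  assume "f \<in> onto_maps k l"
  then have "ran f = {1..l}" "dom f = {}" using True by (auto simp: onto_maps_def)
  then have "{1..l} = {}" by (simp add: ran_def dom_def)
  then show ?thesis by simp
next
  case False
  assume f: "f \<in> onto_maps k l"
  then show ?thesis using onto_maps_le[OF f onto_maps_last[OF f]] False by simp
qed

text \<open>Growth by at most one per step squeezes each value: counted from the left end it gives
  \<open>a \<le> x\<close>, counted up to the right end it gives the reverse.\<close>

lemma onto_maps_id:
  assumes f: "f \<in> onto_maps k k"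
  shows "f = Some |` {1..k}"
proof
  fix x
  show "f x = (Some |` {1..k}) x"
  proof (cases "x \<in> {1..k}")
    case True
    then obtain a where a: "f x = Some a" using onto_mapsE[OF f] by auto
    have "f k = Some k" by (rule onto_maps_last[OF f]) (use True in simp)
    then have "k \<le> a + (k - x)" using onto_maps_lipschitz[OF f a, of "k - x" k] True by simp
    moreover have "a \<le> x" by (rule onto_maps_le[OF f a])
    ultimately show ?thesis using a True by (auto simp: restrict_map_def)
  next
    case False
    then have "x \<notin> dom f" using f by (auto simp: onto_maps_def)
    then show ?thesis using False by (auto simp: restrict_map_def)
  qed
qed

text \<open>Without a repeated value every step would be exactly one, and the last value would be
  \<open>k\<close> instead of \<open>l\<close>.\<close>

lemma onto_maps_collapse:
  assumes f: "f \<in> onto_maps k l" and "l < k"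
  shows "\<exists>i. 1 \<le> i \<and> i < k \<and> f i = f (Suc i)"
proof (rule ccontr)
  assume no: "\<nexists>i. 1 \<le> i \<and> i < k \<and> f i = f (Suc i)"
  have "f x = Some x" if "1 \<le> x" "x \<le> k" for x
    using that
  proof (induction x rule: nat_induct_at_least)
    case base
    then show ?case using onto_maps_first[OF f] by simp
  next
    case (Suc x)
    then have x: "f x = Some x" by simp
    obtain b where b: "f (Suc x) = Some b" using onto_mapsE[OF f, of "Suc x"] Suc by auto
    have "x \<le> b" "b \<le> Suc x" using onto_maps_mono[OF f x b] onto_maps_step[OF f x b] by auto
    moreover have "b \<noteq> x"
    proof
      assume "b = x"
      then have "1 \<le> x \<and> x < k \<and> f x = f (Suc x)" using x b Suc by simp
      then show False using no by blast
    qed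
    ultimately show ?case using b by simp
  qed
  then have "f k = Some k" using assms(2) by simp
  then show False using onto_maps_last[OF f] assms(2) by simp
qed

lemma onto_maps_comp: "\<lbrakk>g \<in> onto_maps l m; f \<in> onto_maps k l\<rbrakk> \<Longrightarrow> g \<circ>\<^sub>m f \<in> onto_maps k m"
  by (simp add: onto_maps_def dom_map_comp ran_map_comp order_preserving_comp)

subsection \<open>Elementary merges\<close>

text \<open>Closed form of the function that identifies \<open>i\<close> and \<open>i + 1\<close>.
  These are the codegeneracies of the simplex category, and \<open>merge_relation\<close> is the
  cosimplicial identity between them.\<close>

definition merge :: "nat \<Rightarrow> nat \<Rightarrow> (nat \<rightharpoonup> nat)" where
  "merge k i = (\<lambda>x. if 1 \<le> x \<and> x \<le> Suc k then Some (if x \<le> i then x else x - 1) else None)"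

lemma merge_onto_maps:
  assumes "1 \<le> i" "i \<le> k"
  shows "merge k i \<in> onto_maps (Suc k) k"
proof -
  have "y \<in> ran (merge k i)" if "1 \<le> y" "y \<le> k" for y
    using that assms by (intro ranI[of _ "if y \<le> i then y else Suc y"]) (simp add: merge_def)
  moreover have "ran (merge k i) \<subseteq> {1..k}"
    using assms by (auto simp: merge_def ran_def split: if_splits)
  ultimately have "ran (merge k i) = {1..k}" by auto
  moreover have "dom (merge k i) = {1..Suc k}" by (auto simp: merge_def dom_def split: if_splits)
  moreover have "order_preserving (merge k i)"
    unfolding order_preserving_alt merge_def using assms by (auto split: if_splits)
  ultimately show ?thesis by (simp add: onto_maps_def)
qed

text \<open>\<open>f\<close> is constant on the fibres of the merge, hence factors through
  it.\<close>

lemma onto_maps_factor: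
  assumes f: "f \<in> onto_maps (Suc k) l" and i: "1 \<le> i" "i \<le> k" and eq: "f i = f (Suc i)"
  shows "\<exists>g\<in>onto_maps k l. f = g \<circ>\<^sub>m merge k i"
proof
  \<comment> \<open>\<open>f\<close> after the section of \<open>merge k i\<close> that skips
    \<open>Suc i\<close>.\<close>
  let ?g = "\<lambda>x. if 1 \<le> x \<and> x \<le> k then f (if x \<le> i then x else Suc x) else None"
  show fg: "f = ?g \<circ>\<^sub>m merge k i"
  proof
    fix x
    show "f x = (?g \<circ>\<^sub>m merge k i) x"
    proof (cases "1 \<le> x \<and> x \<le> Suc k")
      case True
      then show ?thesis
        using i eq by (cases "x = Suc i") (auto simp: map_comp_def merge_def)
    next
      case False
      then have "x \<notin> dom f" using f by (auto simp: onto_maps_def)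
      then show ?thesis using False by (auto simp: map_comp_def merge_def)
    qed
  qed
  have "dom ?g = {1..k}"
  proof -
    have "f (if x \<le> i then x else Suc x) \<noteq> None" if "1 \<le> x" "x \<le> k" for x
    proof -
      have "1 \<le> (if x \<le> i then x else Suc x)" "(if x \<le> i then x else Suc x) \<le> Suc k"
        using that by simp_all
      then obtain y where "f (if x \<le> i then x else Suc x) = Some y" by (rule onto_mapsE[OF f])
      then show ?thesis by simp
    qed
    then show ?thesis by (auto simp: dom_def split: if_splits)
  qed
  moreover have "ran ?g = {1..l}"
    using ran_map_comp[of "merge k i" ?g] fg f merge_onto_maps[OF i] \<open>dom ?g = {1..k}\<close>
    by (simp add: onto_maps_def)
  moreover have "order_preserving ?g"
    unfolding order_preserving_alt
  proof (intro allI impI)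
    fix x y a b
    assume *: "?g x = Some a" "?g y = Some b" "x \<le> y"
    have "(if x \<le> i then x else Suc x) \<le> (if y \<le> i then y else Suc y)" using *(3) by auto
    moreover have "f (if x \<le> i then x else Suc x) = Some a" "f (if y \<le> i then y else Suc y) = Some b"
      using *(1,2) by (auto split: if_splits)
    ultimately show "a \<le> b" using onto_maps_mono[OF f] by blast
  qed
  ultimately show "?g \<in> onto_maps k l" by (simp add: onto_maps_def)
qed

text \<open>Any competitor factors through \<open>merge k i\<close> by an order-preserving
  surjection of \<open>[k]\<close> onto itself, which is the identity. This settles the definite
  description in \<open>merge_map\<close>.\<close>

lemma merge_map_eq:
  assumes "1 \<le> i" "i \<le> k"
  shows "merge_map k i = merge k i"
  unfolding merge_map_def
proof (rule the_equality)
  show "dom (merge k i) = {1..k + 1} \<and> ran (merge k i) = {1..k} \<and> order_preserving (merge k i) \<and>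
      merge k i i = merge k i (i + 1)"
    using merge_onto_maps[OF assms] assms by (simp add: onto_maps_def) (simp add: merge_def)
  fix f :: "nat \<rightharpoonup> nat"
  assume "dom f = {1..k + 1} \<and> ran f = {1..k} \<and> order_preserving f \<and> f i = f (i + 1)"
  then have "f \<in> onto_maps (Suc k) k" "f i = f (Suc i)" by (simp_all add: onto_maps_def)
  then obtain g where "g \<in> onto_maps k k" "f = g \<circ>\<^sub>m merge k i"
    using onto_maps_factor[OF _ assms] by blast
  moreover have "ran (merge k i) \<subseteq> {1..k}"
    using merge_onto_maps[OF assms] by (simp add: onto_maps_def)
  ultimately show "f = merge k i"
    using onto_maps_id restrict_Some_map_comp by metis
qed

lemma merge_relation:
  assumes "1 \<le> i" "i < j" "j \<le> k"
  shows "merge (k - 1) i \<circ>\<^sub>m merge k j = merge (k - 1) (j - 1) \<circ>\<^sub>m merge k i"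
  using assms by (auto simp: merge_def map_comp_def fun_eq_iff)

text \<open>Merges are onto, hence epimorphisms. The lemma strips the common first arrow when two
  sorted paths are compared.\<close>

lemma map_comp_merge_cancel:
  assumes "1 \<le> i" "i \<le> k" "g \<in> onto_maps k l" "h \<in> onto_maps k m"
    and eq: "g \<circ>\<^sub>m merge k i = h \<circ>\<^sub>m merge k i"
  shows "g = h"
proof
  fix y
  show "g y = h y"
  proof (cases "1 \<le> y \<and> y \<le> k")
    case True
    then obtain x where "merge k i x = Some y"
      using onto_maps_surj[OF merge_onto_maps[OF assms(1,2)]] by blast
    then show ?thesis using fun_cong[OF eq, of x] by (simp add: map_comp_def)
  next
    case False
    then have "y \<notin> dom g" "y \<notin> dom h" using assms(3,4) by (auto simp: onto_maps_def)
    then show ?thesis by (simp add: domIff)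
  qed
qed

section \<open>The quiver and relations of the category of order-preserving surjections\<close>

lemma interval_eq_iff: "{1..k} = {1..l} \<longleftrightarrow> k = (l :: nat)"
proof
  assume "{1..k} = {1..l}"
  then have "card {1..k} = card {1..l}" by (rule arg_cong)
  then show "k = l" by simp
qed simp

lemma Arr_SEO_iff: "f \<in> Arr (SEO n) \<longleftrightarrow> (\<exists>k l. k \<le> n \<and> l \<le> n \<and> f \<in> onto_maps k l)"
  by (auto simp: SEO_eq onto_maps_def)

lemma SEO_simps:
  "Obj (SEO n) = {{1..k} |k. k \<le> n}" "Dom (SEO n) = dom" "Cod (SEO n) = ran"
  "Id (SEO n) S = Some |` S" "Comp (SEO n) g f = g \<circ>\<^sub>m f"
  by (simp_all add: SEO_eq)

lemma onto_maps_dom_ran: "f \<in> onto_maps k l \<Longrightarrow> dom f = {1..k} \<and> ran f = {1..l}"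
  by (simp add: onto_maps_def)

text \<open>Cardinality serves as rank: a surjection cannot raise it, and one that keeps it is an
  identity by \<open>onto_maps_id\<close>.\<close>

interpretation SEO: directed_category "SEO n" card for n
proof -
  interpret finite_category "SEO n"
    unfolding SEO_eq by (rule finite_category_onto_cat[of _ "{1..n}"]) auto
  show "directed_category (SEO n) card"
  proof
    fix f assume "f \<in> Arr (SEO n)"
    then obtain k l where f: "f \<in> onto_maps k l" by (auto simp: Arr_SEO_iff)
    show "f = Id (SEO n) (Dom (SEO n) f) \<or> card (Cod (SEO n) f) < card (Dom (SEO n) f)"
      using onto_maps_rank_le[OF f] onto_maps_id[of f k] f onto_maps_dom_ran[OF f]
      by (cases "k = l") (auto simp: SEO_simps)
  qed
qed

lemma SEO_nonid_iff: "f \<in> SEO.nonid n \<longleftrightarrow> (\<exists>k l. l < k \<and> k \<le> n \<and> f \<in> onto_maps k l)"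
proof
  assume "f \<in> SEO.nonid n"
  then have *: "f \<in> Arr (SEO n)" "card (ran f) < card (dom f)"
    by (auto simp: SEO.nonid_iff_rank SEO_simps)
  then obtain k l where "k \<le> n" "f \<in> onto_maps k l" by (auto simp: Arr_SEO_iff)
  then show "\<exists>k l. l < k \<and> k \<le> n \<and> f \<in> onto_maps k l"
    using *(2) onto_maps_dom_ran[of f k l] by auto
next
  assume "\<exists>k l. l < k \<and> k \<le> n \<and> f \<in> onto_maps k l"
  then obtain k l where "l < k" "k \<le> n" "f \<in> onto_maps k l" by blast
  moreover have "f \<in> Arr (SEO n)" unfolding Arr_SEO_iff
    using calculation by (intro exI[of _ k] exI[of _ l]) simp
  ultimately show "f \<in> SEO.nonid n"
    using onto_maps_dom_ran[of f k l] by (simp add: SEO.nonid_iff_rank SEO_simps)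
qed

lemma onto_maps_unique: "\<lbrakk>f \<in> onto_maps k l; f \<in> onto_maps k' l'\<rbrakk> \<Longrightarrow> k = k' \<and> l = l'"
  by (metis interval_eq_iff onto_maps_dom_ran)

text \<open>A composite of two non-identities lowers the size by at least two, so merges are
  irreducible. Conversely, a repeated value splits off a merge on the right, and irreducibility
  forces the other factor to be an identity.\<close>

lemma SEO_irreducible:
  assumes "k \<le> n" "l \<le> n"
  shows "SEO.irreducible n {1..k} {1..l} = (if k = Suc l then merge l ` {1..l} else {})"
proof -
  have red: "Suc m < k'" if gf: "g \<circ>\<^sub>m f \<in> onto_maps k' m" and gn: "g \<in> SEO.nonid n" and fn: "f \<in> SEO.nonid n"
    and dr: "dom g = ran f" for g f k' m
  proof -
    obtain a b where f: "b < a" "f \<in> onto_maps a b" using fn by (auto simp: SEO_nonid_iff)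
    obtain c d where g: "d < c" "g \<in> onto_maps c d" using gn by (auto simp: SEO_nonid_iff)
    have "b = c" using dr onto_maps_dom_ran[OF f(2)] onto_maps_dom_ran[OF g(2)] interval_eq_iff by metis
    then have "g \<circ>\<^sub>m f \<in> onto_maps a d" using onto_maps_comp f g by blast
    then show ?thesis using onto_maps_unique[OF gf] \<open>b = c\<close> f(1) g(1) by fastforce
  qed
  show ?thesis
  proof (intro equalityI subsetI)
    fix f assume "f \<in> SEO.irreducible n {1..k} {1..l}"
    then have f: "f \<in> SEO.nonid n" "f \<notin> SEO.reducible n" "dom f = {1..k}" "ran f = {1..l}"
      by (auto simp: SEO.irreducible_def SEO_simps)
    obtain k' l' where kl: "l' < k'" "f \<in> onto_maps k' l'" using f(1) by (auto simp: SEO_nonid_iff)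
    have "k' = k" "l' = l" using onto_maps_dom_ran[OF kl(2)] f(3,4) interval_eq_iff by metis+
    with kl have f': "l < k" "f \<in> onto_maps k l" by auto
    obtain i where i: "1 \<le> i" "i < k" "f i = f (Suc i)" using onto_maps_collapse[OF f'(2,1)] by blast
    obtain k0 where k0: "k = Suc k0" using f'(1) by (cases k) auto
    obtain g where g: "g \<in> onto_maps k0 l" "f = g \<circ>\<^sub>m merge k0 i"
      using onto_maps_factor[of f k0 l i] f'(2) i k0 by auto
    have m: "merge k0 i \<in> onto_maps (Suc k0) k0" using i k0 by (intro merge_onto_maps) auto
    have "k0 = l"
    proof (rule ccontr)
      assume "k0 \<noteq> l"
      then have "l < k0" using f'(1) k0 by simp
      then have "g \<in> SEO.nonid n"
        unfolding SEO_nonid_iff using g(1) assms k0 by (intro exI[of _ k0] exI[of _ l]) simp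
      moreover have "merge k0 i \<in> SEO.nonid n"
        unfolding SEO_nonid_iff using m assms k0 by (intro exI[of _ "Suc k0"] exI[of _ k0]) simp
      moreover have "dom g = ran (merge k0 i)"
        using onto_maps_dom_ran[OF m] onto_maps_dom_ran[OF g(1)] by simp
      ultimately have "f \<in> SEO.reducible n"
        using g(2) unfolding SEO.reducible_def SEO_simps by blast
      then show False using f(2) by simp
    qed
    then have "g = Some |` {1..l}" using onto_maps_id g(1) by simp
    then have "f = merge l i"
      using g(2) restrict_Some_map_comp[of "merge l i" "{1..l}"] onto_maps_dom_ran[OF m] \<open>k0 = l\<close> by simp
    then show "f \<in> (if k = Suc l then merge l ` {1..l} else {})"
      using i k0 \<open>k0 = l\<close> by auto
  next
    fix f assume *: "f \<in> (if k = Suc l then merge l ` {1..l} else {})"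
    then have k: "k = Suc l" by (auto split: if_splits)
    obtain i where i: "1 \<le> i" "i \<le> l" "f = merge l i" using * by (auto split: if_splits)
    then have f: "f \<in> onto_maps (Suc l) l" using merge_onto_maps by simp
    have "f \<in> SEO.nonid n" using f k assms(1) unfolding SEO_nonid_iff by blast
    moreover have "f \<notin> SEO.reducible n"
      using red[of _ _ "Suc l" l] f by (auto simp: SEO.reducible_def SEO_simps)
    ultimately show "f \<in> SEO.irreducible n {1..k} {1..l}"
      using onto_maps_dom_ran[OF f] k by (simp add: SEO.irreducible_def SEO_simps)
  qed
qed

lemma inj_on_merge: "inj_on (merge l) {1..l}"
proof -
  \<comment> \<open>The point \<open>Suc i\<close> separates the two: the merge at \<open>i\<close>
    sends it to \<open>i\<close>, the merge at a larger index fixes it.\<close>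
  have "\<not> i < j" if "i \<in> {1..l}" "j \<in> {1..l}" "merge l i = merge l j" for i j
    using fun_cong[OF that(3), of "Suc i"] that(1,2) by (auto simp: merge_def)
  then show ?thesis by (intro inj_onI) (metis linorder_neqE_nat)
qed

lemma SEO_quiver_simps [simp]:
  "verts (SEO_quiver n) = {0..n}"
  "arcs (SEO_quiver n) = {(k, i). 1 \<le> k \<and> k \<le> n - 1 \<and> 1 \<le> i \<and> i \<le> k}"
  "tail (SEO_quiver n) = (\<lambda>(k, i). Suc k)" "head (SEO_quiver n) = (\<lambda>(k, i). k)"
  by (auto simp: SEO_quiver_def)

definition SEO_eval_arrow :: "nat \<times> nat \<Rightarrow> nat \<rightharpoonup> nat" where
  "SEO_eval_arrow = (\<lambda>(k, i). merge k i)"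

lemma wf_SEO_quiver: "wf_digraph (SEO_quiver n)"
  by unfold_locales auto

text \<open>Opaque name for \<open>[k]\<close>, so that the simplifier does not rewrite the object map.\<close>

definition initial_segment :: "nat \<Rightarrow> nat set" where
  "initial_segment k = {1..k}"

lemma bij_SEO_verts: "bij_betw initial_segment (verts (SEO_quiver n)) (Obj (SEO n))"
  using interval_eq_iff by (auto simp: bij_betw_def inj_on_def SEO_simps initial_segment_def)

interpretation SEO: quiver_functor "SEO n" card "SEO_quiver n" initial_segment SEO_eval_arrow for n
proof
  fix x assume "x \<in> arcs (SEO_quiver n)"
  then obtain k i where x: "x = (k, i)" "1 \<le> i" "i \<le> k" "Suc k \<le> n" by auto
  have m: "merge k i \<in> onto_maps (Suc k) k" using x by (intro merge_onto_maps)
  show "SEO_eval_arrow x \<in> Arr (SEO n)"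
    unfolding Arr_SEO_iff using m x(1,4)
    by (intro exI[of _ "Suc k"] exI[of _ k]) (simp add: SEO_eval_arrow_def)
  show "Dom (SEO n) (SEO_eval_arrow x) = initial_segment (tail (SEO_quiver n) x)"
    "Cod (SEO n) (SEO_eval_arrow x) = initial_segment (head (SEO_quiver n) x)"
    using m onto_maps_dom_ran[OF m] x(1,4)
    by (auto simp: SEO_eval_arrow_def SEO_simps initial_segment_def)
next
  show "bij_betw initial_segment (verts (SEO_quiver n)) (Obj (SEO n))" by (rule bij_SEO_verts)
qed auto

text \<open>Permits a change of the arrow classes on the arcs alone, since \<open>merge_map\<close>
  is identified with \<open>merge\<close> for the indices of arrows.\<close>

lemma quiver_of_cong:
  assumes eq: "\<And>x. x \<in> arcs Q \<Longrightarrow> \<beta> x = \<beta>' x" and Q: "quiver_of A Q \<epsilon> \<beta>"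
  shows "quiver_of A Q \<epsilon> \<beta>'"
proof -
  have "inj_on \<beta>' {x \<in> arcs Q. P x} = inj_on \<beta> {x \<in> arcs Q. P x}"
    "\<beta>' ` {x \<in> arcs Q. P x} = \<beta> ` {x \<in> arcs Q. P x}" for P
    using eq by (auto intro!: inj_on_cong image_cong)
  then show ?thesis using Q unfolding quiver_of_def by simp
qed

lemma quiver_of_SEO:
  "quiver_of (category_algebra (SEO n) :: ('k::field, (nat \<rightharpoonup> nat) \<Rightarrow> 'k) module)
    (SEO_quiver n) (SEO_vertex n) (SEO_arrow n)"
proof -
  let ?A = "category_algebra (SEO n) :: ('k, (nat \<rightharpoonup> nat) \<Rightarrow> 'k) module"
  let ?Q = "SEO_quiver n"
  have "bij_betw SEO_eval_arrow {x \<in> arcs ?Q. tail ?Q x = u \<and> head ?Q x = v}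
      (SEO.irreducible n (initial_segment u) (initial_segment v))"
    if "u \<in> verts ?Q" "v \<in> verts ?Q" for u v
  proof -
    have "u \<le> n" "v \<le> n" using that by auto
    note irr = SEO_irreducible[OF this, folded initial_segment_def]
    show ?thesis
    proof (cases "u = Suc v")
      case True
      have "{x \<in> arcs ?Q. tail ?Q x = u \<and> head ?Q x = v} = Pair v ` {1..v}"
        using True \<open>u \<le> n\<close> by auto
      moreover have "bij_betw SEO_eval_arrow (Pair v ` {1..v}) (merge v ` {1..v})"
        unfolding bij_betw_def
      proof
        show "inj_on SEO_eval_arrow (Pair v ` {1..v})"
          using inj_on_merge[of v] by (intro inj_on_imageI) (simp add: comp_def SEO_eval_arrow_def)
      qed (simp add: SEO_eval_arrow_def image_image)
      ultimately show ?thesis using irr True by (simp add: initial_segment_def)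
    next
      case False
      have empty: "{x \<in> arcs ?Q. tail ?Q x = u \<and> head ?Q x = v} = {}" using False by auto
      show ?thesis unfolding empty irr using False by (simp add: bij_betw_def)
    qed
  qed
  then have quiver: "quiver_of ?A ?Q (\<lambda>u. basis_vec (Id (SEO n) (initial_segment u)))
      (\<lambda>x. Rad2 ?A +>\<^bsub>?A\<^esub> basis_vec (SEO_eval_arrow x))"
    unfolding SEO.category_algebra_eq by (rule SEO.quiver_of_algebra[OF wf_SEO_quiver bij_SEO_verts])
  have arrow: "SEO_arrow n x = Rad2 ?A +>\<^bsub>?A\<^esub> basis_vec (SEO_eval_arrow x)" if "x \<in> arcs ?Q" for x
    using that by (auto simp: SEO_arrow_def SEO_eval_arrow_def merge_map_eq Let_def)
  have vert: "SEO_vertex n = (\<lambda>u. basis_vec (Id (SEO n) (initial_segment u)) :: (nat \<rightharpoonup> nat) \<Rightarrow> 'k)"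
    by (simp add: SEO_vertex_def fun_eq_iff initial_segment_def)
  show ?thesis
    unfolding vert by (rule quiver_of_cong[OF _ quiver]) (simp only: arrow)
qed

subsection \<open>Normal forms of paths\<close>

text \<open>A path is in normal form if the indices of its arrows weakly increase along the path; the
  relations, read from left to right, rewrite every descent and lower the sum of the indices.\<close>

abbreviation SEO_awalk :: "nat \<Rightarrow> nat \<Rightarrow> (nat \<times> nat) list \<Rightarrow> nat \<Rightarrow> bool" where
  "SEO_awalk n \<equiv> pre_digraph.awalk (SEO_quiver n)"

lemma SEO_awalk_Nil: "SEO_awalk n u [] v \<longleftrightarrow> u = v \<and> u \<le> n"
  by (auto simp: SEO.Q.awalk_Nil_iff)

lemma SEO_awalk_Cons:
  "SEO_awalk n u (x # p) v \<longleftrightarrow>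
    (\<exists>k i. x = (k, i) \<and> u = Suc k \<and> Suc k \<le> n \<and> 1 \<le> i \<and> i \<le> k \<and> SEO_awalk n k p v)"
  by (cases x) (auto simp: SEO.Q.awalk_Cons_iff)

lemma walk_arr_SEO: "SEO_awalk n u p v \<Longrightarrow> SEO.walk_arr n u p \<in> onto_maps u v"
  using SEO.walk_arr_typed[of n u p v] by (auto simp: SEO_simps Arr_SEO_iff onto_maps_def initial_segment_def)

lemma walk_arr_SEO_Cons:
  "SEO.walk_arr n u ((k, i) # p) = SEO.walk_arr n k p \<circ>\<^sub>m merge k i"
  unfolding SEO.walk_arr.simps SEO_simps by (simp add: SEO_eval_arrow_def)

lemma walk_arr_SEO_Nil [simp]: "SEO.walk_arr n u [] = Some |` {1..u}"
  unfolding SEO.walk_arr.simps SEO_simps initial_segment_def ..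

declare SEO.walk_arr.simps(1) [simp del]

lemma SEO_awalk_length: "SEO_awalk n u p v \<Longrightarrow> u = v + length p"
  by (induction p arbitrary: u) (auto simp: SEO_awalk_Nil SEO_awalk_Cons)

text \<open>\<open>merge k i\<close> fixes every point up to \<open>i\<close>, and \<open>y\<close>
  exceeds no index on the path.\<close>

lemma walk_arr_SEO_fixes:
  assumes "SEO_awalk n u p v" "\<And>x. x \<in> set p \<Longrightarrow> y \<le> snd x" "1 \<le> y" "y \<le> u"
  shows "SEO.walk_arr n u p y = Some y"
  using assms
proof (induction p arbitrary: u)
  case Nil
  then show ?case by (simp add: walk_arr_SEO_Nil restrict_map_def)
next
  case (Cons x p)
  then obtain k i where x: "x = (k, i)" "u = Suc k" "i \<le> k" "SEO_awalk n k p v"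
    by (auto simp: SEO_awalk_Cons)
  have "y \<le> i" using Cons.prems(2)[of x] x(1) by simp
  then have "merge k i y = Some y" "y \<le> k" using Cons.prems(3) x(3) by (auto simp: merge_def)
  moreover have "SEO.walk_arr n k p y = Some y"
    using Cons.IH[OF x(4)] Cons.prems(2,3) \<open>y \<le> k\<close> by simp
  ultimately show ?case unfolding x(1) walk_arr_SEO_Cons by (simp add: map_comp_def)
qed

text \<open>The first arrow of a path in normal form is the least \<open>i\<close> with \<open>f(i) = f(i + 1)\<close>.\<close>

lemma sorted_path_first:
  assumes "SEO_awalk n u ((k, i) # p) v" "sorted (map snd ((k, i) # p))"
  shows "\<And>y. \<lbrakk>1 \<le> y; y \<le> i\<rbrakk> \<Longrightarrow> SEO.walk_arr n u ((k, i) # p) y = Some y"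
    and "SEO.walk_arr n u ((k, i) # p) (Suc i) = Some i"
proof -
  have *: "u = Suc k" "1 \<le> i" "i \<le> k" "SEO_awalk n k p v" using assms(1) by (auto simp: SEO_awalk_Cons)
  have ge: "i \<le> snd x" if "x \<in> set p" for x using assms(2) that by auto
  show "SEO.walk_arr n u ((k, i) # p) y = Some y" if "1 \<le> y" "y \<le> i" for y
    using that * ge by (intro walk_arr_SEO_fixes[OF assms(1)]) force+
  have "SEO.walk_arr n k p i = Some i" using * ge by (intro walk_arr_SEO_fixes[OF *(4)]) auto
  moreover have "merge k i (Suc i) = Some i" using *(3) by (simp add: merge_def)
  ultimately show "SEO.walk_arr n u ((k, i) # p) (Suc i) = Some i"
    unfolding walk_arr_SEO_Cons by (simp add: map_comp_def)
qed

text \<open>The composite determines the first index of a sorted path; the first merge is then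
  cancelled and induction applies.\<close>

lemma sorted_path_unique:
  assumes "SEO_awalk n u p v" "SEO_awalk n u q v" "sorted (map snd p)" "sorted (map snd q)"
    and "SEO.walk_arr n u p = SEO.walk_arr n u q"
  shows "p = q"
  using assms
proof (induction p arbitrary: u q)
  case Nil
  then show ?case using SEO_awalk_length[of n u q v] by (auto simp: SEO_awalk_Nil)
next
  case (Cons x p)
  obtain k i where x: "x = (k, i)" "u = Suc k" "1 \<le> i" "i \<le> k" "SEO_awalk n k p v"
    using Cons.prems(1) by (auto simp: SEO_awalk_Cons)
  \<comment> \<open>Each arrow lowers the vertex by one, so the endpoints determine the
    length.\<close>
  have "q \<noteq> []"
    using SEO_awalk_length[OF Cons.prems(1)] SEO_awalk_length[OF Cons.prems(2)] by auto
  then obtain y q' where "q = y # q'" by (cases q) auto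
  then obtain j where q: "q = (k, j) # q'" "1 \<le> j" "j \<le> k" "SEO_awalk n k q' v"
    using Cons.prems(2) x(2) by (auto simp: SEO_awalk_Cons)
  note p1 = sorted_path_first[OF Cons.prems(1)[unfolded x(1)] Cons.prems(3)[unfolded x(1)]]
  note q1 = sorted_path_first[OF Cons.prems(2)[unfolded q(1)] Cons.prems(4)[unfolded q(1)]]
  have eq: "SEO.walk_arr n u ((k, i) # p) = SEO.walk_arr n u ((k, j) # q')"
    using Cons.prems(5) x(1) q(1) by simp
  \<comment> \<open>For \<open>i < j\<close> the point \<open>Suc i\<close> goes to \<open>i\<close>
    along the first path and is fixed along the second.\<close>
  have "\<not> i < j" using p1(2) q1(1)[of "Suc i"] unfolding eq by auto
  moreover have "\<not> j < i" using q1(2) p1(1)[of "Suc j"] unfolding eq by auto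
  ultimately have ij: "j = i" by simp
  have "SEO.walk_arr n k p = SEO.walk_arr n k q'"
    using eq map_comp_merge_cancel[OF x(3,4) walk_arr_SEO[OF x(5)] walk_arr_SEO[OF q(4)]]
    unfolding ij walk_arr_SEO_Cons by blast
  then have "p = q'"
    using Cons.IH[OF x(5) q(4)] Cons.prems(3,4) q(1) by simp
  then show ?case using x(1) q(1) ij by simp
qed

lemma basis_vec_path_in:
  "SEO_awalk n u p v \<Longrightarrow> basis_vec (u, p, v) \<in> carrier (free_space (paths (SEO_quiver n) u v))"
  by (auto simp: basis_vec_def paths_def)

lemma SEO_relations_kernel:
  "(SEO_relations n u v :: (nat \<times> (nat \<times> nat) list \<times> nat \<Rightarrow> 'k::field) rel) \<subseteq> SEO.kernel_rel n u v"
proof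
  fix z :: "(nat \<times> (nat \<times> nat) list \<times> nat \<Rightarrow> 'k) \<times> (nat \<times> (nat \<times> nat) list \<times> nat \<Rightarrow> 'k)"
  assume "z \<in> SEO_relations n u v"
  then obtain k i j where z: "z = (basis_vec (u, [(k, j), (k - 1, i)], v), basis_vec (u, [(k, i), (k - 1, j - 1)], v))"
    and *: "2 \<le> k" "k \<le> n - 1" "1 \<le> i" "i < j" "j \<le> k" "u = k + 1" "v = k - 1"
    unfolding SEO_relations_def by blast
  have walks: "SEO_awalk n u [(k, j), (k - 1, i)] v" "SEO_awalk n u [(k, i), (k - 1, j - 1)] v"
    using * by (auto simp: SEO_awalk_Cons SEO_awalk_Nil)
  have m: "merge (k - 1) i \<in> onto_maps k (k - 1)" "merge (k - 1) (j - 1) \<in> onto_maps k (k - 1)"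
    using merge_onto_maps[of i "k - 1"] merge_onto_maps[of "j - 1" "k - 1"] * by auto
  have "SEO.eval n (u, [(k, j), (k - 1, i)], v) = SEO.eval n (u, [(k, i), (k - 1, j - 1)], v)"
    unfolding SEO.eval_def prod.case walk_arr_SEO_Cons
    using onto_maps_dom_ran[OF m(1)] onto_maps_dom_ran[OF m(2)] merge_relation[OF *(3-5)]
    by (simp add: walk_arr_SEO_Nil restrict_Some_map_comp)
  then show "z \<in> SEO.kernel_rel n u v"
    unfolding z SEO.kernel_rel_def using basis_vec_path_in[OF walks(1), where ?'a = 'k]
      basis_vec_path_in[OF walks(2), where ?'a = 'k] by (simp add: push_basis_vec)
qed

lemma not_sorted_descent:
  assumes "\<not> sorted (xs :: nat list)"
  shows "\<exists>ys a b zs. xs = ys @ a # b # zs \<and> b < a"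
proof -
  obtain i where i: "Suc i < length xs" "\<not> xs ! i \<le> xs ! Suc i"
    using assms by (auto simp: sorted_iff_nth_Suc)
  have "xs = take i xs @ xs ! i # xs ! Suc i # drop (Suc (Suc i)) xs"
    using i(1) by (simp add: Cons_nth_drop_Suc)
  then show ?thesis using i(2) by (metis not_le)
qed

text \<open>The quantifier over \<open>S\<close> stands inside, so that one \<open>q\<close> serves
  all congruences at once: the kernel, to compare values, and an arbitrary congruence containing the
  relations.\<close>

lemma path_normal_form:
  assumes "SEO_awalk n u p v"
  shows "\<exists>q. SEO_awalk n u q v \<and> sorted (map snd q) \<and>
    (\<forall>S :: nat \<Rightarrow> nat \<Rightarrow> (nat \<times> (nat \<times> nat) list \<times> nat \<Rightarrow> 'k::field) rel.
      lin_congruence (path_lincat (SEO_quiver n)) S \<longrightarrow>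
      (\<forall>a\<in>verts (SEO_quiver n). \<forall>b\<in>verts (SEO_quiver n). SEO_relations n a b \<subseteq> S a b) \<longrightarrow>
      (basis_vec (u, p, v), basis_vec (u, q, v)) \<in> S u v)"
  using assms
proof (induction "sum_list (map snd p)" arbitrary: p rule: less_induct)
  case less
  let ?Q = "SEO_quiver n"
  have uv: "u \<in> verts ?Q" "v \<in> verts ?Q"
    using SEO.Q.awalk_hd_in_verts[OF less.prems] SEO.Q.awalk_last_in_verts[OF less.prems] less.prems
    by (auto simp: SEO.Q.awalk_def)
  show ?case
  proof (cases "sorted (map snd p)")
    case True
    have "(basis_vec (u, p, v), basis_vec (u, p, v)) \<in> S u v"
      if "lin_congruence (path_lincat ?Q) S" for S :: "nat \<Rightarrow> nat \<Rightarrow> (nat \<times> (nat \<times> nat) list \<times> nat \<Rightarrow> 'k) rel"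
    proof -
      have "equiv (carrier (free_space (paths ?Q u v))) (S u v)"
        using that uv unfolding lin_congruence_def path_lincat_simps by blast
      then show ?thesis using basis_vec_path_in[OF less.prems] by (meson equivE refl_onD)
    qed
    then show ?thesis using True less.prems by blast
  next
    case False
    then obtain p1 x y p2 where p: "p = p1 @ x # y # p2" and desc: "snd y < snd x"
      using not_sorted_descent[of "map snd p"] by (force simp: map_eq_append_conv map_eq_Cons_conv)
    obtain w where w: "SEO_awalk n u p1 w" "SEO_awalk n w (x # y # p2) v"
      using less.prems unfolding p by (auto simp: SEO.Q.awalk_append_iff)
    obtain k j where x: "x = (k, j)" "w = Suc k" "Suc k \<le> n" "1 \<le> j" "j \<le> k" "SEO_awalk n k (y # p2) v"
      using w(2) by (auto simp: SEO_awalk_Cons)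
    obtain i where y: "y = (k - 1, i)" "1 \<le> i" "i \<le> k - 1" "SEO_awalk n (k - 1) p2 v"
      using x(6) by (auto simp: SEO_awalk_Cons)
    have ij: "i < j" using desc x(1) y(1) by simp
    let ?d = "[(k, j), (k - 1, i)]" and ?d' = "[(k, i), (k - 1, j - 1)]"
    let ?p' = "p1 @ ?d' @ p2"
    \<comment> \<open>Since \<open>i < j \<le> k\<close>, the new index \<open>j - 1\<close> lies
      between 1 and \<open>k - 1\<close>, so the rewritten pair is again a walk.\<close>
    have d: "SEO_awalk n w ?d (k - 1)" and d': "SEO_awalk n w ?d' (k - 1)"
      using x y ij by (auto simp: SEO_awalk_Cons SEO_awalk_Nil)
    have p': "SEO_awalk n u ?p' v"
      by (intro SEO.Q.awalk_appendI[OF w(1)] SEO.Q.awalk_appendI[OF d'] y(4))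
    have "sum_list (map snd ?p') < sum_list (map snd p)"
      unfolding p x(1) y(1) using ij by simp
    from less.hyps[OF this p'] obtain q where q: "SEO_awalk n u q v" "sorted (map snd q)"
      "\<And>S :: nat \<Rightarrow> nat \<Rightarrow> (nat \<times> (nat \<times> nat) list \<times> nat \<Rightarrow> 'k) rel.
        \<lbrakk>lin_congruence (path_lincat ?Q) S;
         \<forall>a\<in>verts ?Q. \<forall>b\<in>verts ?Q. SEO_relations n a b \<subseteq> S a b\<rbrakk> \<Longrightarrow>
        (basis_vec (u, ?p', v), basis_vec (u, q, v)) \<in> S u v"
      by blast
    have "(basis_vec (u, p, v), basis_vec (u, q, v)) \<in> S u v"
      if S: "lin_congruence (path_lincat ?Q) S" and R: "\<forall>a\<in>verts ?Q. \<forall>b\<in>verts ?Q. SEO_relations n a b \<subseteq> S a b"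
      for S :: "nat \<Rightarrow> nat \<Rightarrow> (nat \<times> (nat \<times> nat) list \<times> nat \<Rightarrow> 'k) rel"
    proof -
      have verts: "w \<in> verts ?Q" "k - 1 \<in> verts ?Q" using x(2,3) by auto
      have eq: "equiv (carrier (free_space (paths ?Q a b))) (S a b)"
        if "a \<in> verts ?Q" "b \<in> verts ?Q" for a b
        using that S unfolding lin_congruence_def path_lincat_simps by blast
      have comp: "(path_comp g f, path_comp g' f') \<in> S a c"
        if "a \<in> verts ?Q" "b \<in> verts ?Q" "c \<in> verts ?Q" "(f, f') \<in> S a b" "(g, g') \<in> S b c" for a b c f f' g g'
        using that S unfolding lin_congruence_def path_lincat_simps by blast
      have "2 \<le> k" "k \<le> n - 1" using x y ij by auto
      then have "(basis_vec (w, ?d, k - 1), basis_vec (w, ?d', k - 1)) \<in> SEO_relations n w (k - 1)"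
        using x y ij unfolding SEO_relations_def by auto
      then have 1: "(basis_vec (w, ?d, k - 1), basis_vec (w, ?d', k - 1)) \<in> S w (k - 1)"
        using R verts by blast
      have r1: "(basis_vec (u, p1, w), basis_vec (u, p1, w)) \<in> S u w"
        using eq[OF uv(1) verts(1)] basis_vec_path_in[OF w(1)] by (meson equivE refl_onD)
      have r2: "(basis_vec (k - 1, p2, v), basis_vec (k - 1, p2, v)) \<in> S (k - 1) v"
        using eq[OF verts(2) uv(2)] basis_vec_path_in[OF y(4)] by (meson equivE refl_onD)
      \<comment> \<open>The relation is applied in the middle of the path: it is composed with the
        reflexive pairs of the initial and the final stretch.\<close>
      have "(path_comp (basis_vec (k - 1, p2, v)) (path_comp (basis_vec (w, ?d, k - 1)) (basis_vec (u, p1, w))),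
          path_comp (basis_vec (k - 1, p2, v)) (path_comp (basis_vec (w, ?d', k - 1)) (basis_vec (u, p1, w)))) \<in> S u v"
        using comp[OF uv(1) verts(2) uv(2) comp[OF uv(1) verts r1 1] r2] .
      then have "(basis_vec (u, p, v), basis_vec (u, ?p', v)) \<in> S u v"
        by (simp add: conv_basis_vec p x(1) y(1))
      then show ?thesis using q(3)[OF S R] eq[OF uv] by (meson equivE transD)
    qed
    then show ?thesis using q(1,2) by blast
  qed
qed

text \<open>As long as \<open>v < u\<close> some value repeats; splitting off the merge there lowers
  \<open>u - v\<close> by one.\<close>

lemma SEO_walk_surj:
  assumes "f \<in> onto_maps u v" "u \<le> n"
  shows "\<exists>p. SEO_awalk n u p v \<and> SEO.walk_arr n u p = f"
  using assms
proof (induction "u - v" arbitrary: u f)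
  case 0
  then have "u = v" using onto_maps_rank_le[of f u v] by simp
  then have "f = Some |` {1..u}" using onto_maps_id 0 by simp
  then show ?case using \<open>u = v\<close> 0 by (intro exI[of _ "[]"]) (simp add: SEO_awalk_Nil walk_arr_SEO_Nil)
next
  case (Suc d)
  then have "v < u" by simp
  then obtain k where k: "u = Suc k" by (cases u) auto
  obtain i where i: "1 \<le> i" "i < u" "f i = f (Suc i)"
    using onto_maps_collapse[OF Suc.prems(1) \<open>v < u\<close>] by blast
  obtain g where g: "g \<in> onto_maps k v" "f = g \<circ>\<^sub>m merge k i"
    using onto_maps_factor[of f k v i] Suc.prems i k by auto
  have d: "d = k - v" using Suc.hyps(2) k by simp
  obtain p where p: "SEO_awalk n k p v" "SEO.walk_arr n k p = g"
    using Suc.hyps(1)[OF d g(1)] Suc.prems(2) k by auto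
  then have "SEO_awalk n u ((k, i) # p) v" using k i Suc.prems(2) by (simp add: SEO_awalk_Cons)
  moreover have "SEO.walk_arr n u ((k, i) # p) = f"
    unfolding walk_arr_SEO_Cons g(2) p(2) ..
  ultimately show ?case by blast
qed

lemma basis_vec_inject: "(basis_vec x :: 'm \<Rightarrow> 'k::field) = basis_vec y \<Longrightarrow> x = y"
  by (drule fun_cong[of _ _ x]) (simp add: basis_vec_def split: if_splits)

theorem basic_quiver_presentation_SEO:
  "basic_quiver_presentation (category_algebra (SEO n) :: ('k::field, (nat \<rightharpoonup> nat) \<Rightarrow> 'k) module)
     (SEO_quiver n) (SEO_relations n)"
proof -
  let ?A = "category_algebra (SEO n) :: ('k, (nat \<rightharpoonup> nat) \<Rightarrow> 'k) module"
  let ?Q = "SEO_quiver n"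
  have "lincat_isomorphic (quot_lincat (path_lincat ?Q) (gen_congruence (path_lincat ?Q) (SEO_relations n)))
    (idempotent_lincat ?A ((\<lambda>u. basis_vec (Id (SEO n) (initial_segment u))) ` verts ?Q))"
    unfolding SEO.category_algebra_eq
  proof (rule SEO.lincat_isomorphic_presentation)
    fix u v m assume "u \<in> verts ?Q" "v \<in> verts ?Q" "m \<in> SEO.homset n u v"
    then have "u \<le> n" "m \<in> onto_maps u v"
      by (auto simp: SEO.homset_def Arr_SEO_iff SEO_simps onto_maps_def initial_segment_def)
    from SEO_walk_surj[OF this(2,1)] show "\<exists>x\<in>paths ?Q u v. SEO.eval n x = m"
      by (auto simp: paths_def SEO.eval_def)
  next
    show "SEO_relations n u v \<subseteq> (SEO.kernel_rel n u v :: (_ \<Rightarrow> 'k) rel)" for u v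
      by (rule SEO_relations_kernel)
  next
    fix S :: "nat \<Rightarrow> nat \<Rightarrow> (nat \<times> (nat \<times> nat) list \<times> nat \<Rightarrow> 'k) rel" and u v x y
    assume S: "lin_congruence (path_lincat ?Q) S"
      and R: "\<forall>u\<in>verts ?Q. \<forall>v\<in>verts ?Q. SEO_relations n u v \<subseteq> S u v"
      and uv: "u \<in> verts ?Q" "v \<in> verts ?Q"
      and xy: "x \<in> paths ?Q u v" "y \<in> paths ?Q u v" "SEO.eval n x = SEO.eval n y"
    have nf: "\<exists>q. SEO_awalk n u q v \<and> sorted (map snd q) \<and> SEO.walk_arr n u q = SEO.eval n x \<and>
        (basis_vec x, basis_vec (u, q, v)) \<in> S u v" if "x \<in> paths ?Q u v" for x
    proof -
      obtain p where p: "x = (u, p, v)" "SEO_awalk n u p v" using \<open>x \<in> paths ?Q u v\<close> by (auto simp: paths_def)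
      obtain q where q: "SEO_awalk n u q v" "sorted (map snd q)"
        and cong: "\<And>S :: nat \<Rightarrow> nat \<Rightarrow> (nat \<times> (nat \<times> nat) list \<times> nat \<Rightarrow> 'k) rel.
        \<lbrakk>lin_congruence (path_lincat ?Q) S;
         \<forall>a\<in>verts ?Q. \<forall>b\<in>verts ?Q. SEO_relations n a b \<subseteq> S a b\<rbrakk> \<Longrightarrow>
        (basis_vec (u, p, v), basis_vec (u, q, v)) \<in> S u v"
        using path_normal_form[OF p(2), where ?'k = 'k] by blast
      \<comment> \<open>Used with the kernel as congruence, the normal form statement says that
        \<open>q\<close> has the same value as \<open>x\<close>.\<close>
      have "(basis_vec (u, p, v), basis_vec (u, q, v)) \<in> (SEO.kernel_rel n u v :: (_ \<Rightarrow> 'k) rel)"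
        using SEO_relations_kernel by (intro cong SEO.lin_congruence_kernel) blast
      then have "(basis_vec (SEO.eval n x) :: _ \<Rightarrow> 'k) = basis_vec (SEO.eval n (u, q, v))"
        by (simp add: SEO.kernel_rel_def push_basis_vec p(1))
      then have "SEO.walk_arr n u q = SEO.eval n x"
        using basis_vec_inject by (fastforce simp: SEO.eval_def)
      then show ?thesis using q cong[OF S R] p(1) by blast
    qed
    obtain q where q: "SEO_awalk n u q v" "sorted (map snd q)" "SEO.walk_arr n u q = SEO.eval n x"
      "(basis_vec x, basis_vec (u, q, v)) \<in> S u v" using nf[OF xy(1)] by blast
    obtain r where r: "SEO_awalk n u r v" "sorted (map snd r)" "SEO.walk_arr n u r = SEO.eval n y"
      "(basis_vec y, basis_vec (u, r, v)) \<in> S u v" using nf[OF xy(2)] by blast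
    \<comment> \<open>Equal values force equal normal forms, and \<open>x\<close> and
      \<open>y\<close> are congruent through the common one.\<close>
    have "q = r" using sorted_path_unique[OF q(1) r(1) q(2) r(2)] q(3) r(3) xy(3) by simp
    moreover have "equiv (carrier (free_space (paths ?Q u v))) (S u v)"
      using uv S unfolding lin_congruence_def path_lincat_simps by blast
    ultimately show "(basis_vec x, basis_vec y) \<in> S u v"
      using q(4) r(4) by (meson equivE symD transD)
  qed
  moreover have "SEO_relations n u v \<subseteq> carrier (LHom (path_lincat ?Q) u v) \<times>
      (carrier (LHom (path_lincat ?Q) u v) :: (_ \<Rightarrow> 'k) set)" for u v
    using SEO_relations_kernel[of n u v, where ?'k = 'k] unfolding path_lincat_simps SEO.kernel_rel_def by blast
  moreover have "SEO_vertex n = (\<lambda>u. basis_vec (Id (SEO n) (initial_segment u)) :: (nat \<rightharpoonup> nat) \<Rightarrow> 'k)"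
    by (simp add: SEO_vertex_def fun_eq_iff initial_segment_def)
  ultimately show ?thesis
    unfolding basic_quiver_presentation_def Let_def
    using SEO.split_basic_algebra[of n, where ?'k = 'k] quiver_of_SEO[of n, where ?'k = 'k]
    by (metis SEO.category_algebra_eq)
qed

section \<open>Morita theory for module categories over a fixed universe\<close>

section \<open>Equivalences of linear categories\<close>

locale linear_category =
  fixes C :: "('o, 'h, 'k::field) lincat"
  assumes LId_in: "a \<in> LObj C \<Longrightarrow> LId C a \<in> carrier (LHom C a a)"
    and LComp_in: "\<lbrakk>a \<in> LObj C; b \<in> LObj C; c \<in> LObj C; f \<in> carrier (LHom C a b); g \<in> carrier (LHom C b c)\<rbrakk> \<Longrightarrow>
      LComp C a b c g f \<in> carrier (LHom C a c)"
    and LComp_assoc: "\<lbrakk>a \<in> LObj C; b \<in> LObj C; c \<in> LObj C; d \<in> LObj C;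
      f \<in> carrier (LHom C a b); g \<in> carrier (LHom C b c); h \<in> carrier (LHom C c d)\<rbrakk> \<Longrightarrow>
      LComp C a b d (LComp C b c d h g) f = LComp C a c d h (LComp C a b c g f)"
    and LId_left: "\<lbrakk>a \<in> LObj C; b \<in> LObj C; f \<in> carrier (LHom C a b)\<rbrakk> \<Longrightarrow> LComp C a b b (LId C b) f = f"
    and LId_right: "\<lbrakk>a \<in> LObj C; b \<in> LObj C; f \<in> carrier (LHom C a b)\<rbrakk> \<Longrightarrow> LComp C a a b f (LId C a) = f"
    and add_in: "\<lbrakk>a \<in> LObj C; b \<in> LObj C; f \<in> carrier (LHom C a b); g \<in> carrier (LHom C a b)\<rbrakk> \<Longrightarrow>
      f \<oplus>\<^bsub>LHom C a b\<^esub> g \<in> carrier (LHom C a b)"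
    and smult_in: "\<lbrakk>a \<in> LObj C; b \<in> LObj C; f \<in> carrier (LHom C a b)\<rbrakk> \<Longrightarrow>
      r \<odot>\<^bsub>LHom C a b\<^esub> f \<in> carrier (LHom C a b)"
    and LComp_add_left: "\<lbrakk>a \<in> LObj C; b \<in> LObj C; c \<in> LObj C; f \<in> carrier (LHom C a b);
      g \<in> carrier (LHom C b c); g' \<in> carrier (LHom C b c)\<rbrakk> \<Longrightarrow>
      LComp C a b c (g \<oplus>\<^bsub>LHom C b c\<^esub> g') f = LComp C a b c g f \<oplus>\<^bsub>LHom C a c\<^esub> LComp C a b c g' f"
    and LComp_add_right: "\<lbrakk>a \<in> LObj C; b \<in> LObj C; c \<in> LObj C; f \<in> carrier (LHom C a b);
      f' \<in> carrier (LHom C a b); g \<in> carrier (LHom C b c)\<rbrakk> \<Longrightarrow>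
      LComp C a b c g (f \<oplus>\<^bsub>LHom C a b\<^esub> f') = LComp C a b c g f \<oplus>\<^bsub>LHom C a c\<^esub> LComp C a b c g f'"
    and LComp_smult_left: "\<lbrakk>a \<in> LObj C; b \<in> LObj C; c \<in> LObj C; f \<in> carrier (LHom C a b);
      g \<in> carrier (LHom C b c)\<rbrakk> \<Longrightarrow>
      LComp C a b c (r \<odot>\<^bsub>LHom C b c\<^esub> g) f = r \<odot>\<^bsub>LHom C a c\<^esub> LComp C a b c g f"
    and LComp_smult_right: "\<lbrakk>a \<in> LObj C; b \<in> LObj C; c \<in> LObj C; f \<in> carrier (LHom C a b);
      g \<in> carrier (LHom C b c)\<rbrakk> \<Longrightarrow>
      LComp C a b c g (r \<odot>\<^bsub>LHom C a b\<^esub> f) = r \<odot>\<^bsub>LHom C a c\<^esub> LComp C a b c g f"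

locale fully_faithful_functor = C: linear_category C + D: linear_category D
  for C :: "('o, 'h, 'k::field) lincat" and D :: "('p, 'i, 'k) lincat" +
  fixes Fo :: "'o \<Rightarrow> 'p" and Fa :: "'o \<Rightarrow> 'o \<Rightarrow> 'h \<Rightarrow> 'i"
  assumes is_functor: "lin_functor C D Fo Fa"
    and fully_faithful: "\<lbrakk>a \<in> LObj C; b \<in> LObj C\<rbrakk> \<Longrightarrow>
      bij_betw (Fa a b) (carrier (LHom C a b)) (carrier (LHom D (Fo a) (Fo b)))"
begin

lemma Fo_in: "a \<in> LObj C \<Longrightarrow> Fo a \<in> LObj D"
  using is_functor by (simp add: lin_functor_def)

lemma Fa_id: "a \<in> LObj C \<Longrightarrow> Fa a a (LId C a) = LId D (Fo a)"
  using is_functor by (simp add: lin_functor_def)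

lemma Fa_hom: "\<lbrakk>a \<in> LObj C; b \<in> LObj C\<rbrakk> \<Longrightarrow>
    Fa a b \<in> LinearCombinations.module_hom class_ring (LHom C a b) (LHom D (Fo a) (Fo b))"
  using is_functor by (simp add: lin_functor_def)

lemma Fa_in: "\<lbrakk>a \<in> LObj C; b \<in> LObj C; f \<in> carrier (LHom C a b)\<rbrakk> \<Longrightarrow>
    Fa a b f \<in> carrier (LHom D (Fo a) (Fo b))"
  using Fa_hom unfolding LinearCombinations.module_hom_def by blast

lemma Fa_add: "\<lbrakk>a \<in> LObj C; b \<in> LObj C; f \<in> carrier (LHom C a b); g \<in> carrier (LHom C a b)\<rbrakk> \<Longrightarrow>
    Fa a b (f \<oplus>\<^bsub>LHom C a b\<^esub> g) = Fa a b f \<oplus>\<^bsub>LHom D (Fo a) (Fo b)\<^esub> Fa a b g"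
  using Fa_hom unfolding LinearCombinations.module_hom_def by blast

lemma Fa_smult: "\<lbrakk>a \<in> LObj C; b \<in> LObj C; f \<in> carrier (LHom C a b)\<rbrakk> \<Longrightarrow>
    Fa a b (r \<odot>\<^bsub>LHom C a b\<^esub> f) = r \<odot>\<^bsub>LHom D (Fo a) (Fo b)\<^esub> Fa a b f"
  using Fa_hom unfolding LinearCombinations.module_hom_def by simp

lemma Fa_comp: "\<lbrakk>a \<in> LObj C; b \<in> LObj C; c \<in> LObj C; f \<in> carrier (LHom C a b); g \<in> carrier (LHom C b c)\<rbrakk> \<Longrightarrow>
    Fa a c (LComp C a b c g f) = LComp D (Fo a) (Fo b) (Fo c) (Fa b c g) (Fa a b f)"
  using is_functor by (simp add: lin_functor_def)

lemma Fa_eqD: "\<lbrakk>a \<in> LObj C; b \<in> LObj C; f \<in> carrier (LHom C a b); g \<in> carrier (LHom C a b);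
    Fa a b f = Fa a b g\<rbrakk> \<Longrightarrow> f = g"
  using bij_betw_imp_inj_on[OF fully_faithful] by (meson inj_onD)

definition lift :: "'o \<Rightarrow> 'o \<Rightarrow> 'i \<Rightarrow> 'h" where
  "lift a b = the_inv_into (carrier (LHom C a b)) (Fa a b)"

lemma lift_in: "\<lbrakk>a \<in> LObj C; b \<in> LObj C; f \<in> carrier (LHom D (Fo a) (Fo b))\<rbrakk> \<Longrightarrow>
    lift a b f \<in> carrier (LHom C a b)"
  using bij_betwE[OF bij_betw_the_inv_into[OF fully_faithful]] unfolding lift_def by blast

lemma Fa_lift: "\<lbrakk>a \<in> LObj C; b \<in> LObj C; f \<in> carrier (LHom D (Fo a) (Fo b))\<rbrakk> \<Longrightarrow>
    Fa a b (lift a b f) = f"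
  unfolding lift_def by (rule f_the_inv_into_f_bij_betw[OF fully_faithful])

text \<open>For each \<open>d\<close> an object \<open>Go d\<close> and an isomorphism from its
  image onto \<open>d\<close> are chosen; morphisms are conjugated by these and lifted through the
  bijections \<open>Fa\<close>. The functor laws for \<open>Go\<close> and \<open>Ga\<close> are
  verified after applying \<open>Fa\<close>, which is injective on hom-spaces.\<close>

theorem lincat_equivalentI:
  assumes ess_surj: "\<And>d. d \<in> LObj D \<Longrightarrow> \<exists>c\<in>LObj C. \<exists>f. isomorphism_in D (Fo c) d f"
  shows "lincat_equivalent C D"
proof -
  have "\<forall>d\<in>LObj D. \<exists>c t t'. c \<in> LObj C \<and> t \<in> carrier (LHom D (Fo c) d) \<and> t' \<in> carrier (LHom D d (Fo c)) \<and>
      LComp D (Fo c) d (Fo c) t' t = LId D (Fo c) \<and> LComp D d (Fo c) d t t' = LId D d"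
    using ess_surj unfolding isomorphism_in_def by blast
  then obtain Go \<theta> \<theta>' where G: "\<And>d. d \<in> LObj D \<Longrightarrow> Go d \<in> LObj C"
    and \<theta>: "\<And>d. d \<in> LObj D \<Longrightarrow> \<theta> d \<in> carrier (LHom D (Fo (Go d)) d)"
    and \<theta>': "\<And>d. d \<in> LObj D \<Longrightarrow> \<theta>' d \<in> carrier (LHom D d (Fo (Go d)))"
    and \<theta>'\<theta>: "\<And>d. d \<in> LObj D \<Longrightarrow> LComp D (Fo (Go d)) d (Fo (Go d)) (\<theta>' d) (\<theta> d) = LId D (Fo (Go d))"
    and \<theta>\<theta>': "\<And>d. d \<in> LObj D \<Longrightarrow> LComp D d (Fo (Go d)) d (\<theta> d) (\<theta>' d) = LId D d"
    by metis
  define conj where "conj d d' f = LComp D (Fo (Go d)) d' (Fo (Go d')) (\<theta>' d') (LComp D (Fo (Go d)) d d' f (\<theta> d))" for d d' f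
  define Ga where "Ga d d' f = lift (Go d) (Go d') (conj d d' f)" for d d' f
  have conj_in: "conj d d' f \<in> carrier (LHom D (Fo (Go d)) (Fo (Go d')))"
    if "d \<in> LObj D" "d' \<in> LObj D" "f \<in> carrier (LHom D d d')" for d d' f
    unfolding conj_def using that G \<theta> \<theta>' Fo_in by (intro D.LComp_in) auto
  have Ga_in: "Ga d d' f \<in> carrier (LHom C (Go d) (Go d'))"
    if "d \<in> LObj D" "d' \<in> LObj D" "f \<in> carrier (LHom D d d')" for d d' f
    unfolding Ga_def using that conj_in G by (intro lift_in) auto
  have Fa_Ga: "Fa (Go d) (Go d') (Ga d d' f) = conj d d' f"
    if "d \<in> LObj D" "d' \<in> LObj D" "f \<in> carrier (LHom D d d')" for d d' f
    unfolding Ga_def using that conj_in G by (intro Fa_lift) auto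
  \<comment> \<open>Naturality of \<theta>; it also yields compatibility of \<open>Ga\<close> with
    composition.\<close>
  have \<theta>_conj: "LComp D (Fo (Go d)) (Fo (Go d')) d' (\<theta> d') (conj d d' f) = LComp D (Fo (Go d)) d d' f (\<theta> d)"
    if "d \<in> LObj D" "d' \<in> LObj D" "f \<in> carrier (LHom D d d')" for d d' f
  proof -
    have in1: "LComp D (Fo (Go d)) d d' f (\<theta> d) \<in> carrier (LHom D (Fo (Go d)) d')"
      using that G \<theta> Fo_in by (intro D.LComp_in) auto
    have "LComp D (Fo (Go d)) (Fo (Go d')) d' (\<theta> d') (conj d d' f) =
        LComp D (Fo (Go d)) d' d' (LComp D d' (Fo (Go d')) d' (\<theta> d') (\<theta>' d')) (LComp D (Fo (Go d)) d d' f (\<theta> d))"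
      unfolding conj_def using that G \<theta> \<theta>' Fo_in in1 by (intro D.LComp_assoc[symmetric]) auto
    also have "\<dots> = LComp D (Fo (Go d)) d d' f (\<theta> d)"
      unfolding \<theta>\<theta>'[OF that(2)] using that G Fo_in in1 by (intro D.LId_left) auto
    finally show ?thesis .
  qed
  have "lin_functor D C Go Ga"
    unfolding lin_functor_def
  proof (intro conjI ballI)
    fix d assume d: "d \<in> LObj D"
    show "Go d \<in> LObj C" using d by (rule G)
    have "conj d d (LId D d) = LId D (Fo (Go d))"
      unfolding conj_def using d G \<theta> Fo_in by (simp add: D.LId_left \<theta>'\<theta>)
    then have "Fa (Go d) (Go d) (Ga d d (LId D d)) = Fa (Go d) (Go d) (LId C (Go d))"
      using Fa_Ga[OF d d D.LId_in[OF d]] Fa_id[OF G[OF d]] by simp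
    then show "Ga d d (LId D d) = LId C (Go d)"
      by (intro Fa_eqD[OF G[OF d] G[OF d]] Ga_in C.LId_in D.LId_in d G)
  next
    fix d d' assume d: "d \<in> LObj D" "d' \<in> LObj D"
    note gd = G[OF d(1)] G[OF d(2)]
    note fd = Fo_in[OF gd(1)] Fo_in[OF gd(2)]
    show "Ga d d' \<in> LinearCombinations.module_hom class_ring (LHom D d d') (LHom C (Go d) (Go d'))"
      unfolding LinearCombinations.module_hom_def
    proof (intro CollectI conjI allI impI)
      show "Ga d d' \<in> carrier (LHom D d d') \<rightarrow> carrier (LHom C (Go d) (Go d'))"
        using Ga_in[OF d] by blast
      fix f g assume "f \<in> carrier (LHom D d d') \<and> g \<in> carrier (LHom D d d')"
      then have f: "f \<in> carrier (LHom D d d')" and g: "g \<in> carrier (LHom D d d')" by auto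
      have "conj d d' (f \<oplus>\<^bsub>LHom D d d'\<^esub> g) = conj d d' f \<oplus>\<^bsub>LHom D (Fo (Go d)) (Fo (Go d'))\<^esub> conj d d' g"
        unfolding conj_def using d fd f g \<theta> \<theta>' D.LComp_in
        by (simp add: D.LComp_add_left D.LComp_add_right)
      then have "Fa (Go d) (Go d') (Ga d d' (f \<oplus>\<^bsub>LHom D d d'\<^esub> g)) =
          Fa (Go d) (Go d') (Ga d d' f \<oplus>\<^bsub>LHom C (Go d) (Go d')\<^esub> Ga d d' g)"
        using Fa_Ga[OF d] Fa_add[OF gd Ga_in[OF d f] Ga_in[OF d g]] D.add_in[OF d f g] f g by simp
      then show "Ga d d' (f \<oplus>\<^bsub>LHom D d d'\<^esub> g) = Ga d d' f \<oplus>\<^bsub>LHom C (Go d) (Go d')\<^esub> Ga d d' g"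
        by (intro Fa_eqD[OF gd] Ga_in C.add_in D.add_in d gd f g)
    next
      fix r :: 'k and f assume "r \<in> carrier class_ring \<and> f \<in> carrier (LHom D d d')"
      then have f: "f \<in> carrier (LHom D d d')" by auto
      have "conj d d' (r \<odot>\<^bsub>LHom D d d'\<^esub> f) = r \<odot>\<^bsub>LHom D (Fo (Go d)) (Fo (Go d'))\<^esub> conj d d' f"
        unfolding conj_def using d fd f \<theta> \<theta>' D.LComp_in
        by (simp add: D.LComp_smult_left D.LComp_smult_right)
      then have "Fa (Go d) (Go d') (Ga d d' (r \<odot>\<^bsub>LHom D d d'\<^esub> f)) =
          Fa (Go d) (Go d') (r \<odot>\<^bsub>LHom C (Go d) (Go d')\<^esub> Ga d d' f)"
        using Fa_Ga[OF d] Fa_smult[OF gd Ga_in[OF d f]] D.smult_in[OF d f] f by simp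
      then show "Ga d d' (r \<odot>\<^bsub>LHom D d d'\<^esub> f) = r \<odot>\<^bsub>LHom C (Go d) (Go d')\<^esub> Ga d d' f"
        by (intro Fa_eqD[OF gd] Ga_in C.smult_in D.smult_in d gd f)
    qed
  next
    fix a b c f g
    assume abc: "a \<in> LObj D" "b \<in> LObj D" "c \<in> LObj D"
      and f: "f \<in> carrier (LHom D a b)" and g: "g \<in> carrier (LHom D b c)"
    note gs = G[OF abc(1)] G[OF abc(2)] G[OF abc(3)]
    note fs = Fo_in[OF gs(1)] Fo_in[OF gs(2)] Fo_in[OF gs(3)]
    have fa: "LComp D (Fo (Go a)) a b f (\<theta> a) \<in> carrier (LHom D (Fo (Go a)) b)"
      and gb: "LComp D (Fo (Go b)) b c g (\<theta> b) \<in> carrier (LHom D (Fo (Go b)) c)"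
      using abc fs f g \<theta> by (auto intro!: D.LComp_in)
    have "LComp D (Fo (Go a)) (Fo (Go b)) (Fo (Go c)) (conj b c g) (conj a b f) =
        LComp D (Fo (Go a)) c (Fo (Go c)) (\<theta>' c) (LComp D (Fo (Go a)) (Fo (Go b)) c (LComp D (Fo (Go b)) b c g (\<theta> b)) (conj a b f))"
      unfolding conj_def[of b c] using abc fs gb \<theta>' conj_in[OF abc(1,2) f] by (intro D.LComp_assoc)
    also have "LComp D (Fo (Go a)) (Fo (Go b)) c (LComp D (Fo (Go b)) b c g (\<theta> b)) (conj a b f) =
        LComp D (Fo (Go a)) b c g (LComp D (Fo (Go a)) (Fo (Go b)) b (\<theta> b) (conj a b f))"
      using abc fs g \<theta> conj_in[OF abc(1,2) f] by (intro D.LComp_assoc)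
    also have "LComp D (Fo (Go a)) (Fo (Go b)) b (\<theta> b) (conj a b f) = LComp D (Fo (Go a)) a b f (\<theta> a)"
      using abc f by (intro \<theta>_conj)
    also have "LComp D (Fo (Go a)) b c g (LComp D (Fo (Go a)) a b f (\<theta> a)) = LComp D (Fo (Go a)) a c (LComp D a b c g f) (\<theta> a)"
      using abc fs f g \<theta> by (intro D.LComp_assoc[symmetric])
    finally have "LComp D (Fo (Go a)) (Fo (Go b)) (Fo (Go c)) (conj b c g) (conj a b f) = conj a c (LComp D a b c g f)"
      unfolding conj_def[of a c] .
    then have "Fa (Go a) (Go c) (LComp C (Go a) (Go b) (Go c) (Ga b c g) (Ga a b f)) =
        Fa (Go a) (Go c) (Ga a c (LComp D a b c g f))"
      using abc gs f g by (simp add: Fa_comp Ga_in Fa_Ga D.LComp_in)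
    then show "Ga a c (LComp D a b c g f) = LComp C (Go a) (Go b) (Go c) (Ga b c g) (Ga a b f)"
      by (intro Fa_eqD[OF gs(1,3), symmetric] C.LComp_in Ga_in D.LComp_in abc gs f g)
  qed
  moreover have "naturally_isomorphic D D (\<lambda>a. Fo (Go a)) (\<lambda>a b f. Fa (Go a) (Go b) (Ga a b f)) (\<lambda>a. a) (\<lambda>a b f. f)"
    unfolding naturally_isomorphic_def
  proof (intro exI[of _ \<theta>] conjI ballI)
    fix a assume "a \<in> LObj D"
    then show "isomorphism_in D (Fo (Go a)) a (\<theta> a)"
      unfolding isomorphism_in_def using \<theta> \<theta>' \<theta>'\<theta> \<theta>\<theta>' by blast
  next
    fix a b f assume "a \<in> LObj D" "b \<in> LObj D" "f \<in> carrier (LHom D a b)"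
    then show "LComp D (Fo (Go a)) (Fo (Go b)) b (\<theta> b) (Fa (Go a) (Go b) (Ga a b f)) =
        LComp D (Fo (Go a)) a b f (\<theta> a)"
      by (simp add: Fa_Ga \<theta>_conj)
  qed
  moreover have "naturally_isomorphic C C (\<lambda>a. Go (Fo a)) (\<lambda>a b f. Ga (Fo a) (Fo b) (Fa a b f)) (\<lambda>a. a) (\<lambda>a b f. f)"
    unfolding naturally_isomorphic_def
  proof (intro exI conjI ballI)
    \<comment> \<open>At \<open>a\<close> the natural isomorphism is the lift of \<theta> at
      \<open>Fo a\<close>, so its inverse laws are inherited from \<theta>.\<close>
    let ?\<eta> = "\<lambda>a. lift (Go (Fo a)) a (\<theta> (Fo a))" and ?\<eta>' = "\<lambda>a. lift a (Go (Fo a)) (\<theta>' (Fo a))"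
    have \<eta>: "?\<eta> a \<in> carrier (LHom C (Go (Fo a)) a)" "Fa (Go (Fo a)) a (?\<eta> a) = \<theta> (Fo a)"
      and \<eta>': "?\<eta>' a \<in> carrier (LHom C a (Go (Fo a)))" "Fa a (Go (Fo a)) (?\<eta>' a) = \<theta>' (Fo a)"
      if "a \<in> LObj C" for a
      using that G Fo_in \<theta> \<theta>' by (auto intro!: lift_in Fa_lift)
    {
      fix a assume a: "a \<in> LObj C"
      note ga = G[OF Fo_in[OF a]]
      have "LComp C (Go (Fo a)) a (Go (Fo a)) (?\<eta>' a) (?\<eta> a) = LId C (Go (Fo a))"
        using a ga \<eta>[OF a] \<eta>'[OF a] \<theta>'\<theta>[OF Fo_in[OF a]]
        by (intro Fa_eqD[OF ga ga] C.LComp_in C.LId_in) (simp_all add: Fa_comp Fa_id)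
      moreover have "LComp C a (Go (Fo a)) a (?\<eta> a) (?\<eta>' a) = LId C a"
        using a ga \<eta>[OF a] \<eta>'[OF a] \<theta>\<theta>'[OF Fo_in[OF a]]
        by (intro Fa_eqD[OF a a] C.LComp_in C.LId_in) (simp_all add: Fa_comp Fa_id)
      ultimately show "isomorphism_in C (Go (Fo a)) a (?\<eta> a)"
        unfolding isomorphism_in_def using \<eta>[OF a] \<eta>'[OF a] by blast
    }
    fix a b f assume ab: "a \<in> LObj C" "b \<in> LObj C" and f: "f \<in> carrier (LHom C a b)"
    note g = G[OF Fo_in[OF ab(1)]] G[OF Fo_in[OF ab(2)]]
    have ff: "Fa a b f \<in> carrier (LHom D (Fo a) (Fo b))" using ab f by (rule Fa_in)
    show "LComp C (Go (Fo a)) (Go (Fo b)) b (?\<eta> b) (Ga (Fo a) (Fo b) (Fa a b f)) =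
        LComp C (Go (Fo a)) a b f (?\<eta> a)"
    proof (rule Fa_eqD[OF g(1) ab(2)])
      show "LComp C (Go (Fo a)) (Go (Fo b)) b (?\<eta> b) (Ga (Fo a) (Fo b) (Fa a b f)) \<in> carrier (LHom C (Go (Fo a)) b)"
        "LComp C (Go (Fo a)) a b f (?\<eta> a) \<in> carrier (LHom C (Go (Fo a)) b)"
        using ab g \<eta> f ff Ga_in Fo_in by (auto intro!: C.LComp_in)
      show "Fa (Go (Fo a)) b (LComp C (Go (Fo a)) (Go (Fo b)) b (?\<eta> b) (Ga (Fo a) (Fo b) (Fa a b f))) =
          Fa (Go (Fo a)) b (LComp C (Go (Fo a)) a b f (?\<eta> a))"
        using ab g \<eta> f ff Fo_in by (simp add: Fa_comp Ga_in Fa_Ga \<theta>_conj)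
    qed
  qed
  ultimately show ?thesis
    unfolding lincat_equivalent_def using is_functor by blast
qed

end

section \<open>Module categories\<close>

text \<open>Only additivity is assumed, so that scalar actions, maps multiplying a ring element into
  a fixed module element, and the zeta transform are all covered.\<close>

lemma additive_finsum:
  assumes "abelian_group M" "abelian_group N"
    and f: "f \<in> carrier M \<rightarrow> carrier N"
    and add: "\<And>x y. \<lbrakk>x \<in> carrier M; y \<in> carrier M\<rbrakk> \<Longrightarrow> f (x \<oplus>\<^bsub>M\<^esub> y) = f x \<oplus>\<^bsub>N\<^esub> f y"
    and "finite I" "\<And>i. i \<in> I \<Longrightarrow> g i \<in> carrier M"
  shows "f (\<Oplus>\<^bsub>M\<^esub>i\<in>I. g i) = (\<Oplus>\<^bsub>N\<^esub>i\<in>I. f (g i))"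
proof -
  interpret M: abelian_group M by fact
  interpret N: abelian_group N by fact
  have z: "f \<zero>\<^bsub>M\<^esub> \<in> carrier N" using f M.zero_closed by blast
  have "f \<zero>\<^bsub>M\<^esub> \<oplus>\<^bsub>N\<^esub> f \<zero>\<^bsub>M\<^esub> = f \<zero>\<^bsub>M\<^esub>"
    using add[OF M.zero_closed M.zero_closed] M.l_zero[OF M.zero_closed] by simp
  then have "(f \<zero>\<^bsub>M\<^esub> \<oplus>\<^bsub>N\<^esub> f \<zero>\<^bsub>M\<^esub>) \<oplus>\<^bsub>N\<^esub> (\<ominus>\<^bsub>N\<^esub> f \<zero>\<^bsub>M\<^esub>) = f \<zero>\<^bsub>M\<^esub> \<oplus>\<^bsub>N\<^esub> (\<ominus>\<^bsub>N\<^esub> f \<zero>\<^bsub>M\<^esub>)"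
    by simp
  then have zero: "f \<zero>\<^bsub>M\<^esub> = \<zero>\<^bsub>N\<^esub>"
    using z by (simp add: N.a_assoc N.r_neg)
  show ?thesis using assms(5,6)
  proof (induction I rule: finite_induct)
    case (insert x F)
    then have "(\<Oplus>\<^bsub>M\<^esub>i\<in>F. g i) \<in> carrier M" by (intro M.finsum_closed) auto
    then show ?case using insert f add by (simp add: Pi_iff)
  qed (simp add: zero)
qed

context left_module
begin

lemma finsum_smult:
  assumes "a \<in> carrier R" "finite I" "\<And>i. i \<in> I \<Longrightarrow> g i \<in> carrier M"
  shows "a \<odot>\<^bsub>M\<^esub> (\<Oplus>\<^bsub>M\<^esub>i\<in>I. g i) = (\<Oplus>\<^bsub>M\<^esub>i\<in>I. a \<odot>\<^bsub>M\<^esub> g i)"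
  using assms smult_closed smult_r_distr M.abelian_group_axioms
  by (intro additive_finsum[where f = "\<lambda>x. a \<odot>\<^bsub>M\<^esub> x"]) auto

end

lemma module_homD:
  assumes "f \<in> LinearCombinations.module_hom A M N"
  shows "x \<in> carrier M \<Longrightarrow> f x \<in> carrier N"
    and "\<lbrakk>x \<in> carrier M; y \<in> carrier M\<rbrakk> \<Longrightarrow> f (x \<oplus>\<^bsub>M\<^esub> y) = f x \<oplus>\<^bsub>N\<^esub> f y"
    and "\<lbrakk>a \<in> carrier A; x \<in> carrier M\<rbrakk> \<Longrightarrow> f (a \<odot>\<^bsub>M\<^esub> x) = a \<odot>\<^bsub>N\<^esub> f x"
  using assms unfolding LinearCombinations.module_hom_def by blast+

lemma module_homI:
  assumes "\<And>x. x \<in> carrier M \<Longrightarrow> f x \<in> carrier N"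
    and "\<And>x y. \<lbrakk>x \<in> carrier M; y \<in> carrier M\<rbrakk> \<Longrightarrow> f (x \<oplus>\<^bsub>M\<^esub> y) = f x \<oplus>\<^bsub>N\<^esub> f y"
    and "\<And>a x. \<lbrakk>a \<in> carrier A; x \<in> carrier M\<rbrakk> \<Longrightarrow> f (a \<odot>\<^bsub>M\<^esub> x) = a \<odot>\<^bsub>N\<^esub> f x"
  shows "f \<in> LinearCombinations.module_hom A M N"
  using assms unfolding LinearCombinations.module_hom_def by blast

lemma fin_dim_algebra_scalar:
  assumes "fin_dim_algebra A"
  shows "c \<odot>\<^bsub>A\<^esub> \<one>\<^bsub>A\<^esub> \<in> carrier A"
    and "x \<in> carrier A \<Longrightarrow> (c \<odot>\<^bsub>A\<^esub> \<one>\<^bsub>A\<^esub>) \<otimes>\<^bsub>A\<^esub> x = c \<odot>\<^bsub>A\<^esub> x"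
    and "x \<in> carrier A \<Longrightarrow> x \<otimes>\<^bsub>A\<^esub> (c \<odot>\<^bsub>A\<^esub> \<one>\<^bsub>A\<^esub>) = c \<odot>\<^bsub>A\<^esub> x"
proof -
  interpret A: ring A using assms by (simp add: fin_dim_algebra_def)
  interpret V: vectorspace class_ring A using assms by (simp add: fin_dim_algebra_def)
  show "c \<odot>\<^bsub>A\<^esub> \<one>\<^bsub>A\<^esub> \<in> carrier A" using V.smult_closed[of c "\<one>\<^bsub>A\<^esub>"] by simp
  show "(c \<odot>\<^bsub>A\<^esub> \<one>\<^bsub>A\<^esub>) \<otimes>\<^bsub>A\<^esub> x = c \<odot>\<^bsub>A\<^esub> x" "x \<otimes>\<^bsub>A\<^esub> (c \<odot>\<^bsub>A\<^esub> \<one>\<^bsub>A\<^esub>) = c \<odot>\<^bsub>A\<^esub> x" if "x \<in> carrier A"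
    using assms that A.one_closed A.l_one A.r_one unfolding fin_dim_algebra_def by metis+
qed

lemma left_modules_simps:
  "LObj (left_modules A) = {M. left_module A M}"
  "carrier (LHom (left_modules A) M N) = LinearCombinations.module_hom A M N \<inter> extensional (carrier M)"
  "f \<oplus>\<^bsub>LHom (left_modules A) M N\<^esub> g = (\<lambda>x\<in>carrier M. f x \<oplus>\<^bsub>N\<^esub> g x)"
  "c \<odot>\<^bsub>LHom (left_modules A) M N\<^esub> f = (\<lambda>x\<in>carrier M. (c \<odot>\<^bsub>A\<^esub> \<one>\<^bsub>A\<^esub>) \<odot>\<^bsub>N\<^esub> f x)"
  "LId (left_modules A) M = (\<lambda>x\<in>carrier M. x)"
  "LComp (left_modules A) M N P g f = compose (carrier M) g f"
  by (simp_all add: left_modules_def)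

lemma linear_category_left_modules:
  fixes A :: "('k::field, 'a) module"
  assumes A: "fin_dim_algebra A"
  shows "linear_category (left_modules A :: (('a, 'm) module, 'm \<Rightarrow> 'm, 'k) lincat)"
proof
  fix M N P T :: "('a, 'm) module" and f g f' g' h and r :: 'k
  note sc = fin_dim_algebra_scalar[OF A]
  assume M: "M \<in> LObj (left_modules A)"
  then interpret M: left_module A M by (simp add: left_modules_simps)
  show "LId (left_modules A) M \<in> carrier (LHom (left_modules A) M M)"
    using M.smult_closed by (auto simp: left_modules_simps intro!: module_homI)
  assume N: "N \<in> LObj (left_modules A)"
  then interpret N: left_module A N by (simp add: left_modules_simps)
  assume f: "f \<in> carrier (LHom (left_modules A) M N)"
  then have fh: "f \<in> LinearCombinations.module_hom A M N" "f \<in> extensional (carrier M)"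
    by (auto simp: left_modules_simps)
  note fD = module_homD[OF fh(1)]
  show "LComp (left_modules A) M N N (LId (left_modules A) N) f = f"
    "LComp (left_modules A) M M N f (LId (left_modules A) M) = f"
    using fh fD by (auto simp: left_modules_simps compose_def extensional_def fun_eq_iff)
  \<comment> \<open>Scalar multiples of the unit are central, which makes a scalar multiple of an
    \<open>A\<close>-linear map again \<open>A\<close>-linear.\<close>
  have comm: "(r \<odot>\<^bsub>A\<^esub> \<one>\<^bsub>A\<^esub>) \<odot>\<^bsub>N\<^esub> (a \<odot>\<^bsub>N\<^esub> x) = a \<odot>\<^bsub>N\<^esub> ((r \<odot>\<^bsub>A\<^esub> \<one>\<^bsub>A\<^esub>) \<odot>\<^bsub>N\<^esub> x)"
    if "a \<in> carrier A" "x \<in> carrier N" for a x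
    using N.smult_assoc[OF sc(1) that] N.smult_assoc[OF that(1) sc(1) that(2)] sc that by metis
  show "r \<odot>\<^bsub>LHom (left_modules A) M N\<^esub> f \<in> carrier (LHom (left_modules A) M N)"
    using fD sc N.smult_closed N.smult_r_distr comm M.smult_closed
    by (auto simp: left_modules_simps intro!: module_homI)
  {
    fix g assume "g \<in> carrier (LHom (left_modules A) M N)"
    then have "g \<in> LinearCombinations.module_hom A M N" by (simp add: left_modules_simps)
    note gD = module_homD[OF this]
    have "f (x \<oplus>\<^bsub>M\<^esub> y) \<oplus>\<^bsub>N\<^esub> g (x \<oplus>\<^bsub>M\<^esub> y) = (f x \<oplus>\<^bsub>N\<^esub> g x) \<oplus>\<^bsub>N\<^esub> (f y \<oplus>\<^bsub>N\<^esub> g y)"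
      if "x \<in> carrier M" "y \<in> carrier M" for x y
      using fD gD that by (simp add: N.a_ac)
    then show "f \<oplus>\<^bsub>LHom (left_modules A) M N\<^esub> g \<in> carrier (LHom (left_modules A) M N)"
      using fD gD N.smult_r_distr M.smult_closed
      by (auto simp: left_modules_simps intro!: module_homI)
  }
  assume P: "P \<in> LObj (left_modules A)"
  then interpret P: left_module A P by (simp add: left_modules_simps)
  assume g: "g \<in> carrier (LHom (left_modules A) N P)"
  then have gh: "g \<in> LinearCombinations.module_hom A N P" "g \<in> extensional (carrier N)"
    by (auto simp: left_modules_simps)
  note gD = module_homD[OF gh(1)]
  show "LComp (left_modules A) M N P g f \<in> carrier (LHom (left_modules A) M P)"
    using fD gD M.smult_closed by (auto simp: left_modules_simps compose_def intro!: module_homI)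
  show "LComp (left_modules A) M N P (r \<odot>\<^bsub>LHom (left_modules A) N P\<^esub> g) f =
      r \<odot>\<^bsub>LHom (left_modules A) M P\<^esub> LComp (left_modules A) M N P g f"
    using fD gD by (auto simp: left_modules_simps compose_def fun_eq_iff)
  show "LComp (left_modules A) M N P g (r \<odot>\<^bsub>LHom (left_modules A) M N\<^esub> f) =
      r \<odot>\<^bsub>LHom (left_modules A) M P\<^esub> LComp (left_modules A) M N P g f"
    using fD gD sc by (auto simp: left_modules_simps compose_def fun_eq_iff)
  {
    fix g' assume "g' \<in> carrier (LHom (left_modules A) N P)"
    show "LComp (left_modules A) M N P (g \<oplus>\<^bsub>LHom (left_modules A) N P\<^esub> g') f =
        LComp (left_modules A) M N P g f \<oplus>\<^bsub>LHom (left_modules A) M P\<^esub> LComp (left_modules A) M N P g' f"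
      using fD by (auto simp: left_modules_simps compose_def fun_eq_iff)
  }
  {
    fix f' assume "f' \<in> carrier (LHom (left_modules A) M N)"
    then have "f' \<in> LinearCombinations.module_hom A M N" by (simp add: left_modules_simps)
    note f'D = module_homD[OF this]
    show "LComp (left_modules A) M N P g (f \<oplus>\<^bsub>LHom (left_modules A) M N\<^esub> f') =
        LComp (left_modules A) M N P g f \<oplus>\<^bsub>LHom (left_modules A) M P\<^esub> LComp (left_modules A) M N P g f'"
      using fD f'D gD by (auto simp: left_modules_simps compose_def fun_eq_iff)
  }
  assume "h \<in> carrier (LHom (left_modules A) P T)"
  show "LComp (left_modules A) M N T (LComp (left_modules A) N P T h g) f =
      LComp (left_modules A) M P T h (LComp (left_modules A) M N P g f)"
    using fD by (auto simp: left_modules_simps compose_def fun_eq_iff)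
qed

section \<open>Morita equivalence with a full corner\<close>

context left_module
begin

lemma smult_zero:
  assumes "a \<in> carrier R"
  shows "a \<odot>\<^bsub>M\<^esub> \<zero>\<^bsub>M\<^esub> = \<zero>\<^bsub>M\<^esub>"
proof -
  have z: "a \<odot>\<^bsub>M\<^esub> \<zero>\<^bsub>M\<^esub> \<in> carrier M" using assms smult_closed by simp
  have "a \<odot>\<^bsub>M\<^esub> \<zero>\<^bsub>M\<^esub> \<oplus>\<^bsub>M\<^esub> a \<odot>\<^bsub>M\<^esub> \<zero>\<^bsub>M\<^esub> = a \<odot>\<^bsub>M\<^esub> \<zero>\<^bsub>M\<^esub>"
    using smult_r_distr[OF assms M.zero_closed M.zero_closed] by simp
  then have "(a \<odot>\<^bsub>M\<^esub> \<zero>\<^bsub>M\<^esub> \<oplus>\<^bsub>M\<^esub> a \<odot>\<^bsub>M\<^esub> \<zero>\<^bsub>M\<^esub>) \<oplus>\<^bsub>M\<^esub> (\<ominus>\<^bsub>M\<^esub> (a \<odot>\<^bsub>M\<^esub> \<zero>\<^bsub>M\<^esub>)) =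
      a \<odot>\<^bsub>M\<^esub> \<zero>\<^bsub>M\<^esub> \<oplus>\<^bsub>M\<^esub> (\<ominus>\<^bsub>M\<^esub> (a \<odot>\<^bsub>M\<^esub> \<zero>\<^bsub>M\<^esub>))"
    by simp
  then show ?thesis using z by (simp add: M.a_assoc M.r_neg)
qed

lemma smult_minus:
  assumes a: "a \<in> carrier R" and x: "x \<in> carrier M"
  shows "a \<odot>\<^bsub>M\<^esub> (\<ominus>\<^bsub>M\<^esub> x) = \<ominus>\<^bsub>M\<^esub> (a \<odot>\<^bsub>M\<^esub> x)"
proof (rule M.minus_equality[symmetric])
  show "a \<odot>\<^bsub>M\<^esub> (\<ominus>\<^bsub>M\<^esub> x) \<oplus>\<^bsub>M\<^esub> a \<odot>\<^bsub>M\<^esub> x = \<zero>\<^bsub>M\<^esub>"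
    using smult_r_distr[OF a M.a_inv_closed[OF x] x] M.l_neg[OF x] smult_zero[OF a] by simp
qed (use smult_closed[OF a] x in auto)

end

text \<open>Structure transport along an injection \<open>J\<close>. The elements of the induced
  module are tuples, whereas the module category only contains modules on the universe type.\<close>

definition transport_module :: "('x \<Rightarrow> 'm) \<Rightarrow> ('a, 'x) module \<Rightarrow> ('a, 'm) module" where
  "transport_module J M =
     \<lparr>carrier = J ` carrier M, monoid.mult = undefined, one = undefined, zero = J \<zero>\<^bsub>M\<^esub>,
      add = (\<lambda>u v. J (the_inv_into (carrier M) J u \<oplus>\<^bsub>M\<^esub> the_inv_into (carrier M) J v)),
      smult = (\<lambda>a u. J (a \<odot>\<^bsub>M\<^esub> the_inv_into (carrier M) J u))\<rparr>"

lemma transport_module_simps: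
  assumes "inj_on J (carrier M)"
  shows "carrier (transport_module J M) = J ` carrier M" "\<zero>\<^bsub>transport_module J M\<^esub> = J \<zero>\<^bsub>M\<^esub>"
    "\<lbrakk>x \<in> carrier M; y \<in> carrier M\<rbrakk> \<Longrightarrow> J x \<oplus>\<^bsub>transport_module J M\<^esub> J y = J (x \<oplus>\<^bsub>M\<^esub> y)"
    "x \<in> carrier M \<Longrightarrow> a \<odot>\<^bsub>transport_module J M\<^esub> J x = J (a \<odot>\<^bsub>M\<^esub> x)"
  using assms by (simp_all add: transport_module_def the_inv_into_f_f)

lemma left_module_transport:
  assumes "left_module A M" and inj: "inj_on J (carrier M)"
  shows "left_module A (transport_module J M)"
proof -
  interpret M: left_module A M by fact
  note simps = transport_module_simps[OF inj]
  have "abelian_group (transport_module J M)"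
  proof (rule abelian_groupI)
    fix u assume "u \<in> carrier (transport_module J M)"
    then obtain x where x: "x \<in> carrier M" "u = J x" by (auto simp: simps)
    show "\<exists>v\<in>carrier (transport_module J M). v \<oplus>\<^bsub>transport_module J M\<^esub> u = \<zero>\<^bsub>transport_module J M\<^esub>"
      using x by (intro bexI[of _ "J (\<ominus>\<^bsub>M\<^esub> x)"]) (simp_all add: simps M.l_neg)
  qed (auto simp: simps M.a_ac)
  moreover have "left_module_axioms A (transport_module J M)"
    by unfold_locales (auto simp: simps M.smult_closed M.smult_l_distr M.smult_r_distr M.smult_assoc M.smult_one)
  ultimately show ?thesis by (intro left_module.intro M.R.ring_axioms)
qed

text \<open>By induction on \<open>I\<close>: over an infinite type a pair of elements can be
  encoded by a single one.\<close>

lemma ex_inj_on_PiE: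
  assumes "finite I" "infinite (UNIV :: 'm set)"
  shows "\<exists>J :: ('i \<Rightarrow> 'm) \<Rightarrow> 'm. inj_on J (I \<rightarrow>\<^sub>E UNIV)"
  using assms(1)
proof (induction I rule: finite_induct)
  case empty
  then show ?case by (simp add: PiE_empty_domain)
next
  case (insert i I)
  then obtain J :: "('i \<Rightarrow> 'm) \<Rightarrow> 'm" where J: "inj_on J (I \<rightarrow>\<^sub>E UNIV)" by blast
  obtain pr :: "'m \<times> 'm \<Rightarrow> 'm" where "bij_betw pr (UNIV \<times> UNIV) UNIV"
    using card_of_Times_same_infinite[OF assms(2)] unfolding card_of_ordIso[symmetric] by blast
  then have pr: "inj pr" by (simp add: bij_betw_def)
  have "inj_on (\<lambda>x. pr (x i, J (restrict x I))) (insert i I \<rightarrow>\<^sub>E UNIV)"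
  proof (rule inj_onI)
    fix x y :: "'i \<Rightarrow> 'm"
    assume x: "x \<in> insert i I \<rightarrow>\<^sub>E UNIV" and y: "y \<in> insert i I \<rightarrow>\<^sub>E UNIV"
      and eq: "pr (x i, J (restrict x I)) = pr (y i, J (restrict y I))"
    have *: "x i = y i" "J (restrict x I) = J (restrict y I)"
      using injD[OF pr eq] by auto
    have r: "restrict x I = restrict y I"
      using *(2) by (rule inj_onD[OF J]) simp_all
    show "x = y"
    proof
      fix j show "x j = y j"
        using *(1) fun_cong[OF r, of j] x y by (cases "j \<in> insert i I") (auto simp: PiE_def extensional_def)
    qed
  qed
  then show ?case by blast
qed

text \<open>\<open>\<iota>\<close> identifies \<open>B\<close> with the corner \<open>e A e\<close>,
  where \<open>e\<close> is the image of the unit of \<open>B\<close>, in general different from the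
  unit of \<open>A\<close>. The elements \<open>p i\<close> of \<open>A e\<close> and
  \<open>q i\<close> of \<open>e A\<close> witness that \<open>e\<close> generates \<open>A\<close>
  as a two-sided ideal, which is fullness.\<close>

locale full_corner =
  fixes A :: "('k::field, 'a) module" and B :: "('k, 'b) module" and \<iota> :: "'b \<Rightarrow> 'a"
    and I :: "'i set" and p q :: "'i \<Rightarrow> 'a"
  assumes A: "fin_dim_algebra A" and B: "fin_dim_algebra B"
    and \<iota>_in: "b \<in> carrier B \<Longrightarrow> \<iota> b \<in> carrier A"
    and \<iota>_add: "\<lbrakk>b \<in> carrier B; c \<in> carrier B\<rbrakk> \<Longrightarrow> \<iota> (b \<oplus>\<^bsub>B\<^esub> c) = \<iota> b \<oplus>\<^bsub>A\<^esub> \<iota> c"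
    and \<iota>_mult: "\<lbrakk>b \<in> carrier B; c \<in> carrier B\<rbrakk> \<Longrightarrow> \<iota> (b \<otimes>\<^bsub>B\<^esub> c) = \<iota> b \<otimes>\<^bsub>A\<^esub> \<iota> c"
    and \<iota>_smult: "b \<in> carrier B \<Longrightarrow> \<iota> (r \<odot>\<^bsub>B\<^esub> b) = r \<odot>\<^bsub>A\<^esub> \<iota> b"
    and \<iota>_inj: "inj_on \<iota> (carrier B)"
    and \<iota>_onto: "\<lbrakk>x \<in> carrier A; \<iota> \<one>\<^bsub>B\<^esub> \<otimes>\<^bsub>A\<^esub> x = x; x \<otimes>\<^bsub>A\<^esub> \<iota> \<one>\<^bsub>B\<^esub> = x\<rbrakk> \<Longrightarrow> x \<in> \<iota> ` carrier B"
    and finite_I: "finite I"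
    and p_in: "i \<in> I \<Longrightarrow> p i \<in> carrier A" and q_in: "i \<in> I \<Longrightarrow> q i \<in> carrier A"
    and p_e: "i \<in> I \<Longrightarrow> p i \<otimes>\<^bsub>A\<^esub> \<iota> \<one>\<^bsub>B\<^esub> = p i" and e_q: "i \<in> I \<Longrightarrow> \<iota> \<one>\<^bsub>B\<^esub> \<otimes>\<^bsub>A\<^esub> q i = q i"
    and sum_pq: "(\<Oplus>\<^bsub>A\<^esub>i\<in>I. p i \<otimes>\<^bsub>A\<^esub> q i) = \<one>\<^bsub>A\<^esub>"
begin

sublocale A: ring A using A by (simp add: fin_dim_algebra_def)

sublocale B: ring B using B by (simp add: fin_dim_algebra_def)

abbreviation e :: 'a where "e \<equiv> \<iota> \<one>\<^bsub>B\<^esub>"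

abbreviation mult_A (infixl "\<diamondop>" 70) where "x \<diamondop> y \<equiv> x \<otimes>\<^bsub>A\<^esub> y"

definition corner :: "'a set" where
  "corner = {x \<in> carrier A. e \<diamondop> x = x \<and> x \<diamondop> e = x}"

text \<open>Inverse of \<open>\<iota>\<close>, meaningful on \<open>corner\<close> only; through it
  elements of the corner act on \<open>B\<close>-modules.\<close>

definition \<beta> :: "'a \<Rightarrow> 'b" where
  "\<beta> = the_inv_into (carrier B) \<iota>"

lemma e_in: "e \<in> carrier A" by (simp add: \<iota>_in)

lemma \<iota>_corner: "b \<in> carrier B \<Longrightarrow> \<iota> b \<in> corner"
  using \<iota>_mult[of "\<one>\<^bsub>B\<^esub>" b] \<iota>_mult[of b "\<one>\<^bsub>B\<^esub>"] by (simp add: corner_def \<iota>_in)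

lemma e_idem: "e \<diamondop> e = e"
  using \<iota>_corner[OF B.one_closed] by (simp add: corner_def)

lemma corner_in: "x \<in> corner \<Longrightarrow> x \<in> carrier A" by (simp add: corner_def)

lemma cornerI:
  assumes "u \<in> carrier A" "w \<in> carrier A" "e \<diamondop> u = u" "w \<diamondop> e = w"
  shows "u \<diamondop> w \<in> corner"
  using assms A.m_assoc[OF e_in assms(1,2)] A.m_assoc[OF assms(1,2) e_in] by (simp add: corner_def)

lemma \<beta>_in: "x \<in> corner \<Longrightarrow> \<beta> x \<in> carrier B"
  unfolding \<beta>_def using \<iota>_onto by (intro the_inv_into_into[OF \<iota>_inj]) (auto simp: corner_def)

lemma \<iota>_\<beta>: "x \<in> corner \<Longrightarrow> \<iota> (\<beta> x) = x"
  unfolding \<beta>_def using \<iota>_onto by (intro f_the_inv_into_f[OF \<iota>_inj]) (auto simp: corner_def)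

lemma \<beta>_\<iota>: "b \<in> carrier B \<Longrightarrow> \<beta> (\<iota> b) = b"
  unfolding \<beta>_def by (rule the_inv_into_f_f[OF \<iota>_inj])

lemma \<beta>_add: "x \<in> corner \<Longrightarrow> y \<in> corner \<Longrightarrow> \<beta> (x \<oplus>\<^bsub>A\<^esub> y) = \<beta> x \<oplus>\<^bsub>B\<^esub> \<beta> y"
  using \<beta>_\<iota>[of "\<beta> x \<oplus>\<^bsub>B\<^esub> \<beta> y"] by (simp add: \<iota>_add \<beta>_in \<iota>_\<beta>)

lemma \<beta>_mult: "x \<in> corner \<Longrightarrow> y \<in> corner \<Longrightarrow> \<beta> (x \<diamondop> y) = \<beta> x \<otimes>\<^bsub>B\<^esub> \<beta> y"
  using \<beta>_\<iota>[of "\<beta> x \<otimes>\<^bsub>B\<^esub> \<beta> y"] by (simp add: \<iota>_mult \<beta>_in \<iota>_\<beta>)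

lemma \<beta>_e: "\<beta> e = \<one>\<^bsub>B\<^esub>"
  by (simp add: \<beta>_\<iota>)

subsection \<open>Restriction of modules to the corner\<close>

definition corner_module :: "('a, 'm) module \<Rightarrow> ('b, 'm) module" where
  "corner_module M =
     \<lparr>carrier = {x \<in> carrier M. e \<odot>\<^bsub>M\<^esub> x = x}, monoid.mult = undefined, one = undefined,
      zero = \<zero>\<^bsub>M\<^esub>, add = add M, smult = (\<lambda>b x. \<iota> b \<odot>\<^bsub>M\<^esub> x)\<rparr>"

lemma corner_module_simps [simp]:
  "carrier (corner_module M) = {x \<in> carrier M. e \<odot>\<^bsub>M\<^esub> x = x}"
  "\<zero>\<^bsub>corner_module M\<^esub> = \<zero>\<^bsub>M\<^esub>"
  "x \<oplus>\<^bsub>corner_module M\<^esub> y = x \<oplus>\<^bsub>M\<^esub> y"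
  "b \<odot>\<^bsub>corner_module M\<^esub> x = \<iota> b \<odot>\<^bsub>M\<^esub> x"
  by (simp_all add: corner_module_def)

lemma left_module_corner:
  assumes "left_module A M"
  shows "left_module B (corner_module M)"
proof -
  interpret M: left_module A M by fact
  have "abelian_group (corner_module M)"
  proof (rule abelian_groupI)
    fix x assume "x \<in> carrier (corner_module M)"
    then show "\<exists>y\<in>carrier (corner_module M). y \<oplus>\<^bsub>corner_module M\<^esub> x = \<zero>\<^bsub>corner_module M\<^esub>"
      using e_in by (intro bexI[of _ "\<ominus>\<^bsub>M\<^esub> x"]) (auto simp: M.smult_minus M.l_neg)
  qed (auto simp: M.smult_r_distr M.smult_zero e_in M.a_ac)
  moreover have "e \<odot>\<^bsub>M\<^esub> (\<iota> b \<odot>\<^bsub>M\<^esub> x) = \<iota> b \<odot>\<^bsub>M\<^esub> x" if "b \<in> carrier B" "x \<in> carrier M" for b x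
    using M.smult_assoc[OF e_in \<iota>_in[OF that(1)] that(2)] \<iota>_corner[OF that(1)] by (simp add: corner_def)
  then have "left_module_axioms B (corner_module M)"
    by unfold_locales
      (auto simp: M.smult_closed M.smult_l_distr M.smult_r_distr M.smult_assoc \<iota>_in \<iota>_add \<iota>_mult)
  ultimately show ?thesis by (intro left_module.intro B.ring_axioms)
qed

lemma q_smult_in:
  assumes "left_module A M" "i \<in> I" "x \<in> carrier M"
  shows "q i \<odot>\<^bsub>M\<^esub> x \<in> carrier (corner_module M)"
proof -
  interpret M: left_module A M by fact
  show ?thesis
    using M.smult_assoc[OF e_in q_in[OF assms(2)] assms(3)] e_q[OF assms(2)] M.smult_closed[OF q_in[OF assms(2)] assms(3)]
    by simp
qed

text \<open>The decomposition of the unit inserted between \<open>a\<close> and \<open>x\<close>.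
  The factor \<open>a\<close> is carried along because \<open>a p i\<close> may lie in the corner
  although \<open>p i\<close> in general does not.\<close>

lemma finsum_p_q:
  assumes "left_module A M" "x \<in> carrier M" "a \<in> carrier A"
  shows "(\<Oplus>\<^bsub>M\<^esub>i\<in>I. (a \<diamondop> p i) \<odot>\<^bsub>M\<^esub> (q i \<odot>\<^bsub>M\<^esub> x)) = a \<odot>\<^bsub>M\<^esub> x"
proof -
  interpret M: left_module A M by fact
  have pq: "p i \<diamondop> q i \<in> carrier A" if "i \<in> I" for i using that p_in q_in by simp
  have "a \<odot>\<^bsub>M\<^esub> x = (a \<diamondop> (\<Oplus>\<^bsub>A\<^esub>i\<in>I. p i \<diamondop> q i)) \<odot>\<^bsub>M\<^esub> x"
    using assms by (simp add: sum_pq)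
  also have "\<dots> = (\<Oplus>\<^bsub>M\<^esub>i\<in>I. (a \<diamondop> (p i \<diamondop> q i)) \<odot>\<^bsub>M\<^esub> x)"
    using assms(2,3) finite_I pq M.smult_closed M.smult_l_distr A.r_distr A.abelian_group_axioms M.M.abelian_group_axioms
    by (intro additive_finsum[where f = "\<lambda>z. (a \<diamondop> z) \<odot>\<^bsub>M\<^esub> x"]) auto
  also have "\<dots> = (\<Oplus>\<^bsub>M\<^esub>i\<in>I. (a \<diamondop> p i) \<odot>\<^bsub>M\<^esub> (q i \<odot>\<^bsub>M\<^esub> x))"
    using assms p_in q_in M.smult_closed
    by (intro M.finsum_cong') (auto simp: A.m_assoc[symmetric] M.smult_assoc)
  finally show ?thesis ..
qed

lemma finsum_p_q_one:
  assumes "left_module A M" "x \<in> carrier M"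
  shows "(\<Oplus>\<^bsub>M\<^esub>i\<in>I. p i \<odot>\<^bsub>M\<^esub> (q i \<odot>\<^bsub>M\<^esub> x)) = x"
proof -
  interpret M: left_module A M by fact
  have "(\<Oplus>\<^bsub>M\<^esub>i\<in>I. p i \<odot>\<^bsub>M\<^esub> (q i \<odot>\<^bsub>M\<^esub> x)) = (\<Oplus>\<^bsub>M\<^esub>i\<in>I. (\<one>\<^bsub>A\<^esub> \<diamondop> p i) \<odot>\<^bsub>M\<^esub> (q i \<odot>\<^bsub>M\<^esub> x))"
    using assms(2) p_in q_in M.smult_closed by (intro M.finsum_cong') auto
  also have "\<dots> = x" using finsum_p_q[OF assms A.one_closed] assms(2) M.smult_one by simp
  finally show ?thesis .
qed

lemma finsum_corner_module:
  assumes "left_module A M" "finite J" "\<And>j. j \<in> J \<Longrightarrow> g j \<in> carrier (corner_module M)"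
  shows "(\<Oplus>\<^bsub>corner_module M\<^esub>j\<in>J. g j) = (\<Oplus>\<^bsub>M\<^esub>j\<in>J. g j)"
proof -
  interpret M: left_module A M by fact
  interpret C: left_module B "corner_module M" by (rule left_module_corner[OF assms(1)])
  show ?thesis
    using assms(2,3) M.abelian_group_axioms C.abelian_group_axioms
    by (intro additive_finsum[where f = "\<lambda>x. x"]) auto
qed

text \<open>The only possible extension: an \<open>A\<close>-linear map \<open>f\<close> satisfies f
  x = sum of p i f (q i x), and each \<open>q i x\<close> lies in the corner module, where
  \<open>h\<close> is given.\<close>

definition extend_hom :: "('a, 'm) module \<Rightarrow> ('a, 'm) module \<Rightarrow> ('m \<Rightarrow> 'm) \<Rightarrow> 'm \<Rightarrow> 'm" where
  "extend_hom M N h = (\<lambda>x\<in>carrier M. \<Oplus>\<^bsub>N\<^esub>i\<in>I. p i \<odot>\<^bsub>N\<^esub> h (q i \<odot>\<^bsub>M\<^esub> x))"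

lemma extend_hom:
  assumes M: "left_module A M" and N: "left_module A N"
    and h: "h \<in> LinearCombinations.module_hom B (corner_module M) (corner_module N)"
  shows "extend_hom M N h \<in> LinearCombinations.module_hom A M N"
    and "x \<in> carrier (corner_module M) \<Longrightarrow> extend_hom M N h x = h x"
proof -
  interpret M: left_module A M by (rule M)
  interpret N: left_module A N by (rule N)
  interpret CM: left_module B "corner_module M" by (rule left_module_corner[OF M])
  interpret CN: left_module B "corner_module N" by (rule left_module_corner[OF N])
  note hD = module_homD[OF h]
  have h_in: "h y \<in> carrier N" if "y \<in> carrier (corner_module M)" for y using hD(1)[OF that] by simp
  have qx: "q i \<odot>\<^bsub>M\<^esub> x \<in> carrier (corner_module M)" if "i \<in> I" "x \<in> carrier M" for i x
    using q_smult_in[OF M that] .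
  have summand: "p i \<odot>\<^bsub>N\<^esub> h (q i \<odot>\<^bsub>M\<^esub> x) \<in> carrier N" if "i \<in> I" "x \<in> carrier M" for i x
    using N.smult_closed p_in h_in[OF qx] that by blast
  text \<open>Left multiplication by \<open>u a\<close> with \<open>u \<in> eA\<close> is \<open>B\<close>-linear up to the decomposition of the unit.\<close>
  have key: "(\<Oplus>\<^bsub>N\<^esub>i\<in>I. (u \<diamondop> p i) \<odot>\<^bsub>N\<^esub> h (q i \<odot>\<^bsub>M\<^esub> x)) = h (u \<odot>\<^bsub>M\<^esub> x)"
    if u: "u \<in> carrier A" "e \<diamondop> u = u" and x: "x \<in> carrier M" for u x
  proof -
    have c: "u \<diamondop> p i \<in> corner" if "i \<in> I" for i using that u p_in p_e by (intro cornerI) auto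
    have summand': "(u \<diamondop> p i) \<odot>\<^bsub>M\<^esub> (q i \<odot>\<^bsub>M\<^esub> x) \<in> carrier (corner_module M)" if "i \<in> I" for i
      using CM.smult_closed[OF \<beta>_in[OF c[OF that]] qx[OF that x]] \<iota>_\<beta>[OF c[OF that]] by simp
    have "h (u \<odot>\<^bsub>M\<^esub> x) = h (\<Oplus>\<^bsub>corner_module M\<^esub>i\<in>I. (u \<diamondop> p i) \<odot>\<^bsub>M\<^esub> (q i \<odot>\<^bsub>M\<^esub> x))"
      by (subst finsum_corner_module[OF M finite_I summand'], assumption)
        (simp only: finsum_p_q[OF M x u(1)])
    also have "\<dots> = (\<Oplus>\<^bsub>corner_module N\<^esub>i\<in>I. h ((u \<diamondop> p i) \<odot>\<^bsub>M\<^esub> (q i \<odot>\<^bsub>M\<^esub> x)))"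
      using finite_I summand' hD(1,2) CM.M.abelian_group_axioms CN.M.abelian_group_axioms
      by (intro additive_finsum) blast+
    also have "\<dots> = (\<Oplus>\<^bsub>N\<^esub>i\<in>I. h ((u \<diamondop> p i) \<odot>\<^bsub>M\<^esub> (q i \<odot>\<^bsub>M\<^esub> x)))"
      using hD(1)[OF summand'] by (intro finsum_corner_module[OF N finite_I])
    also have "\<dots> = (\<Oplus>\<^bsub>N\<^esub>i\<in>I. (u \<diamondop> p i) \<odot>\<^bsub>N\<^esub> h (q i \<odot>\<^bsub>M\<^esub> x))"
    proof (intro N.finsum_cong' refl)
      show "(\<lambda>i. (u \<diamondop> p i) \<odot>\<^bsub>N\<^esub> h (q i \<odot>\<^bsub>M\<^esub> x)) \<in> I \<rightarrow> carrier N"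
        using N.smult_closed corner_in[OF c] h_in[OF qx] x by blast
      fix i assume i: "i \<in> I"
      show "h ((u \<diamondop> p i) \<odot>\<^bsub>M\<^esub> (q i \<odot>\<^bsub>M\<^esub> x)) = (u \<diamondop> p i) \<odot>\<^bsub>N\<^esub> h (q i \<odot>\<^bsub>M\<^esub> x)"
        using hD(3)[OF \<beta>_in[OF c[OF i]] qx[OF i x]] \<iota>_\<beta>[OF c[OF i]] by simp
    qed
    finally show ?thesis ..
  qed
  show "extend_hom M N h \<in> LinearCombinations.module_hom A M N"
  proof (rule module_homI)
    fix x assume x: "x \<in> carrier M"
    show "extend_hom M N h x \<in> carrier N"
      using summand x by (auto simp: extend_hom_def intro!: N.finsum_closed)
    fix y assume y: "y \<in> carrier M"
    have "(\<Oplus>\<^bsub>N\<^esub>i\<in>I. p i \<odot>\<^bsub>N\<^esub> h (q i \<odot>\<^bsub>M\<^esub> (x \<oplus>\<^bsub>M\<^esub> y))) =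
        (\<Oplus>\<^bsub>N\<^esub>i\<in>I. p i \<odot>\<^bsub>N\<^esub> h (q i \<odot>\<^bsub>M\<^esub> x) \<oplus>\<^bsub>N\<^esub> p i \<odot>\<^bsub>N\<^esub> h (q i \<odot>\<^bsub>M\<^esub> y))"
    proof (intro N.finsum_cong' refl)
      show "(\<lambda>i. p i \<odot>\<^bsub>N\<^esub> h (q i \<odot>\<^bsub>M\<^esub> x) \<oplus>\<^bsub>N\<^esub> p i \<odot>\<^bsub>N\<^esub> h (q i \<odot>\<^bsub>M\<^esub> y)) \<in> I \<rightarrow> carrier N"
        using summand x y by blast
      fix i assume i: "i \<in> I"
      have "h (q i \<odot>\<^bsub>M\<^esub> (x \<oplus>\<^bsub>M\<^esub> y)) = h (q i \<odot>\<^bsub>M\<^esub> x) \<oplus>\<^bsub>N\<^esub> h (q i \<odot>\<^bsub>M\<^esub> y)"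
        using hD(2)[OF qx[OF i x] qx[OF i y]] M.smult_r_distr[OF q_in[OF i] x y] by simp
      then show "p i \<odot>\<^bsub>N\<^esub> h (q i \<odot>\<^bsub>M\<^esub> (x \<oplus>\<^bsub>M\<^esub> y)) =
          p i \<odot>\<^bsub>N\<^esub> h (q i \<odot>\<^bsub>M\<^esub> x) \<oplus>\<^bsub>N\<^esub> p i \<odot>\<^bsub>N\<^esub> h (q i \<odot>\<^bsub>M\<^esub> y)"
        using N.smult_r_distr[OF p_in[OF i] h_in[OF qx[OF i x]] h_in[OF qx[OF i y]]] by simp
    qed
    also have "\<dots> = (\<Oplus>\<^bsub>N\<^esub>i\<in>I. p i \<odot>\<^bsub>N\<^esub> h (q i \<odot>\<^bsub>M\<^esub> x)) \<oplus>\<^bsub>N\<^esub> (\<Oplus>\<^bsub>N\<^esub>i\<in>I. p i \<odot>\<^bsub>N\<^esub> h (q i \<odot>\<^bsub>M\<^esub> y))"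
      using summand x y by (intro N.finsum_addf) auto
    finally show "extend_hom M N h (x \<oplus>\<^bsub>M\<^esub> y) = extend_hom M N h x \<oplus>\<^bsub>N\<^esub> extend_hom M N h y"
      using x y by (simp add: extend_hom_def)
  next
    fix a x assume a: "a \<in> carrier A" and x: "x \<in> carrier M"
    have ax: "a \<odot>\<^bsub>M\<^esub> x \<in> carrier M" using M.smult_closed[OF a x] .
    define y where "y = extend_hom M N h x"
    have y: "y \<in> carrier N" "y = (\<Oplus>\<^bsub>N\<^esub>j\<in>I. p j \<odot>\<^bsub>N\<^esub> h (q j \<odot>\<^bsub>M\<^esub> x))"
      using summand x by (auto simp: y_def extend_hom_def intro!: N.finsum_closed)
    \<comment> \<open>It suffices to compare after applying each \<open>q i\<close>, since the
      \<open>p i\<close> reassemble the pieces. The row \<open>q i a\<close> lies in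
      \<open>e A\<close>, so \<open>key\<close> applies to it.\<close>
    have "q i \<odot>\<^bsub>N\<^esub> (a \<odot>\<^bsub>N\<^esub> y) = h (q i \<odot>\<^bsub>M\<^esub> (a \<odot>\<^bsub>M\<^esub> x))" if i: "i \<in> I" for i
    proof -
      have qa: "q i \<diamondop> a \<in> carrier A" "e \<diamondop> (q i \<diamondop> a) = q i \<diamondop> a"
        using q_in[OF i] a A.m_assoc[OF e_in q_in[OF i] a] e_q[OF i] by auto
      have "q i \<odot>\<^bsub>N\<^esub> (a \<odot>\<^bsub>N\<^esub> y) = (q i \<diamondop> a) \<odot>\<^bsub>N\<^esub> y"
        using N.smult_assoc[OF q_in[OF i] a y(1)] by simp
      also have "\<dots> = (\<Oplus>\<^bsub>N\<^esub>j\<in>I. (q i \<diamondop> a) \<odot>\<^bsub>N\<^esub> (p j \<odot>\<^bsub>N\<^esub> h (q j \<odot>\<^bsub>M\<^esub> x)))"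
        unfolding y(2) using summand x by (intro N.finsum_smult qa finite_I)
      also have "\<dots> = (\<Oplus>\<^bsub>N\<^esub>j\<in>I. (q i \<diamondop> a \<diamondop> p j) \<odot>\<^bsub>N\<^esub> h (q j \<odot>\<^bsub>M\<^esub> x))"
        using N.smult_assoc[OF qa(1) p_in h_in[OF qx]] x N.smult_closed qa(1) p_in h_in[OF qx]
        by (intro N.finsum_cong') auto
      also have "\<dots> = h ((q i \<diamondop> a) \<odot>\<^bsub>M\<^esub> x)" by (rule key[OF qa x])
      also have "\<dots> = h (q i \<odot>\<^bsub>M\<^esub> (a \<odot>\<^bsub>M\<^esub> x))"
        using M.smult_assoc[OF q_in[OF i] a x] by simp
      finally show ?thesis .
    qed
    then have "(\<Oplus>\<^bsub>N\<^esub>i\<in>I. p i \<odot>\<^bsub>N\<^esub> h (q i \<odot>\<^bsub>M\<^esub> (a \<odot>\<^bsub>M\<^esub> x))) = (\<Oplus>\<^bsub>N\<^esub>i\<in>I. p i \<odot>\<^bsub>N\<^esub> (q i \<odot>\<^bsub>N\<^esub> (a \<odot>\<^bsub>N\<^esub> y)))"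
      using summand[OF _ ax] by (intro N.finsum_cong' refl) auto
    also have "\<dots> = a \<odot>\<^bsub>N\<^esub> y"
      using finsum_p_q_one[OF N N.smult_closed[OF a y(1)]] .
    finally show "extend_hom M N h (a \<odot>\<^bsub>M\<^esub> x) = a \<odot>\<^bsub>N\<^esub> extend_hom M N h x"
      using ax by (simp add: extend_hom_def[of M N h] y_def)
  qed
  show "extend_hom M N h x = h x" if x: "x \<in> carrier (corner_module M)"
  proof -
    have xM: "x \<in> carrier M" "e \<odot>\<^bsub>M\<^esub> x = x" using x by auto
    have "(\<Oplus>\<^bsub>N\<^esub>i\<in>I. p i \<odot>\<^bsub>N\<^esub> h (q i \<odot>\<^bsub>M\<^esub> x)) = (\<Oplus>\<^bsub>N\<^esub>i\<in>I. p i \<odot>\<^bsub>N\<^esub> (q i \<odot>\<^bsub>N\<^esub> h x))"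
    proof (intro N.finsum_cong' refl)
      show "(\<lambda>i. p i \<odot>\<^bsub>N\<^esub> (q i \<odot>\<^bsub>N\<^esub> h x)) \<in> I \<rightarrow> carrier N"
        using N.smult_closed p_in q_in h_in[OF x] by blast
      fix i assume i: "i \<in> I"
      \<comment> \<open>On elements fixed by \<open>e\<close>, \<open>q i\<close> acts as
        \<open>q i e\<close>, which belongs to the corner, so \<open>h\<close> commutes with
        it.\<close>
      have c: "q i \<diamondop> e \<in> corner"
        using i q_in e_q e_in e_idem by (intro cornerI) auto
      have hx: "h x \<in> carrier N" "e \<odot>\<^bsub>N\<^esub> h x = h x" using hD(1)[OF x] by auto
      have "q i \<odot>\<^bsub>M\<^esub> x = (q i \<diamondop> e) \<odot>\<^bsub>M\<^esub> x"
        using M.smult_assoc[OF q_in[OF i] e_in xM(1)] xM(2) by simp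
      then have "h (q i \<odot>\<^bsub>M\<^esub> x) = (q i \<diamondop> e) \<odot>\<^bsub>N\<^esub> h x"
        using hD(3)[OF \<beta>_in[OF c] x] \<iota>_\<beta>[OF c] by simp
      also have "\<dots> = q i \<odot>\<^bsub>N\<^esub> h x"
        using N.smult_assoc[OF q_in[OF i] e_in hx(1)] hx(2) by simp
      finally show "p i \<odot>\<^bsub>N\<^esub> h (q i \<odot>\<^bsub>M\<^esub> x) = p i \<odot>\<^bsub>N\<^esub> (q i \<odot>\<^bsub>N\<^esub> h x)" by simp
    qed
    also have "\<dots> = h x" using finsum_p_q_one[OF N h_in[OF x]] .
    finally show ?thesis using xM(1) by (simp add: extend_hom_def)
  qed
qed

definition corner_hom :: "('a, 'm) module \<Rightarrow> ('a, 'm) module \<Rightarrow> ('m \<Rightarrow> 'm) \<Rightarrow> 'm \<Rightarrow> 'm" where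
  "corner_hom M N f = restrict f (carrier (corner_module M))"

lemma corner_hom_in:
  assumes "left_module A M" and f: "f \<in> LinearCombinations.module_hom A M N"
  shows "corner_hom M N f \<in> LinearCombinations.module_hom B (corner_module M) (corner_module N)"
proof -
  interpret M: left_module A M by fact
  interpret CM: left_module B "corner_module M" by (rule left_module_corner) fact
  note fD = module_homD[OF f]
  have "f x \<in> carrier (corner_module N)" if "x \<in> carrier (corner_module M)" for x
    using that fD(1)[of x] fD(3)[OF e_in, of x] by simp
  then show ?thesis
    using CM.smult_closed CM.M.a_closed fD(2,3) \<iota>_in
    by (intro module_homI) (auto simp: corner_hom_def)
qed

text \<open>By the decomposition of the unit a linear map is determined by its values on the corner
  module; conversely \<open>extend_hom\<close> reconstructs it from them.\<close>

lemma bij_corner_hom: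
  assumes M: "left_module A M" and N: "left_module A N"
  shows "bij_betw (corner_hom M N)
    (LinearCombinations.module_hom A M N \<inter> extensional (carrier M))
    (LinearCombinations.module_hom B (corner_module M) (corner_module N) \<inter> extensional (carrier (corner_module M)))"
  unfolding bij_betw_def
proof
  interpret M: left_module A M by (rule M)
  interpret N: left_module A N by (rule N)
  show "inj_on (corner_hom M N) (LinearCombinations.module_hom A M N \<inter> extensional (carrier M))"
  proof (rule inj_onI)
    fix f g
    assume f: "f \<in> LinearCombinations.module_hom A M N \<inter> extensional (carrier M)"
      and g: "g \<in> LinearCombinations.module_hom A M N \<inter> extensional (carrier M)"
      and eq: "corner_hom M N f = corner_hom M N g"
    have dec: "f x = (\<Oplus>\<^bsub>N\<^esub>i\<in>I. p i \<odot>\<^bsub>N\<^esub> f (q i \<odot>\<^bsub>M\<^esub> x))"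
      if f: "f \<in> LinearCombinations.module_hom A M N" and x: "x \<in> carrier M" for f x
    proof -
      note fD = module_homD[OF f]
      have qx: "q i \<odot>\<^bsub>M\<^esub> x \<in> carrier M" if "i \<in> I" for i using that q_in x M.smult_closed by blast
      have "f x = f (\<Oplus>\<^bsub>M\<^esub>i\<in>I. p i \<odot>\<^bsub>M\<^esub> (q i \<odot>\<^bsub>M\<^esub> x))"
        using finsum_p_q_one[OF M x] by simp
      also have "\<dots> = (\<Oplus>\<^bsub>N\<^esub>i\<in>I. f (p i \<odot>\<^bsub>M\<^esub> (q i \<odot>\<^bsub>M\<^esub> x)))"
        using finite_I fD(1,2) p_in qx M.smult_closed M.M.abelian_group_axioms N.M.abelian_group_axioms
        by (intro additive_finsum) blast+
      also have "\<dots> = (\<Oplus>\<^bsub>N\<^esub>i\<in>I. p i \<odot>\<^bsub>N\<^esub> f (q i \<odot>\<^bsub>M\<^esub> x))"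
        using fD(1,3) p_in qx N.smult_closed by (intro N.finsum_cong' refl) auto
      finally show ?thesis .
    qed
    show "f = g"
    proof
      fix x show "f x = g x"
      proof (cases "x \<in> carrier M")
        case True
        have "f (q i \<odot>\<^bsub>M\<^esub> x) = g (q i \<odot>\<^bsub>M\<^esub> x)" if "i \<in> I" for i
          using fun_cong[OF eq, of "q i \<odot>\<^bsub>M\<^esub> x"] q_smult_in[OF M that True] by (simp add: corner_hom_def)
        moreover have "p i \<odot>\<^bsub>N\<^esub> g (q i \<odot>\<^bsub>M\<^esub> x) \<in> carrier N" if "i \<in> I" for i
          using module_homD(1)[of g A M N] g that p_in q_in True M.smult_closed N.smult_closed by blast
        ultimately show ?thesis
          unfolding dec[OF IntD1[OF f] True] dec[OF IntD1[OF g] True]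
          by (intro N.finsum_cong' refl) auto
      next
        case False
        then show ?thesis using f g by (auto simp: extensional_def)
      qed
    qed
  qed
  show "corner_hom M N ` (LinearCombinations.module_hom A M N \<inter> extensional (carrier M)) =
    LinearCombinations.module_hom B (corner_module M) (corner_module N) \<inter> extensional (carrier (corner_module M))"
  proof
    show "corner_hom M N ` (LinearCombinations.module_hom A M N \<inter> extensional (carrier M)) \<subseteq>
      LinearCombinations.module_hom B (corner_module M) (corner_module N) \<inter> extensional (carrier (corner_module M))"
      using corner_hom_in[OF M] by (auto simp: corner_hom_def)
    show "LinearCombinations.module_hom B (corner_module M) (corner_module N) \<inter> extensional (carrier (corner_module M)) \<subseteq>
      corner_hom M N ` (LinearCombinations.module_hom A M N \<inter> extensional (carrier M))"
    proof
      fix h assume h: "h \<in> LinearCombinations.module_hom B (corner_module M) (corner_module N) \<inter> extensional (carrier (corner_module M))"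
      note ext = extend_hom[OF M N IntD1[OF h]]
      have "corner_hom M N (extend_hom M N h) = h"
      proof
        fix x show "corner_hom M N (extend_hom M N h) x = h x"
          using ext(2)[of x] h by (cases "x \<in> carrier (corner_module M)") (auto simp: corner_hom_def extensional_def)
      qed
      moreover have "extend_hom M N h \<in> extensional (carrier M)" by (simp add: extend_hom_def)
      ultimately show "h \<in> corner_hom M N ` (LinearCombinations.module_hom A M N \<inter> extensional (carrier M))"
        using ext(1) by (metis IntI imageI)
    qed
  qed
qed

end

context full_corner
begin

subsection \<open>Induced modules\<close>

text \<open>The module \<open>A e \<otimes> N\<close> over \<open>e A e\<close>, realised inside a finite power of \<open>N\<close>: as \<open>A e\<close> is
  generated by the \<open>p i\<close>, the tensor \<open>\<Sum> p i \<otimes> x i\<close> is stored as the tuple \<open>x\<close>, normalised by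
  the idempotent matrix with entries \<open>q i p j\<close>. The functional below is the contraction of \<open>x\<close> with \<open>u \<in> e A\<close>.\<close>

definition contract :: "('b, 'm) module \<Rightarrow> 'a \<Rightarrow> ('i \<Rightarrow> 'm) \<Rightarrow> 'm" where
  "contract N u x = (\<Oplus>\<^bsub>N\<^esub>t\<in>I. \<beta> (u \<diamondop> p t) \<odot>\<^bsub>N\<^esub> x t)"

definition induced_module :: "('b, 'm) module \<Rightarrow> ('a, 'i \<Rightarrow> 'm) module" where
  "induced_module N =
     \<lparr>carrier = {x \<in> I \<rightarrow>\<^sub>E carrier N. \<forall>s\<in>I. x s = contract N (q s) x},
      monoid.mult = undefined, one = undefined, zero = (\<lambda>s\<in>I. \<zero>\<^bsub>N\<^esub>),
      add = (\<lambda>x y. \<lambda>s\<in>I. x s \<oplus>\<^bsub>N\<^esub> y s),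
      smult = (\<lambda>a x. \<lambda>s\<in>I. contract N (q s \<diamondop> a) x)\<rparr>"

lemma row_corner: "\<lbrakk>u \<in> carrier A; e \<diamondop> u = u; t \<in> I\<rbrakk> \<Longrightarrow> u \<diamondop> p t \<in> corner"
  using p_in p_e by (intro cornerI) auto

lemma col_corner: "\<lbrakk>w \<in> carrier A; w \<diamondop> e = w; t \<in> I\<rbrakk> \<Longrightarrow> q t \<diamondop> w \<in> corner"
  using q_in e_q by (intro cornerI) auto

lemma row_mult: "\<lbrakk>u \<in> carrier A; e \<diamondop> u = u; a \<in> carrier A\<rbrakk> \<Longrightarrow> u \<diamondop> a \<in> carrier A \<and> e \<diamondop> (u \<diamondop> a) = u \<diamondop> a"
  using A.m_assoc[OF e_in, of u a] by simp

lemma q_mult: "\<lbrakk>s \<in> I; a \<in> carrier A\<rbrakk> \<Longrightarrow> q s \<diamondop> a \<in> carrier A \<and> e \<diamondop> (q s \<diamondop> a) = q s \<diamondop> a"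
  using row_mult q_in e_q by blast

context
  fixes N :: "('b, 'm) module"
  assumes N: "left_module B N"
begin

interpretation N: left_module B N by (rule N)

lemma entry_in:
  "\<lbrakk>u \<in> carrier A; e \<diamondop> u = u; x \<in> I \<rightarrow> carrier N; t \<in> I\<rbrakk> \<Longrightarrow> \<beta> (u \<diamondop> p t) \<odot>\<^bsub>N\<^esub> x t \<in> carrier N"
  using row_corner \<beta>_in N.smult_closed funcset_mem by metis

lemma contract_in:
  assumes "u \<in> carrier A" "e \<diamondop> u = u" "x \<in> I \<rightarrow> carrier N"
  shows "contract N u x \<in> carrier N"
  unfolding contract_def by (intro N.finsum_closed Pi_I entry_in assms)

lemma contract_cong:
  assumes "u \<in> carrier A" "e \<diamondop> u = u" "y \<in> I \<rightarrow> carrier N" "\<And>t. t \<in> I \<Longrightarrow> x t = y t"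
  shows "contract N u x = contract N u y"
  unfolding contract_def using assms(4)
  by (intro N.finsum_cong' refl Pi_I entry_in assms(1-3)) simp_all

lemma contract_zero:
  assumes "u \<in> carrier A" "e \<diamondop> u = u"
  shows "contract N u (\<lambda>t\<in>I. \<zero>\<^bsub>N\<^esub>) = \<zero>\<^bsub>N\<^esub>"
proof -
  have "contract N u (\<lambda>t\<in>I. \<zero>\<^bsub>N\<^esub>) = (\<Oplus>\<^bsub>N\<^esub>t\<in>I. \<zero>\<^bsub>N\<^esub>)"
    unfolding contract_def using row_corner[OF assms] \<beta>_in
    by (intro N.finsum_cong' refl) (auto simp: N.smult_zero)
  then show ?thesis by simp
qed

lemma contract_add:
  assumes "u \<in> carrier A" "e \<diamondop> u = u" "x \<in> I \<rightarrow> carrier N" "y \<in> I \<rightarrow> carrier N"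
  shows "contract N u (\<lambda>t\<in>I. x t \<oplus>\<^bsub>N\<^esub> y t) = contract N u x \<oplus>\<^bsub>N\<^esub> contract N u y"
proof -
  have c: "\<beta> (u \<diamondop> p t) \<in> carrier B" if "t \<in> I" for t using that assms(1,2) row_corner \<beta>_in by blast
  have "contract N u (\<lambda>t\<in>I. x t \<oplus>\<^bsub>N\<^esub> y t) =
      (\<Oplus>\<^bsub>N\<^esub>t\<in>I. \<beta> (u \<diamondop> p t) \<odot>\<^bsub>N\<^esub> x t \<oplus>\<^bsub>N\<^esub> \<beta> (u \<diamondop> p t) \<odot>\<^bsub>N\<^esub> y t)"
    unfolding contract_def using assms c N.smult_closed N.smult_r_distr
    by (intro N.finsum_cong' refl) (auto simp: Pi_iff)
  also have "\<dots> = contract N u x \<oplus>\<^bsub>N\<^esub> contract N u y"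
    unfolding contract_def by (intro N.finsum_addf Pi_I entry_in assms)
  finally show ?thesis .
qed

lemma contract_add_row:
  assumes "u \<in> carrier A" "e \<diamondop> u = u" "v \<in> carrier A" "e \<diamondop> v = v" "x \<in> I \<rightarrow> carrier N"
  shows "contract N (u \<oplus>\<^bsub>A\<^esub> v) x = contract N u x \<oplus>\<^bsub>N\<^esub> contract N v x"
proof -
  have c: "\<beta> (u \<diamondop> p t) \<in> carrier B" "\<beta> (v \<diamondop> p t) \<in> carrier B" if "t \<in> I" for t
    using that assms(1-4) row_corner \<beta>_in by blast+
  have b: "\<beta> ((u \<oplus>\<^bsub>A\<^esub> v) \<diamondop> p t) = \<beta> (u \<diamondop> p t) \<oplus>\<^bsub>B\<^esub> \<beta> (v \<diamondop> p t)" if "t \<in> I" for t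
    using that assms(1-4) row_corner p_in by (simp add: A.l_distr \<beta>_add)
  have "contract N (u \<oplus>\<^bsub>A\<^esub> v) x = (\<Oplus>\<^bsub>N\<^esub>t\<in>I. \<beta> (u \<diamondop> p t) \<odot>\<^bsub>N\<^esub> x t \<oplus>\<^bsub>N\<^esub> \<beta> (v \<diamondop> p t) \<odot>\<^bsub>N\<^esub> x t)"
    unfolding contract_def using assms c b N.smult_closed N.smult_l_distr
    by (intro N.finsum_cong' refl) (auto simp: Pi_iff)
  also have "\<dots> = contract N u x \<oplus>\<^bsub>N\<^esub> contract N v x"
    unfolding contract_def by (intro N.finsum_addf Pi_I entry_in assms)
  finally show ?thesis .
qed

text \<open>\<open>\<beta>\<close> is multiplicative on the corner, so a left factor from the corner
  can be pulled out of every entry of the row.\<close>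

lemma contract_smult:
  assumes "u \<in> carrier A" "e \<diamondop> u = u" "b \<in> carrier B" "x \<in> I \<rightarrow> carrier N"
  shows "contract N (\<iota> b \<diamondop> u) x = b \<odot>\<^bsub>N\<^esub> contract N u x"
proof -
  have c: "\<beta> (u \<diamondop> p t) \<in> carrier B" if "t \<in> I" for t using that assms(1,2) row_corner \<beta>_in by blast
  have b: "\<beta> (\<iota> b \<diamondop> u \<diamondop> p t) = b \<otimes>\<^bsub>B\<^esub> \<beta> (u \<diamondop> p t)" if "t \<in> I" for t
    using that assms(1-3) row_corner[OF assms(1,2)] p_in A.m_assoc[OF \<iota>_in[OF assms(3)] assms(1) p_in]
    by (simp add: \<beta>_mult \<iota>_corner \<beta>_\<iota>)
  have "contract N (\<iota> b \<diamondop> u) x = (\<Oplus>\<^bsub>N\<^esub>t\<in>I. b \<odot>\<^bsub>N\<^esub> (\<beta> (u \<diamondop> p t) \<odot>\<^bsub>N\<^esub> x t))"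
    unfolding contract_def using assms c b N.smult_closed N.smult_assoc
    by (intro N.finsum_cong' refl) (auto simp: Pi_iff)
  also have "\<dots> = b \<odot>\<^bsub>N\<^esub> contract N u x"
    unfolding contract_def using assms c N.smult_closed finite_I by (intro N.finsum_smult[symmetric]) auto
  finally show ?thesis .
qed

text \<open>Inserts the decomposition of the unit between \<open>u\<close> and \<open>w\<close>. For
  \<open>w\<close> in \<open>A e\<close> the tuple used here represents the tensor of
  \<open>w\<close> and \<open>y\<close>.\<close>

lemma contract_column:
  assumes u: "u \<in> carrier A" "e \<diamondop> u = u" and w: "w \<in> carrier A" "w \<diamondop> e = w" and y: "y \<in> carrier N"
  shows "contract N u (\<lambda>t\<in>I. \<beta> (q t \<diamondop> w) \<odot>\<^bsub>N\<^esub> y) = \<beta> (u \<diamondop> w) \<odot>\<^bsub>N\<^esub> y"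
proof -
  have pq: "p t \<diamondop> q t \<in> carrier A" if "t \<in> I" for t using that p_in q_in by simp
  have uzw: "u \<diamondop> z \<diamondop> w \<in> corner" if "z \<in> carrier A" for z
    using row_mult[OF u that] w by (intro cornerI) auto
  have "u \<diamondop> w = u \<diamondop> (\<Oplus>\<^bsub>A\<^esub>t\<in>I. p t \<diamondop> q t) \<diamondop> w" using u w by (simp add: sum_pq)
  then have "\<beta> (u \<diamondop> w) \<odot>\<^bsub>N\<^esub> y = \<beta> (u \<diamondop> (\<Oplus>\<^bsub>A\<^esub>t\<in>I. p t \<diamondop> q t) \<diamondop> w) \<odot>\<^bsub>N\<^esub> y" by simp
  also have "\<dots> = (\<Oplus>\<^bsub>N\<^esub>t\<in>I. \<beta> (u \<diamondop> (p t \<diamondop> q t) \<diamondop> w) \<odot>\<^bsub>N\<^esub> y)"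
  proof (rule additive_finsum[where f = "\<lambda>z. \<beta> (u \<diamondop> z \<diamondop> w) \<odot>\<^bsub>N\<^esub> y"])
    show "abelian_group A" "abelian_group N" by (rule A.abelian_group_axioms N.abelian_group_axioms)+
    show "(\<lambda>z. \<beta> (u \<diamondop> z \<diamondop> w) \<odot>\<^bsub>N\<^esub> y) \<in> carrier A \<rightarrow> carrier N"
      using uzw \<beta>_in N.smult_closed y by blast
    fix z z' assume z: "z \<in> carrier A" "z' \<in> carrier A"
    have "u \<diamondop> (z \<oplus>\<^bsub>A\<^esub> z') \<diamondop> w = u \<diamondop> z \<diamondop> w \<oplus>\<^bsub>A\<^esub> u \<diamondop> z' \<diamondop> w"
      using z u w by (simp add: A.l_distr A.r_distr)
    then show "\<beta> (u \<diamondop> (z \<oplus>\<^bsub>A\<^esub> z') \<diamondop> w) \<odot>\<^bsub>N\<^esub> y =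
        \<beta> (u \<diamondop> z \<diamondop> w) \<odot>\<^bsub>N\<^esub> y \<oplus>\<^bsub>N\<^esub> \<beta> (u \<diamondop> z' \<diamondop> w) \<odot>\<^bsub>N\<^esub> y"
      using uzw z y \<beta>_in by (simp add: \<beta>_add N.smult_l_distr)
  qed (use finite_I pq in auto)
  also have "\<dots> = contract N u (\<lambda>t\<in>I. \<beta> (q t \<diamondop> w) \<odot>\<^bsub>N\<^esub> y)"
    unfolding contract_def
  proof (intro N.finsum_cong' refl)
    show "(\<lambda>t. \<beta> (u \<diamondop> p t) \<odot>\<^bsub>N\<^esub> (\<lambda>t\<in>I. \<beta> (q t \<diamondop> w) \<odot>\<^bsub>N\<^esub> y) t) \<in> I \<rightarrow> carrier N"
      using row_corner[OF u] col_corner[OF w] \<beta>_in N.smult_closed y by auto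
    fix t assume t: "t \<in> I"
    have "u \<diamondop> (p t \<diamondop> q t) \<diamondop> w = (u \<diamondop> p t) \<diamondop> (q t \<diamondop> w)"
      using u w p_in[OF t] q_in[OF t] by (simp add: A.m_assoc)
    then have "\<beta> (u \<diamondop> (p t \<diamondop> q t) \<diamondop> w) = \<beta> (u \<diamondop> p t) \<otimes>\<^bsub>B\<^esub> \<beta> (q t \<diamondop> w)"
      using row_corner[OF u t] col_corner[OF w t] by (simp add: \<beta>_mult)
    then show "\<beta> (u \<diamondop> (p t \<diamondop> q t) \<diamondop> w) \<odot>\<^bsub>N\<^esub> y = \<beta> (u \<diamondop> p t) \<odot>\<^bsub>N\<^esub> (\<lambda>t\<in>I. \<beta> (q t \<diamondop> w) \<odot>\<^bsub>N\<^esub> y) t"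
      using t row_corner[OF u t] col_corner[OF w t] \<beta>_in y by (simp add: N.smult_assoc)
  qed
  finally show ?thesis ..
qed

text \<open>The tuple of contractions is the sum over \<open>r\<close> of the columns belonging to
  \<open>a p r\<close> and \<open>x r\<close>, and \<open>contract_column\<close> evaluates each of
  them. Normalisation of products and associativity of the action both come from this
  identity.\<close>

lemma contract_contract:
  assumes u: "u \<in> carrier A" "e \<diamondop> u = u" and a: "a \<in> carrier A" and x: "x \<in> I \<rightarrow> carrier N"
  shows "contract N u (\<lambda>t\<in>I. contract N (q t \<diamondop> a) x) = contract N (u \<diamondop> a) x"
proof -
  have col: "a \<diamondop> p r \<in> carrier A" "(a \<diamondop> p r) \<diamondop> e = a \<diamondop> p r" if "r \<in> I" for r
    using a p_in[OF that] p_e[OF that] e_in by (simp_all add: A.m_assoc)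
  have entry: "\<beta> (q t \<diamondop> (a \<diamondop> p r)) \<odot>\<^bsub>N\<^esub> x r \<in> carrier N" if "t \<in> I" "r \<in> I" for t r
    using col_corner[OF col[OF that(2)] that(1)] \<beta>_in N.smult_closed x that(2) by blast
  \<comment> \<open>Induction over subsets of the index set moves the contraction past the
    sum.\<close>
  have sum: "contract N u (\<lambda>t\<in>I. \<Oplus>\<^bsub>N\<^esub>r\<in>J. \<beta> (q t \<diamondop> (a \<diamondop> p r)) \<odot>\<^bsub>N\<^esub> x r) =
      (\<Oplus>\<^bsub>N\<^esub>r\<in>J. \<beta> (u \<diamondop> (a \<diamondop> p r)) \<odot>\<^bsub>N\<^esub> x r)" if "finite J" "J \<subseteq> I" for J
    using that
  proof (induction J rule: finite_induct)
    case empty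
    show ?case unfolding N.finsum_empty by (rule contract_zero[OF u])
  next
    case (insert r J)
    let ?f = "\<lambda>t. \<Oplus>\<^bsub>N\<^esub>r\<in>J. \<beta> (q t \<diamondop> (a \<diamondop> p r)) \<odot>\<^bsub>N\<^esub> x r"
    let ?g = "\<lambda>t\<in>I. \<beta> (q t \<diamondop> (a \<diamondop> p r)) \<odot>\<^bsub>N\<^esub> x r"
    have r: "r \<in> I" and J: "J \<subseteq> I" using insert.prems by auto
    have xr: "x r \<in> carrier N" using x r by blast
    have f: "?f \<in> I \<rightarrow> carrier N" using entry J by (intro Pi_I N.finsum_closed) blast
    have g: "?g \<in> I \<rightarrow> carrier N" using entry r by auto
    have row: "\<beta> (u \<diamondop> (a \<diamondop> p s)) \<odot>\<^bsub>N\<^esub> x s \<in> carrier N" if "s \<in> I" for s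
    proof -
      have "u \<diamondop> (a \<diamondop> p s) \<in> corner" using u col[OF that] by (intro cornerI)
      then show ?thesis using \<beta>_in N.smult_closed x that by blast
    qed
    have "contract N u (\<lambda>t\<in>I. \<Oplus>\<^bsub>N\<^esub>r\<in>insert r J. \<beta> (q t \<diamondop> (a \<diamondop> p r)) \<odot>\<^bsub>N\<^esub> x r) =
        contract N u (\<lambda>t\<in>I. ?g t \<oplus>\<^bsub>N\<^esub> ?f t)"
    proof (rule contract_cong[OF u])
      show "(\<lambda>t\<in>I. ?g t \<oplus>\<^bsub>N\<^esub> ?f t) \<in> I \<rightarrow> carrier N" using f g by (auto simp: Pi_iff)
      fix t assume t: "t \<in> I"
      have "(\<lambda>r. \<beta> (q t \<diamondop> (a \<diamondop> p r)) \<odot>\<^bsub>N\<^esub> x r) \<in> J \<rightarrow> carrier N" using entry[OF t] J by blast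
      then show "(\<lambda>t\<in>I. \<Oplus>\<^bsub>N\<^esub>r\<in>insert r J. \<beta> (q t \<diamondop> (a \<diamondop> p r)) \<odot>\<^bsub>N\<^esub> x r) t = (\<lambda>t\<in>I. ?g t \<oplus>\<^bsub>N\<^esub> ?f t) t"
        using t insert.hyps entry[OF t r] by (simp add: N.finsum_insert)
    qed
    also have "\<dots> = contract N u ?g \<oplus>\<^bsub>N\<^esub> contract N u ?f"
      by (rule contract_add[OF u g f])
    also have "contract N u ?g = \<beta> (u \<diamondop> (a \<diamondop> p r)) \<odot>\<^bsub>N\<^esub> x r"
      by (rule contract_column[OF u col[OF r] xr])
    also have "contract N u ?f = contract N u (\<lambda>t\<in>I. ?f t)"
      using f by (intro contract_cong[OF u]) auto
    also have "\<dots> = (\<Oplus>\<^bsub>N\<^esub>r\<in>J. \<beta> (u \<diamondop> (a \<diamondop> p r)) \<odot>\<^bsub>N\<^esub> x r)"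
      by (rule insert.IH[OF J])
    also have "\<beta> (u \<diamondop> (a \<diamondop> p r)) \<odot>\<^bsub>N\<^esub> x r \<oplus>\<^bsub>N\<^esub> (\<Oplus>\<^bsub>N\<^esub>r\<in>J. \<beta> (u \<diamondop> (a \<diamondop> p r)) \<odot>\<^bsub>N\<^esub> x r) =
        (\<Oplus>\<^bsub>N\<^esub>r\<in>insert r J. \<beta> (u \<diamondop> (a \<diamondop> p r)) \<odot>\<^bsub>N\<^esub> x r)"
      using insert.hyps row r J by (intro N.finsum_insert[symmetric]) auto
    finally show ?case .
  qed
  have "contract N u (\<lambda>t\<in>I. contract N (q t \<diamondop> a) x) =
      contract N u (\<lambda>t\<in>I. \<Oplus>\<^bsub>N\<^esub>r\<in>I. \<beta> (q t \<diamondop> (a \<diamondop> p r)) \<odot>\<^bsub>N\<^esub> x r)"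
  proof (rule contract_cong[OF u])
    show "(\<lambda>t\<in>I. \<Oplus>\<^bsub>N\<^esub>r\<in>I. \<beta> (q t \<diamondop> (a \<diamondop> p r)) \<odot>\<^bsub>N\<^esub> x r) \<in> I \<rightarrow> carrier N"
      using entry by (auto intro!: N.finsum_closed)
    fix t assume t: "t \<in> I"
    show "(\<lambda>t\<in>I. contract N (q t \<diamondop> a) x) t = (\<lambda>t\<in>I. \<Oplus>\<^bsub>N\<^esub>r\<in>I. \<beta> (q t \<diamondop> (a \<diamondop> p r)) \<odot>\<^bsub>N\<^esub> x r) t"
      using t entry[OF t] a p_in q_in[OF t] by (simp add: contract_def) (intro N.finsum_cong' refl, auto simp: A.m_assoc)
  qed
  also have "\<dots> = (\<Oplus>\<^bsub>N\<^esub>r\<in>I. \<beta> (u \<diamondop> (a \<diamondop> p r)) \<odot>\<^bsub>N\<^esub> x r)"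
    by (rule sum[OF finite_I order.refl])
  also have "\<dots> = contract N (u \<diamondop> a) x"
    unfolding contract_def
  proof (intro N.finsum_cong' refl)
    show "(\<lambda>r. \<beta> (u \<diamondop> a \<diamondop> p r) \<odot>\<^bsub>N\<^esub> x r) \<in> I \<rightarrow> carrier N"
      using row_corner row_mult[OF u a] \<beta>_in N.smult_closed x by blast
    fix r assume "r \<in> I"
    then show "\<beta> (u \<diamondop> (a \<diamondop> p r)) \<odot>\<^bsub>N\<^esub> x r = \<beta> (u \<diamondop> a \<diamondop> p r) \<odot>\<^bsub>N\<^esub> x r"
      using u a p_in by (simp add: A.m_assoc)
  qed
  finally show ?thesis .
qed

lemma induced_module_simps:
  "carrier (induced_module N) = {x \<in> I \<rightarrow>\<^sub>E carrier N. \<forall>s\<in>I. x s = contract N (q s) x}"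
  "\<zero>\<^bsub>induced_module N\<^esub> = (\<lambda>s\<in>I. \<zero>\<^bsub>N\<^esub>)"
  "x \<oplus>\<^bsub>induced_module N\<^esub> y = (\<lambda>s\<in>I. x s \<oplus>\<^bsub>N\<^esub> y s)"
  "a \<odot>\<^bsub>induced_module N\<^esub> x = (\<lambda>s\<in>I. contract N (q s \<diamondop> a) x)"
  by (simp_all add: induced_module_def)

text \<open>The result is normalised for any tuple \<open>x\<close>, because
  \<open>contract_contract\<close> absorbs \<open>q s\<close> into the row
  \<open>q s a\<close>.\<close>

lemma induced_smult_in:
  assumes a: "a \<in> carrier A" and x: "x \<in> I \<rightarrow> carrier N"
  shows "(\<lambda>s\<in>I. contract N (q s \<diamondop> a) x) \<in> carrier (induced_module N)"
proof -
  have "contract N (q s \<diamondop> a) x \<in> carrier N" if "s \<in> I" for s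
    using q_mult[OF that a] x by (intro contract_in) auto
  then show ?thesis
    unfolding induced_module_simps using q_in e_q a x by (auto simp: contract_contract)
qed

lemma left_module_induced: "left_module A (induced_module N)"
proof -
  have qD: "q s \<in> carrier A" "e \<diamondop> q s = q s" if "s \<in> I" for s using that q_in e_q by auto
  have mem: "x \<in> I \<rightarrow> carrier N" "x \<in> extensional I" "s \<in> I \<Longrightarrow> x s \<in> carrier N" "s \<in> I \<Longrightarrow> contract N (q s) x = x s"
    if "x \<in> carrier (induced_module N)" for x s
  proof -
    have x: "x \<in> I \<rightarrow>\<^sub>E carrier N" "\<forall>s\<in>I. x s = contract N (q s) x"
      using that unfolding induced_module_simps by blast+
    show "x \<in> I \<rightarrow> carrier N" "x \<in> extensional I" using x(1) by (simp_all add: PiE_def)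
    show "x s \<in> carrier N" if "s \<in> I" using x(1) that by blast
    show "contract N (q s) x = x s" if "s \<in> I" using x(2) that by simp
  qed
  have eqI: "x = y" if "x \<in> carrier (induced_module N)" "y \<in> carrier (induced_module N)" "\<And>s. s \<in> I \<Longrightarrow> x s = y s" for x y
    using extensionalityI[OF mem(2)[OF that(1)] mem(2)[OF that(2)]] that(3) by blast
  have add_in: "(\<lambda>s\<in>I. x s \<oplus>\<^bsub>N\<^esub> y s) \<in> carrier (induced_module N)"
    if x: "x \<in> carrier (induced_module N)" and y: "y \<in> carrier (induced_module N)" for x y
    using mem[OF x] mem[OF y] qD unfolding induced_module_simps by (auto simp: contract_add)
  have zero_in: "(\<lambda>s\<in>I. \<zero>\<^bsub>N\<^esub>) \<in> carrier (induced_module N)"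
    using contract_zero[OF qD] unfolding induced_module_simps by simp
  have neg_in: "(\<lambda>s\<in>I. \<ominus>\<^bsub>N\<^esub> x s) \<in> carrier (induced_module N)" if x: "x \<in> carrier (induced_module N)" for x
  proof -
    \<comment> \<open>Additivity of the contraction shows that the negated tuple is normalised as
      well.\<close>
    have "\<ominus>\<^bsub>N\<^esub> x s = contract N (q s) (\<lambda>s\<in>I. \<ominus>\<^bsub>N\<^esub> x s)" if s: "s \<in> I" for s
    proof (rule N.minus_equality)
      have n: "(\<lambda>s\<in>I. \<ominus>\<^bsub>N\<^esub> x s) \<in> I \<rightarrow> carrier N" using mem[OF x] by auto
      show "contract N (q s) (\<lambda>s\<in>I. \<ominus>\<^bsub>N\<^esub> x s) \<in> carrier N" using qD[OF s] n by (rule contract_in)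
      show "x s \<in> carrier N" by (rule mem(3)[OF x s])
      have "contract N (q s) (\<lambda>s\<in>I. \<ominus>\<^bsub>N\<^esub> x s) \<oplus>\<^bsub>N\<^esub> x s =
          contract N (q s) (\<lambda>t\<in>I. (\<lambda>s\<in>I. \<ominus>\<^bsub>N\<^esub> x s) t \<oplus>\<^bsub>N\<^esub> x t)"
        using contract_add[OF qD[OF s] n mem(1)[OF x]] mem(4)[OF x s] by simp
      also have "\<dots> = contract N (q s) (\<lambda>t\<in>I. \<zero>\<^bsub>N\<^esub>)"
        using mem(3)[OF x] by (intro contract_cong[OF qD[OF s]]) (auto simp: N.l_neg)
      finally show "contract N (q s) (\<lambda>s\<in>I. \<ominus>\<^bsub>N\<^esub> x s) \<oplus>\<^bsub>N\<^esub> x s = \<zero>\<^bsub>N\<^esub>"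
        using contract_zero[OF qD[OF s]] by simp
    qed
    then show ?thesis using mem[OF x] by (auto simp: induced_module_simps)
  qed
  have "abelian_group (induced_module N)"
  proof (rule abelian_groupI)
    fix x assume x: "x \<in> carrier (induced_module N)"
    show "\<zero>\<^bsub>induced_module N\<^esub> \<oplus>\<^bsub>induced_module N\<^esub> x = x"
      unfolding induced_module_simps(2,3) using mem[OF x]
      by (intro eqI[OF add_in[OF zero_in x] x]) simp
    show "\<exists>y\<in>carrier (induced_module N). y \<oplus>\<^bsub>induced_module N\<^esub> x = \<zero>\<^bsub>induced_module N\<^esub>"
      unfolding induced_module_simps(2,3) using mem[OF x]
      by (intro bexI[OF _ neg_in[OF x]] eqI[OF add_in[OF neg_in[OF x] x] zero_in]) (simp add: N.l_neg)
    fix y assume y: "y \<in> carrier (induced_module N)"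
    show "x \<oplus>\<^bsub>induced_module N\<^esub> y \<in> carrier (induced_module N)"
      unfolding induced_module_simps(3) by (rule add_in[OF x y])
    show "x \<oplus>\<^bsub>induced_module N\<^esub> y = y \<oplus>\<^bsub>induced_module N\<^esub> x"
      unfolding induced_module_simps(3) using mem(3)[OF x] mem(3)[OF y]
      by (intro eqI[OF add_in[OF x y] add_in[OF y x]]) (simp add: N.a_comm)
    fix z assume z: "z \<in> carrier (induced_module N)"
    show "x \<oplus>\<^bsub>induced_module N\<^esub> y \<oplus>\<^bsub>induced_module N\<^esub> z = x \<oplus>\<^bsub>induced_module N\<^esub> (y \<oplus>\<^bsub>induced_module N\<^esub> z)"
      unfolding induced_module_simps(3) using mem(3)[OF x] mem(3)[OF y] mem(3)[OF z]
      by (intro eqI[OF add_in[OF add_in[OF x y] z] add_in[OF x add_in[OF y z]]]) (simp add: N.a_assoc)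
  next
    show "\<zero>\<^bsub>induced_module N\<^esub> \<in> carrier (induced_module N)"
      unfolding induced_module_simps(2) by (rule zero_in)
  qed
  moreover have "left_module_axioms A (induced_module N)"
  proof
    fix a b x y
    assume a: "a \<in> carrier A" and x: "x \<in> carrier (induced_module N)"
    have sm: "(\<lambda>s\<in>I. contract N (q s \<diamondop> a) x) \<in> carrier (induced_module N)" if "a \<in> carrier A" for a
      using that mem(1)[OF x] by (rule induced_smult_in)
    show "a \<odot>\<^bsub>induced_module N\<^esub> x \<in> carrier (induced_module N)"
      unfolding induced_module_simps(4) by (rule sm[OF a])
    {
      assume y: "y \<in> carrier (induced_module N)"
      show "a \<odot>\<^bsub>induced_module N\<^esub> (x \<oplus>\<^bsub>induced_module N\<^esub> y) =
          a \<odot>\<^bsub>induced_module N\<^esub> x \<oplus>\<^bsub>induced_module N\<^esub> a \<odot>\<^bsub>induced_module N\<^esub> y"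
        unfolding induced_module_simps(3,4) using q_mult[OF _ a] mem(1)[OF x] mem(1)[OF y]
        by (intro restrict_ext) (simp add: contract_add)
    }
    assume b: "b \<in> carrier A"
    show "(a \<oplus>\<^bsub>A\<^esub> b) \<odot>\<^bsub>induced_module N\<^esub> x = a \<odot>\<^bsub>induced_module N\<^esub> x \<oplus>\<^bsub>induced_module N\<^esub> b \<odot>\<^bsub>induced_module N\<^esub> x"
      unfolding induced_module_simps(3,4) using q_mult[OF _ a] q_mult[OF _ b] mem(1)[OF x] q_in a b
      by (intro restrict_ext) (simp add: A.r_distr contract_add_row)
    show "(a \<diamondop> b) \<odot>\<^bsub>induced_module N\<^esub> x = a \<odot>\<^bsub>induced_module N\<^esub> (b \<odot>\<^bsub>induced_module N\<^esub> x)"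
      unfolding induced_module_simps(4) using q_mult[OF _ a] b mem(1)[OF x] q_in a
      by (intro restrict_ext) (simp add: contract_contract A.m_assoc)
  next
    fix x assume x: "x \<in> carrier (induced_module N)"
    \<comment> \<open>The unit acts by the idempotent matrix, and the tuples in the carrier are its
      fixed points.\<close>
    have "(\<lambda>s\<in>I. contract N (q s \<diamondop> \<one>\<^bsub>A\<^esub>) x) \<in> carrier (induced_module N)"
      using A.one_closed mem(1)[OF x] by (rule induced_smult_in)
    then show "\<one>\<^bsub>A\<^esub> \<odot>\<^bsub>induced_module N\<^esub> x = x"
      unfolding induced_module_simps(4) using mem(4)[OF x] q_in by (intro eqI[OF _ x]) simp_all
  qed
  ultimately show ?thesis by (intro left_module.intro A.ring_axioms)
qed

text \<open>The part of the induced module fixed by \<open>e\<close> is \<open>e A e\<close>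
  tensored with \<open>N\<close>, that is \<open>N\<close>: \<open>\<phi>\<close> multiplies the
  tensors out, and \<open>\<psi> y\<close> is the tuple of the tensor of \<open>e\<close> and
  \<open>y\<close>.\<close>

lemma induced_module_iso:
  defines "\<phi> \<equiv> \<lambda>x. contract N e x" and "\<psi> \<equiv> \<lambda>y. \<lambda>s\<in>I. \<beta> (q s \<diamondop> e) \<odot>\<^bsub>N\<^esub> y"
  shows "\<phi> \<in> LinearCombinations.module_hom B (corner_module (induced_module N)) N"
    and "\<psi> \<in> LinearCombinations.module_hom B N (corner_module (induced_module N))"
    and "x \<in> carrier (corner_module (induced_module N)) \<Longrightarrow> \<psi> (\<phi> x) = x"
    and "y \<in> carrier N \<Longrightarrow> \<phi> (\<psi> y) = y"
proof -
  note ee = e_in e_idem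
  have qe: "q s \<diamondop> e \<in> corner" if "s \<in> I" for s using col_corner[OF ee that] .
  have mem: "x \<in> I \<rightarrow> carrier N" "x \<in> extensional I" "s \<in> I \<Longrightarrow> contract N (q s \<diamondop> e) x = x s"
    if "x \<in> carrier (corner_module (induced_module N))" for x s
  proof -
    have x: "x \<in> carrier (induced_module N)" "(\<lambda>s\<in>I. contract N (q s \<diamondop> e) x) = x"
      using that by (simp_all add: induced_module_simps)
    show "x \<in> I \<rightarrow> carrier N" "x \<in> extensional I" using x(1) by (auto simp: induced_module_simps PiE_def)
    show "contract N (q s \<diamondop> e) x = x s" if "s \<in> I" using fun_cong[OF x(2), of s] that by simp
  qed
  have \<psi>_Pi: "\<psi> y \<in> I \<rightarrow> carrier N" if "y \<in> carrier N" for y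
    using that qe \<beta>_in N.smult_closed by (auto simp: \<psi>_def)
  have \<psi>_in: "\<psi> y \<in> carrier (corner_module (induced_module N))" if y: "y \<in> carrier N" for y
  proof -
    have c: "contract N u (\<psi> y) = \<beta> (u \<diamondop> e) \<odot>\<^bsub>N\<^esub> y" if "u \<in> carrier A" "e \<diamondop> u = u" for u
      unfolding \<psi>_def using that ee y by (intro contract_column)
    have "contract N (q s) (\<psi> y) = \<psi> y s" "contract N (q s \<diamondop> e) (\<psi> y) = \<psi> y s" if s: "s \<in> I" for s
      using c[OF q_in[OF s] e_q[OF s]] c[of "q s \<diamondop> e"] q_mult[OF s e_in] s q_in[OF s] e_in e_idem
      by (simp_all add: \<psi>_def A.m_assoc)
    moreover have "\<psi> y \<in> extensional I" by (simp add: \<psi>_def)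
    ultimately show ?thesis
      using \<psi>_Pi[OF y] by (auto simp: induced_module_simps PiE_def intro!: extensionalityI[of _ I])
  qed
  show "\<phi> \<in> LinearCombinations.module_hom B (corner_module (induced_module N)) N"
  proof (rule module_homI)
    fix x assume x: "x \<in> carrier (corner_module (induced_module N))"
    show "\<phi> x \<in> carrier N" unfolding \<phi>_def using ee mem(1)[OF x] by (rule contract_in)
    {
      fix y assume y: "y \<in> carrier (corner_module (induced_module N))"
      show "\<phi> (x \<oplus>\<^bsub>corner_module (induced_module N)\<^esub> y) = \<phi> x \<oplus>\<^bsub>N\<^esub> \<phi> y"
        unfolding \<phi>_def using contract_add[OF ee mem(1)[OF x] mem(1)[OF y]]
        by (simp add: induced_module_simps)
    }
    fix b assume b: "b \<in> carrier B"
    have "\<phi> (b \<odot>\<^bsub>corner_module (induced_module N)\<^esub> x) = contract N (e \<diamondop> \<iota> b) x"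
      unfolding \<phi>_def using contract_contract[OF ee \<iota>_in[OF b] mem(1)[OF x]]
      by (simp add: induced_module_simps)
    \<comment> \<open>Both products equal \<open>\<iota> b\<close>; the form with
      \<open>\<iota> b\<close> on the left is the one that \<open>contract_smult\<close>
      handles.\<close>
    also have "e \<diamondop> \<iota> b = \<iota> b \<diamondop> e" using \<iota>_corner[OF b] by (simp add: corner_def)
    also have "contract N (\<iota> b \<diamondop> e) x = b \<odot>\<^bsub>N\<^esub> \<phi> x"
      unfolding \<phi>_def using ee b mem(1)[OF x] by (rule contract_smult)
    finally show "\<phi> (b \<odot>\<^bsub>corner_module (induced_module N)\<^esub> x) = b \<odot>\<^bsub>N\<^esub> \<phi> x" .
  qed
  show \<phi>\<psi>: "\<phi> (\<psi> y) = y" if y: "y \<in> carrier N" for y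
    unfolding \<phi>_def \<psi>_def using contract_column[OF ee ee y] y by (simp add: e_idem \<beta>_e N.smult_one)
  show \<psi>\<phi>: "\<psi> (\<phi> x) = x" if x: "x \<in> carrier (corner_module (induced_module N))" for x
  proof (rule extensionalityI[OF _ mem(2)[OF x]])
    show "\<psi> (\<phi> x) \<in> extensional I" by (simp add: \<psi>_def)
    fix s assume s: "s \<in> I"
    have "\<beta> (q s \<diamondop> e) \<odot>\<^bsub>N\<^esub> contract N e x = contract N (\<iota> (\<beta> (q s \<diamondop> e)) \<diamondop> e) x"
      using contract_smult[OF ee \<beta>_in[OF qe[OF s]] mem(1)[OF x]] ..
    also have "\<dots> = contract N (q s \<diamondop> e) x"
      using \<iota>_\<beta>[OF qe[OF s]] qe[OF s] by (simp add: corner_def)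
    finally show "\<psi> (\<phi> x) s = x s" using s mem(3)[OF x s] by (simp add: \<psi>_def \<phi>_def)
  qed
  show "\<psi> \<in> LinearCombinations.module_hom B N (corner_module (induced_module N))"
  proof (rule module_homI)
    fix x assume x: "x \<in> carrier N"
    show "\<psi> x \<in> carrier (corner_module (induced_module N))" by (rule \<psi>_in[OF x])
    {
      fix y assume y: "y \<in> carrier N"
      show "\<psi> (x \<oplus>\<^bsub>N\<^esub> y) = \<psi> x \<oplus>\<^bsub>corner_module (induced_module N)\<^esub> \<psi> y"
        using x y qe \<beta>_in by (auto simp: \<psi>_def induced_module_simps N.smult_r_distr intro!: restrict_ext)
    }
    fix b assume b: "b \<in> carrier B"
    have "contract N (q s \<diamondop> \<iota> b) (\<psi> x) = \<beta> (q s \<diamondop> e) \<odot>\<^bsub>N\<^esub> (b \<odot>\<^bsub>N\<^esub> x)" if s: "s \<in> I" for s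
    proof -
      have "contract N (q s \<diamondop> \<iota> b) (\<psi> x) = \<beta> (q s \<diamondop> \<iota> b \<diamondop> e) \<odot>\<^bsub>N\<^esub> x"
        unfolding \<psi>_def using q_mult[OF s \<iota>_in[OF b]] ee x by (intro contract_column) auto
      also have "q s \<diamondop> \<iota> b \<diamondop> e = (q s \<diamondop> e) \<diamondop> \<iota> b"
        using q_in[OF s] e_in \<iota>_in[OF b] \<iota>_corner[OF b] by (simp add: A.m_assoc corner_def)
      also have "\<beta> \<dots> = \<beta> (q s \<diamondop> e) \<otimes>\<^bsub>B\<^esub> b"
        using qe[OF s] \<iota>_corner[OF b] b by (simp add: \<beta>_mult \<beta>_\<iota>)
      finally show ?thesis using qe[OF s] \<beta>_in b x by (simp add: N.smult_assoc)
    qed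
    then show "\<psi> (b \<odot>\<^bsub>N\<^esub> x) = b \<odot>\<^bsub>corner_module (induced_module N)\<^esub> \<psi> x"
      unfolding corner_module_simps induced_module_simps
      by (subst \<psi>_def) (intro restrict_ext, simp)
  qed
qed

end

lemma corner_module_transport_iso:
  assumes M: "left_module A M" and inj: "inj_on J (carrier M)"
  shows "J \<in> LinearCombinations.module_hom B (corner_module M) (corner_module (transport_module J M))"
    and "the_inv_into (carrier M) J \<in>
      LinearCombinations.module_hom B (corner_module (transport_module J M)) (corner_module M)"
    and "carrier (corner_module (transport_module J M)) = J ` carrier (corner_module M)"
proof -
  interpret M: left_module A M by (rule M)
  note simps = transport_module_simps[OF inj]
  have inv: "the_inv_into (carrier M) J (J x) = x" if "x \<in> carrier M" for x
    using the_inv_into_f_f[OF inj that] .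
  have "e \<odot>\<^bsub>transport_module J M\<^esub> J x = J x \<longleftrightarrow> e \<odot>\<^bsub>M\<^esub> x = x" if "x \<in> carrier M" for x
    using that M.smult_closed[OF e_in that] inj_on_eq_iff[OF inj] by (simp add: simps)
  then show carrier_eq: "carrier (corner_module (transport_module J M)) = J ` carrier (corner_module M)"
    by (auto simp: simps)
  show "J \<in> LinearCombinations.module_hom B (corner_module M) (corner_module (transport_module J M))"
    using carrier_eq by (intro module_homI) (auto simp: simps)
  show "the_inv_into (carrier M) J \<in>
      LinearCombinations.module_hom B (corner_module (transport_module J M)) (corner_module M)"
  proof (rule module_homI, unfold carrier_eq)
    fix u assume "u \<in> J ` carrier (corner_module M)"
    then obtain x where x: "x \<in> carrier (corner_module M)" "u = J x" by blast
    then show "the_inv_into (carrier M) J u \<in> carrier (corner_module M)" by (simp add: inv)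
    {
      fix v assume "v \<in> J ` carrier (corner_module M)"
      then obtain y where y: "y \<in> carrier (corner_module M)" "v = J y" by blast
      show "the_inv_into (carrier M) J (u \<oplus>\<^bsub>corner_module (transport_module J M)\<^esub> v) =
          the_inv_into (carrier M) J u \<oplus>\<^bsub>corner_module M\<^esub> the_inv_into (carrier M) J v"
        using x y by (simp add: simps inv)
    }
    fix b assume "b \<in> carrier B"
    then show "the_inv_into (carrier M) J (b \<odot>\<^bsub>corner_module (transport_module J M)\<^esub> u) =
        b \<odot>\<^bsub>corner_module M\<^esub> the_inv_into (carrier M) J u"
      using x M.smult_closed \<iota>_in by (simp add: simps inv)
  qed
qed

text \<open>Full faithfulness is \<open>bij_corner_hom\<close>. For essential surjectivity,
  \<open>N\<close> is recovered as the corner of its induced module, after the tuples have been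
  encoded in the universe.\<close>

theorem morita_equivalent:
  assumes "infinite (UNIV :: 'm set)"
  shows "morita_equivalent TYPE('m) A B"
  unfolding morita_equivalent_def
proof (rule fully_faithful_functor.lincat_equivalentI)
  let ?C = "left_modules A :: (('a, 'm) module, 'm \<Rightarrow> 'm, 'k) lincat"
  let ?D = "left_modules B :: (('b, 'm) module, 'm \<Rightarrow> 'm, 'k) lincat"
  interpret C: linear_category ?C by (rule linear_category_left_modules[OF A])
  interpret D: linear_category ?D by (rule linear_category_left_modules[OF B])
  show "fully_faithful_functor ?C ?D corner_module corner_hom"
  proof
    fix M N :: "('a, 'm) module" assume "M \<in> LObj ?C" "N \<in> LObj ?C"
    then show "bij_betw (corner_hom M N) (carrier (LHom ?C M N)) (carrier (LHom ?D (corner_module M) (corner_module N)))"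
      unfolding left_modules_simps using bij_corner_hom by blast
  next
    show "lin_functor ?C ?D corner_module corner_hom"
      unfolding lin_functor_def
    proof (intro conjI ballI)
      fix M :: "('a, 'm) module" assume "M \<in> LObj ?C"
      then show "corner_module M \<in> LObj ?D" by (simp add: left_modules_simps left_module_corner)
      show "corner_hom M M (LId ?C M) = LId ?D (corner_module M)"
        by (auto simp: corner_hom_def left_modules_simps intro!: restrict_ext)
    next
      fix M N :: "('a, 'm) module" assume MN: "M \<in> LObj ?C" "N \<in> LObj ?C"
      then have M: "left_module A M" and N: "left_module A N" by (simp_all add: left_modules_simps)
      interpret N: left_module A N by (rule N)
      show "corner_hom M N \<in> LinearCombinations.module_hom class_ring (LHom ?C M N)
          (LHom ?D (corner_module M) (corner_module N))"
      proof (rule module_homI)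
        show "corner_hom M N f \<in> carrier (LHom ?D (corner_module M) (corner_module N))"
          if "f \<in> carrier (LHom ?C M N)" for f
          using bij_betwE[OF bij_corner_hom[OF M N]] that unfolding left_modules_simps by blast
        show "corner_hom M N (f \<oplus>\<^bsub>LHom ?C M N\<^esub> g) =
            corner_hom M N f \<oplus>\<^bsub>LHom ?D (corner_module M) (corner_module N)\<^esub> corner_hom M N g" for f g
          by (auto simp: corner_hom_def left_modules_simps intro!: restrict_ext)
        show "corner_hom M N (r \<odot>\<^bsub>LHom ?C M N\<^esub> f) =
            r \<odot>\<^bsub>LHom ?D (corner_module M) (corner_module N)\<^esub> corner_hom M N f"
          if f: "f \<in> carrier (LHom ?C M N)" for r f
        proof -
          have f': "f \<in> LinearCombinations.module_hom A M N" using f by (simp add: left_modules_simps)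
          \<comment> \<open>The field acts through multiples of two different units. They agree on
            elements fixed by \<open>e\<close>, as \<open>\<iota>\<close> sends r 1 to r e.\<close>
          have "(r \<odot>\<^bsub>A\<^esub> \<one>\<^bsub>A\<^esub>) \<odot>\<^bsub>N\<^esub> f x = \<iota> (r \<odot>\<^bsub>B\<^esub> \<one>\<^bsub>B\<^esub>) \<odot>\<^bsub>N\<^esub> f x"
            if x: "x \<in> carrier (corner_module M)" for x
          proof -
            have fx: "f x \<in> carrier N" "e \<odot>\<^bsub>N\<^esub> f x = f x"
              using module_homD(1)[OF f', of x] module_homD(3)[OF f' e_in, of x] x by auto
            have "\<iota> (r \<odot>\<^bsub>B\<^esub> \<one>\<^bsub>B\<^esub>) = (r \<odot>\<^bsub>A\<^esub> \<one>\<^bsub>A\<^esub>) \<diamondop> e"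
              using \<iota>_smult[OF B.one_closed] fin_dim_algebra_scalar(2)[OF A e_in] by simp
            then show ?thesis
              using N.smult_assoc[OF fin_dim_algebra_scalar(1)[OF A] e_in fx(1), of r] fx(2) by simp
          qed
          then show ?thesis
            by (auto simp: corner_hom_def left_modules_simps intro!: restrict_ext)
        qed
      qed
    next
      fix M N P :: "('a, 'm) module" and f g
      assume "M \<in> LObj ?C" "N \<in> LObj ?C" "P \<in> LObj ?C"
        and f: "f \<in> carrier (LHom ?C M N)" and g: "g \<in> carrier (LHom ?C N P)"
      have f': "f \<in> LinearCombinations.module_hom A M N" using f by (simp add: left_modules_simps)
      have "f x \<in> carrier (corner_module N)" if "x \<in> carrier (corner_module M)" for x
        using module_homD(1)[OF f', of x] module_homD(3)[OF f' e_in, of x] that by auto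
      then show "corner_hom M P (LComp ?C M N P g f) =
          LComp ?D (corner_module M) (corner_module N) (corner_module P) (corner_hom N P g) (corner_hom M N f)"
        by (auto simp: corner_hom_def left_modules_simps compose_def intro!: restrict_ext)
    qed
  qed
  fix N :: "('b, 'm) module" assume "N \<in> LObj ?D"
  then have N: "left_module B N" by (simp add: left_modules_simps)
  obtain J :: "('i \<Rightarrow> 'm) \<Rightarrow> 'm" where J: "inj_on J (I \<rightarrow>\<^sub>E UNIV)"
    using ex_inj_on_PiE[OF finite_I assms] by blast
  let ?Ind = "induced_module N"
  let ?M = "transport_module J ?Ind"
  let ?K = "the_inv_into (carrier ?Ind) J"
  have "carrier ?Ind \<subseteq> I \<rightarrow>\<^sub>E UNIV" by (auto simp: induced_module_def)
  then have inj: "inj_on J (carrier ?Ind)" using J by (rule inj_on_subset[rotated])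
  have M0: "left_module A ?Ind" by (rule left_module_induced[OF N])
  have M: "left_module A ?M" by (rule left_module_transport[OF M0 inj])
  note iso = induced_module_iso[OF N]
  note tr = corner_module_transport_iso[OF M0 inj]
  let ?\<phi> = "contract N e" and ?\<psi> = "\<lambda>y. \<lambda>s\<in>I. \<beta> (q s \<diamondop> e) \<odot>\<^bsub>N\<^esub> y"
  let ?t = "\<lambda>u\<in>carrier (corner_module ?M). ?\<phi> (?K u)" and ?t' = "\<lambda>y\<in>carrier N. J (?\<psi> y)"
  have comp: "(\<lambda>x\<in>carrier X. g (f x)) \<in> LinearCombinations.module_hom B X Z \<inter> extensional (carrier X)"
    if X: "left_module B X" and f: "f \<in> LinearCombinations.module_hom B X Y" and g: "g \<in> LinearCombinations.module_hom B Y Z"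
    for X :: "('b, 'x) module" and Y :: "('b, 'y) module" and Z :: "('b, 'z) module" and f g
  proof -
    interpret X: left_module B X by (rule X)
    show ?thesis
      using module_homD[OF f] module_homD[OF g] X.smult_closed by (auto intro!: module_homI)
  qed
  have t: "?t \<in> carrier (LHom ?D (corner_module ?M) N)"
    unfolding left_modules_simps by (rule comp[OF left_module_corner[OF M] tr(2) iso(1)])
  have t': "?t' \<in> carrier (LHom ?D N (corner_module ?M))"
    unfolding left_modules_simps by (rule comp[OF N iso(2) tr(1)])
  have "?t' (?t u) = u" if u: "u \<in> carrier (corner_module ?M)" for u
  proof -
    obtain x where x: "x \<in> carrier (corner_module ?Ind)" "u = J x" using u unfolding tr(3) by blast
    have "?K u = x" using x the_inv_into_f_f[OF inj, of x] by simp
    then have "?t u = ?\<phi> x" using u by simp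
    then show ?thesis using iso(3)[OF x(1)] module_homD(1)[OF iso(1) x(1)] x(2) by simp
  qed
  moreover have "?t (?t' y) = y" if "y \<in> carrier N" for y
  proof -
    have \<psi>: "?\<psi> y \<in> carrier (corner_module ?Ind)" by (rule module_homD(1)[OF iso(2) that])
    then have "?K (J (?\<psi> y)) = ?\<psi> y" using the_inv_into_f_f[OF inj, of "?\<psi> y"] by simp
    moreover have "J (?\<psi> y) \<in> carrier (corner_module ?M)" unfolding tr(3) using \<psi> by blast
    ultimately show ?thesis using iso(4)[OF that] that by simp
  qed
  ultimately have "isomorphism_in ?D (corner_module ?M) N ?t"
    unfolding isomorphism_in_def using t t'
    by (intro conjI bexI[of _ ?t']) (auto simp: left_modules_simps(5,6) compose_def intro!: restrict_ext simp del: restrict_apply)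
  then show "\<exists>M\<in>LObj ?C. \<exists>f. isomorphism_in ?D (corner_module M) N f"
    using M by (auto simp: left_modules_simps)
qed

end

section \<open>From the monoid algebra of partial functions to the surjection category\<close>

section \<open>The monoid of order-preserving partial functions\<close>

abbreviation EO :: "nat \<Rightarrow> (nat set, nat \<rightharpoonup> nat) smallcat" where
  "EO n \<equiv> onto_cat (Pow {1..n})"

interpretation EO: finite_category "EO n" for n
  by (rule finite_category_onto_cat[of _ "{1..n}"]) auto

text \<open>Each partial function is a morphism from its domain onto its range, so monoid and
  category share a basis. Only the products differ: the category product vanishes unless the range
  of the first map is the domain of the second.\<close>

lemma carrier_PO: "carrier (PO n) = Arr (EO n)"
  by (auto simp: PO_def)

lemma map_comp_in_EO: "\<lbrakk>g \<in> Arr (EO n); f \<in> Arr (EO n)\<rbrakk> \<Longrightarrow> g \<circ>\<^sub>m f \<in> Arr (EO n)"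
proof -
  assume g: "g \<in> Arr (EO n)" and f: "f \<in> Arr (EO n)"
  have "dom (g \<circ>\<^sub>m f) \<subseteq> dom f" "ran (g \<circ>\<^sub>m f) \<subseteq> ran g"
    by (auto simp: map_comp_def ran_def split: option.splits)
  moreover have "dom f \<subseteq> {1..n}" "ran g \<subseteq> {1..n}" "order_preserving (g \<circ>\<^sub>m f)"
    using f g order_preserving_comp by auto
  ultimately have "dom (g \<circ>\<^sub>m f) \<subseteq> {1..n}" "ran (g \<circ>\<^sub>m f) \<subseteq> {1..n}" "order_preserving (g \<circ>\<^sub>m f)"
    by blast+
  then show ?thesis by simp
qed

interpretation PO: partial_monoid "Arr (EO n)" "\<lambda>_ _. True" "\<lambda>g f. g \<circ>\<^sub>m f" "{Some |` {1..n}}" for n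
proof
  show "finite (Arr (EO n))" by (rule EO.finite_arr)
  show "{Some |` {1..n}} \<subseteq> Arr (EO n)"
    using EO.id_in[of "{1..n}" n] by simp
qed (simp_all only: map_comp_in_EO map_comp_assoc, auto simp: map_comp_restrict_Some restrict_Some_map_comp)

lemma monoid_algebra_PO: "monoid_algebra (PO n) = (PO.algebra n :: ('k::field, _) module)"
proof -
  have "(basis_vec (Some |` {1..n}) :: _ \<Rightarrow> 'k) = (\<lambda>m. if m \<in> {Some |` {1..n}} then 1 else 0)"
    by (auto simp: basis_vec_def)
  then show ?thesis
    by (simp only: monoid_algebra_def PO.algebra_def carrier_PO) (simp add: PO_def)
qed

subsection \<open>The zeta transform\<close>

text \<open>Restrictions of partial functions turn the monoid algebra into the category algebra:
  a function \<open>g\<close> is sent to the sum of all its restrictions, corestricted to their images.\<close>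

definition zeta :: "nat \<Rightarrow> ((nat \<rightharpoonup> nat) \<Rightarrow> 'k::field) \<Rightarrow> (nat \<rightharpoonup> nat) \<Rightarrow> 'k" where
  "zeta n a = (\<lambda>f. \<Sum>g\<in>Arr (EO n). if f \<subseteq>\<^sub>m g then a g else 0)"

lemma restriction_in_EO: "\<lbrakk>g \<in> Arr (EO n); f \<subseteq>\<^sub>m g\<rbrakk> \<Longrightarrow> f \<in> Arr (EO n)"
proof -
  assume g: "g \<in> Arr (EO n)" and fg: "f \<subseteq>\<^sub>m g"
  have *: "g x = Some y" if "f x = Some y" for x y using fg that by (auto simp: map_le_def dom_def)
  then have "dom f \<subseteq> dom g" "ran f \<subseteq> ran g" by (force simp: ran_def)+
  moreover have "dom g \<subseteq> {1..n}" "ran g \<subseteq> {1..n}" "order_preserving g" using g by auto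
  moreover have "order_preserving f"
    using \<open>order_preserving g\<close> * unfolding order_preserving_alt by meson
  ultimately have "dom f \<subseteq> {1..n}" "ran f \<subseteq> {1..n}" "order_preserving f" by blast+
  then show ?thesis by simp
qed

lemma zeta_in: "zeta n a \<in> supported (Arr (EO n))"
  unfolding supported_iff zeta_def
proof (intro allI impI sum.neutral ballI)
  fix f g assume "f \<notin> Arr (EO n)" "g \<in> Arr (EO n)"
  then have "\<not> f \<subseteq>\<^sub>m g" using restriction_in_EO by blast
  then show "(if f \<subseteq>\<^sub>m g then a g else 0) = 0" by (rule if_not_P)
qed

lemma zeta_add: "zeta n (\<lambda>m. a m + b m) = (\<lambda>m. zeta n a m + zeta n b m)"
  unfolding zeta_def sum.distrib[symmetric] by (intro ext sum.cong refl) simp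

lemma zeta_scale: "zeta n (\<lambda>m. c * a m) = (\<lambda>m. c * zeta n a m)"
  unfolding zeta_def sum_distrib_left by (intro ext sum.cong refl) simp

text \<open>This unique factorisation of restrictions of \<open>g f\<close> is what makes the zeta transform multiplicative.\<close>

lemma restriction_factor_iff:
  "(g' \<subseteq>\<^sub>m g \<and> f' \<subseteq>\<^sub>m f \<and> dom g' = ran f' \<and> g' \<circ>\<^sub>m f' = h) \<longleftrightarrow>
    h \<subseteq>\<^sub>m g \<circ>\<^sub>m f \<and> f' = f |` dom h \<and> g' = g |` ran (f |` dom h)"
proof
  assume *: "g' \<subseteq>\<^sub>m g \<and> f' \<subseteq>\<^sub>m f \<and> dom g' = ran f' \<and> g' \<circ>\<^sub>m f' = h"
  have g: "g x = Some y" if "g' x = Some y" for x y using * that by (auto simp: map_le_def dom_def)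
  have f: "f x = Some y" if "f' x = Some y" for x y using * that by (auto simp: map_le_def dom_def)
  have dom: "dom h = dom f'" using * dom_map_comp[of f' g'] by auto
  have f': "f' = f |` dom h"
  proof
    fix x show "f' x = (f |` dom h) x"
      unfolding dom using f by (cases "f' x") (auto simp: restrict_map_def dom_def)
  qed
  have "g' = g |` dom g'"
  proof
    fix x show "g' x = (g |` dom g') x"
      using g by (cases "g' x") (auto simp: restrict_map_def dom_def)
  qed
  moreover have "h \<subseteq>\<^sub>m g \<circ>\<^sub>m f"
    unfolding map_le_def
  proof
    fix x assume "x \<in> dom h"
    then obtain y z where "f' x = Some y" "g' y = Some z" "h x = Some z"
      using * by (auto simp: map_comp_def dom_def split: option.splits)
    then show "h x = (g \<circ>\<^sub>m f) x" using f g by (simp add: map_comp_def)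
  qed
  ultimately show "h \<subseteq>\<^sub>m g \<circ>\<^sub>m f \<and> f' = f |` dom h \<and> g' = g |` ran (f |` dom h)"
    using * f' by simp
next
  assume *: "h \<subseteq>\<^sub>m g \<circ>\<^sub>m f \<and> f' = f |` dom h \<and> g' = g |` ran (f |` dom h)"
  have fg: "\<exists>y. f x = Some y \<and> g y = Some z" if "h x = Some z" for x z
  proof -
    have "(g \<circ>\<^sub>m f) x = Some z" using * that by (auto simp: map_le_def dom_def)
    then show ?thesis by (auto simp: map_comp_def split: option.splits)
  qed
  have ran: "ran (f |` dom h) \<subseteq> dom g"
  proof
    fix y assume "y \<in> ran (f |` dom h)"
    then obtain x z where "f x = Some y" "h x = Some z"
      by (auto simp: ran_def restrict_map_def dom_def split: if_splits)
    then show "y \<in> dom g" using fg[of x z] by auto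
  qed
  have "g' \<circ>\<^sub>m f' = h"
  proof
    fix x
    show "(g' \<circ>\<^sub>m f') x = h x"
    proof (cases "h x")
      case None
      then show ?thesis using * by (simp add: map_comp_def restrict_map_def domIff)
    next
      case (Some z)
      then obtain y where y: "f x = Some y" "g y = Some z" using fg by blast
      have "f' x = Some y" using * y Some by (auto simp: restrict_map_def)
      moreover have "y \<in> ran (f |` dom h)"
        using y Some by (auto simp: ran_def restrict_map_def)
      ultimately show ?thesis using * y Some by (simp add: map_comp_def)
    qed
  qed
  moreover have "dom g' = ran f'" using * ran by (auto simp: restrict_map_def dom_def split: if_splits)
  ultimately show "g' \<subseteq>\<^sub>m g \<and> f' \<subseteq>\<^sub>m f \<and> dom g' = ran f' \<and> g' \<circ>\<^sub>m f' = h"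
    using * by (auto simp: map_le_def)
qed

lemma zeta_mult:
  fixes a b :: "(nat \<rightharpoonup> nat) \<Rightarrow> 'k::field"
  assumes a: "a \<in> supported (Arr (EO n))" and b: "b \<in> supported (Arr (EO n))"
  shows "zeta n (conv (\<lambda>_ _. True) (\<lambda>g f. g \<circ>\<^sub>m f) a b) =
    conv (\<lambda>g f. dom g = ran f) (\<lambda>g f. g \<circ>\<^sub>m f) (zeta n a) (zeta n b)"
proof
  fix h
  let ?S = "Arr (EO n)"
  have fin: "finite ?S" by (rule EO.finite_arr)
  have a0: "\<forall>m. m \<notin> ?S \<longrightarrow> a m = 0" and b0: "\<forall>m. m \<notin> ?S \<longrightarrow> b m = 0"
    using a b by (auto simp: supported_iff)
  have za: "\<forall>m. m \<notin> ?S \<longrightarrow> zeta n a m = 0" and zb: "\<forall>m. m \<notin> ?S \<longrightarrow> zeta n b m = 0"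
    using zeta_in[of n a] zeta_in[of n b] by (auto simp: supported_iff)
  let ?K = "\<lambda>(g' :: nat \<rightharpoonup> nat) (f' :: nat \<rightharpoonup> nat). if dom g' = ran f' \<and> g' \<circ>\<^sub>m f' = h then 1 else 0 :: 'k"
  let ?Z = "\<lambda>(f :: nat \<rightharpoonup> nat) (g :: nat \<rightharpoonup> nat). if f \<subseteq>\<^sub>m g then 1 else 0 :: 'k"
  have indicators: "(if P \<and> Q then 1 else 0) * ((if R then 1 else 0) * (if S then 1 else 0)) =
    (if R \<and> S \<and> P \<and> Q then 1 else (0 :: 'k))" for P Q R S by simp
  \<comment> \<open>The double sum counts composable pairs of restrictions of \<open>g\<close> and
    \<open>f\<close> with composite \<open>h\<close>. By \<open>restriction_factor_iff\<close> there
    is exactly one if \<open>h\<close> restricts \<open>g \<circ>\<^sub>m f\<close>, and none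
    otherwise.\<close>
  have kernel: "(\<Sum>g'\<in>?S. \<Sum>f'\<in>?S. ?K g' f' * (?Z g' g * ?Z f' f)) = ?Z h (g \<circ>\<^sub>m f)"
    if "g \<in> ?S" "f \<in> ?S" for g f
  proof (cases "h \<subseteq>\<^sub>m g \<circ>\<^sub>m f")
    case True
    let ?f0 = "f |` dom h" and ?g0 = "g |` ran (f |` dom h)"
    have "?g0 \<subseteq>\<^sub>m g" "?f0 \<subseteq>\<^sub>m f" by (simp_all add: map_le_def)
    then have S: "?g0 \<in> ?S" "?f0 \<in> ?S"
      using restriction_in_EO[OF that(1)] restriction_in_EO[OF that(2)] by blast+
    have "(\<Sum>g'\<in>?S. \<Sum>f'\<in>?S. ?K g' f' * (?Z g' g * ?Z f' f)) =
        (\<Sum>g'\<in>?S. \<Sum>f'\<in>?S. if f' = ?f0 then (if g' = ?g0 then 1 else 0) else 0)"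
    proof (intro sum.cong refl)
      fix g' f'
      show "?K g' f' * (?Z g' g * ?Z f' f) = (if f' = ?f0 then (if g' = ?g0 then 1 else 0) else 0)"
        unfolding indicators restriction_factor_iff using True by simp
    qed
    also have "\<dots> = (\<Sum>g'\<in>?S. if g' = ?g0 then 1 else 0)"
      using fin S by (intro sum.cong refl) simp
    also have "\<dots> = 1" using fin S by simp
    finally show ?thesis using True by simp
  next
    case False
    then have "?K g' f' * (?Z g' g * ?Z f' f) = 0" for g' f'
      unfolding indicators restriction_factor_iff by simp
    then show ?thesis using False by (simp add: sum.neutral)
  qed
  have "zeta n (conv (\<lambda>_ _. True) (\<lambda>g f. g \<circ>\<^sub>m f) a b) h =
      (\<Sum>x\<in>?S. conv (\<lambda>_ _. True) (\<lambda>g f. g \<circ>\<^sub>m f) a b x * ?Z h x)"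
    unfolding zeta_def by (intro sum.cong refl) simp
  also have "\<dots> = (\<Sum>g\<in>?S. \<Sum>f\<in>?S. if True then a g * b f * ?Z h (g \<circ>\<^sub>m f) else 0)"
    using map_comp_in_EO by (intro sum_conv[OF fin fin fin a0 b0])
  also have "\<dots> = (\<Sum>g\<in>?S. \<Sum>f\<in>?S. a g * b f * (\<Sum>g'\<in>?S. \<Sum>f'\<in>?S. ?K g' f' * (?Z g' g * ?Z f' f)))"
    by (intro sum.cong refl) (simp only: kernel if_True)
  \<comment> \<open>The four sums are now reordered until those over \<open>g\<close> and
    \<open>f\<close> are innermost and factor into two zeta values.\<close>
  also have "\<dots> = (\<Sum>g\<in>?S. \<Sum>f\<in>?S. \<Sum>g'\<in>?S. \<Sum>f'\<in>?S. ?K g' f' * ((a g * ?Z g' g) * (b f * ?Z f' f)))"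
    unfolding sum_distrib_left by (intro sum.cong refl) (simp only: mult_ac)
  also have "\<dots> = (\<Sum>g\<in>?S. \<Sum>g'\<in>?S. \<Sum>f\<in>?S. \<Sum>f'\<in>?S. ?K g' f' * ((a g * ?Z g' g) * (b f * ?Z f' f)))"
    by (intro sum.cong refl sum.swap)
  also have "\<dots> = (\<Sum>g'\<in>?S. \<Sum>g\<in>?S. \<Sum>f'\<in>?S. \<Sum>f\<in>?S. ?K g' f' * ((a g * ?Z g' g) * (b f * ?Z f' f)))"
    by (subst sum.swap) (intro sum.cong refl sum.swap)
  also have "\<dots> = (\<Sum>g'\<in>?S. \<Sum>f'\<in>?S. \<Sum>g\<in>?S. \<Sum>f\<in>?S. ?K g' f' * ((a g * ?Z g' g) * (b f * ?Z f' f)))"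
    by (intro sum.cong refl sum.swap)
  also have "\<dots> = (\<Sum>g'\<in>?S. \<Sum>f'\<in>?S. ?K g' f' * (zeta n a g' * zeta n b f'))"
  proof (intro sum.cong refl)
    fix g' f'
    have z: "zeta n c k = (\<Sum>g\<in>?S. c g * ?Z k g)" for c :: "(nat \<rightharpoonup> nat) \<Rightarrow> 'k" and k
      unfolding zeta_def by (intro sum.cong refl) simp
    show "(\<Sum>g\<in>?S. \<Sum>f\<in>?S. ?K g' f' * ((a g * ?Z g' g) * (b f * ?Z f' f))) =
        ?K g' f' * (zeta n a g' * zeta n b f')"
      unfolding z unfolding sum_product unfolding sum_distrib_left ..
  qed
  also have "\<dots> = conv (\<lambda>g f. dom g = ran f) (\<lambda>g f. g \<circ>\<^sub>m f) (zeta n a) (zeta n b) h"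
    unfolding conv_eq_sum[OF fin za fin zb] by (intro sum.cong refl) simp
  finally show "zeta n (conv (\<lambda>_ _. True) (\<lambda>g f. g \<circ>\<^sub>m f) a b) h =
    conv (\<lambda>g f. dom g = ran f) (\<lambda>g f. g \<circ>\<^sub>m f) (zeta n a) (zeta n b) h" .
qed

lemma map_le_card_dom:
  assumes "f \<subseteq>\<^sub>m g" "g \<in> Arr (EO n)" "card (dom g) \<le> card (dom f)"
  shows "f = g"
proof -
  have "dom g \<subseteq> {1..n}" using assms(2) by simp
  then have "finite (dom g)" by (rule finite_subset) simp
  moreover have "dom f \<subseteq> dom g" using assms(1) by (rule map_le_implies_dom_le)
  ultimately have "dom f = dom g" using assms(3) by (rule card_seteq)
  then show ?thesis using assms(1) by (metis map_le_antisym map_le_def)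
qed

lemma card_dom_le: "f \<in> Arr (EO n) \<Longrightarrow> card (dom f) \<le> n"
  using card_mono[of "{1..n}" "dom f"] by auto

text \<open>Unitriangularity: at an \<open>f\<close> of maximal domain size with
  \<open>a f \<noteq> b f\<close>, all other terms of the two zeta sums agree, because proper
  extensions of \<open>f\<close> have larger domains.\<close>

lemma inj_zeta: "inj_on (zeta n) (supported (Arr (EO n)) :: ((nat \<rightharpoonup> nat) \<Rightarrow> 'k::field) set)"
proof (rule inj_onI, rule ccontr)
  fix a b :: "(nat \<rightharpoonup> nat) \<Rightarrow> 'k"
  assume a: "a \<in> supported (Arr (EO n))" and b: "b \<in> supported (Arr (EO n))"
    and eq: "zeta n a = zeta n b" and "a \<noteq> b"
  let ?D = "{g \<in> Arr (EO n). a g \<noteq> b g}"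
  obtain g where "a g \<noteq> b g" using \<open>a \<noteq> b\<close> by blast
  moreover from this have "g \<in> Arr (EO n)" using a b unfolding supported_iff by metis
  ultimately have g: "g \<in> ?D" by blast
  have "\<forall>g. g \<in> ?D \<longrightarrow> card (dom g) < Suc n" using card_dom_le by (simp only: mem_Collect_eq less_Suc_eq_le) blast
  then obtain f where f: "f \<in> ?D" "\<And>g. g \<in> ?D \<Longrightarrow> card (dom g) \<le> card (dom f)"
    using ex_has_greatest_nat[where P = "\<lambda>g. g \<in> ?D" and f = "\<lambda>g. card (dom g)", OF g] by blast
  have rest: "(\<Sum>g\<in>Arr (EO n) - {f}. if f \<subseteq>\<^sub>m g then a g else 0) = (\<Sum>g\<in>Arr (EO n) - {f}. if f \<subseteq>\<^sub>m g then b g else 0)"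
  proof (intro sum.cong refl)
    fix g assume g: "g \<in> Arr (EO n) - {f}"
    show "(if f \<subseteq>\<^sub>m g then a g else 0) = (if f \<subseteq>\<^sub>m g then b g else 0)"
      using map_le_card_dom[of f g n] f(2)[of g] g by auto
  qed
  have split: "zeta n c f = c f + (\<Sum>g\<in>Arr (EO n) - {f}. if f \<subseteq>\<^sub>m g then c g else 0)"
    for c :: "(nat \<rightharpoonup> nat) \<Rightarrow> 'k"
    unfolding zeta_def using f(1) EO.finite_arr by (subst sum.remove[of _ f]) auto
  have "a f = b f" using fun_cong[OF eq, of f] unfolding split rest by (rule add_right_imp_eq)
  then show False using f(1) by simp
qed

text \<open>Back substitution by decreasing domain size. After \<open>j\<close> rounds the values
  are right where \<open>n < card (dom f) + j\<close>, and correcting the next smaller size leaves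
  these values unchanged.\<close>

lemma surj_zeta:
  fixes b :: "(nat \<rightharpoonup> nat) \<Rightarrow> 'k::field"
  assumes b: "b \<in> supported (Arr (EO n))"
  shows "\<exists>a\<in>supported (Arr (EO n)). zeta n a = b"
proof -
  have "\<exists>a\<in>supported (Arr (EO n)). \<forall>f\<in>Arr (EO n). n < card (dom f) + j \<longrightarrow> zeta n a f = b f" for j
  proof (induction j)
    case 0
    have "(\<lambda>_. 0) \<in> supported (Arr (EO n))" by (simp add: supported_iff)
    then show ?case using card_dom_le by (metis add.right_neutral not_less)
  next
    case (Suc j)
    then obtain a where a: "a \<in> supported (Arr (EO n))"
      and eq: "\<And>f. \<lbrakk>f \<in> Arr (EO n); n < card (dom f) + j\<rbrakk> \<Longrightarrow> zeta n a f = b f" by blast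
    \<comment> \<open>The correction lives on the single size \<open>n - j\<close>; for
      \<open>f\<close> of at least this size only the term of \<open>f\<close> itself enters the
      zeta sum of \<open>d\<close>.\<close>
    define d where "d = (\<lambda>f. if f \<in> Arr (EO n) \<and> card (dom f) + j = n then b f - zeta n a f else 0)"
    have "zeta n (\<lambda>f. a f + d f) f = b f" if f: "f \<in> Arr (EO n)" "n < card (dom f) + Suc j" for f
    proof -
      have "zeta n d f = (\<Sum>g\<in>Arr (EO n). if g = f then d f else 0)"
        unfolding zeta_def
      proof (intro sum.cong refl)
        fix g assume g: "g \<in> Arr (EO n)"
        show "(if f \<subseteq>\<^sub>m g then d g else 0) = (if g = f then d f else 0)"
        proof (cases "f \<subseteq>\<^sub>m g \<and> g \<noteq> f")
          case True
          then have "card (dom f) < card (dom g)"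
            using map_le_card_dom[OF _ g, of f] leI by blast
          then have "d g = 0" using f(2) by (simp add: d_def)
          then show ?thesis using True by simp
        qed auto
      qed
      also have "\<dots> = d f" using f(1) EO.finite_arr by simp
      finally have "zeta n d f = d f" .
      then show ?thesis
        using f eq[OF f(1)] by (cases "card (dom f) + j = n") (auto simp: zeta_add d_def)
    qed
    moreover have "(\<lambda>f. a f + d f) \<in> supported (Arr (EO n))"
      using a by (auto simp: supported_iff d_def)
    ultimately show ?case by blast
  qed
  \<comment> \<open>After \<open>Suc n\<close> rounds the empty domain is reached as well.\<close>
  then obtain a where a: "a \<in> supported (Arr (EO n))"
    and eq: "\<And>f. \<lbrakk>f \<in> Arr (EO n); n < card (dom f) + Suc n\<rbrakk> \<Longrightarrow> zeta n a f = b f" by meson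
  have "zeta n a f = b f" for f
    using eq[of f] b zeta_in[of n a] by (cases "f \<in> Arr (EO n)") (auto simp: supported_iff)
  then show ?thesis using a by blast
qed

text \<open>The restrictions of the identity of \<open>[n]\<close> are exactly the identities of its
  subsets.\<close>

lemma zeta_one: "zeta n (\<lambda>m. if m \<in> {Some |` {1..n}} then 1 else 0) = (\<lambda>m. if m \<in> Id (EO n) ` Obj (EO n) then 1 else (0 :: 'k::field))"
proof
  fix f
  have id: "Some |` {1..n} \<in> Arr (EO n)" using EO.id_in[of "{1..n}" n] by simp
  have "zeta n (\<lambda>m. if m \<in> {Some |` {1..n}} then 1 else (0 :: 'k)) f =
      (\<Sum>g\<in>Arr (EO n). if g = Some |` {1..n} then (if f \<subseteq>\<^sub>m Some |` {1..n} then 1 else 0) else 0)"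
    unfolding zeta_def by (intro sum.cong refl) auto
  also have "\<dots> = (if f \<subseteq>\<^sub>m Some |` {1..n} then 1 else 0)"
    using id EO.finite_arr[of n] by simp
  also have "f \<subseteq>\<^sub>m Some |` {1..n} \<longleftrightarrow> f \<in> Id (EO n) ` Obj (EO n)"
  proof
    assume le: "f \<subseteq>\<^sub>m Some |` {1..n}"
    have "f = Some |` dom f"
    proof
      fix x show "f x = (Some |` dom f) x"
      proof (cases "f x")
        case (Some a)
        then have "(Some |` {1..n}) x = Some a" using le domI[of f x a] unfolding map_le_def by metis
        then have "a = x" by (simp add: restrict_map_def split: if_splits)
        then show ?thesis using Some domI[of f x a] by (simp add: restrict_map_def)
      qed (simp add: restrict_map_def domIff)
    qed
    moreover have "dom f \<subseteq> {1..n}" using map_le_implies_dom_le[OF le] by (simp add: dom_restrict_Some)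
    ultimately show "f \<in> Id (EO n) ` Obj (EO n)" by auto
  next
    assume "f \<in> Id (EO n) ` Obj (EO n)"
    then show "f \<subseteq>\<^sub>m Some |` {1..n}" by (auto simp: map_le_def restrict_map_def split: if_splits)
  qed
  finally show "zeta n (\<lambda>m. if m \<in> {Some |` {1..n}} then 1 else (0 :: 'k)) f =
    (if f \<in> Id (EO n) ` Obj (EO n) then 1 else 0)" .
qed

subsection \<open>Relabelling a subset by an initial segment\<close>

text \<open>The position of \<open>y\<close> in the increasing enumeration of \<open>X\<close>: an
  isomorphism from \<open>X\<close> to an initial segment, with inverse
  \<open>unrelabel\<close>.\<close>

definition relabel :: "nat set \<Rightarrow> nat \<rightharpoonup> nat" where
  "relabel X = (\<lambda>y. if y \<in> X then Some (card {z \<in> X. z \<le> y}) else None)"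

definition unrelabel :: "nat set \<Rightarrow> nat \<rightharpoonup> nat" where
  "unrelabel X = (\<lambda>i. if i \<in> {1..card X} then Some (the_inv_into X (\<lambda>y. card {z \<in> X. z \<le> y}) i) else None)"

lemma relabel_unrelabel:
  assumes "finite X"
  shows "dom (relabel X) = X" "ran (relabel X) = {1..card X}" "order_preserving (relabel X)"
    "dom (unrelabel X) = {1..card X}" "ran (unrelabel X) = X" "order_preserving (unrelabel X)"
    "unrelabel X \<circ>\<^sub>m relabel X = Some |` X"
proof -
  let ?r = "\<lambda>y. card {z \<in> X. z \<le> y}"
  have fin: "finite {z \<in> X. z \<le> y}" for y using assms by simp
  have mono: "?r x \<le> ?r y" if "x \<le> y" for x y
    using that by (intro card_mono fin) auto
  have strict: "?r x < ?r y" if "x < y" "y \<in> X" for x y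
  proof (rule psubset_card_mono[OF fin psubsetI])
    show "{z \<in> X. z \<le> x} \<subseteq> {z \<in> X. z \<le> y}" using that by auto
    have "y \<in> {z \<in> X. z \<le> y}" "y \<notin> {z \<in> X. z \<le> x}" using that by simp_all
    then show "{z \<in> X. z \<le> x} \<noteq> {z \<in> X. z \<le> y}" by metis
  qed
  have inj: "inj_on ?r X"
  proof (rule linorder_inj_onI')
    fix x y assume "y \<in> X" "x < y"
    from strict[OF this(2,1)] show "?r x \<noteq> ?r y" by (rule less_imp_neq)
  qed
  have "?r ` X \<subseteq> {1..card X}"
  proof
    fix i assume "i \<in> ?r ` X"
    then obtain y where y: "y \<in> X" "i = ?r y" by blast
    have "?r y \<le> card X" using assms by (intro card_mono) auto
    moreover have "?r y \<noteq> 0" using y fin by auto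
    ultimately show "i \<in> {1..card X}" unfolding y(2) atLeastAtMost_iff by linarith
  qed
  then have img: "?r ` X = {1..card X}"
    using card_image[OF inj] by (intro card_subset_eq) auto
  have inv: "the_inv_into X ?r (?r y) = y" if "y \<in> X" for y
    using the_inv_into_f_f[OF inj that] .
  show "dom (relabel X) = X" by (auto simp: relabel_def dom_def)
  show "ran (relabel X) = {1..card X}" unfolding img[symmetric] by (auto simp: relabel_def ran_def)
  show "order_preserving (relabel X)"
    unfolding order_preserving_alt relabel_def using mono by auto
  show "dom (unrelabel X) = {1..card X}" by (auto simp: unrelabel_def dom_def)
  have un: "unrelabel X (?r y) = Some y" if "y \<in> X" for y
    using that img inv by (auto simp: unrelabel_def)
  have unE: "\<exists>y\<in>X. i = ?r y \<and> a = y" if "unrelabel X i = Some a" for i a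
  proof -
    have "i \<in> ?r ` X" using that unfolding img unrelabel_def by (auto split: if_splits)
    then obtain y where "y \<in> X" "i = ?r y" by blast
    then show ?thesis using that un by auto
  qed
  show "ran (unrelabel X) = X"
    using un unE by (force simp: ran_def)
  show "order_preserving (unrelabel X)"
    unfolding order_preserving_alt
  proof (intro allI impI)
    fix i j a b assume "unrelabel X i = Some a" "unrelabel X j = Some b" "i \<le> j"
    then have "a \<in> X" "?r a \<le> ?r b" using unE by blast+
    then show "a \<le> b" using strict[of b a] by (meson leD not_le_imp_less)
  qed
  show "unrelabel X \<circ>\<^sub>m relabel X = Some |` X"
  proof
    fix y show "(unrelabel X \<circ>\<^sub>m relabel X) y = (Some |` X) y"
      using un by (cases "y \<in> X") (simp_all add: map_comp_def relabel_def)
  qed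
qed

subsection \<open>The Morita equivalence\<close>

lemma SEO_arr_EO: "Arr (SEO n) \<subseteq> Arr (EO n)"
proof
  fix f assume "f \<in> Arr (SEO n)"
  then obtain k l where "k \<le> n" "l \<le> n" "dom f = {1..k}" "ran f = {1..l}" "order_preserving f"
    by (auto simp: SEO_eq)
  then show "f \<in> Arr (EO n)" by simp
qed

lemma conv_SEO: "conv (\<lambda>g f. Dom (SEO n) g = Cod (SEO n) f) (Comp (SEO n)) = conv (\<lambda>g f. dom g = ran f) (\<lambda>g f. g \<circ>\<^sub>m f)"
  "conv (\<lambda>g f. Dom (EO n) g = Cod (EO n) f) (Comp (EO n)) = conv (\<lambda>g f. dom g = ran f) (\<lambda>g f. g \<circ>\<^sub>m f)"
  by (simp_all add: SEO_eq onto_cat_def)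

text \<open>The corner consists of the zeta preimages of functions supported on \<open>SEO\<close>.
  The unit is decomposed over the subsets \<open>X\<close> of \<open>[n]\<close>:
  \<open>relabel X\<close> followed by \<open>unrelabel X\<close> is the identity of
  \<open>X\<close>, and these identities sum to the zeta transform of the unit.\<close>

theorem morita_equivalent_PO_SEO:
  assumes "infinite (UNIV :: 'm set)"
  shows "morita_equivalent TYPE('m) (monoid_algebra (PO n) :: ('k::field, (nat \<rightharpoonup> nat) \<Rightarrow> 'k) module)
    (category_algebra (SEO n) :: ('k, (nat \<rightharpoonup> nat) \<Rightarrow> 'k) module)"
proof -
  let ?S = "Arr (EO n)" and ?T = "Arr (SEO n)"
  let ?A = "PO.algebra n :: ('k, (nat \<rightharpoonup> nat) \<Rightarrow> 'k) module"
  let ?B = "SEO.algebra n :: ('k, (nat \<rightharpoonup> nat) \<Rightarrow> 'k) module"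
  let ?E = "EO.algebra n :: ('k, (nat \<rightharpoonup> nat) \<Rightarrow> 'k) module"
  let ?c = "conv (\<lambda>g f. dom g = ran f) (\<lambda>g f. g \<circ>\<^sub>m f) :: ((nat \<rightharpoonup> nat) \<Rightarrow> 'k) \<Rightarrow> _"
  define \<iota> :: "((nat \<rightharpoonup> nat) \<Rightarrow> 'k) \<Rightarrow> (nat \<rightharpoonup> nat) \<Rightarrow> 'k" where "\<iota> = the_inv_into (supported ?S) (zeta n)"
  interpret A: ring ?A by (rule PO.algebra_ring)
  interpret B: ring ?B by (rule SEO.algebra_ring)
  interpret E: ring ?E by (rule EO.algebra_ring)
  have \<iota>_in: "\<iota> b \<in> supported ?S" and zeta_\<iota>: "zeta n (\<iota> b) = b" if "b \<in> supported ?S" for b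
  proof -
    have "b \<in> zeta n ` supported ?S" using surj_zeta[OF that] by blast
    then show "\<iota> b \<in> supported ?S" "zeta n (\<iota> b) = b"
      unfolding \<iota>_def using the_inv_into_into[OF inj_zeta] f_the_inv_into_f[OF inj_zeta] by blast+
  qed
  have zeta_eqD: "x = y" if "zeta n x = zeta n y" "x \<in> supported ?S" "y \<in> supported ?S"
    for x y :: "(nat \<rightharpoonup> nat) \<Rightarrow> 'k"
    using inj_onD[OF inj_zeta] that by blast
  have sub: "b \<in> supported ?S" if "b \<in> supported ?T" for b :: "(nat \<rightharpoonup> nat) \<Rightarrow> 'k"
    using supported_mono[OF SEO_arr_EO that] .
  have zeta_A_mult: "zeta n (x \<otimes>\<^bsub>?A\<^esub> y) = ?c (zeta n x) (zeta n y)"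
    if "x \<in> supported ?S" "y \<in> supported ?S" for x y
    using zeta_mult[OF that] by (simp only: PO.algebra_simps)
  have B_mult: "b \<otimes>\<^bsub>?B\<^esub> c = ?c b c" for b c
    by (simp only: SEO.algebra_simps conv_SEO)
  have E_mult: "b \<otimes>\<^bsub>?E\<^esub> c = ?c b c" for b c
    by (simp only: EO.algebra_simps conv_SEO)
  have A_closed: "x \<otimes>\<^bsub>?A\<^esub> y \<in> supported ?S" if "x \<in> supported ?S" "y \<in> supported ?S" for x y
    using A.m_closed[of x y] that by (simp only: PO.algebra_simps)
  have oneB: "\<one>\<^bsub>?B\<^esub> \<in> supported ?T" using B.one_closed by (simp only: SEO.algebra_simps)
  have un: "basis_vec (unrelabel X) \<in> supported ?S" and re: "basis_vec (relabel X) \<in> supported ?S"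
    if "X \<in> Pow {1..n}" for X
  proof -
    have "finite X" using that finite_subset by auto
    note r = relabel_unrelabel[OF this]
    have "card X \<le> n" using card_mono[of "{1..n}" X] that by auto
    then have "{1..card X} \<subseteq> {1..n}" by simp
    then have S: "unrelabel X \<in> ?S" "relabel X \<in> ?S"
      using r that by (simp_all only: onto_cat_simps mem_Collect_eq Pow_iff simp_thms)
    show "basis_vec (unrelabel X) \<in> supported ?S" using S(1) by (rule basis_vec_supported)
    show "basis_vec (relabel X) \<in> supported ?S" using S(2) by (rule basis_vec_supported)
  qed
  text \<open>The identities on initial segments act as \<open>\<one>\<^bsub>B\<^esub>\<close>; associativity extends this to the relabellings.\<close>
  have unit: "?c (basis_vec (unrelabel X)) \<one>\<^bsub>?B\<^esub> = (basis_vec (unrelabel X) :: _ \<Rightarrow> 'k)"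
    "?c \<one>\<^bsub>?B\<^esub> (basis_vec (relabel X)) = (basis_vec (relabel X) :: _ \<Rightarrow> 'k)" if X: "X \<in> Pow {1..n}" for X
  proof -
    have "finite X" using X finite_subset by auto
    note r = relabel_unrelabel[OF this]
    have "card X \<le> n" using card_mono[of "{1..n}" X] X by auto
    let ?i = "basis_vec (Some |` {1..card X}) :: _ \<Rightarrow> 'k"
    have i: "?i \<in> supported ?T"
      using SEO.id_in[of "{1..card X}" n] \<open>card X \<le> n\<close> by (intro basis_vec_supported) (auto simp: SEO_simps)
    have iB: "?i \<in> carrier ?B" using i by (simp only: SEO.algebra_simps)
    have E: "?i \<in> carrier ?E" "basis_vec (unrelabel X) \<in> carrier ?E" "basis_vec (relabel X) \<in> carrier ?E" "\<one>\<^bsub>?B\<^esub> \<in> carrier ?E"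
      using sub[OF i] un[OF X] re[OF X] sub[OF oneB] by (simp_all only: EO.algebra_simps)
    have u: "?c (basis_vec (unrelabel X)) ?i = basis_vec (unrelabel X)"
      using r by (subst conv_basis_vec) (simp_all add: ran_restrict_Some map_comp_restrict_Some)
    have v: "?c ?i (basis_vec (relabel X)) = basis_vec (relabel X)"
      using r by (subst conv_basis_vec) (simp_all add: dom_restrict_Some restrict_Some_map_comp)
    have "?c ?i \<one>\<^bsub>?B\<^esub> = ?i" "?c \<one>\<^bsub>?B\<^esub> ?i = ?i"
      using B.r_one[OF iB] B.l_one[OF iB] unfolding B_mult by blast+
    then show "?c (basis_vec (unrelabel X)) \<one>\<^bsub>?B\<^esub> = basis_vec (unrelabel X)"
      "?c \<one>\<^bsub>?B\<^esub> (basis_vec (relabel X)) = basis_vec (relabel X)"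
      using E.m_assoc[OF E(2,1,4)] E.m_assoc[OF E(4,1,3)] u v unfolding E_mult by metis+
  qed
  interpret full_corner ?A ?B \<iota> "Pow {1..n}" "\<lambda>X. \<iota> (basis_vec (unrelabel X))" "\<lambda>X. \<iota> (basis_vec (relabel X))"
  proof
    show "fin_dim_algebra ?A" by (rule PO.fin_dim_algebra)
    show "fin_dim_algebra ?B" by (rule SEO.fin_dim_algebra)
    fix b c :: "(nat \<rightharpoonup> nat) \<Rightarrow> 'k" and r :: 'k
    assume "b \<in> carrier ?B"
    then have bT: "b \<in> supported ?T" by (simp only: SEO.algebra_simps)
    note b = sub[OF this]
    show "\<iota> b \<in> carrier ?A" using \<iota>_in[OF b] by (simp only: PO.algebra_simps)
    have rb: "(\<lambda>m. r * b m) \<in> supported ?S" using b by (simp add: supported_iff)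
    show "\<iota> (r \<odot>\<^bsub>?B\<^esub> b) = r \<odot>\<^bsub>?A\<^esub> \<iota> b"
      unfolding SEO.algebra_simps PO.algebra_simps
    proof (rule zeta_eqD)
      show "zeta n (\<iota> (\<lambda>m. r * b m)) = zeta n (\<lambda>m. r * \<iota> b m)"
        by (simp only: zeta_scale zeta_\<iota>[OF b] zeta_\<iota>[OF rb])
      show "\<iota> (\<lambda>m. r * b m) \<in> supported ?S" using rb by (rule \<iota>_in)
      show "(\<lambda>m. r * \<iota> b m) \<in> supported ?S" using \<iota>_in[OF b] by (simp add: supported_iff)
    qed
    assume "c \<in> carrier ?B"
    then have cT: "c \<in> supported ?T" by (simp only: SEO.algebra_simps)
    note c = sub[OF this]
    have bc: "(\<lambda>m. b m + c m) \<in> supported ?S" using b c by (simp add: supported_iff)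
    show "\<iota> (b \<oplus>\<^bsub>?B\<^esub> c) = \<iota> b \<oplus>\<^bsub>?A\<^esub> \<iota> c"
      unfolding SEO.algebra_simps PO.algebra_simps
    proof (rule zeta_eqD)
      show "zeta n (\<iota> (\<lambda>m. b m + c m)) = zeta n (\<lambda>m. \<iota> b m + \<iota> c m)"
        by (simp only: zeta_add zeta_\<iota>[OF b] zeta_\<iota>[OF c] zeta_\<iota>[OF bc])
      show "\<iota> (\<lambda>m. b m + c m) \<in> supported ?S" using bc by (rule \<iota>_in)
      show "(\<lambda>m. \<iota> b m + \<iota> c m) \<in> supported ?S" using \<iota>_in[OF b] \<iota>_in[OF c] by (simp add: supported_iff)
    qed
    have bcB: "b \<otimes>\<^bsub>?B\<^esub> c \<in> supported ?S"
      using B.m_closed[of b c] bT cT sub by (simp only: SEO.algebra_simps)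
    show "\<iota> (b \<otimes>\<^bsub>?B\<^esub> c) = \<iota> b \<otimes>\<^bsub>?A\<^esub> \<iota> c"
    proof (rule zeta_eqD)
      have "zeta n (\<iota> b \<otimes>\<^bsub>?A\<^esub> \<iota> c) = ?c b c"
        unfolding zeta_A_mult[OF \<iota>_in[OF b] \<iota>_in[OF c]] zeta_\<iota>[OF b] zeta_\<iota>[OF c] ..
      with trans[OF zeta_\<iota>[OF bcB] B_mult]
      show "zeta n (\<iota> (b \<otimes>\<^bsub>?B\<^esub> c)) = zeta n (\<iota> b \<otimes>\<^bsub>?A\<^esub> \<iota> c)" by (rule trans[OF _ sym])
      show "\<iota> (b \<otimes>\<^bsub>?B\<^esub> c) \<in> supported ?S" using bcB by (rule \<iota>_in)
      show "\<iota> b \<otimes>\<^bsub>?A\<^esub> \<iota> c \<in> supported ?S" using \<iota>_in[OF b] \<iota>_in[OF c] by (rule A_closed)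
    qed
  next
    show "inj_on \<iota> (carrier ?B)"
      by (rule inj_on_inverseI[of _ "zeta n"]) (use zeta_\<iota>[OF sub] in \<open>simp only: SEO.algebra_simps\<close>)
  next
    fix x assume "x \<in> carrier ?A" and ex: "\<iota> \<one>\<^bsub>?B\<^esub> \<otimes>\<^bsub>?A\<^esub> x = x" and xe: "x \<otimes>\<^bsub>?A\<^esub> \<iota> \<one>\<^bsub>?B\<^esub> = x"
    then have x: "x \<in> supported ?S" by (simp only: PO.algebra_simps)
    have one: "\<one>\<^bsub>?B\<^esub> \<in> supported ?S" "\<iota> \<one>\<^bsub>?B\<^esub> \<in> supported ?S" "zeta n (\<iota> \<one>\<^bsub>?B\<^esub>) = \<one>\<^bsub>?B\<^esub>"
      using sub[OF oneB] \<iota>_in zeta_\<iota> by blast+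
    have l: "?c \<one>\<^bsub>?B\<^esub> (zeta n x) = zeta n x" and r: "?c (zeta n x) \<one>\<^bsub>?B\<^esub> = zeta n x"
      using zeta_A_mult[OF one(2) x] zeta_A_mult[OF x one(2)] unfolding ex xe one(3) by simp_all
    \<comment> \<open>A morphism in the support of \<open>zeta n x\<close> factors on either side
      through the identity of an initial segment, so its domain and range are initial
      segments.\<close>
    have "zeta n x \<in> supported ?T"
      unfolding supported_iff
    proof (intro allI impI, rule ccontr)
      fix m assume "m \<notin> ?T" and nz: "zeta n x m \<noteq> 0"
      have "m \<in> ?S" using zeta_in[of n x] nz by (auto simp: supported_iff)
      have idE: "\<exists>k\<le>n. h = Some |` {1..k}" if "\<one>\<^bsub>?B\<^esub> h \<noteq> 0" for h
        using that by (simp only: SEO.algebra_simps) (auto simp: SEO_simps split: if_splits)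
      have "?c \<one>\<^bsub>?B\<^esub> (zeta n x) m \<noteq> 0" using nz l by simp
      then obtain g f where "\<one>\<^bsub>?B\<^esub> g \<noteq> 0" "dom g = ran f" "g \<circ>\<^sub>m f = m" by (rule conv_nonzeroE)
      with idE[of g] obtain k where k: "k \<le> n" "ran m = {1..k}"
        using restrict_Some_map_comp[of f] by (auto simp: dom_restrict_Some)
      have "?c (zeta n x) \<one>\<^bsub>?B\<^esub> m \<noteq> 0" using nz r by simp
      then obtain g f where "\<one>\<^bsub>?B\<^esub> f \<noteq> 0" "dom g = ran f" "g \<circ>\<^sub>m f = m" by (rule conv_nonzeroE)
      with idE[of f] obtain l where l: "l \<le> n" "dom m = {1..l}"
        using map_comp_restrict_Some[of g] by (auto simp: ran_restrict_Some)
      have "m \<in> ?T" using k l \<open>m \<in> ?S\<close> by (auto simp: SEO_eq)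
      then show False using \<open>m \<notin> ?T\<close> by simp
    qed
    moreover have "\<iota> (zeta n x) = x"
      by (rule zeta_eqD[OF zeta_\<iota>[OF zeta_in] \<iota>_in[OF zeta_in] x])
    ultimately show "x \<in> \<iota> ` carrier ?B" unfolding SEO.algebra_simps by (intro image_eqI[OF sym])
  next
    show "finite (Pow {1..n})" by simp
  next
    fix X assume X: "X \<in> Pow {1..n}"
    show "\<iota> (basis_vec (unrelabel X)) \<in> carrier ?A" "\<iota> (basis_vec (relabel X)) \<in> carrier ?A"
      using \<iota>_in[OF un[OF X]] \<iota>_in[OF re[OF X]] by (simp_all only: PO.algebra_simps)
    note one = sub[OF oneB]
    show "\<iota> (basis_vec (unrelabel X)) \<otimes>\<^bsub>?A\<^esub> \<iota> \<one>\<^bsub>?B\<^esub> = \<iota> (basis_vec (unrelabel X))"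
    proof (rule zeta_eqD[OF _ A_closed])
      show "zeta n (\<iota> (basis_vec (unrelabel X)) \<otimes>\<^bsub>?A\<^esub> \<iota> \<one>\<^bsub>?B\<^esub>) = zeta n (\<iota> (basis_vec (unrelabel X)))"
        unfolding zeta_A_mult[OF \<iota>_in[OF un[OF X]] \<iota>_in[OF one]] zeta_\<iota>[OF un[OF X]] zeta_\<iota>[OF one]
        by (rule unit(1)[OF X])
    qed (rule \<iota>_in un[OF X] one)+
    show "\<iota> \<one>\<^bsub>?B\<^esub> \<otimes>\<^bsub>?A\<^esub> \<iota> (basis_vec (relabel X)) = \<iota> (basis_vec (relabel X))"
    proof (rule zeta_eqD[OF _ A_closed])
      show "zeta n (\<iota> \<one>\<^bsub>?B\<^esub> \<otimes>\<^bsub>?A\<^esub> \<iota> (basis_vec (relabel X))) = zeta n (\<iota> (basis_vec (relabel X)))"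
        unfolding zeta_A_mult[OF \<iota>_in[OF one] \<iota>_in[OF re[OF X]]] zeta_\<iota>[OF re[OF X]] zeta_\<iota>[OF one]
        by (rule unit(2)[OF X])
    qed (rule \<iota>_in re[OF X] one)+
  next
    let ?pq = "\<lambda>X. \<iota> (basis_vec (unrelabel X)) \<otimes>\<^bsub>?A\<^esub> \<iota> (basis_vec (relabel X))"
    have pq_in: "?pq X \<in> carrier ?A" if "X \<in> Pow {1..n}" for X
      using A_closed[OF \<iota>_in[OF un[OF that]] \<iota>_in[OF re[OF that]]] by (simp only: PO.algebra_simps)
    have zpq: "zeta n (?pq X) = basis_vec (Some |` X)" if X: "X \<in> Pow {1..n}" for X
    proof -
      have "finite X" using X finite_subset by auto
      note r = relabel_unrelabel[OF this]
      show ?thesis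
        unfolding zeta_A_mult[OF \<iota>_in[OF un[OF X]] \<iota>_in[OF re[OF X]]] zeta_\<iota>[OF un[OF X]] zeta_\<iota>[OF re[OF X]]
        using r by (simp add: conv_basis_vec)
    qed
    \<comment> \<open>The sum is computed in the algebra of \<open>EO n\<close>, where it becomes
      the sum of all identities, and is pulled back by injectivity of \<open>zeta\<close>.\<close>
    have "zeta n (\<Oplus>\<^bsub>?A\<^esub>X\<in>Pow {1..n}. ?pq X) = (\<Oplus>\<^bsub>?E\<^esub>X\<in>Pow {1..n}. zeta n (?pq X))"
    proof (rule additive_finsum[where f = "zeta n"])
      show "zeta n \<in> carrier ?A \<rightarrow> carrier ?E"
        by (rule Pi_I) (simp only: EO.algebra_simps zeta_in)
      show "zeta n (x \<oplus>\<^bsub>?A\<^esub> y) = zeta n x \<oplus>\<^bsub>?E\<^esub> zeta n y" for x y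
        by (simp only: PO.algebra_simps EO.algebra_simps zeta_add)
    qed (use A.abelian_group_axioms E.abelian_group_axioms pq_in in \<open>simp_all only: finite_Pow_iff finite_atLeastAtMost\<close>)
    also have "\<dots> = (\<Oplus>\<^bsub>?E\<^esub>X\<in>Pow {1..n}. basis_vec (Some |` X))"
    proof (rule E.finsum_cong'[OF refl])
      show "(\<lambda>X. basis_vec (Some |` X)) \<in> Pow {1..n} \<rightarrow> carrier ?E"
      proof
        fix X assume "X \<in> Pow {1..n}"
        from zpq[OF this] zeta_in[of n "?pq X"] show "basis_vec (Some |` X) \<in> carrier ?E"
          by (simp only: EO.algebra_simps)
      qed
      show "zeta n (?pq X) = basis_vec (Some |` X)" if "X \<in> Pow {1..n}" for X
        using zpq[OF that] .
    qed
    also have "\<dots> = (\<lambda>m. \<Sum>X\<in>Pow {1..n}. basis_vec (Some |` X) m)"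
    proof (rule EO.finsum_algebra)
      show "basis_vec (Some |` X) \<in> supported ?S" if "X \<in> Pow {1..n}" for X
        using EO.id_in[of X n] that by (intro basis_vec_supported) simp
    qed simp
    also have "\<dots> = (\<lambda>m. if m \<in> Id (EO n) ` Obj (EO n) then 1 else 0)"
    proof
      fix m
      have "(\<Sum>X\<in>Pow {1..n}. basis_vec (Some |` X) m) =
          (\<Sum>X\<in>Pow {1..n}. if X = dom m then (if m = Some |` dom m then 1 else 0) else (0 :: 'k))"
        by (intro sum.cong refl) (auto simp: basis_vec_def dom_restrict_Some)
      also have "\<dots> = (if m \<in> Id (EO n) ` Obj (EO n) then 1 else 0)"
      proof -
        have "m \<in> Id (EO n) ` Obj (EO n) \<longleftrightarrow> dom m \<in> Pow {1..n} \<and> m = Some |` dom m"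
        proof
          assume "m \<in> Id (EO n) ` Obj (EO n)"
          then obtain X where "X \<in> Obj (EO n)" "m = Id (EO n) X" by blast
          then show "dom m \<in> Pow {1..n} \<and> m = Some |` dom m" by (simp only: onto_cat_simps dom_restrict_Some simp_thms)
        next
          assume "dom m \<in> Pow {1..n} \<and> m = Some |` dom m"
          then show "m \<in> Id (EO n) ` Obj (EO n)" by (intro image_eqI[of _ _ "dom m"]) (simp_all only: onto_cat_simps)
        qed
        then show ?thesis by simp
      qed
      finally show "(\<Sum>X\<in>Pow {1..n}. basis_vec (Some |` X) m) = (if m \<in> Id (EO n) ` Obj (EO n) then 1 else (0 :: 'k))" .
    qed
    also have "\<dots> = zeta n \<one>\<^bsub>?A\<^esub>" by (simp only: PO.algebra_simps zeta_one)
    finally have "zeta n (\<Oplus>\<^bsub>?A\<^esub>X\<in>Pow {1..n}. ?pq X) = zeta n \<one>\<^bsub>?A\<^esub>" .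
    moreover have "(\<Oplus>\<^bsub>?A\<^esub>X\<in>Pow {1..n}. ?pq X) \<in> supported ?S"
      using A.finsum_closed[of ?pq "Pow {1..n}"] pq_in by (simp only: PO.algebra_simps Pi_I)
    moreover have "\<one>\<^bsub>?A\<^esub> \<in> supported ?S" using A.one_closed by (simp only: PO.algebra_simps)
    ultimately show "(\<Oplus>\<^bsub>?A\<^esub>X\<in>Pow {1..n}. ?pq X) = \<one>\<^bsub>?A\<^esub>" by (rule zeta_eqD)
  qed
  show ?thesis
    unfolding monoid_algebra_PO SEO.category_algebra_eq using assms by (rule morita_equivalent)
qed

theorem corollary4p13:
  fixes n :: nat
  assumes "n \<ge> 1"
    and "infinite (UNIV :: 'm set)"
  shows
    "quiver_of (category_algebra (SEO n) :: ('k::field, (nat \<rightharpoonup> nat) \<Rightarrow> 'k) module)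
       (SEO_quiver n) (SEO_vertex n) (SEO_arrow n) \<and>
     basic_quiver_presentation (category_algebra (SEO n) :: ('k, (nat \<rightharpoonup> nat) \<Rightarrow> 'k) module)
       (SEO_quiver n) (SEO_relations n) \<and>
     quiver_presentation TYPE('m) (monoid_algebra (PO n) :: ('k, (nat \<rightharpoonup> nat) \<Rightarrow> 'k) module)
       (SEO_quiver n) (SEO_relations n)"
proof -
  have "fin_dim_algebra (monoid_algebra (PO n) :: ('k, (nat \<rightharpoonup> nat) \<Rightarrow> 'k) module)"
    unfolding monoid_algebra_PO by (rule PO.fin_dim_algebra)
  \<comment> \<open>The algebra of \<open>SEO n\<close> is itself split basic and serves as the
    basic algebra Morita equivalent to that of the monoid.\<close>
  then have "quiver_presentation TYPE('m) (monoid_algebra (PO n) :: ('k, (nat \<rightharpoonup> nat) \<Rightarrow> 'k) module)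
      (SEO_quiver n) (SEO_relations n)"
    unfolding quiver_presentation_def
    using morita_equivalent_PO_SEO[OF assms(2)] basic_quiver_presentation_SEO by blast
  then show ?thesis
    using quiver_of_SEO basic_quiver_presentation_SEO by blast
qed

end
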